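(* Let $d$ be the space dimension, let $\alpha<d-1$ and let $K:\mathbb{R}^d\to\mathbb{R}^d$ satisfy, for some constant $C_K$, $$|K(x)|+|x||\nabla K(x)|\le\frac{C_K}{|x|^\alpha}\quad\text{for all }x\in\mathbb{R}^d\setminus\{0\},\qquad\operatorname{div}K=0.$$ Let $q>\frac d{d-\alpha-1}$, $\frac1q+\frac1{q'}=1$, $\sigma^0\in\mathcal P(\mathbb{R}^d)\cap L^q(\mathbb{R}^d)$, and let $\sigma\in L^\infty([0,\infty);\mathcal P(\mathbb{R}^d)\cap L^q(\mathbb{R}^d))$ be the global in time solution of $\partial_t\sigma+\operatorname{div}((K*\sigma)\sigma)=0$, $\sigma(0)=\sigma^0$. For each $N$ let $\lambda_N>0$ and initial data $(X^0,V^0)\in(\mathbb{R}^d)^N\times(\mathbb{R}^d)^N$ be given, and let $(X_i,V_i)$ be the solution (until first collision) of $$\dot X_i=V_i,\qquad\dot V_i=\lambda_N\Big(-V_i+\frac1N\sum_{j\ne i}K(X_i-X_j)\Big),\qquad X_i(0)=X_i^0,\ V_i(0)=V_i^0,$$ with empirical measure $\sigma_N(t)=\frac1N\sum_i\delta_{X_i(t)}$ and $d_{\min}(t)=\min_{i\ne j}|X_i(t)-X_j(t)|$. Assume that for some $p\in[1,\infty]$: (1) $\displaystyle\lim_{N\to\infty}\Big(\mathcal W_p(\sigma_N(0),\sigma^0)+\frac1{\lambda_N}\Big)^{\frac{p(d-\alpha-1)}{d+pq'}}\Big(1+\frac1{N^{1/d}d_{\min}(0)}\Big)^{\alpha+1}=0$;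 (2) for all $N$ and all $1\le i,j\le N$: $|V_i^0-V_j^0|\le\frac12\lambda_N|X_i^0-X_j^0|$; (3) there is $C_V>0$ such that for all $N$: $\frac1N|V^0|_p^p\le C_V$. Then for all $T>0$ and all $N$ sufficiently large (depending on $T$) there is no collision up to time $T$, and for all $t\in[0,T]$ $$\mathcal W_p(\sigma_N(t),\sigma(t))\le C\Big(\mathcal W_p(\sigma_N(0),\sigma^0)+\frac1{\lambda_N}\Big)e^{Ct},$$ where $C$ depends only on $d$, $\alpha$, $q$, $p$, $C_K$, $C_V$ and $\|\sigma^0\|_{L^q}$.
   Context: $\mathcal P(\mathbb{R}^d)$ denotes probability measures (densities) on $\mathbb{R}^d$; $\mathcal W_p$ is the $p$-Wasserstein distance; $|V|_p^p=\sum_i|V_i|^p$ and $|V|_\infty=\max_i|V_i|$. For $p=\infty$, the exponent in (1) is understood as its limit $\frac{d-\alpha-1}{q'}$ and (3) as $|V^0|_\infty\le C_V$. A collision is a time at which $X_i=X_j$ for some $i\ne j$. The case $q=\infty$ ($q'=1$) is allowed.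
   Formalization: The formal statement assumes 0 ≤ α < d−1 instead of α < d−1. For α < 0 and d ≥ 2 the kernel may grow at infinity and no C depending only on the listed quantities exists (two far-apart blobs); for d = 1 the hypotheses force K = 0 off the origin. *)

theory Defs
  imports "HOL-Analysis.Analysis" "HOL-Probability.Essential_Supremum"
begin

section \<open>Lebesgue norms and Wasserstein distances for exponents in $[1,\infty]$\<close>

text \<open>Only used with a positive exponent, where \<open>\<infinity>\<close> is sent to \<open>\<infinity>\<close> and \<open>0\<close> to \<open>0\<close>.\<close>

definition epow :: "ennreal \<Rightarrow> real \<Rightarrow> ennreal" where
  "epow x r = (if x = \<infinity> then \<infinity> else ennreal (enn2real x powr r))"

definition Lp_norm :: "ennreal \<Rightarrow> 'b measure \<Rightarrow> ('b \<Rightarrow> real) \<Rightarrow> ennreal" where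
  "Lp_norm p M f =
     (if p = \<infinity> then esssup M (\<lambda>x. ennreal \<bar>f x\<bar>)
      else epow (\<integral>\<^sup>+ x. ennreal (\<bar>f x\<bar> powr enn2real p) \<partial>M) (1 / enn2real p))"

definition couplings :: "'a::euclidean_space measure \<Rightarrow> 'a measure \<Rightarrow> ('a \<times> 'a) measure set" where
  "couplings \<mu> \<nu> =
     {\<gamma>. sets \<gamma> = sets borel \<and> distr \<gamma> borel fst = \<mu> \<and> distr \<gamma> borel snd = \<nu>}"

definition wasserstein :: "ennreal \<Rightarrow> 'a::euclidean_space measure \<Rightarrow> 'a measure \<Rightarrow> ennreal" where
  "wasserstein p \<mu> \<nu> = (INF \<gamma>\<in>couplings \<mu> \<nu>. Lp_norm p \<gamma> (\<lambda>(x, y). dist x y))"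


section \<open>The limit equation\<close>

text \<open>An element of $\mathcal P(\mathbb R^d) \cap L^q(\mathbb R^d)$ is represented by a
  nonnegative Lebesgue density; \<open>law\<close> is the probability measure it defines.\<close>

definition prob_Lq :: "ennreal \<Rightarrow> ('a::euclidean_space \<Rightarrow> real) set" where
  "prob_Lq q = {f. f \<in> borel_measurable borel \<and> (\<forall>x. 0 \<le> f x) \<and>
                   (\<integral>\<^sup>+ x. ennreal (f x) \<partial>lborel) = 1 \<and> Lp_norm q lborel f < \<infinity>}"

definition law :: "('a::euclidean_space \<Rightarrow> real) \<Rightarrow> 'a measure" where
  "law f = density lborel (\<lambda>x. ennreal (f x))"

definition divergence :: "('a::euclidean_space \<Rightarrow> 'a) \<Rightarrow> 'a \<Rightarrow> real" where
  "divergence K x = (\<Sum>b\<in>Basis. frechet_derivative K (at x) b \<bullet> b)"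

text \<open>The value of \<open>K\<close> at the origin is irrelevant and left arbitrary.\<close>

definition admissible_kernel :: "real \<Rightarrow> real \<Rightarrow> ('a::euclidean_space \<Rightarrow> 'a) \<Rightarrow> bool" where
  "admissible_kernel \<alpha> C\<^sub>K K \<longleftrightarrow>
     (\<forall>x. x \<noteq> 0 \<longrightarrow>
        K differentiable (at x) \<and>
        norm (K x) + norm x * onorm (frechet_derivative K (at x)) \<le> C\<^sub>K / norm x powr \<alpha> \<and>
        divergence K x = 0)"

definition conv :: "('a::euclidean_space \<Rightarrow> 'a) \<Rightarrow> ('a \<Rightarrow> real) \<Rightarrow> 'a \<Rightarrow> 'a" where
  "conv K f x = (\<integral>y. f y *\<^sub>R K (x - y) \<partial>lborel)"

text \<open>Test functions in $C^1_c((0,\infty)\times\mathbb R^d)$, paired with their Frechet derivative.\<close>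

definition test_function ::
    "(real \<times> 'a::euclidean_space \<Rightarrow> real) \<Rightarrow> (real \<times> 'a \<Rightarrow> (real \<times> 'a) \<Rightarrow>\<^sub>L real) \<Rightarrow> bool" where
  "test_function \<phi> D\<phi> \<longleftrightarrow>
     (\<forall>z. (\<phi> has_derivative blinfun_apply (D\<phi> z)) (at z)) \<and>
     continuous_on UNIV D\<phi> \<and>
     (\<exists>S. compact S \<and> S \<subseteq> {0<..} \<times> UNIV \<and> (\<forall>z. z \<notin> S \<longrightarrow> \<phi> z = 0))"

text \<open>Weak solutions of $\partial_t\sigma + \mathrm{div}((K*\sigma)\sigma) = 0$,
  $\sigma(0) = \sigma^0$, in $L^\infty([0,\infty);\mathcal P\cap L^q)$. As usual the
  representative that is weakly continuous in time is taken, so that \<open>\<sigma> t\<close> is meaningful for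
  every \<open>t \<ge> 0\<close>. Note that
  $\partial_t\varphi + (K*\sigma)\cdot\nabla\varphi = D\varphi\,(1, K*\sigma)$.\<close>

definition transport_solution ::
    "ennreal \<Rightarrow> ('a::euclidean_space \<Rightarrow> 'a) \<Rightarrow> ('a \<Rightarrow> real) \<Rightarrow> (real \<Rightarrow> 'a \<Rightarrow> real) \<Rightarrow> bool" where
  "transport_solution q K \<sigma>\<^sub>0 \<sigma> \<longleftrightarrow>
     (\<forall>t\<ge>0. \<sigma> t \<in> prob_Lq q) \<and>
     (\<exists>B::real. \<forall>t\<ge>0. Lp_norm q lborel (\<sigma> t) \<le> ennreal B) \<and>
     (\<forall>f :: 'a \<Rightarrow> real. continuous_on UNIV f \<and> bounded (range f) \<longrightarrow>
        continuous_on {0..} (\<lambda>t. \<integral>x. f x * \<sigma> t x \<partial>lborel)) \<and>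
     (AE x in lborel. \<sigma> 0 x = \<sigma>\<^sub>0 x) \<and>
     (\<forall>\<phi> D\<phi>. test_function \<phi> D\<phi> \<longrightarrow>
        (LINT t:{0<..}|lborel.
           (\<integral>x. blinfun_apply (D\<phi> (t, x)) (1, conv K (\<sigma> t) x) * \<sigma> t x \<partial>lborel)) = 0)"


section \<open>The particle system\<close>

text \<open>The \<open>N\<close> particles are indexed by \<open>i < N\<close>.\<close>

definition empirical :: "nat \<Rightarrow> (nat \<Rightarrow> 'a::euclidean_space) \<Rightarrow> 'a measure" where
  "empirical N x = distr (uniform_count_measure {..<N}) borel x"

definition d_min :: "nat \<Rightarrow> (nat \<Rightarrow> 'a::euclidean_space) \<Rightarrow> ennreal" where
  "d_min N x = (INF (i, j)\<in>{(i, j). i < N \<and> j < N \<and> i \<noteq> j}. ennreal (dist (x i) (x j)))"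

definition collision :: "nat \<Rightarrow> (nat \<Rightarrow> real \<Rightarrow> 'a) \<Rightarrow> real \<Rightarrow> bool" where
  "collision N X t \<longleftrightarrow> (\<exists>i<N. \<exists>j<N. i \<noteq> j \<and> X i t = X j t)"

definition particle_solution ::
    "('a::euclidean_space \<Rightarrow> 'a) \<Rightarrow> real \<Rightarrow> nat \<Rightarrow> (nat \<Rightarrow> 'a) \<Rightarrow> (nat \<Rightarrow> 'a) \<Rightarrow>
     ereal \<Rightarrow> (nat \<Rightarrow> real \<Rightarrow> 'a) \<Rightarrow> (nat \<Rightarrow> real \<Rightarrow> 'a) \<Rightarrow> bool" where
  "particle_solution K lam N X\<^sub>0 V\<^sub>0 \<tau> X V \<longleftrightarrow>
     (\<forall>i<N. X i 0 = X\<^sub>0 i \<and> V i 0 = V\<^sub>0 i) \<and>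
     (\<forall>t. 0 \<le> t \<and> ereal t < \<tau> \<longrightarrow>
        \<not> collision N X t \<and>
        (\<forall>i<N.
          (X i has_vector_derivative V i t) (at t within {s. 0 \<le> s \<and> ereal s < \<tau>}) \<and>
          (V i has_vector_derivative
             lam *\<^sub>R (- V i t + (1 / real N) *\<^sub>R (\<Sum>j\<in>{..<N} - {i}. K (X i t - X j t))))
            (at t within {s. 0 \<le> s \<and> ereal s < \<tau>})))"

text \<open>The solution until the first collision: the collision-free solution on \<open>[0, \<tau>)\<close> with the
  largest possible \<open>\<tau> \<in> [0, \<infinity>]\<close>. In the degenerate case of coinciding initial positions
  \<open>\<tau> = 0\<close>.\<close>

definition maximal_particle_solution ::
    "('a::euclidean_space \<Rightarrow> 'a) \<Rightarrow> real \<Rightarrow> nat \<Rightarrow> (nat \<Rightarrow> 'a) \<Rightarrow> (nat \<Rightarrow> 'a) \<Rightarrow>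
     ereal \<Rightarrow> (nat \<Rightarrow> real \<Rightarrow> 'a) \<Rightarrow> (nat \<Rightarrow> real \<Rightarrow> 'a) \<Rightarrow> bool" where
  "maximal_particle_solution K lam N X\<^sub>0 V\<^sub>0 \<tau> X V \<longleftrightarrow>
     particle_solution K lam N X\<^sub>0 V\<^sub>0 \<tau> X V \<and>
     (\<forall>\<tau>' X' V'. particle_solution K lam N X\<^sub>0 V\<^sub>0 \<tau>' X' V' \<longrightarrow> \<tau>' \<le> \<tau>)"

definition rate_exponent :: "ennreal \<Rightarrow> ennreal \<Rightarrow> nat \<Rightarrow> real \<Rightarrow> real" where
  "rate_exponent p q' d \<alpha> =
     (if p = \<infinity> then (real d - \<alpha> - 1) / enn2real q'
      else enn2real p * (real d - \<alpha> - 1) / (real d + enn2real p * enn2real q'))"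

definition velocity_bound :: "ennreal \<Rightarrow> nat \<Rightarrow> (nat \<Rightarrow> 'a::euclidean_space) \<Rightarrow> real \<Rightarrow> bool" where
  "velocity_bound p N V C\<^sub>V \<longleftrightarrow>
     (if p = \<infinity> then \<forall>i<N. norm (V i) \<le> C\<^sub>V
      else (1 / real N) * (\<Sum>i<N. norm (V i) powr enn2real p) \<le> C\<^sub>V)"

end

theory Submission
  imports Defs "HOL-Probability.Probability"
begin

text \<open>
  The Lagrangian flow \<open>Y\<close> of \<open>K * \<sigma>\<close> preserves Lebesgue measure since \<open>div K = 0\<close>, so the bounds
  that \<open>\<sigma>\<^sub>0 \<in> L\<^sup>q\<close> gives on the mass of balls persist, uniformly in time. A coupling of \<open>\<sigma>\<^sub>N(0)\<close> and
  \<open>\<sigma>\<^sub>0\<close> is transported by the particle flow in the first and by \<open>Y\<close> in the second component, and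
  \<open>D\<^sub>t\<close> denotes the distance of the two components. As
  \<open>(X\<^sub>i + V\<^sub>i / \<lambda>)' = (1 / N) \<Sum>\<^sub>j K (X\<^sub>i - X\<^sub>j)\<close>, the inertia only costs terms of order \<open>1 / \<lambda>\<close>, and
  \<open>|K x - K y| \<le> C |x - y| (|x| powr - (\<alpha> + 1) + |y| powr - (\<alpha> + 1))\<close> turns the difference of the two
  velocities into \<open>D\<close> integrated against a symmetric kernel \<open>k\<close>. As long as the discrete sums
  \<open>s\<^sub>i = (1 / N) \<Sum>\<^sub>j |X\<^sub>i - X\<^sub>j| powr - (\<alpha> + 1)\<close> stay below a constant \<open>\<Lambda>\<close>, the marginals of \<open>k\<close> are
  bounded, and testing with \<open>D\<^sub>t powr (p - 1)\<close> yields a Gronwall estimate for \<open>\<parallel>D\<^sub>t\<parallel>\<^sub>p\<close>, hence the claimed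
  stability.

  The bound on \<open>s\<^sub>i\<close> is recovered by a continuity argument. Chebyshev's inequality transfers the mass
  bounds of \<open>\<sigma>\<close> to the particles on balls of radius at least \<open>\<rho> = \<parallel>D\<^sub>t\<parallel>\<^sub>p powr (p / (p + d / q'))\<close>, which
  controls the sum over distant particles independently of time. The particles within distance
  \<open>\<rho>\<close> are controlled by the minimal distance, which decays at most exponentially because
  \<open>|V\<^sub>i - V\<^sub>j| \<le> \<lambda> |X\<^sub>i - X\<^sub>j| / 2\<close> initially; their contribution is, up to a factor depending on the time
  horizon, the quantity assumed to vanish, so the bound improves strictly to \<open>\<Lambda> - 1 / 2\<close>.\<close>

section \<open>Riesz kernels\<close>

text \<open>Since \<open>\<sigma>\<close> is only a weak solution, its representation by
  \<open>Y\<close> is a uniqueness statement. It is proved by duality for the linear equation with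
  frozen velocity; the same argument applied to Lebesgue measure replaces Liouville's theorem, so a
  Lipschitz flow suffices. This also keeps the time-uniform bound contained in the notion of
  solution out of the constants: it serves to construct \<open>Y\<close>, after which only the norm
  of \<open>\<sigma>\<^sub>0\<close> enters. The rate exponent comes from packing: \<open>n\<close>
  points at mutual distance \<open>dm\<close> have Riesz sums of order
  \<open>n powr (1 - s / d) * dm powr - s\<close>, with \<open>s = \<alpha> + 1\<close>. For
  \<open>n = N * \<rho> powr \<delta>\<close>, \<open>\<delta> = d / q'\<close>, their share of the
  mean is \<open>(N powr (1 / d) * dm) powr - s * \<rho> powr (\<delta> * (1 - s / d))\<close>, and
  the choice of \<open>\<rho>\<close> turns the last factor into the assumed power of the norm of
  \<open>D\<close>. The Gronwall constants have \<open>p\<close>-th roots bounded in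
  \<open>p\<close>, which gives \<open>p = \<infinity>\<close> as a limit of moments. The time
  horizon only multiplies the vanishing quantity, so it affects how large \<open>N\<close> must be,
  but not \<open>C\<close>.\<close>

definition riesz :: "real \<Rightarrow> 'a::real_normed_vector \<Rightarrow> real" where
  "riesz s x = norm x powr (- s)"

lemma riesz_nonneg [simp]: "0 \<le> riesz s x"
  by (simp add: riesz_def)

lemma riesz_0 [simp]: "riesz s 0 = 0"
  by (simp add: riesz_def)

lemma riesz_minus_commute: "riesz s (x - y) = riesz s (y - x)"
  by (simp add: riesz_def norm_minus_commute)

lemma riesz_measurable [measurable]: "riesz s \<in> borel_measurable borel"
  unfolding riesz_def by measurable

lemma riesz_le_1: "0 < s \<Longrightarrow> 1 \<le> norm x \<Longrightarrow> riesz s x \<le> 1"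
  using powr_mono[of "- s" 0 "norm x"] unfolding riesz_def by (cases "norm x = 0") auto

lemma riesz_antimono: "0 \<le> s \<Longrightarrow> 0 < r \<Longrightarrow> r \<le> norm x \<Longrightarrow> riesz s x \<le> r powr (- s)"
  unfolding riesz_def by (rule powr_mono2') auto

text \<open>Value of \<open>2 powr s * (\<Sum>k. (2 powr (s - \<delta>)) ^ k)\<close>, a sum over
  dyadic shells; the series converges exactly when the growth exponent \<delta> exceeds
  \<open>s\<close>.\<close>

definition dyadic_const :: "real \<Rightarrow> real \<Rightarrow> real" where
  "dyadic_const s \<delta> = 2 powr s / (1 - 2 powr (s - \<delta>))"

lemma dyadic_const_pos: "s < \<delta> \<Longrightarrow> 0 < dyadic_const s \<delta>"
  unfolding dyadic_const_def by (auto intro!: divide_pos_pos simp: powr_less_one)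

text \<open>A point in the shell between \<open>R / 2 ^ (k + 1)\<close> and \<open>R / 2 ^ k\<close>
  has a kernel value of at most the \<open>k\<close>-th coefficient; that term alone dominates, and
  the others are nonnegative.\<close>

lemma riesz_le_dyadic_sum:
  fixes z :: "'a::real_normed_vector"
  assumes "0 < s" "0 < norm z" "norm z \<le> R"
  shows "ennreal (riesz s z) \<le> (\<Sum>k. ennreal (2 powr s * R powr - s * 2 powr (s * real k)) *
           indicator {z. norm z \<le> R / 2 ^ k} z)"
proof -
  have "0 < R" using assms by linarith
  have "\<exists>n. R / 2 ^ n < norm z"
  proof -
    obtain n where "R / norm z < 2 ^ n" using real_arch_pow[of 2 "R / norm z"] by auto
    thus ?thesis using assms by (intro exI[of _ n]) (simp add: field_simps)
  qed
  \<comment> \<open>The first dyadic radius below the norm. It is not the radius for 0, so its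
    predecessor \<open>k\<close> names a ball that contains the point.\<close>
  define n where "n = (LEAST n. R / 2 ^ n < norm z)"
  have n: "R / 2 ^ n < norm z" unfolding n_def by (rule LeastI_ex) fact
  have "n \<noteq> 0" using n assms by (intro notI) simp
  then obtain k where k: "n = Suc k" by (cases n) auto
  have "\<not> R / 2 ^ k < norm z" using not_less_Least[of k "\<lambda>n. R / 2 ^ n < norm z"] k n_def by simp
  hence le: "norm z \<le> R / 2 ^ k" by simp
  have "riesz s z \<le> (R / 2 ^ n) powr - s"
    using n assms \<open>0 < R\<close> by (intro riesz_antimono) auto
  also have "\<dots> = 2 powr s * R powr - s * 2 powr (s * real k)"
  proof -
    have "(2::real) ^ n = 2 powr (1 + real k)" using k by (simp add: powr_realpow[symmetric] powr_add)
    thus ?thesis using \<open>0 < R\<close>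
      by (simp add: powr_divide powr_powr powr_minus_divide powr_add[symmetric] field_simps distrib_left)
  qed
  finally have "ennreal (riesz s z) \<le> ennreal (2 powr s * R powr - s * 2 powr (s * real k)) *
       indicator {z. norm z \<le> R / 2 ^ k} z"
    using le by (simp add: ennreal_leI)
  also have "\<dots> \<le> (\<Sum>k. ennreal (2 powr s * R powr - s * 2 powr (s * real k)) *
           indicator {z. norm z \<le> R / 2 ^ k} z)"
    using sum_le_suminf[of "\<lambda>k. ennreal (2 powr s * R powr - s * 2 powr (s * real k)) *
           indicator {z. norm z \<le> R / 2 ^ k} z" "{k}"] by (simp del: indicator_simps mem_Collect_eq sum_mult_indicator)
  finally show ?thesis .
qed

text \<open>Integration of the dyadic bound: the growth condition turns the masses of the balls into
  a geometric series. The centre is removed from the balls because \<open>riesz\<close> vanishes at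
  0; this admits measures with an atom at \<open>x\<close>, such as the counting measure of
  particles that include the one at \<open>x\<close>.\<close>

lemma nn_integral_riesz_cball_le:
  fixes x :: "'a::euclidean_space"
  assumes M [measurable_cong]: "sets M = sets borel"
    and s: "0 < s" "s < \<delta>" and "0 < R" "0 \<le> A"
    and growth: "\<And>r. 0 < r \<Longrightarrow> r \<le> R \<Longrightarrow> emeasure M (cball x r - {x}) \<le> ennreal (A * r powr \<delta>)"
  shows "(\<integral>\<^sup>+ y. ennreal (riesz s (x - y)) * indicator (cball x R) y \<partial>M)
           \<le> ennreal (dyadic_const s \<delta> * A * R powr (\<delta> - s))"
proof -
  define c where "c k = 2 powr s * R powr - s * 2 powr (s * real k)" for k :: nat
  have c0: "0 \<le> c k" for k by (simp add: c_def)
  have [measurable]: "cball x r - {x} \<in> sets borel" for r by simp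
  have "(\<integral>\<^sup>+ y. ennreal (riesz s (x - y)) * indicator (cball x R) y \<partial>M)
      \<le> (\<integral>\<^sup>+ y. (\<Sum>k. ennreal (c k) * indicator (cball x (R / 2 ^ k) - {x}) y) \<partial>M)"
  proof (rule nn_integral_mono)
    fix y
    show "ennreal (riesz s (x - y)) * indicator (cball x R) y
       \<le> (\<Sum>k. ennreal (c k) * indicator (cball x (R / 2 ^ k) - {x}) y)"
    proof (cases "y = x \<or> y \<notin> cball x R")
      case False
      hence "0 < norm (x - y)" "norm (x - y) \<le> R" by (auto simp: dist_norm)
      from riesz_le_dyadic_sum[OF s(1) this] False show ?thesis
        by (auto simp: c_def indicator_def dist_norm cong: if_cong)
    qed auto
  qed
  also have "\<dots> = (\<Sum>k. ennreal (c k) * emeasure M (cball x (R / 2 ^ k) - {x}))"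
    by (subst nn_integral_suminf) (auto simp: nn_integral_cmult_indicator M)
  also have "\<dots> \<le> (\<Sum>k. ennreal (2 powr s * A * R powr (\<delta> - s) * (2 powr (s - \<delta>)) ^ k))"
  proof (rule suminf_le)
    fix k :: nat
    have "R / 2 ^ k \<le> R" using \<open>0 < R\<close> by (simp add: field_simps)
    hence "ennreal (c k) * emeasure M (cball x (R / 2 ^ k) - {x}) \<le> ennreal (c k) * ennreal (A * (R / 2 ^ k) powr \<delta>)"
      using \<open>0 < R\<close> by (intro mult_left_mono growth) auto
    also have "\<dots> = ennreal (c k * (A * (R / 2 ^ k) powr \<delta>))"
      using c0 \<open>0 \<le> A\<close> by (simp add: ennreal_mult)
    also have "c k * (A * (R / 2 ^ k) powr \<delta>) = 2 powr s * A * R powr (\<delta> - s) * (2 powr (s - \<delta>)) ^ k"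
    proof -
      have "(2::real) ^ k = 2 powr real k" by (simp add: powr_realpow)
      moreover have "(2 powr (s - \<delta>)) ^ k = 2 powr ((s - \<delta>) * real k)"
        by (subst powr_realpow[symmetric]) (auto simp: powr_powr)
      moreover have "(R / 2 powr real k) powr \<delta> = R powr \<delta> * 2 powr (- (\<delta> * real k))"
        using \<open>0 < R\<close> by (simp add: powr_divide powr_powr powr_minus_divide mult.commute)
      moreover have "R powr (\<delta> - s) = R powr \<delta> * R powr - s"
        by (simp add: powr_add[symmetric])
      moreover have "2 powr ((s - \<delta>) * real k) = (2::real) powr (s * real k) * 2 powr (- (\<delta> * real k))"
        by (simp add: powr_add[symmetric] left_diff_distrib)
      ultimately show ?thesis unfolding c_def by simp
    qed
    finally show "ennreal (c k) * emeasure M (cball x (R / 2 ^ k) - {x})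
      \<le> ennreal (2 powr s * A * R powr (\<delta> - s) * (2 powr (s - \<delta>)) ^ k)" .
  qed auto
  also have "\<dots> = ennreal (\<Sum>k. 2 powr s * A * R powr (\<delta> - s) * (2 powr (s - \<delta>)) ^ k)"
    using s \<open>0 \<le> A\<close> by (intro suminf_ennreal2 summable_mult summable_geometric) (auto simp: powr_less_one)
  also have "(\<Sum>k. 2 powr s * A * R powr (\<delta> - s) * (2 powr (s - \<delta>)) ^ k)
      = 2 powr s * A * R powr (\<delta> - s) * (1 / (1 - 2 powr (s - \<delta>)))"
    using s by (subst suminf_mult) (auto intro!: summable_geometric simp: suminf_geometric powr_less_one)
  also have "\<dots> = dyadic_const s \<delta> * A * R powr (\<delta> - s)"
    by (simp add: dyadic_const_def)
  finally show ?thesis .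
qed

text \<open>Outside the unit ball the kernel is at most 1 and the total mass is 1, which explains
  the summand 1; the growth condition handles the unit ball.\<close>

lemma nn_integral_riesz_le:
  fixes x :: "'a::euclidean_space"
  assumes "prob_space M" and M [measurable_cong]: "sets M = sets borel"
    and s: "0 < s" "s < \<delta>" and "0 \<le> A"
    and growth: "\<And>r. 0 < r \<Longrightarrow> r \<le> 1 \<Longrightarrow> emeasure M (cball x r - {x}) \<le> ennreal (A * r powr \<delta>)"
  shows "(\<integral>\<^sup>+ y. ennreal (riesz s (x - y)) \<partial>M) \<le> ennreal (1 + dyadic_const s \<delta> * A)"
proof -
  interpret prob_space M by fact
  have [measurable]: "cball x 1 \<in> sets borel" by simp
  have "(\<integral>\<^sup>+ y. ennreal (riesz s (x - y)) \<partial>M)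
     \<le> (\<integral>\<^sup>+ y. 1 + ennreal (riesz s (x - y)) * indicator (cball x 1) y \<partial>M)"
  proof (rule nn_integral_mono)
    fix y
    show "ennreal (riesz s (x - y)) \<le> 1 + ennreal (riesz s (x - y)) * indicator (cball x 1) y"
    proof (cases "y \<in> cball x 1")
      case False
      hence "ennreal (riesz s (x - y)) \<le> ennreal 1"
        using s by (intro ennreal_leI riesz_le_1) (auto simp: dist_norm)
      thus ?thesis using False by (auto simp: indicator_def)
    qed (simp add: le_add2 add_increasing)
  qed
  also have "\<dots> = 1 + (\<integral>\<^sup>+ y. ennreal (riesz s (x - y)) * indicator (cball x 1) y \<partial>M)"
    by (subst nn_integral_add) (auto simp: emeasure_space_1)
  also have "\<dots> \<le> 1 + ennreal (dyadic_const s \<delta> * A * 1 powr (\<delta> - s))"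
    using growth \<open>0 \<le> A\<close> s by (intro add_left_mono nn_integral_riesz_cball_le M) auto
  also have "\<dots> = ennreal (1 + dyadic_const s \<delta> * A)"
    using dyadic_const_pos[OF s(2)] \<open>0 \<le> A\<close> by (simp add: ennreal_plus)
  finally show ?thesis .
qed


section \<open>Pointwise and difference bounds for the interaction kernel\<close>

locale kernel =
  fixes K :: "'a::euclidean_space \<Rightarrow> 'a" and \<alpha> C\<^sub>K :: real
  assumes admissible: "admissible_kernel \<alpha> C\<^sub>K K"
    and alpha_nonneg: "0 \<le> \<alpha>" and alpha_less: "\<alpha> < real DIM('a) - 1"
begin

abbreviation \<kappa> :: "'a \<Rightarrow> real" where "\<kappa> \<equiv> riesz (\<alpha> + 1)"

text \<open>Setting the arbitrary value at the origin to 0 removes self-interaction, so forces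
  become sums or integrals over all particles, including the one acted upon.\<close>

definition K0 :: "'a \<Rightarrow> 'a" where "K0 x = (if x = 0 then 0 else K x)"

text \<open>The power of 2 pays for evaluating the derivative bound at half the radius.\<close>

definition C1 :: real where "C1 = C\<^sub>K * 2 powr (\<alpha> + 1)"

lemma K0_0 [simp]: "K0 0 = 0"
  by (simp add: K0_def)

lemma K_deriv: "x \<noteq> 0 \<Longrightarrow> (K has_derivative frechet_derivative K (at x)) (at x)"
  using admissible frechet_derivative_works unfolding admissible_kernel_def by blast

lemma onorm_K_nonneg: "x \<noteq> 0 \<Longrightarrow> 0 \<le> onorm (frechet_derivative K (at x))"
  by (rule onorm_pos_le) (use K_deriv has_derivative_bounded_linear in blast)

lemma norm_times_riesz: "x \<noteq> 0 \<Longrightarrow> norm x * \<kappa> x = 1 / norm x powr \<alpha>"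
  by (simp add: riesz_def powr_diff powr_minus_divide)

lemma admissible_bound:
  "x \<noteq> 0 \<Longrightarrow> norm (K x) + norm x * onorm (frechet_derivative K (at x)) \<le> C\<^sub>K * (norm x * \<kappa> x)"
  using admissible norm_times_riesz[of x] unfolding admissible_kernel_def by auto

lemma CK_nonneg: "0 \<le> C\<^sub>K"
proof -
  obtain b :: 'a where b: "b \<in> Basis" using nonempty_Basis by blast
  hence "b \<noteq> 0" "norm b = 1" by auto
  have "0 \<le> norm (K b) + norm b * onorm (frechet_derivative K (at b))"
    using onorm_K_nonneg[OF \<open>b \<noteq> 0\<close>] by simp
  also have "\<dots> \<le> C\<^sub>K * (norm b * \<kappa> b)" by (rule admissible_bound) fact
  also have "\<dots> = C\<^sub>K" using \<open>norm b = 1\<close> by (simp add: riesz_def)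
  finally show ?thesis .
qed

lemma C1_nonneg: "0 \<le> C1" using CK_nonneg by (simp add: C1_def)

lemma norm_K0_le: "norm (K0 x) \<le> C\<^sub>K * (norm x * \<kappa> x)"
proof (cases "x = 0")
  case False
  have "0 \<le> norm x * onorm (frechet_derivative K (at x))"
    using onorm_K_nonneg[OF False] by simp
  with admissible_bound[OF False] show ?thesis by (simp add: K0_def False)
qed auto

text \<open>Off the origin the left side is \<open>norm x powr - \<alpha>\<close>: at most
  \<open>\<kappa> x\<close> inside the unit ball and, as \<alpha> is nonnegative, at most 1
  outside.\<close>

lemma norm_times_riesz_le: "norm x * \<kappa> x \<le> 1 + \<kappa> x"
proof (cases "norm x \<le> 1")
  case True
  hence "norm x * \<kappa> x \<le> 1 * \<kappa> x" by (intro mult_right_mono) auto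
  thus ?thesis by simp
next
  case False
  hence "x \<noteq> 0" by auto
  have "1 \<le> norm x powr \<alpha>" using False alpha_nonneg ge_one_powr_ge_zero[of "norm x" \<alpha>] by auto
  hence "1 / norm x powr \<alpha> \<le> 1" by (simp add: divide_le_eq_1)
  thus ?thesis using norm_times_riesz[OF \<open>x \<noteq> 0\<close>] riesz_nonneg[of "\<alpha> + 1" x] by linarith
qed

lemma norm_K0_le': "norm (K0 x) \<le> C\<^sub>K * (1 + \<kappa> x)"
  using norm_K0_le[of x] mult_left_mono[OF norm_times_riesz_le[of x] CK_nonneg] by linarith

lemma onorm_K_le: "x \<noteq> 0 \<Longrightarrow> onorm (frechet_derivative K (at x)) \<le> C\<^sub>K * \<kappa> x"
proof -
  assume x: "x \<noteq> 0"
  have "norm x * onorm (frechet_derivative K (at x)) \<le> norm x * (C\<^sub>K * \<kappa> x)"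
    using admissible_bound[OF x] norm_ge_zero[of "K x"] unfolding mult.left_commute[of "norm x"] by linarith
  thus ?thesis using x by (simp add: mult_le_cancel_left_pos)
qed

text \<open>If \<open>a\<close> and \<open>b\<close> are close relative to \<open>norm a\<close>,
  the segment between them avoids the open ball of radius \<open>norm a / 2\<close> about 0, and the
  mean value inequality applies. Otherwise both norms are at most
  \<open>norm a < 2 * norm (a - b)\<close>, and the size bound on \<open>K\<close> suffices.\<close>

lemma K0_diff_le_aux:
  assumes "a \<noteq> 0" "b \<noteq> 0" "norm b \<le> norm a"
  shows "norm (K a - K b) \<le> C1 * norm (a - b) * (\<kappa> a + \<kappa> b)"
proof (cases "norm (a - b) \<le> norm a / 2")
  case True
  define S where "S = closed_segment a b"
  have S: "norm a / 2 \<le> norm x" if "x \<in> S" for x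
  proof -
    have "norm (x - a) \<le> norm (a - b)"
      using segment_bound(1)[of x a b] that by (simp add: S_def norm_minus_commute)
    thus ?thesis using True norm_triangle_ineq2[of a x] by (simp add: norm_minus_commute)
  qed
  have "norm (K a - K b) \<le> C1 * \<kappa> a * norm (a - b)"
  proof (rule differentiable_bound[of S K "\<lambda>x. frechet_derivative K (at x)"])
    fix x assume x: "x \<in> S"
    have "0 < norm a" using assms by simp
    with S[OF x] have x0: "x \<noteq> 0" by auto
    show "(K has_derivative frechet_derivative K (at x)) (at x within S)"
      using K_deriv[OF x0] has_derivative_at_withinI by blast
    have "\<kappa> x \<le> (norm a / 2) powr - (\<alpha> + 1)"
      using S[OF x] alpha_nonneg \<open>0 < norm a\<close> by (intro riesz_antimono) auto
    also have "\<dots> = 2 powr (\<alpha> + 1) * \<kappa> a"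
      unfolding riesz_def using \<open>0 < norm a\<close> by (simp only: powr_divide powr_minus) (simp add: field_simps)
    finally show "onorm (frechet_derivative K (at x)) \<le> C1 * \<kappa> a"
      using onorm_K_le[OF x0] mult_left_mono[OF _ CK_nonneg, of "\<kappa> x"] unfolding C1_def
      by (metis mult.assoc order_trans)
  qed (auto simp: S_def)
  also have "\<dots> \<le> C1 * norm (a - b) * (\<kappa> a + \<kappa> b)"
    using mult_nonneg_nonneg[OF mult_nonneg_nonneg[OF C1_nonneg norm_ge_zero[of "a - b"]] riesz_nonneg[of "\<alpha> + 1" b]]
    by (simp add: algebra_simps)
  finally show ?thesis .
next
  case False
  have K0: "norm (K x) \<le> C\<^sub>K * (norm x * \<kappa> x)" if "x \<noteq> 0" for x
    using norm_K0_le[of x] that by (simp add: K0_def)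
  have le: "C\<^sub>K * (norm x * \<kappa> x) \<le> C\<^sub>K * (2 * norm (a - b) * \<kappa> x)" if "norm x \<le> norm a" for x
    using False that CK_nonneg by (intro mult_left_mono mult_right_mono) auto
  have "norm (K a - K b) \<le> norm (K a) + norm (K b)" by (rule norm_triangle_ineq4)
  also have "\<dots> \<le> C\<^sub>K * 2 * norm (a - b) * (\<kappa> a + \<kappa> b)"
    using K0[OF assms(1)] K0[OF assms(2)] le[of a] le[of b] assms(3) by (simp add: algebra_simps)
  also have "\<dots> \<le> C1 * norm (a - b) * (\<kappa> a + \<kappa> b)"
    unfolding C1_def using CK_nonneg powr_mono[of 1 "\<alpha> + 1" 2] alpha_nonneg
    by (intro mult_right_mono mult_left_mono) auto
  finally show ?thesis .
qed

text \<open>Both \<open>K0\<close> and \<kappa> vanish at 0, so a zero argument leaves only the size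
  bound; the other cases are symmetric in \<open>a\<close> and \<open>b\<close>.\<close>

lemma K0_diff_le: "norm (K0 a - K0 b) \<le> C1 * norm (a - b) * (\<kappa> a + \<kappa> b)"
proof -
  have "C\<^sub>K \<le> C1" unfolding C1_def using CK_nonneg ge_one_powr_ge_zero[of 2 "\<alpha> + 1"] alpha_nonneg
    by (simp add: mult_left_le mult_le_cancel_left1)
  hence *: "norm (K0 x) \<le> C1 * norm x * \<kappa> x" for x
    using norm_K0_le[of x] mult_right_mono[of "C\<^sub>K" C1 "norm x * \<kappa> x"] by (simp add: mult.assoc)
  consider "a = 0" | "b = 0" | "a \<noteq> 0" "b \<noteq> 0" "norm b \<le> norm a" | "a \<noteq> 0" "b \<noteq> 0" "norm a \<le> norm b"
    by linarith
  then show ?thesis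
  proof cases
    case 3 then show ?thesis using K0_diff_le_aux[of a b] by (simp add: K0_def)
  next
    case 4 then show ?thesis using K0_diff_le_aux[of b a] by (simp add: K0_def norm_minus_commute add.commute)
  qed (use * in \<open>auto\<close>)
qed

lemma continuous_on_K: "continuous_on (- {0}) K"
  using K_deriv has_derivative_continuous continuous_at_imp_continuous_on by (metis ComplD singletonI)

lemma K0_measurable [measurable]: "K0 \<in> borel_measurable borel"
proof -
  have "K0 = (\<lambda>x. if x \<in> - {0} then K x else 0)" by (auto simp: K0_def)
  moreover have "(\<lambda>x. if x \<in> - {0} then K x else 0) \<in> borel_measurable borel"
    by (rule borel_measurable_continuous_on_if) (auto intro: continuous_on_K)
  ultimately show ?thesis by simp
qed

end

section \<open>Flows of bounded Lipschitz fields\<close>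

text \<open>The integrating factor \<open>exp (c * t)\<close> makes the product nondecreasing. The
  sign of \<open>c\<close> is free, so upper bounds follow by application to
  \<open>- Q\<close>.\<close>

lemma linear_differential_inequality:
  fixes Q :: "real \<Rightarrow> real"
  assumes "a \<le> b" and "continuous_on {a..b} Q"
    and "\<And>t. a < t \<Longrightarrow> t < b \<Longrightarrow> (Q has_real_derivative Q' t) (at t)"
    and "\<And>t. a < t \<Longrightarrow> t < b \<Longrightarrow> - c * Q t \<le> Q' t"
  shows "exp (- c * (b - a)) * Q a \<le> Q b"
proof -
  have "exp (c * a) * Q a \<le> exp (c * b) * Q b"
  proof (rule DERIV_nonneg_imp_increasing_open[OF assms(1), of "\<lambda>t. exp (c * t) * Q t"])
    fix t assume t: "a < t" "t < b"
    show "\<exists>y. ((\<lambda>t. exp (c * t) * Q t) has_real_derivative y) (at t) \<and> 0 \<le> y"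
    proof (intro exI conjI)
      show "((\<lambda>t. exp (c * t) * Q t) has_real_derivative exp (c * t) * (c * Q t + Q' t)) (at t)"
        by (rule derivative_eq_intros assms(3)[OF t] refl | simp add: algebra_simps)+
      show "0 \<le> exp (c * t) * (c * Q t + Q' t)" using assms(4)[OF t] by simp
    qed
  qed (intro continuous_intros assms(2))
  hence "exp (- c * b) * (exp (c * a) * Q a) \<le> exp (- c * b) * (exp (c * b) * Q b)"
    by simp
  also have "\<dots> = Q b" by (simp add: exp_minus)
  also have "exp (- c * b) * (exp (c * a) * Q a) = exp (- c * (b - a)) * Q a"
    by (simp only: mult.assoc[symmetric] exp_add[symmetric]) (simp add: algebra_simps)
  finally show ?thesis .
qed

text \<open>Oriented integral: the integral over a reversed interval vanishes, so at most one term
  survives. Trajectories are followed both forward and backward in time.\<close>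

definition signed_integral :: "(real \<Rightarrow> 'b::banach) \<Rightarrow> real \<Rightarrow> real \<Rightarrow> 'b" where
  "signed_integral f a t = integral {a..t} f - integral {t..a} f"

lemma signed_integral_self [simp]: "signed_integral f a a = 0"
  by (simp add: signed_integral_def)

lemma signed_integral_eq:
  assumes "continuous_on UNIV f" "b \<le> a" "b \<le> t"
  shows "signed_integral f a t = integral {b..t} f - integral {b..a} f"
proof -
  have int: "f integrable_on {x..y}" for x y
    using assms(1) by (intro integrable_continuous_real) (auto intro: continuous_on_subset)
  consider "a < t" | "a = t" | "t < a" by linarith
  then show ?thesis
  proof cases
    case 1 then show ?thesis using Henstock_Kurzweil_Integration.integral_combine[of b a t f] assms int
      by (simp add: signed_integral_def algebra_simps)
  next
    case 3 then show ?thesis using Henstock_Kurzweil_Integration.integral_combine[of b t a f] assms int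
      by (simp add: signed_integral_def algebra_simps)
  qed (simp add: signed_integral_def)
qed

lemma signed_integral_deriv:
  assumes "continuous_on UNIV f"
  shows "(signed_integral f a has_vector_derivative f t) (at t)"
proof -
  define b where "b = min a t - 1"
  have c: "continuous_on {b..t+1} f" using assms continuous_on_subset by blast
  have "((\<lambda>t. integral {b..t} f) has_vector_derivative f t) (at t within {b..t+1})"
    by (rule integral_has_vector_derivative[OF c]) (auto simp: b_def)
  hence "((\<lambda>t. integral {b..t} f) has_vector_derivative f t) (at t)"
    by (subst (asm) at_within_interior) (auto simp: b_def)
  hence "((\<lambda>t. integral {b..t} f - integral {b..a} f) has_vector_derivative f t) (at t)"
    by (auto intro!: derivative_eq_intros)
  thus ?thesis
    by (rule has_vector_derivative_transform_within_open[of _ _ _ "{b<..}"])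
       (use signed_integral_eq[OF assms, of b a] in \<open>auto simp: b_def\<close>)
qed

text \<open>Integrating the exponential weight gains a factor \<open>1 / c\<close>, which makes the
  Picard map a contraction on the whole line once \<open>c\<close> is large.\<close>

lemma norm_signed_integral_exp_le:
  assumes "continuous_on UNIV f" "0 < c" "\<And>s. norm (f s) \<le> B * exp (c * \<bar>s - a\<bar>)"
  shows "norm (signed_integral f a t) \<le> B / c * exp (c * \<bar>t - a\<bar>)"
proof -
  have "0 \<le> B" using order_trans[OF norm_ge_zero assms(3)[of a]] by simp
  have int: "f integrable_on {x..y}" for x y
    using assms(1) by (intro integrable_continuous_real) (auto intro: continuous_on_subset)
  show ?thesis
  proof (cases "a \<le> t")
    case True
    have "((\<lambda>s. B * exp (c * (s - a))) has_integral B / c * exp (c * (t - a)) - B / c * exp (c * (a - a))) {a..t}"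
      using \<open>0 < c\<close> by (intro fundamental_theorem_of_calculus True)
        (auto intro!: derivative_eq_intros simp: has_real_derivative_iff_has_vector_derivative[symmetric])
    hence "norm (integral {a..t} f) \<le> B / c * exp (c * (t - a)) - B / c * exp (c * (a - a))"
      using assms(3) by (intro integral_norm_bound_integral[of f "{a..t}" "\<lambda>s. B * exp (c * (s - a))", THEN order_trans] int)
        (auto dest: integral_unique intro!: order_trans[OF assms(3)])
    moreover have "0 \<le> B / c" using \<open>0 \<le> B\<close> \<open>0 < c\<close> by simp
    moreover have "signed_integral f a t = integral {a..t} f"
      using True by (cases "a = t") (auto simp: signed_integral_def)
    ultimately show ?thesis using True by simp
  next
    case False
    have "((\<lambda>s. B * exp (c * (a - s))) has_integral (- B / c * exp (c * (a - a))) - (- B / c * exp (c * (a - t)))) {t..a}"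
      using \<open>0 < c\<close> False by (intro fundamental_theorem_of_calculus)
        (auto intro!: derivative_eq_intros simp: has_real_derivative_iff_has_vector_derivative[symmetric])
    hence "norm (integral {t..a} f) \<le> (- B / c * exp (c * (a - a))) - (- B / c * exp (c * (a - t)))"
      using assms(3) by (intro integral_norm_bound_integral[of f "{t..a}" "\<lambda>s. B * exp (c * (a - s))", THEN order_trans] int)
        (auto dest: integral_unique intro!: order_trans[OF assms(3)])
    moreover have "0 \<le> B / c" using \<open>0 \<le> B\<close> \<open>0 < c\<close> by simp
    moreover have "signed_integral f a t = - integral {t..a} f"
      using False by (auto simp: signed_integral_def)
    ultimately show ?thesis using False by simp
  qed
qed

lemma continuous_on_Lipschitz_joint:
  fixes F :: "real \<Rightarrow> 'b::real_normed_vector \<Rightarrow> 'c::real_normed_vector"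
  assumes lip: "\<And>t x y. norm (F t x - F t y) \<le> L * norm (x - y)"
    and cont: "\<And>x. continuous_on UNIV (\<lambda>t. F t x)"
  shows "continuous_on UNIV (\<lambda>(t, x). F t x)"
  unfolding continuous_on_def
proof safe
  fix t :: real and x :: 'b
  have "((\<lambda>z. L * norm (snd z - x) + norm (F (fst z) x - F t x)) \<longlongrightarrow> L * norm (snd (t, x) - x) + norm (F (fst (t, x)) x - F t x)) (at (t, x))"
    by (intro tendsto_intros isCont_tendsto_compose[of _ "\<lambda>t. F t x"])
       (use cont in \<open>auto simp: continuous_on_eq_continuous_at\<close>)
  hence "((\<lambda>z. L * norm (snd z - x) + norm (F (fst z) x - F t x)) \<longlongrightarrow> 0) (at (t, x))" by simp
  hence "((\<lambda>z. (case z of (t, x) \<Rightarrow> F t x) - F t x) \<longlongrightarrow> 0) (at (t, x))"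
  proof (rule Lim_null_comparison[rotated], intro always_eventually allI)
    fix z :: "real \<times> 'b"
    show "norm ((case z of (t, x) \<Rightarrow> F t x) - F t x) \<le> L * norm (snd z - x) + norm (F (fst z) x - F t x)"
      using norm_triangle_le[OF add_mono[OF lip[of "fst z" "snd z" x] order_refl[of "norm (F (fst z) x - F t x)"]]]
      by (simp add: case_prod_beta)
  qed
  thus "((\<lambda>(t, x). F t x) \<longlongrightarrow> F t x) (at (t, x))" by (simp add: Lim_null[symmetric])
qed

text \<open>The global bound and Lipschitz constant allow a single application of Banach's fixed
  point theorem on the whole line, in a space of continuous functions with exponential weight.
  Banach spaces are allowed because whole particle configurations are treated by the same
  theorem.\<close>

theorem picard_lindelof:
  fixes F :: "real \<Rightarrow> 'b::banach \<Rightarrow> 'b"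
  assumes lip: "\<And>t x y. norm (F t x - F t y) \<le> L * norm (x - y)" and "0 \<le> L"
    and bd: "\<And>t x. norm (F t x) \<le> B"
    and cont: "\<And>x. continuous_on UNIV (\<lambda>t. F t x)"
  shows "\<exists>z. z a = x\<^sub>0 \<and> (\<forall>t. (z has_vector_derivative F t (z t)) (at t))"
proof -
  \<comment> \<open>Makes \<open>L / c\<close> at most 1/2, the contraction factor.\<close>
  define c where "c = 2 * L + 1"
  have "0 < c" using \<open>0 \<le> L\<close> by (simp add: c_def)
  have "0 \<le> B" using bd[of 0 0] norm_ge_zero order_trans by blast
  \<comment> \<open>The unknown \<open>w\<close> is the displacement divided by the weight, hence a
    bounded function.\<close>
  define path where "path w s = x\<^sub>0 + exp (c * \<bar>s - a\<bar>) *\<^sub>R apply_bcontfun w s" for w :: "real \<Rightarrow>\<^sub>C 'b" and s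
  define H where "H w t = exp (- c * \<bar>t - a\<bar>) *\<^sub>R signed_integral (\<lambda>s. F s (path w s)) a t" for w t
  have path: "continuous_on UNIV (path w)" for w
    unfolding path_def by (intro continuous_intros) auto
  have Fpath: "continuous_on UNIV (\<lambda>s. F s (path w s))" for w
  proof -
    have "continuous_on UNIV ((\<lambda>(t, x). F t x) \<circ> (\<lambda>s. (s, path w s)))"
      by (rule continuous_on_compose) (auto intro!: continuous_intros path
          continuous_on_subset[OF continuous_on_Lipschitz_joint[OF lip cont]])
    thus ?thesis by (simp add: o_def)
  qed
  have scale: "exp (- c * \<bar>t - a\<bar>) * (M / c * exp (c * \<bar>t - a\<bar>)) = M / c" for t M
    by (simp add: mult.left_commute exp_add[symmetric])
  have H: "H w \<in> bcontfun" for w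
  proof (rule bcontfun_normI)
    show "continuous_on UNIV (H w)"
      unfolding H_def
      by (intro continuous_intros continuous_on_vector_derivative)
         (use signed_integral_deriv[OF Fpath] has_vector_derivative_at_within in blast)
    fix t
    have "norm (signed_integral (\<lambda>s. F s (path w s)) a t) \<le> B / c * exp (c * \<bar>t - a\<bar>)"
      using \<open>0 < c\<close> \<open>0 \<le> B\<close> by (intro norm_signed_integral_exp_le Fpath order_trans[OF bd])
        (simp_all add: mult_le_cancel_left1)
    from mult_left_mono[OF this, of "exp (- c * \<bar>t - a\<bar>)"] show "norm (H w t) \<le> B / c"
      unfolding H_def by (simp only: norm_scaleR scale) simp
  qed
  have "\<exists>!w. Bcontfun (H w) = w"
  proof (rule banach_fix_type[of "1/2"])
    show "\<forall>v w. dist (Bcontfun (H v)) (Bcontfun (H w)) \<le> 1/2 * dist v w"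
    proof (intro allI dist_bound)
      fix v w t
      have int: "signed_integral (\<lambda>s. F s (path v s)) a t - signed_integral (\<lambda>s. F s (path w s)) a t
          = signed_integral (\<lambda>s. F s (path v s) - F s (path w s)) a t"
        unfolding signed_integral_def
        by (subst (1 2) integral_diff)
          (auto intro!: integrable_continuous_real continuous_on_subset[OF Fpath] simp: algebra_simps)
      have "norm (F s (path v s) - F s (path w s)) \<le> (L * dist v w) * exp (c * \<bar>s - a\<bar>)" for s
      proof -
        have "norm (path v s - path w s) = exp (c * \<bar>s - a\<bar>) * dist (apply_bcontfun v s) (apply_bcontfun w s)"
          by (simp add: path_def dist_norm scaleR_diff_right[symmetric])
        also have "\<dots> \<le> exp (c * \<bar>s - a\<bar>) * dist v w"
          by (intro mult_left_mono dist_bounded) auto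
        finally have "L * norm (path v s - path w s) \<le> L * (exp (c * \<bar>s - a\<bar>) * dist v w)"
          using \<open>0 \<le> L\<close> by (rule mult_left_mono)
        with lip[of s "path v s" "path w s"] show ?thesis by (simp add: mult_ac)
      qed
      hence "norm (signed_integral (\<lambda>s. F s (path v s) - F s (path w s)) a t)
          \<le> (L * dist v w) / c * exp (c * \<bar>t - a\<bar>)"
        using \<open>0 < c\<close> by (intro norm_signed_integral_exp_le continuous_intros Fpath)
      from mult_left_mono[OF this, of "exp (- c * \<bar>t - a\<bar>)"]
      have "norm (H v t - H w t) \<le> L * dist v w / c"
        unfolding H_def by (simp only: scaleR_diff_right[symmetric] int norm_scaleR scale) simp
      also have "\<dots> \<le> 1/2 * dist v w"
        using \<open>0 < c\<close> mult_right_mono[of "2 * L" c "dist v w"] by (simp add: c_def field_simps)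
      finally show "dist (apply_bcontfun (Bcontfun (H v)) t) (apply_bcontfun (Bcontfun (H w)) t) \<le> 1/2 * dist v w"
        by (simp add: Bcontfun_inverse H dist_norm)
    qed
  qed auto
  then obtain w where w: "Bcontfun (H w) = w" by blast
  have "apply_bcontfun w t = H w t" for t
    using w by (metis Bcontfun_inverse H)
  hence z: "path w t = x\<^sub>0 + signed_integral (\<lambda>s. F s (path w s)) a t" for t
    by (simp add: path_def[of w t] H_def exp_add[symmetric])
  have "(path w has_vector_derivative F t (path w t)) (at t)" for t
  proof -
    have "((\<lambda>t. x\<^sub>0 + signed_integral (\<lambda>s. F s (path w s)) a t) has_vector_derivative F t (path w t)) (at t)"
      using signed_integral_deriv[OF Fpath[of w], of a t] by (auto intro!: derivative_eq_intros)
    thus ?thesis by (simp only: z[symmetric])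
  qed
  moreover have "path w a = x\<^sub>0" using z[of a] by simp
  ultimately show ?thesis by blast
qed

lemma norm_vector_deriv_bound:
  fixes z :: "real \<Rightarrow> 'b::real_normed_vector"
  assumes "a \<le> b" "\<And>t. a \<le> t \<Longrightarrow> t \<le> b \<Longrightarrow> (z has_vector_derivative z' t) (at t within {a..b})"
    and "\<And>t. a \<le> t \<Longrightarrow> t \<le> b \<Longrightarrow> norm (z' t) \<le> B"
  shows "norm (z b - z a) \<le> B * (b - a)"
proof -
  have "norm (z b - z a) \<le> B * norm (b - a)"
  proof (rule differentiable_bound[of "{a..b}" z "\<lambda>t h. h *\<^sub>R z' t" B b a])
    have "0 \<le> B" using assms(3)[OF order_refl assms(1)] norm_ge_zero order_trans by blast
    fix t assume "t \<in> {a..b}"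
    thus "onorm (\<lambda>h. h *\<^sub>R z' t) \<le> B"
      using assms(3) \<open>0 \<le> B\<close> by (intro onorm_bound) (auto simp: mult.commute[of B] intro!: mult_left_mono)
  qed (use assms in \<open>auto simp: has_vector_derivative_def\<close>)
  thus ?thesis using assms(1) by simp
qed

locale lipschitz_field =
  fixes u :: "real \<Rightarrow> 'a::euclidean_space \<Rightarrow> 'a" and L B :: real
  assumes lip: "\<And>t x y. norm (u t x - u t y) \<le> L * norm (x - y)" and L_nonneg: "0 \<le> L"
    and bd: "\<And>t x. norm (u t x) \<le> B"
    and cont: "\<And>x. continuous_on UNIV (\<lambda>t. u t x)"
begin

lemma B_nonneg: "0 \<le> B"
  using bd[of 0 0] norm_ge_zero order_trans by blast

text \<open>The initial time \<open>s\<close> is a parameter because the duality argument runs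
  trajectories backward from a variable time.\<close>

definition flow :: "real \<Rightarrow> 'a \<Rightarrow> real \<Rightarrow> 'a" where
  "flow s x = (SOME z. z s = x \<and> (\<forall>t. (z has_vector_derivative u t (z t)) (at t)))"

lemma flow_props: "flow s x s = x \<and> (\<forall>t. (flow s x has_vector_derivative u t (flow s x t)) (at t))"
  using someI_ex[OF picard_lindelof[OF lip L_nonneg bd cont, of s x]] unfolding flow_def by blast

lemma flow_init [simp]: "flow s x s = x" and
  flow_deriv: "(flow s x has_vector_derivative u t (flow s x t)) (at t)"
  using flow_props by blast+

text \<open>The squared distance is differentiable, and its derivative is at most
  \<open>2 * L\<close> times itself in absolute value. The differential inequality is applied to its
  negative forward from \<open>s\<close>, and to itself for times before \<open>s\<close>.\<close>

lemma solution_dist: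
  assumes z: "\<And>t. (z has_vector_derivative u t (z t)) (at t)"
    and w: "\<And>t. (w has_vector_derivative u t (w t)) (at t)"
  shows "norm (z t - w t) \<le> exp (L * \<bar>t - s\<bar>) * norm (z s - w s)"
proof -
  define Q where "Q t = (norm (z t - w t))\<^sup>2" for t
  define Q' where "Q' t = 2 * ((z t - w t) \<bullet> (u t (z t) - u t (w t)))" for t
  have Q: "(Q has_real_derivative Q' t) (at t)" for t
  proof -
    have "((\<lambda>t. (z t - w t) \<bullet> (z t - w t)) has_derivative
       (\<lambda>h. (z t - w t) \<bullet> (h *\<^sub>R u t (z t) - h *\<^sub>R u t (w t)) + (h *\<^sub>R u t (z t) - h *\<^sub>R u t (w t)) \<bullet> (z t - w t))) (at t)"
      using z[of t] w[of t] unfolding has_vector_derivative_def by (intro derivative_intros)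
    thus ?thesis unfolding Q_def Q'_def power2_norm_eq_inner has_field_derivative_def
      by (rule has_derivative_eq_rhs) (auto simp: fun_eq_iff inner_commute algebra_simps)
  qed
  have Qc: "continuous_on S Q" for S
    by (intro continuous_at_imp_continuous_on ballI DERIV_isCont) (rule Q)
  have "\<bar>(z t - w t) \<bullet> (u t (z t) - u t (w t))\<bar> \<le> L * Q t" for t
    using Cauchy_Schwarz_ineq2[of "z t - w t" "u t (z t) - u t (w t)"]
      mult_left_mono[OF lip[of t "z t" "w t"] norm_ge_zero[of "z t - w t"]]
    unfolding Q_def power2_eq_square by (simp add: mult_ac)
  hence Q': "\<bar>Q' t\<bar> \<le> (2 * L) * Q t" for t unfolding Q'_def by (simp add: abs_mult)
  have "Q t \<le> exp (2 * L * \<bar>t - s\<bar>) * Q s"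
  proof (cases "s \<le> t")
    case True
    have "exp (- (- (2 * L)) * (t - s)) * - Q s \<le> - Q t"
    proof (rule linear_differential_inequality[of s t "\<lambda>t. - Q t" "\<lambda>t. - Q' t"])
      show "((\<lambda>t. - Q t) has_real_derivative - Q' r) (at r)" for r by (rule DERIV_minus[OF Q])
      show "continuous_on {s..t} (\<lambda>t. - Q t)" by (intro continuous_on_minus Qc)
      show "- (- (2 * L)) * - Q t \<le> - Q' t" for t using Q'[of t] by linarith
    qed (use True in simp)
    thus ?thesis using True by simp
  next
    case False
    have "exp (- (2 * L) * (s - t)) * Q t \<le> Q s"
    proof (rule linear_differential_inequality[of t s Q Q'])
      show "- (2 * L) * Q t \<le> Q' t" for t using Q'[of t] by linarith
      show "(Q has_real_derivative Q' r) (at r)" for r by (rule Q)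
    qed (use False Qc in auto)
    hence "exp (2 * L * (s - t)) * (exp (- (2 * L) * (s - t)) * Q t) \<le> exp (2 * L * (s - t)) * Q s"
      by (intro mult_left_mono) auto
    thus ?thesis using False by (simp add: exp_minus mult.assoc[symmetric] del: mult_le_cancel_left_pos)
  qed
  also have "\<dots> = (exp (L * \<bar>t - s\<bar>) * norm (z s - w s))\<^sup>2"
    by (simp add: Q_def power_mult_distrib exp_double[symmetric] mult.assoc)
  finally show ?thesis unfolding Q_def by (rule power2_le_imp_le) simp
qed

lemma flow_eqI:
  assumes "\<And>t. (z has_vector_derivative u t (z t)) (at t)"
  shows "flow s (z s) t = z t"
  using solution_dist[OF flow_deriv[of s "z s"] assms, of t s] by simp

lemma flow_flow: "flow r (flow s x r) t = flow s x t"
  by (rule flow_eqI) (rule flow_deriv)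

lemma flow_lipschitz: "norm (flow s x t - flow s y t) \<le> exp (L * \<bar>t - s\<bar>) * norm (x - y)"
  using solution_dist[OF flow_deriv flow_deriv, of s x t s y s] by simp

text \<open>Mean value inequality for the trajectory minus a uniform motion with velocity
  \<open>c\<close>. With \<open>c\<close> the velocity at a point it controls an Euler step; with
  \<open>c = 0\<close> it bounds the displacement.\<close>

lemma flow_approx:
  assumes "\<And>r. min s t \<le> r \<Longrightarrow> r \<le> max s t \<Longrightarrow> norm (u r (flow s x r) - c) \<le> \<eta>"
  shows "norm (flow s x t - x - (t - s) *\<^sub>R c) \<le> \<eta> * \<bar>t - s\<bar>"
proof -
  have d: "((\<lambda>r. flow s x r - r *\<^sub>R c) has_vector_derivative u r (flow s x r) - c) (at r within S)" for r S
    by (intro has_vector_derivative_diff has_vector_derivative_at_within[OF flow_deriv])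
       (auto simp: has_vector_derivative_def intro!: derivative_eq_intros)
  show ?thesis
  proof (cases "s \<le> t")
    case True
    have "norm ((flow s x t - t *\<^sub>R c) - (flow s x s - s *\<^sub>R c)) \<le> \<eta> * (t - s)"
      using True assms by (intro norm_vector_deriv_bound[OF _ d]) auto
    thus ?thesis using True by (simp add: algebra_simps)
  next
    case False
    have "norm ((flow s x s - s *\<^sub>R c) - (flow s x t - t *\<^sub>R c)) \<le> \<eta> * (s - t)"
      using False assms by (intro norm_vector_deriv_bound[OF _ d]) auto
    moreover have "flow s x t - x - (t - s) *\<^sub>R c = - ((flow s x s - s *\<^sub>R c) - (flow s x t - t *\<^sub>R c))"
      by (simp add: algebra_simps)
    ultimately show ?thesis using False by (simp only: norm_minus_cancel) simp
  qed
qed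

lemma flow_displacement: "norm (flow s x t - flow s x r) \<le> B * \<bar>t - r\<bar>"
  using flow_approx[of r t "flow s x r" 0 B] bd by (simp add: flow_flow)

lemma continuous_on_flow: "continuous_on UNIV (\<lambda>(t, x). flow s x t)"
proof (subst continuous_on_eq_continuous_at[OF open_UNIV], safe)
  fix t :: real and x :: 'a
  have "((\<lambda>z. B * \<bar>fst z - t\<bar> + exp (L * \<bar>t - s\<bar>) * norm (snd z - x)) \<longlongrightarrow>
      B * \<bar>fst (t, x) - t\<bar> + exp (L * \<bar>t - s\<bar>) * norm (snd (t, x) - x)) (at (t, x))"
    by (intro tendsto_intros)
  hence "((\<lambda>z. B * \<bar>fst z - t\<bar> + exp (L * \<bar>t - s\<bar>) * norm (snd z - x)) \<longlongrightarrow> 0) (at (t, x))" by simp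
  hence "((\<lambda>z. (case z of (t, x) \<Rightarrow> flow s x t) - flow s x t) \<longlongrightarrow> 0) (at (t, x))"
  proof (rule Lim_null_comparison[rotated], intro always_eventually allI)
    fix z :: "real \<times> 'a"
    show "norm ((case z of (t, x) \<Rightarrow> flow s x t) - flow s x t)
        \<le> B * \<bar>fst z - t\<bar> + exp (L * \<bar>t - s\<bar>) * norm (snd z - x)"
      using norm_triangle_le[OF add_mono[OF flow_displacement[of s "snd z" "fst z" t] flow_lipschitz[of s "snd z" t x]]]
      by (simp add: case_prod_beta)
  qed
  thus "isCont (\<lambda>(t, x). flow s x t) (t, x)" by (simp add: isCont_def Lim_null[symmetric])
qed

lemma flow_measurable [measurable]: "(\<lambda>x. flow s x t) \<in> borel_measurable borel"
proof (rule borel_measurable_continuous_onI)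
  have "continuous_on UNIV ((\<lambda>(t, x). flow s x t) \<circ> (\<lambda>x. (t, x)))"
    by (rule continuous_on_compose) (auto intro!: continuous_intros continuous_on_subset[OF continuous_on_flow])
  thus "continuous_on UNIV (\<lambda>x. flow s x t)" by (simp add: o_def)
qed

lemma continuous_on_field: "continuous_on UNIV (\<lambda>(t, x). u t x)"
  by (rule continuous_on_Lipschitz_joint[OF lip cont])

lemma field_uniform_time:
  assumes "compact S" "0 < \<eta>"
  shows "\<exists>d>0. \<forall>r x. \<bar>r - s\<bar> < d \<and> x \<in> S \<longrightarrow> norm (u r x - u s x) \<le> \<eta>"
proof -
  have "uniformly_continuous_on (cball s 1 \<times> S) (\<lambda>(t, x). u t x)"
    by (intro compact_uniformly_continuous continuous_on_subset[OF continuous_on_field] compact_Times assms) auto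
  then obtain d where d: "d > 0" "\<And>z z'. z \<in> cball s 1 \<times> S \<Longrightarrow> z' \<in> cball s 1 \<times> S \<Longrightarrow> dist z' z < d \<Longrightarrow>
      dist ((\<lambda>(t, x). u t x) z') ((\<lambda>(t, x). u t x) z) < \<eta>"
    unfolding uniformly_continuous_on_def using assms(2) by meson
  have "norm (u r x - u s x) \<le> \<eta>" if "\<bar>r - s\<bar> < min d 1" "x \<in> S" for r x
    using d(2)[of "(s, x)" "(r, x)"] that by (fastforce simp: dist_norm dist_Pair_Pair abs_minus_commute)
  thus ?thesis using d(1) by (intro exI[of _ "min d 1"]) auto
qed

end

section \<open>Continuous induction on real intervals\<close>

lemma real_interval_induct:
  fixes a b :: real
  assumes "a \<le> b" "P a"
    and step: "\<And>s. a \<le> s \<Longrightarrow> s < b \<Longrightarrow> (\<And>r. a \<le> r \<Longrightarrow> r \<le> s \<Longrightarrow> P r) \<Longrightarrow>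
        \<exists>d>0. \<forall>r. s < r \<and> r < s + d \<and> r \<le> b \<longrightarrow> P r"
    and limit: "\<And>s. a < s \<Longrightarrow> s \<le> b \<Longrightarrow> (\<And>r. a \<le> r \<Longrightarrow> r < s \<Longrightarrow> P r) \<Longrightarrow> P s"
  shows "P b"
proof (rule ccontr)
  assume "\<not> P b"
  define X where "X = {r \<in> {a..b}. \<not> P r}"
  \<comment> \<open>Infimum of the failures: the property holds before \<open>c\<close>, therefore
    at \<open>c\<close>, therefore slightly beyond, so \<open>c\<close> is no infimum.\<close>
  define c where "c = Inf X"
  have "b \<in> X" using \<open>\<not> P b\<close> \<open>a \<le> b\<close> by (simp add: X_def)
  have bdd: "bdd_below X" by (rule bdd_belowI[of _ a]) (auto simp: X_def)
  have "a \<le> c" unfolding c_def using \<open>b \<in> X\<close> by (intro cInf_greatest) (auto simp: X_def)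
  have "c \<le> b" unfolding c_def using \<open>b \<in> X\<close> bdd by (rule cInf_lower)
  have lt: "P r" if "a \<le> r" "r < c" for r
    using cInf_lower[OF _ bdd, of r] that \<open>c \<le> b\<close> by (force simp: c_def X_def)
  have "P c" using limit[of c] lt \<open>P a\<close> \<open>a \<le> c\<close> \<open>c \<le> b\<close> by (cases "a = c") auto
  hence "c < b" using \<open>\<not> P b\<close> \<open>c \<le> b\<close> by (cases "c = b") auto
  have "P r" if "a \<le> r" "r \<le> c" for r using lt \<open>P c\<close> that by (cases "r = c") auto
  with step[OF \<open>a \<le> c\<close> \<open>c < b\<close>] obtain d where d: "d > 0" "\<forall>r. c < r \<and> r < c + d \<and> r \<le> b \<longrightarrow> P r"
    by blast
  have "c + d \<le> c"
  proof -
    have "c + d \<le> x" if x: "x \<in> X" for x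
    proof -
      have "c \<le> x" unfolding c_def using bdd x by (intro cInf_lower)
      moreover have "x \<noteq> c" using x \<open>P c\<close> by (auto simp: X_def)
      ultimately show ?thesis using d x by (force simp: X_def)
    qed
    hence "c + d \<le> Inf X" using \<open>b \<in> X\<close> by (intro cInf_greatest) auto
    thus ?thesis by (simp add: c_def)
  qed
  with d show False by simp
qed

text \<open>The admissible length \<open>d\<close> varies with \<open>s\<close> without a uniform
  lower bound, so increments cannot simply be summed; continuous induction carries the bound on,
  with continuity of \<open>g\<close> at the limit points.\<close>

lemma right_increment_bound:
  fixes g :: "real \<Rightarrow> real"
  assumes "a \<le> b" and cont: "continuous_on {a..b} g"
    and "\<And>s. a \<le> s \<Longrightarrow> s < b \<Longrightarrow> \<exists>d>0. \<forall>h. 0 < h \<and> h < d \<longrightarrow> \<bar>g (s + h) - g s\<bar> \<le> M * h"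
  shows "\<bar>g b - g a\<bar> \<le> M * (b - a)"
proof (rule real_interval_induct[OF assms(1), of "\<lambda>s. \<bar>g s - g a\<bar> \<le> M * (s - a)"])
  fix s assume s: "a \<le> s" "s < b" and P: "\<And>r. a \<le> r \<Longrightarrow> r \<le> s \<Longrightarrow> \<bar>g r - g a\<bar> \<le> M * (r - a)"
  from assms(3)[OF s] obtain d where d: "d > 0" "\<And>h. 0 < h \<and> h < d \<Longrightarrow> \<bar>g (s + h) - g s\<bar> \<le> M * h" by blast
  have "\<bar>g r - g a\<bar> \<le> M * (r - a)" if "s < r" "r < s + d" for r
    using d(2)[of "r - s"] P[OF s(1) order_refl] that by (simp add: algebra_simps)
  thus "\<exists>d>0. \<forall>r. s < r \<and> r < s + d \<and> r \<le> b \<longrightarrow> \<bar>g r - g a\<bar> \<le> M * (r - a)" using d(1) by blast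
next
  fix s assume s: "a < s" "s \<le> b" and P: "\<And>r. a \<le> r \<Longrightarrow> r < s \<Longrightarrow> \<bar>g r - g a\<bar> \<le> M * (r - a)"
  have "continuous (at s within {a..<s}) g"
    using cont s by (meson atLeastAtMost_iff atLeastLessThan_subseteq_atLeastAtMost_iff continuous_on_eq_continuous_within
        continuous_within_subset less_imp_le order_refl)
  hence g: "(g \<longlongrightarrow> g s) (at s within {a..<s})" by (simp add: continuous_within)
  show "\<bar>g s - g a\<bar> \<le> M * (s - a)"
  proof (rule tendsto_le)
    show "((\<lambda>r. M * (r - a)) \<longlongrightarrow> M * (s - a)) (at s within {a..<s})" by (intro tendsto_intros)
    show "((\<lambda>r. \<bar>g r - g a\<bar>) \<longlongrightarrow> \<bar>g s - g a\<bar>) (at s within {a..<s})" by (intro tendsto_intros g)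
    show "at s within {a..<s} \<noteq> bot"
      using s by (simp add: at_within_eq_bot_iff[symmetric] trivial_limit_within islimpt_greaterThanLessThan2
          islimpt_subset[of s "{a<..<s}" "{a..<s}"] greaterThanLessThan_subseteq_atLeastLessThan_iff)
    show "\<forall>\<^sub>F r in at s within {a..<s}. \<bar>g r - g a\<bar> \<le> M * (r - a)"
      unfolding eventually_at_filter using P by (auto intro!: always_eventually)
  qed
qed simp

section \<open>Test functions with quadratic Taylor remainder, and mollification\<close>

definition C11_compact :: "('a::euclidean_space \<Rightarrow> real) \<Rightarrow> ('a \<Rightarrow> 'a) \<Rightarrow> bool" where
  "C11_compact f gf \<longleftrightarrow> (\<exists>C. \<forall>x h. \<bar>f (x + h) - f x - gf x \<bullet> h\<bar> \<le> C * (norm h)\<^sup>2) \<and>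
     (\<exists>R. \<forall>x. R < norm x \<longrightarrow> f x = 0 \<and> gf x = 0)"

text \<open>The Taylor expansions with increment \<open>v\<close> at \<open>y\<close>,
  \<open>y - x + v\<close> at \<open>x\<close> and \<open>y - x\<close> at \<open>x\<close> combine
  to \<open>(gf y - gf x) \<bullet> v\<close> with error \<open>C * (1 + 4 + 1) * r\<^sup>2\<close>;
  the vector \<open>v\<close> has length \<open>r\<close> and points along the difference of the
  gradients.\<close>

lemma C11_gradient_lipschitz:
  fixes gf :: "'a::euclidean_space \<Rightarrow> 'a"
  assumes taylor: "\<And>x h. \<bar>f (x + h) - f x - gf x \<bullet> h\<bar> \<le> C * (norm h)\<^sup>2"
  shows "norm (gf y - gf x) \<le> 6 * C * norm (y - x)"
proof (cases "y = x \<or> gf y = gf x")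
  case False
  define r where "r = norm (y - x)"
  define v where "v = (r / norm (gf y - gf x)) *\<^sub>R (gf y - gf x)"
  have r: "0 < r" "norm v = r" using False by (auto simp: r_def v_def)
  have "(gf y - gf x) \<bullet> v = r * norm (gf y - gf x)"
    using False by (simp add: v_def power2_norm_eq_inner[symmetric] power2_eq_square)
  moreover have "(gf y - gf x) \<bullet> v \<le> 6 * C * r\<^sup>2"
  proof -
    have C: "0 \<le> C * r\<^sup>2" using taylor[of x v] r by (simp add: order_trans[OF abs_ge_zero])
    have "norm (y - x + v) \<le> 2 * r" using norm_triangle_ineq[of "y - x" v] r by (simp add: r_def)
    hence "(norm (y - x + v))\<^sup>2 \<le> 4 * r\<^sup>2" using power_mono[of "norm (y - x + v)" "2 * r" 2] by simp
    moreover have "0 \<le> C" using C r by (simp add: zero_le_mult_iff)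
    ultimately have "C * (norm (y - x + v))\<^sup>2 \<le> 4 * (C * r\<^sup>2)"
      using mult_left_mono[of "(norm (y - x + v))\<^sup>2" "4 * r\<^sup>2" C] by simp
    moreover have "\<bar>f (y + v) - f y - gf y \<bullet> v\<bar> \<le> C * r\<^sup>2" using taylor[of y v] r by simp
    moreover have "\<bar>f (y + v) - f x - gf x \<bullet> (y - x + v)\<bar> \<le> C * (norm (y - x + v))\<^sup>2"
      using taylor[of x "y - x + v"] by (simp add: algebra_simps)
    moreover have "\<bar>f y - f x - gf x \<bullet> (y - x)\<bar> \<le> C * r\<^sup>2" using taylor[of x "y - x"] by (simp add: r_def)
    ultimately show ?thesis by (simp add: inner_diff_left inner_add_right mult.assoc)
  qed
  ultimately have "r * norm (gf y - gf x) \<le> r * (6 * C * r)" by (simp add: power2_eq_square mult_ac)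
  thus ?thesis using r by (simp add: r_def)
next
  case True
  have "0 \<le> C * (norm (y - x))\<^sup>2" by (rule order_trans[OF abs_ge_zero taylor])
  hence "y \<noteq> x \<Longrightarrow> 0 \<le> C" by (simp add: zero_le_mult_iff)
  thus ?thesis using True by (cases "y = x") auto
qed

lemma C11_continuous_gradient:
  assumes "C11_compact f gf"
  shows "continuous_on S gf"
proof -
  from assms obtain C where C: "\<And>x h. \<bar>f (x + h) - f x - gf x \<bullet> h\<bar> \<le> C * (norm h)\<^sup>2"
    unfolding C11_compact_def by blast
  have "(6 * C)-lipschitz_on S gf"
  proof (rule lipschitz_onI)
    obtain b :: 'a where "b \<in> Basis" using nonempty_Basis by blast
    thus "0 \<le> 6 * C" using order_trans[OF abs_ge_zero C[of 0 b]] by simp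
  qed (use C11_gradient_lipschitz[OF C] in \<open>simp add: dist_norm\<close>)
  thus ?thesis by (rule lipschitz_on_continuous_on)
qed

lemma C11_has_derivative:
  assumes "C11_compact f gf"
  shows "(f has_derivative (\<lambda>h. gf x \<bullet> h)) (at x)"
proof -
  from assms obtain C where C: "\<And>x h. \<bar>f (x + h) - f x - gf x \<bullet> h\<bar> \<le> C * (norm h)\<^sup>2"
    unfolding C11_compact_def by blast
  show ?thesis
    unfolding has_derivative_at
  proof (intro conjI bounded_linear_inner_right)
    have "(\<lambda>h. C * norm h) \<midarrow>(0::'a)\<rightarrow> 0"
      by (rule tendsto_mult_right_zero[OF tendsto_norm_zero[OF tendsto_ident_at]])
    thus "(\<lambda>h. norm (f (x + h) - f x - gf x \<bullet> h) / norm h) \<midarrow>0\<rightarrow> 0"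
    proof (rule Lim_null_comparison[rotated], intro always_eventually allI)
      fix h show "norm (norm (f (x + h) - f x - gf x \<bullet> h) / norm h) \<le> C * norm h"
        using C[of x h] by (cases "h = 0") (auto simp: divide_le_eq power2_eq_square mult.assoc)
    qed
  qed
qed

lemma C11_continuous: "C11_compact f gf \<Longrightarrow> continuous_on S f"
  by (intro continuous_at_imp_continuous_on ballI has_derivative_continuous[OF C11_has_derivative])

lemma integrable_bounded_support:
  fixes f :: "'a::euclidean_space \<Rightarrow> 'b::{banach, second_countable_topology}"
  assumes M [measurable_cong]: "sets M = sets borel" and [measurable]: "f \<in> borel_measurable borel"
    and "\<And>x. norm (f x) \<le> B" "\<And>x. R < norm x \<Longrightarrow> f x = 0"
    and fin: "emeasure M (cball 0 R) \<le> ennreal c"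
  shows "integrable M f"
proof (rule integrableI_bounded_set[where A="cball 0 R" and B=B])
  show "emeasure M (cball 0 R) < \<infinity>" using fin by (simp add: less_top[symmetric] top_unique)
    (metis ennreal_less_top order_le_less_trans less_top)
qed (use assms in \<open>auto simp: M\<close>)

lemma integral_bound_support:
  fixes f :: "'a::euclidean_space \<Rightarrow> real"
  assumes M [measurable_cong]: "sets M = sets borel" and [measurable]: "f \<in> borel_measurable borel"
    and f: "\<And>x. norm x \<le> R \<Longrightarrow> \<bar>f x\<bar> \<le> \<eta>" "\<And>x. R < norm x \<Longrightarrow> f x = 0"
    and fin: "emeasure M (cball 0 R) \<le> ennreal c" and "0 \<le> c" "0 \<le> \<eta>"
  shows "\<bar>\<integral>x. f x \<partial>M\<bar> \<le> \<eta> * c"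
proof -
  have b: "\<bar>f x\<bar> \<le> \<eta>" for x using f \<open>0 \<le> \<eta>\<close> by (cases "norm x \<le> R") auto
  have int: "integrable M f" by (rule integrable_bounded_support[OF M _ _ f(2) fin]) (use b in auto)
  have "ennreal \<bar>\<integral>x. f x \<partial>M\<bar> \<le> (\<integral>\<^sup>+x. ennreal \<bar>f x\<bar> \<partial>M)"
    using integral_norm_bound_ennreal[OF int] by simp
  also have "\<dots> \<le> (\<integral>\<^sup>+x. ennreal \<eta> * indicator (cball 0 R) x \<partial>M)"
    using f by (intro nn_integral_mono) (auto simp: indicator_def ennreal_leI not_le)
  also have "\<dots> = ennreal \<eta> * emeasure M (cball 0 R)"
    by (subst nn_integral_cmult_indicator) (auto simp: M)
  also have "\<dots> \<le> ennreal \<eta> * ennreal c" by (intro mult_left_mono fin) auto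
  also have "\<dots> = ennreal (\<eta> * c)" using assms by (simp add: ennreal_mult)
  finally show ?thesis using assms by (simp add: ennreal_le_iff)
qed

text \<open>Polynomial in the unit ball with a gradient that is Lipschitz across the boundary: just
  smooth enough for \<open>C11_compact\<close>, and with an elementary Taylor estimate.\<close>

definition bump :: "'a::euclidean_space \<Rightarrow> real" where
  "bump x = (max 0 (1 - (norm x)\<^sup>2))\<^sup>2"

definition bump_grad :: "'a::euclidean_space \<Rightarrow> 'a" where
  "bump_grad x = (- 4 * max 0 (1 - (norm x)\<^sup>2)) *\<^sub>R x"

lemma pos_part_square_taylor:
  fixes z w :: real
  shows "\<bar>(max 0 (z + w))\<^sup>2 - (max 0 z)\<^sup>2 - 2 * max 0 z * w\<bar> \<le> w\<^sup>2"
proof -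
  consider "0 \<le> z" "0 \<le> z + w" | "0 \<le> z" "z + w < 0" | "z < 0" "0 \<le> z + w" | "z < 0" "z + w < 0"
    by linarith
  thus ?thesis
  proof cases
    case 1 thus ?thesis by (simp add: power2_eq_square algebra_simps)
  next
    case 2
    have "z\<^sup>2 + 2 * z * w = z * (z + w) + z * w" by (simp add: power2_eq_square algebra_simps)
    moreover have "z * (z + w) \<le> 0" "z * w \<le> 0" using 2 by (auto intro: mult_nonneg_nonpos)
    moreover have "- w\<^sup>2 \<le> z\<^sup>2 + 2 * z * w" using zero_le_power2[of "z + w"] by (simp add: power2_sum)
    ultimately have "\<bar>- z\<^sup>2 - 2 * z * w\<bar> \<le> w\<^sup>2" by (intro abs_leI; linarith)
    thus ?thesis using 2 by simp
  next
    case 3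
    hence "(z + w)\<^sup>2 \<le> w\<^sup>2" by (intro power_mono) auto
    thus ?thesis using 3 by simp
  qed auto
qed

lemma bump_nonneg [simp]: "0 \<le> bump x" by (simp add: bump_def)

lemma bump_eq_0: "1 < norm x \<Longrightarrow> bump x = 0"
  using one_less_power[of "norm x" 2] by (simp add: bump_def)

lemma bump_grad_eq_0: "1 < norm x \<Longrightarrow> bump_grad x = 0"
  using one_less_power[of "norm x" 2] by (simp add: bump_grad_def)

lemma bump_le_1: "bump x \<le> 1"
  by (auto simp: bump_def max_def power_le_one)

lemma norm_bump_grad_le: "norm (bump_grad x) \<le> 4"
proof (cases "norm x \<le> 1")
  case True
  hence "\<bar>max 0 (1 - (norm x)\<^sup>2)\<bar> * norm x \<le> 1 * 1" by (intro mult_mono) auto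
  thus ?thesis by (simp add: bump_grad_def abs_mult)
qed (simp add: bump_grad_eq_0)

lemma continuous_on_bump: "continuous_on S bump"
  unfolding bump_def by (intro continuous_intros)

lemma continuous_on_bump_grad: "continuous_on S bump_grad"
  unfolding bump_grad_def by (intro continuous_intros)

text \<open>Increments of norm at least 1 are covered by boundedness. For shorter ones,
  \<open>bump\<close> is the squared positive part of \<open>z = 1 - (norm x)\<^sup>2\<close>, whose
  increment \<open>w\<close> is at most \<open>5 * norm h\<close>: this gives 25. The quadratic part
  of \<open>w\<close>, absent from \<open>bump_grad\<close>, gives another 2.\<close>

lemma bump_taylor: "\<bar>bump (x + h) - bump x - bump_grad x \<bullet> h\<bar> \<le> 27 * (norm h)\<^sup>2"
proof (cases "1 \<le> norm h")
  case True
  have "\<bar>bump_grad x \<bullet> h\<bar> \<le> 4 * norm h"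
    using Cauchy_Schwarz_ineq2[of "bump_grad x" h] mult_right_mono[OF norm_bump_grad_le[of x] norm_ge_zero[of h]]
    by linarith
  moreover have "norm h \<le> (norm h)\<^sup>2"
    using mult_left_mono[OF True norm_ge_zero[of h]] by (simp add: power2_eq_square)
  ultimately show ?thesis
    using bump_le_1[of x] bump_le_1[of "x + h"] bump_nonneg[of x] bump_nonneg[of "x + h"] True by linarith
next
  case False
  show ?thesis
  proof (cases "2 < norm x")
    case True
    hence "1 < norm (x + h)" using False norm_triangle_ineq2[of x "- h"] by simp
    thus ?thesis using True by (simp add: bump_eq_0 bump_grad_eq_0)
  next
    case x: False
    define z where "z = 1 - (norm x)\<^sup>2"
    define w where "w = - (2 * (x \<bullet> h) + (norm h)\<^sup>2)"
    have "\<bar>x \<bullet> h\<bar> \<le> 2 * norm h"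
      using Cauchy_Schwarz_ineq2[of x h] mult_right_mono[of "norm x" 2 "norm h"] x by simp
    moreover have "(norm h)\<^sup>2 \<le> norm h" using False by (simp add: power2_eq_square mult_left_le)
    moreover have "0 \<le> (norm h)\<^sup>2" "0 \<le> norm h" by auto
    ultimately have "\<bar>w\<bar> \<le> 5 * norm h" unfolding w_def by linarith
    hence "w\<^sup>2 \<le> 25 * (norm h)\<^sup>2" using power_mono[of "\<bar>w\<bar>" "5 * norm h" 2] by (simp add: power_mult_distrib)
    moreover have "\<bar>(max 0 (z + w))\<^sup>2 - (max 0 z)\<^sup>2 - 2 * max 0 z * w\<bar> \<le> w\<^sup>2" by (rule pos_part_square_taylor)
    moreover have "z + w = 1 - (norm (x + h))\<^sup>2"
      by (simp add: z_def w_def power2_norm_eq_inner inner_add_left inner_add_right inner_commute)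
    moreover have "\<bar>2 * max 0 z * (norm h)\<^sup>2\<bar> \<le> 2 * (norm h)\<^sup>2"
    proof -
      have "0 \<le> max 0 z" "max 0 z \<le> 1" by (auto simp: z_def)
      hence "max 0 z * (norm h)\<^sup>2 \<le> 1 * (norm h)\<^sup>2" by (intro mult_right_mono) auto
      thus ?thesis by (simp add: abs_mult)
    qed
    moreover have "2 * max 0 z * w = bump_grad x \<bullet> h - 2 * max 0 z * (norm h)\<^sup>2"
      by (simp add: w_def bump_grad_def z_def algebra_simps)
    ultimately have "\<bar>(max 0 (1 - (norm (x + h))\<^sup>2))\<^sup>2 - (max 0 z)\<^sup>2 - (bump_grad x \<bullet> h - 2 * max 0 z * (norm h)\<^sup>2)\<bar>
        \<le> 25 * (norm h)\<^sup>2" "\<bar>2 * max 0 z * (norm h)\<^sup>2\<bar> \<le> 2 * (norm h)\<^sup>2" by auto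
    thus ?thesis unfolding bump_def z_def[symmetric] by linarith
  qed
qed

text \<open>The type argument carries the dimension, on which the normalisation depends.\<close>

definition bump_mass :: "'a::euclidean_space itself \<Rightarrow> real \<Rightarrow> real" where
  "bump_mass _ \<epsilon> = (\<integral>x. bump ((1 / \<epsilon>) *\<^sub>R (x::'a)) \<partial>lborel)"

definition mollify :: "real \<Rightarrow> ('a::euclidean_space \<Rightarrow> real) \<Rightarrow> 'a \<Rightarrow> real" where
  "mollify \<epsilon> \<Phi> x = (\<integral>y. bump ((1 / \<epsilon>) *\<^sub>R (x - y)) * \<Phi> y \<partial>lborel) / bump_mass TYPE('a) \<epsilon>"

definition mollify_grad :: "real \<Rightarrow> ('a::euclidean_space \<Rightarrow> real) \<Rightarrow> 'a \<Rightarrow> 'a" where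
  "mollify_grad \<epsilon> \<Phi> x = (1 / (\<epsilon> * bump_mass TYPE('a) \<epsilon>)) *\<^sub>R
     (\<integral>y. \<Phi> y *\<^sub>R bump_grad ((1 / \<epsilon>) *\<^sub>R (x - y)) \<partial>lborel)"

lemma emeasure_lborel_cball_le: "emeasure lborel (cball (x::'a::euclidean_space) R) \<le> ennreal (measure lborel (cball x R))"
  by (subst emeasure_eq_ennreal_measure) (use emeasure_lborel_cball_finite[of x R] in auto)

lemma bump_measurable [measurable]: "bump \<in> borel_measurable borel"
  and bump_grad_measurable [measurable]: "bump_grad \<in> borel_measurable borel"
  using continuous_on_bump continuous_on_bump_grad by (auto intro!: borel_measurable_continuous_onI)

lemma scaled_norm_gt_1: "0 < \<epsilon> \<Longrightarrow> \<epsilon> < norm x \<Longrightarrow> 1 < norm ((1 / \<epsilon>) *\<^sub>R x)"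
  by (simp add: field_simps)

lemma integrable_bump:
  assumes "0 < \<epsilon>"
  shows "integrable lborel (\<lambda>x::'a::euclidean_space. bump ((1 / \<epsilon>) *\<^sub>R x))"
  by (rule integrable_bounded_support[where R=\<epsilon> and B=1, OF _ _ _ _ emeasure_lborel_cball_le])
     (auto simp: bump_le_1 bump_eq_0[OF scaled_norm_gt_1[OF assms]])

lemma bump_mass_pos:
  assumes "0 < \<epsilon>" shows "0 < bump_mass TYPE('a::euclidean_space) \<epsilon>"
proof -
  have "0 < measure lborel (cball (0::'a) (\<epsilon> / 2)) * (1 / 4)"
    using assms by (simp add: content_cball_gt_0_iff)
  also have "\<dots> = (\<integral>x. indicator (cball (0::'a) (\<epsilon> / 2)) x * (1 / 4) \<partial>lborel)"
    by simp
  also have "\<dots> \<le> bump_mass TYPE('a) \<epsilon>"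
    unfolding bump_mass_def
  proof (rule integral_mono[OF _ integrable_bump[OF assms]])
    show "integrable lborel (\<lambda>x. indicator (cball (0::'a) (\<epsilon> / 2)) x * (1 / 4::real))"
      by (intro integrable_mult_left integrable_real_indicator) (use emeasure_lborel_cball_finite[of "0::'a"] in auto)
    fix x :: 'a
    show "indicator (cball 0 (\<epsilon> / 2)) x * (1 / 4) \<le> bump ((1 / \<epsilon>) *\<^sub>R x)"
    proof (cases "norm x \<le> \<epsilon> / 2")
      case True
      define n where "n = norm ((1 / \<epsilon>) *\<^sub>R x)"
      have "n \<le> 1 / 2" using True assms by (simp add: n_def field_simps)
      hence "n\<^sup>2 \<le> (1 / 2)\<^sup>2" by (intro power_mono) (auto simp: n_def)
      hence "3 / 4 \<le> 1 - n\<^sup>2" by (simp add: power_divide)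
      hence "3 / 4 \<le> max 0 (1 - n\<^sup>2)" by (rule order_trans) simp
      hence "(3 / 4)\<^sup>2 \<le> bump ((1 / \<epsilon>) *\<^sub>R x)"
        unfolding bump_def n_def[symmetric] by (rule power_mono) simp
      thus ?thesis by (simp add: indicator_def power2_eq_square)
    qed (simp add: indicator_def)
  qed
  finally show ?thesis .
qed

lemma lborel_integral_reflect:
  fixes f :: "'a::euclidean_space \<Rightarrow> 'b::{banach, second_countable_topology}"
  assumes [measurable]: "f \<in> borel_measurable borel"
  shows "(\<integral>y. f (x - y) \<partial>lborel) = (\<integral>y. f y \<partial>lborel)"
proof -
  have "lborel = distr (lborel::'a measure) borel (\<lambda>y. x - y)"
    using lborel_affine[of "- 1" x] by (simp add: density_1)
  hence "(\<integral>y. f y \<partial>lborel) = (\<integral>y. f y \<partial>distr (lborel::'a measure) borel (\<lambda>y. x - y))" by simp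
  also have "\<dots> = (\<integral>y. f (x - y) \<partial>lborel)" by (subst integral_distr) auto
  finally show ?thesis by simp
qed

lemma mollify_eq:
  fixes \<Phi> :: "'a::euclidean_space \<Rightarrow> real"
  assumes [measurable]: "\<Phi> \<in> borel_measurable borel"
  shows "mollify \<epsilon> \<Phi> x = (\<integral>z. bump ((1 / \<epsilon>) *\<^sub>R z) * \<Phi> (x - z) \<partial>lborel) / bump_mass TYPE('a) \<epsilon>"
  unfolding mollify_def
  by (subst lborel_integral_reflect[where x=x and f="\<lambda>y. bump ((1 / \<epsilon>) *\<^sub>R (x - y)) * \<Phi> y", symmetric]) auto

lemma integrable_bump_mult:
  fixes \<Phi> :: "'a::euclidean_space \<Rightarrow> real"
  assumes "0 < \<epsilon>" and [measurable]: "\<Phi> \<in> borel_measurable borel" and "\<And>x. \<bar>\<Phi> x\<bar> \<le> B"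
  shows "integrable lborel (\<lambda>z. bump ((1 / \<epsilon>) *\<^sub>R z) * \<Phi> z)"
proof (rule integrable_bounded_support[where R=\<epsilon> and B=B, OF _ _ _ _ emeasure_lborel_cball_le])
  show "norm (bump ((1 / \<epsilon>) *\<^sub>R x) * \<Phi> x) \<le> B" for x
    using mult_mono[OF bump_le_1[of "(1/\<epsilon>) *\<^sub>R x"] assms(3)[of x]] by (simp add: abs_mult)
qed (auto simp: bump_eq_0[OF scaled_norm_gt_1[OF assms(1)]])

text \<open>Two functions are compared at different base points with the same offset
  \<open>z\<close>. In this way a translation passes through the mollifier, and only values of the
  functions are compared, not derivatives.\<close>

lemma mollify_close:
  fixes \<Phi> \<Psi> :: "'a::euclidean_space \<Rightarrow> real"
  assumes "0 < \<epsilon>" and [measurable]: "\<Phi> \<in> borel_measurable borel" "\<Psi> \<in> borel_measurable borel"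
    and bd: "\<And>x. \<bar>\<Phi> x\<bar> \<le> B" "\<And>x. \<bar>\<Psi> x\<bar> \<le> B'"
    and close: "\<And>z. norm z \<le> \<epsilon> \<Longrightarrow> \<bar>\<Phi> (x - z) - \<Psi> (y - z)\<bar> \<le> \<eta>"
  shows "\<bar>mollify \<epsilon> \<Phi> x - mollify \<epsilon> \<Psi> y\<bar> \<le> \<eta>"
proof -
  let ?m = "bump_mass TYPE('a) \<epsilon>" and ?b = "\<lambda>z::'a. bump ((1 / \<epsilon>) *\<^sub>R z)"
  have i1: "integrable lborel (\<lambda>z. ?b z * \<Phi> (x - z))" and i2: "integrable lborel (\<lambda>z. ?b z * \<Psi> (y - z))"
    using integrable_bump_mult[OF assms(1), of "\<lambda>z. \<Phi> (x - z)" B]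
      integrable_bump_mult[OF assms(1), of "\<lambda>z. \<Psi> (y - z)" B'] bd by auto
  have "mollify \<epsilon> \<Phi> x - mollify \<epsilon> \<Psi> y = (\<integral>z. ?b z * \<Phi> (x - z) - ?b z * \<Psi> (y - z) \<partial>lborel) / ?m"
    using i1 i2 by (simp add: mollify_eq diff_divide_distrib)
  moreover have "\<bar>\<integral>z. ?b z * \<Phi> (x - z) - ?b z * \<Psi> (y - z) \<partial>lborel\<bar> \<le> (\<integral>z. \<eta> * ?b z \<partial>lborel)"
  proof (rule order_trans[OF integral_abs_bound integral_mono])
    fix z
    show "\<bar>?b z * \<Phi> (x - z) - ?b z * \<Psi> (y - z)\<bar> \<le> \<eta> * ?b z"
    proof (cases "norm z \<le> \<epsilon>")
      case True
      thus ?thesis using mult_left_mono[OF close[OF True] bump_nonneg[of "(1 / \<epsilon>) *\<^sub>R z"]]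
        unfolding right_diff_distrib[symmetric] abs_mult by (simp add: mult.commute)
    next
      case False
      hence "?b z = 0" using scaled_norm_gt_1[OF assms(1), of z] by (intro bump_eq_0) auto
      thus ?thesis by simp
    qed
  qed (use i1 i2 integrable_bump[OF assms(1), where 'a='a] in auto)
  moreover have "(\<integral>z. \<eta> * ?b z \<partial>lborel) = \<eta> * ?m" by (simp add: bump_mass_def)
  ultimately have "\<bar>\<integral>z. ?b z * \<Phi> (x - z) - ?b z * \<Psi> (y - z) \<partial>lborel\<bar> \<le> \<eta> * ?m"
    "mollify \<epsilon> \<Phi> x - mollify \<epsilon> \<Psi> y = (\<integral>z. ?b z * \<Phi> (x - z) - ?b z * \<Psi> (y - z) \<partial>lborel) / ?m"
    by linarith+
  thus ?thesis using bump_mass_pos[OF assms(1), where 'a='a] by (simp add: divide_le_eq)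
qed

lemma mollify_const: "0 < \<epsilon> \<Longrightarrow> mollify \<epsilon> (\<lambda>_::'a::euclidean_space. c) x = c"
  using bump_mass_pos[of \<epsilon>, where 'a='a] by (simp add: mollify_eq bump_mass_def)

lemma mollify_close_const:
  fixes \<Phi> :: "'a::euclidean_space \<Rightarrow> real"
  assumes "0 < \<epsilon>" "\<Phi> \<in> borel_measurable borel" "\<And>x. \<bar>\<Phi> x\<bar> \<le> B"
    and "\<And>z. norm z \<le> \<epsilon> \<Longrightarrow> \<bar>\<Phi> (x - z) - c\<bar> \<le> \<eta>"
  shows "\<bar>mollify \<epsilon> \<Phi> x - c\<bar> \<le> \<eta>"
  using mollify_close[of \<epsilon> \<Phi> "\<lambda>_. c" B "\<bar>c\<bar>" x x \<eta>] assms mollify_const[of \<epsilon> c x] by simp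

lemma mollify_support:
  fixes \<Phi> :: "'a::euclidean_space \<Rightarrow> real"
  assumes "0 < \<epsilon>" and supp: "\<And>x. R < norm x \<Longrightarrow> \<Phi> x = 0" and "R + \<epsilon> < norm x"
  shows "mollify \<epsilon> \<Phi> x = 0" "mollify_grad \<epsilon> \<Phi> x = 0"
proof -
  have "\<Phi> y = 0 \<or> 1 < norm ((1 / \<epsilon>) *\<^sub>R (x - y))" for y
    using supp[of y] scaled_norm_gt_1[OF assms(1), of "x - y"] norm_triangle_ineq2[of x y] assms(3) by linarith
  hence "bump ((1 / \<epsilon>) *\<^sub>R (x - y)) * \<Phi> y = 0" "\<Phi> y *\<^sub>R bump_grad ((1 / \<epsilon>) *\<^sub>R (x - y)) = 0" for y
    using bump_eq_0 bump_grad_eq_0 by (metis mult_eq_0_iff scaleR_eq_0_iff)+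
  thus "mollify \<epsilon> \<Phi> x = 0" "mollify_grad \<epsilon> \<Phi> x = 0"
    by (simp_all only: mollify_def mollify_grad_def integral_zero div_0 scaleR_zero_right)
qed

text \<open>The Taylor expansion falls on the kernel \<open>bump\<close>, so boundedness,
  measurability and bounded support of \<Phi> suffice.\<close>

lemma mollify_C11:
  fixes \<Phi> :: "'a::euclidean_space \<Rightarrow> real"
  assumes \<epsilon>: "0 < \<epsilon>" and [measurable]: "\<Phi> \<in> borel_measurable borel"
    and bd: "\<And>x. \<bar>\<Phi> x\<bar> \<le> B" and supp: "\<And>x. R < norm x \<Longrightarrow> \<Phi> x = 0"
  shows "C11_compact (mollify \<epsilon> \<Phi>) (mollify_grad \<epsilon> \<Phi>)"
proof -
  let ?m = "bump_mass TYPE('a) \<epsilon>"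
  let ?c = "measure lborel (cball (0::'a) R)"
  have m: "0 < ?m" by (rule bump_mass_pos) fact
  have "0 \<le> B" using bd[of 0] abs_ge_zero order_trans by blast
  define C where "C = 27 * B * ?c / (\<epsilon>\<^sup>2 * ?m)"
  have "\<bar>mollify \<epsilon> \<Phi> (x + h) - mollify \<epsilon> \<Phi> x - mollify_grad \<epsilon> \<Phi> x \<bullet> h\<bar> \<le> C * (norm h)\<^sup>2" for x h
  proof -
    let ?a = "\<lambda>y. (1 / \<epsilon>) *\<^sub>R (x - y)"
    have i0: "integrable lborel (\<lambda>y. bump ((1 / \<epsilon>) *\<^sub>R (x' - y)) * \<Phi> y)" for x'
    proof (rule integrable_bounded_support[where R=R and B=B, OF _ _ _ _ emeasure_lborel_cball_le])
      show "norm (bump ((1 / \<epsilon>) *\<^sub>R (x' - y)) * \<Phi> y) \<le> B" for y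
        using mult_mono[OF bump_le_1[of "(1/\<epsilon>) *\<^sub>R (x' - y)"] bd[of y]] by (simp add: abs_mult)
    qed (use supp in auto)
    have i1: "integrable lborel (\<lambda>y. \<Phi> y *\<^sub>R bump_grad (?a y))"
    proof (rule integrable_bounded_support[where R=R and B="B * 4", OF _ _ _ _ emeasure_lborel_cball_le])
      show "norm (\<Phi> y *\<^sub>R bump_grad (?a y)) \<le> B * 4" for y
        using mult_mono[OF bd[of y] norm_bump_grad_le[of "?a y"]] \<open>0 \<le> B\<close> by simp
    qed (use supp in auto)
    have i2: "integrable lborel (\<lambda>y. \<Phi> y * (bump_grad (?a y) \<bullet> (h /\<^sub>R \<epsilon>)))"
      using integrable_inner_left[of "h /\<^sub>R \<epsilon>" lborel "\<lambda>y. \<Phi> y *\<^sub>R bump_grad (?a y)"] i1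
      by (simp only: inner_scaleR_left)
    have "mollify_grad \<epsilon> \<Phi> x \<bullet> h = (\<integral>y. (\<Phi> y *\<^sub>R bump_grad (?a y)) \<bullet> (h /\<^sub>R \<epsilon>) \<partial>lborel) / ?m"
      using i1 by (subst integral_inner_left) (auto simp: mollify_grad_def divide_inverse mult_ac)
    hence eq: "mollify \<epsilon> \<Phi> (x + h) - mollify \<epsilon> \<Phi> x - mollify_grad \<epsilon> \<Phi> x \<bullet> h
       = (\<integral>y. \<Phi> y * (bump (?a y + h /\<^sub>R \<epsilon>) - bump (?a y) - bump_grad (?a y) \<bullet> (h /\<^sub>R \<epsilon>)) \<partial>lborel) / ?m"
    proof -
      have "\<Phi> y * (bump (?a y + h /\<^sub>R \<epsilon>) - bump (?a y) - bump_grad (?a y) \<bullet> (h /\<^sub>R \<epsilon>))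
        = bump ((1 / \<epsilon>) *\<^sub>R (x + h - y)) * \<Phi> y - bump (?a y) * \<Phi> y - \<Phi> y * (bump_grad (?a y) \<bullet> (h /\<^sub>R \<epsilon>))" for y
      proof -
        have "?a y + h /\<^sub>R \<epsilon> = (1 / \<epsilon>) *\<^sub>R (x + h - y)"
          by (simp add: inverse_eq_divide scaleR_add_right scaleR_diff_right)
        thus ?thesis by (simp only: right_diff_distrib mult.commute[of "\<Phi> y"])
      qed
      hence "(\<integral>y. \<Phi> y * (bump (?a y + h /\<^sub>R \<epsilon>) - bump (?a y) - bump_grad (?a y) \<bullet> (h /\<^sub>R \<epsilon>)) \<partial>lborel)
        = (\<integral>y. bump ((1 / \<epsilon>) *\<^sub>R (x + h - y)) * \<Phi> y - bump (?a y) * \<Phi> y - \<Phi> y * (bump_grad (?a y) \<bullet> (h /\<^sub>R \<epsilon>)) \<partial>lborel)"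
        by (simp only:)
      also have "\<dots> = (\<integral>y. bump ((1 / \<epsilon>) *\<^sub>R (x + h - y)) * \<Phi> y \<partial>lborel) - (\<integral>y. bump (?a y) * \<Phi> y \<partial>lborel)
          - (\<integral>y. \<Phi> y * (bump_grad (?a y) \<bullet> (h /\<^sub>R \<epsilon>)) \<partial>lborel)"
        by (subst Bochner_Integration.integral_diff, intro Bochner_Integration.integrable_diff i0 i2, rule i2,
            subst Bochner_Integration.integral_diff, rule i0, rule i0) (rule refl)
      finally show ?thesis
        unfolding \<open>mollify_grad \<epsilon> \<Phi> x \<bullet> h = _\<close> mollify_def inner_scaleR_left
        by (simp only: diff_divide_distrib)
    qed
    have "\<bar>\<integral>y. \<Phi> y * (bump (?a y + h /\<^sub>R \<epsilon>) - bump (?a y) - bump_grad (?a y) \<bullet> (h /\<^sub>R \<epsilon>)) \<partial>lborel\<bar>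
      \<le> B * (27 * (norm (h /\<^sub>R \<epsilon>))\<^sup>2) * ?c"
    proof (rule integral_bound_support[OF _ _ _ _ emeasure_lborel_cball_le])
      show "\<bar>\<Phi> y * (bump (?a y + h /\<^sub>R \<epsilon>) - bump (?a y) - bump_grad (?a y) \<bullet> (h /\<^sub>R \<epsilon>))\<bar>
         \<le> B * (27 * (norm (h /\<^sub>R \<epsilon>))\<^sup>2)" for y
        unfolding abs_mult by (intro mult_mono bd bump_taylor) (use \<open>0 \<le> B\<close> in auto)
    qed (use supp \<open>0 \<le> B\<close> in auto)
    also have "\<dots> = C * (norm h)\<^sup>2 * ?m"
      using m \<epsilon> by (simp add: C_def power_mult_distrib field_simps)
    finally show ?thesis unfolding eq using m by (simp add: divide_le_eq)
  qed
  moreover have "\<forall>x. R + \<epsilon> < norm x \<longrightarrow> mollify \<epsilon> \<Phi> x = 0 \<and> mollify_grad \<epsilon> \<Phi> x = 0"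
    using mollify_support[OF \<epsilon>, of R \<Phi>] supp by blast
  ultimately show ?thesis unfolding C11_compact_def by blast
qed

section \<open>The continuity equation\<close>

text \<open>Open boxes generate the Borel sets, and the indicator of a box is the pointwise limit of
  \<open>min 1 (n * infdist x (- box a b))\<close>, which is Lipschitz and vanishes outside the
  box.\<close>

lemma measure_eqI_lipschitz:
  fixes M N :: "'a::euclidean_space measure"
  assumes M: "sets M = sets borel" and N: "sets N = sets borel"
    and finM: "\<And>R. emeasure M (cball 0 R) < \<infinity>" and finN: "\<And>R. emeasure N (cball 0 R) < \<infinity>"
    and eq: "\<And>\<psi> \<Lambda> R. (\<And>x y. \<bar>\<psi> x - \<psi> y\<bar> \<le> \<Lambda> * norm (x - y)) \<Longrightarrow> (\<And>x. R < norm x \<Longrightarrow> \<psi> x = 0) \<Longrightarrow>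
        (\<integral>x. \<psi> x \<partial>M) = (\<integral>x. \<psi> x \<partial>N)"
  shows "M = N"
proof (rule measure_eqI_generator_eq)
  let ?E = "range (\<lambda>(a, b). box a b :: 'a set)"
  show "Int_stable ?E" by (auto simp: Int_stable_def box_Int_box)
  show "?E \<subseteq> Pow UNIV" "sets M = sigma_sets UNIV ?E" "sets N = sigma_sets UNIV ?E"
    by (simp_all add: borel_eq_box M N)
  show "range (\<lambda>n. box (- (real n *\<^sub>R One)) (real n *\<^sub>R One)) \<subseteq> ?E" by auto
  show "(\<Union>n. box (- (real n *\<^sub>R One)) (real n *\<^sub>R One) :: 'a set) = UNIV"
    by (rule UN_box_eq_UNIV)
  have fin: "emeasure L (box a b) < \<infinity>"
    if "sets L = sets borel" "\<And>R. emeasure L (cball 0 R) < \<infinity>" for L and a b :: 'a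
  proof -
    obtain R where "\<forall>x\<in>box a b. norm x \<le> R" using bounded_box[of a b] bounded_iff by metis
    hence "box a b \<subseteq> cball 0 R" by auto
    hence "emeasure L (box a b) \<le> emeasure L (cball 0 R)" by (intro emeasure_mono) (auto simp: that)
    thus ?thesis using that(2)[of R] by (rule order_le_less_trans)
  qed
  show "emeasure M (box (- (real i *\<^sub>R One)) (real i *\<^sub>R One)) \<noteq> \<infinity>" for i
    using fin[OF M finM] by (metis less_irrefl)
  fix X assume "X \<in> ?E"
  then obtain a b where X: "X = box a b" by auto
  obtain R where "\<forall>x\<in>box a b. norm x \<le> R" using bounded_box[of a b] bounded_iff by metis
  hence R: "box a b \<subseteq> cball 0 R" by auto
  \<comment> \<open>The distance to the empty set is 0 by convention, so positivity of
    \<open>infdist\<close> inside the box relies on a nonempty complement.\<close>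
  have ne: "- box a b \<noteq> {}" 
  proof
    assume "- box a b = {}"
    hence "box a b = UNIV" by (metis Compl_empty_eq double_complement)
    thus False using bounded_box[of a b] not_bounded_UNIV[where 'a='a] by simp
  qed
  define \<psi> where "\<psi> n x = min 1 (real n * infdist x (- box a b))" for n :: nat and x
  have lip: "\<bar>\<psi> n x - \<psi> n y\<bar> \<le> real n * norm (x - y)" for n x y
  proof -
    have "\<bar>\<psi> n x - \<psi> n y\<bar> \<le> \<bar>real n * infdist x (- box a b) - real n * infdist y (- box a b)\<bar>"
      unfolding \<psi>_def by linarith
    also have "\<dots> = real n * \<bar>infdist x (- box a b) - infdist y (- box a b)\<bar>"
      by (simp add: right_diff_distrib[symmetric] abs_mult)
    also have "\<dots> \<le> real n * norm (x - y)"
      by (intro mult_left_mono) (auto simp: infdist_triangle_abs dist_norm[symmetric])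
    finally show ?thesis .
  qed
  have out: "\<psi> n x = 0" if "x \<notin> box a b" for n x
    using that by (simp add: \<psi>_def)
  have nonneg: "0 \<le> \<psi> n x" for n x by (simp add: \<psi>_def infdist_nonneg)
  have lim: "(\<lambda>n. ennreal (\<psi> n x)) \<longlonglongrightarrow> indicator (box a b) x" for x
  proof (cases "x \<in> box a b")
    case True
    have "closed (- box a b)" by (simp add: open_box closed_Compl)
    hence pos: "0 < infdist x (- box a b)"
      using in_closed_iff_infdist_zero[of "- box a b" x] ne True infdist_nonneg[of x "- box a b"] by fastforce
    obtain n0 :: nat where n0: "1 < real n0 * infdist x (- box a b)"
      using reals_Archimedean3[OF pos] by blast
    have "\<forall>\<^sub>F n in sequentially. ennreal (\<psi> n x) = indicator (box a b) x"
      using eventually_ge_at_top[of n0]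
    proof eventually_elim
      case (elim n)
      have "real n0 * infdist x (- box a b) \<le> real n * infdist x (- box a b)"
        using elim pos by (intro mult_right_mono) auto
      thus ?case using n0 True by (simp add: \<psi>_def)
    qed
    thus ?thesis by (rule tendsto_eventually)
  qed (simp add: out)
  have conv: "(\<lambda>n. ennreal (\<integral>x. \<psi> n x \<partial>L)) \<longlonglongrightarrow> emeasure L (box a b)"
    if L: "sets L = sets borel" "\<And>R. emeasure L (cball 0 R) < \<infinity>" for L
  proof -
    note [measurable_cong] = L(1)
    have [measurable]: "\<psi> n \<in> borel_measurable borel" for n
      unfolding \<psi>_def[abs_def] by (intro borel_measurable_continuous_onI continuous_intros)
    have int: "integrable L (\<psi> n)" for n
    proof (rule integrable_bounded_support[where R=R and B=1 and c="enn2real (emeasure L (cball 0 R))"])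
      show "norm (\<psi> n x) \<le> 1" for x using nonneg[of n x] by (simp add: \<psi>_def)
      show "\<psi> n x = 0" if "R < norm x" for x using R that by (intro out) auto
      show "emeasure L (cball 0 R) \<le> ennreal (enn2real (emeasure L (cball 0 R)))"
        using L(2)[of R] by (simp add: less_top)
    qed (use L in auto)
    have "(\<lambda>n. \<integral>\<^sup>+x. ennreal (\<psi> n x) \<partial>L) \<longlonglongrightarrow> (\<integral>\<^sup>+x. indicator (box a b) x \<partial>L)"
    proof (rule nn_integral_dominated_convergence[where w="indicator (box a b)"])
      show "AE x in L. ennreal (\<psi> n x) \<le> indicator (box a b) x" for n
        using out by (intro always_eventually allI) (auto simp: \<psi>_def indicator_def)
      show "(\<integral>\<^sup>+x. indicator (box a b) x \<partial>L) < \<infinity>" using fin[OF L] L by simp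
    qed (use lim in auto)
    moreover have "(\<integral>\<^sup>+x. ennreal (\<psi> n x) \<partial>L) = ennreal (\<integral>x. \<psi> n x \<partial>L)" for n
      using int nonneg by (intro nn_integral_eq_integral) auto
    ultimately show ?thesis using L by simp
  qed
  have "(\<integral>x. \<psi> n x \<partial>M) = (\<integral>x. \<psi> n x \<partial>N)" for n
    using R by (intro eq[where \<Lambda>="real n" and R=R] lip out) auto
  with conv[OF M finM] conv[OF N finN] show "emeasure M X = emeasure N X"
    unfolding X by (simp add: LIMSEQ_unique)
qed

text \<open>The linear equation with a prescribed velocity. Local finiteness in place of finite mass
  makes Lebesgue measure an instance next to \<open>law (\<sigma> t)\<close>.\<close>

locale continuity_equation = lipschitz_field u L B
  for u :: "real \<Rightarrow> 'a::euclidean_space \<Rightarrow> 'a" and L B :: real +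
  fixes \<mu> :: "real \<Rightarrow> 'a measure"
  assumes sets_mu [measurable_cong]: "\<And>t. sets (\<mu> t) = sets borel"
    and locally_finite: "\<And>R. \<exists>c. \<forall>t\<ge>0. emeasure (\<mu> t) (cball 0 R) \<le> ennreal c"
    and weakly_continuous: "\<And>G :: 'a \<Rightarrow> real. continuous_on UNIV G \<Longrightarrow> (\<exists>R. \<forall>x. R < norm x \<longrightarrow> G x = 0) \<Longrightarrow>
        continuous_on {0..} (\<lambda>t. \<integral>x. G x \<partial>\<mu> t)"
    and weak_solution: "\<And>f gf t. C11_compact f gf \<Longrightarrow> 0 \<le> t \<Longrightarrow>
        ((\<lambda>t. \<integral>x. f x \<partial>\<mu> t) has_real_derivative (\<integral>x. gf x \<bullet> u t x \<partial>\<mu> t)) (at t within {0..})"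
begin

context
  fixes \<psi> :: "'a \<Rightarrow> real" and \<Lambda> R t M :: real
  assumes psi_lip: "\<And>x y. \<bar>\<psi> x - \<psi> y\<bar> \<le> \<Lambda> * norm (x - y)" and psi_supp: "\<And>x. R < norm x \<Longrightarrow> \<psi> x = 0"
    and psi_bd: "\<And>x. \<bar>\<psi> x\<bar> \<le> M" and Lambda_nonneg: "0 \<le> \<Lambda>" and t_nonneg: "0 \<le> t"
begin

text \<open>Solution of the backward transport equation with final value \<psi>: it is constant
  along trajectories. It inherits only Lipschitz regularity from \<psi> and the flow, and therefore
  has to be mollified before \<open>weak_solution\<close> applies.\<close>

definition \<Phi> :: "real \<Rightarrow> 'a \<Rightarrow> real" where "\<Phi> s x = \<psi> (flow s x t)"

text \<open>A Lipschitz constant valid for \<open>\<Phi> s\<close> at all \<open>s\<close> in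
  \<open>{0..t}\<close>; the radius \<open>R'\<close> plays the same part for the supports.\<close>

definition \<Lambda>' :: real where "\<Lambda>' = \<Lambda> * exp (L * t)"

definition R' :: real where "R' = R + B * t"

lemma Lambda'_nonneg: "0 \<le> \<Lambda>'" by (simp add: \<Lambda>'_def Lambda_nonneg)

lemma Phi_lip:
  assumes "0 \<le> s" "s \<le> t" shows "\<bar>\<Phi> s x - \<Phi> s y\<bar> \<le> \<Lambda>' * norm (x - y)"
proof -
  have "\<bar>\<Phi> s x - \<Phi> s y\<bar> \<le> \<Lambda> * norm (flow s x t - flow s y t)" unfolding \<Phi>_def by (rule psi_lip)
  also have "\<dots> \<le> \<Lambda> * (exp (L * t) * norm (x - y))"
    using assms L_nonneg Lambda_nonneg
    by (intro mult_left_mono order_trans[OF flow_lipschitz] mult_right_mono) (auto intro: mult_left_mono)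
  finally show ?thesis by (simp add: \<Lambda>'_def mult.assoc)
qed

lemma Phi_supp: assumes "0 \<le> s" "s \<le> t" "R' < norm x" shows "\<Phi> s x = 0"
proof -
  have "norm (flow s x t - x) \<le> B * t"
    using flow_displacement[of s x t s] assms mult_left_mono[of "t - s" t B] B_nonneg by simp
  hence "R < norm (flow s x t)"
    using assms(3) norm_triangle_ineq2[of x "flow s x t"] by (simp add: R'_def norm_minus_commute)
  thus ?thesis by (simp add: \<Phi>_def psi_supp)
qed

lemma Phi_bd: "\<bar>\<Phi> s x\<bar> \<le> M" by (simp add: \<Phi>_def psi_bd)

lemma Phi_measurable [measurable]: "\<Phi> s \<in> borel_measurable borel"
proof -
  have "\<Lambda>-lipschitz_on UNIV \<psi>"
    by (rule lipschitz_onI) (use psi_lip Lambda_nonneg in \<open>auto simp: dist_norm\<close>)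
  hence [measurable]: "\<psi> \<in> borel_measurable borel"
    by (intro borel_measurable_continuous_onI lipschitz_on_continuous_on)
  show ?thesis unfolding \<Phi>_def by measurable
qed

lemma Phi_shift: "\<Phi> r x = \<Phi> s (flow r x s)"
  by (simp add: \<Phi>_def flow_flow)

lemma Phi_time:
  assumes "0 \<le> s" "s \<le> t" shows "\<bar>\<Phi> r x - \<Phi> s x\<bar> \<le> \<Lambda>' * (B * \<bar>r - s\<bar>)"
proof -
  have "\<bar>\<Phi> r x - \<Phi> s x\<bar> \<le> \<Lambda>' * norm (flow r x s - x)"
    unfolding Phi_shift[of r x s] using assms by (rule Phi_lip)
  also have "\<dots> \<le> \<Lambda>' * (B * \<bar>r - s\<bar>)"
    using flow_displacement[of r x s r] by (intro mult_left_mono Lambda'_nonneg) (simp add: abs_minus_commute)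
  finally show ?thesis .
qed

context
  fixes \<epsilon> c :: real
  assumes eps: "0 < \<epsilon>" "\<epsilon> \<le> 1" and mass: "\<And>s. 0 \<le> s \<Longrightarrow> emeasure (\<mu> s) (cball 0 (R' + 2)) \<le> ennreal c" and c: "0 \<le> c"
begin

definition f where "f s = mollify \<epsilon> (\<Phi> s)"
definition gf where "gf s = mollify_grad \<epsilon> (\<Phi> s)"
text \<open>With \<open>\<Phi> s\<close> in place of its mollification this integral would be
  constant in time; mollification lets it change at a rate of order \<epsilon> only.\<close>

definition g where "g s = (\<integral>x. f s x \<partial>\<mu> s)"

lemma f_C11: "0 \<le> s \<Longrightarrow> s \<le> t \<Longrightarrow> C11_compact (f s) (gf s)"
  unfolding f_def gf_def by (rule mollify_C11[OF eps(1) _ Phi_bd Phi_supp]) auto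

lemma f_supp: "0 \<le> s \<Longrightarrow> s \<le> t \<Longrightarrow> R' + 1 < norm x \<Longrightarrow> f s x = 0"
  and gf_supp: "0 \<le> s \<Longrightarrow> s \<le> t \<Longrightarrow> R' + 1 < norm x \<Longrightarrow> gf s x = 0"
  unfolding f_def gf_def using mollify_support[OF eps(1), of R' "\<Phi> s" x] Phi_supp[of s] eps(2) by auto

lemma f_continuous: "0 \<le> s \<Longrightarrow> s \<le> t \<Longrightarrow> continuous_on S (f s)"
  using f_C11 C11_continuous by blast

lemma f_measurable: "0 \<le> s \<Longrightarrow> s \<le> t \<Longrightarrow> f s \<in> borel_measurable borel"
  by (intro borel_measurable_continuous_onI f_continuous)

lemma f_bd: "\<bar>f s x\<bar> \<le> M"
  using mollify_close_const[OF eps(1), of "\<Phi> s" M x 0 M] Phi_bd by (simp add: f_def)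

lemma f_integrable:
  assumes "0 \<le> s" "s \<le> t" "0 \<le> r" shows "integrable (\<mu> r) (f s)"
  by (rule integrable_bounded_support[where R="R' + 2" and B=M, OF sets_mu f_measurable[OF assms(1,2)] _ _ mass[OF assms(3)]])
     (use f_bd f_supp assms in auto)

lemma f_close: "0 \<le> s \<Longrightarrow> s \<le> t \<Longrightarrow> \<bar>f s x - \<Phi> s x\<bar> \<le> \<Lambda>' * \<epsilon>"
  unfolding f_def
proof (rule mollify_close_const[OF eps(1) Phi_measurable Phi_bd])
  fix z :: 'a assume "0 \<le> s" "s \<le> t" "norm z \<le> \<epsilon>"
  thus "\<bar>\<Phi> s (x - z) - \<Phi> s x\<bar> \<le> \<Lambda>' * \<epsilon>"
    using order_trans[OF Phi_lip[of s "x - z" x] mult_left_mono[OF _ Lambda'_nonneg]] by simp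
qed

lemma f_time:
  assumes "0 \<le> s" "s \<le> t" "0 \<le> r" "r \<le> t" shows "\<bar>f r x - f s x\<bar> \<le> \<Lambda>' * (B * \<bar>r - s\<bar>)"
  unfolding f_def by (rule mollify_close[OF eps(1) Phi_measurable Phi_measurable Phi_bd Phi_bd Phi_time]) (use assms in auto)

lemma integral_f_diff:
  assumes F: "F \<in> borel_measurable borel" "\<And>x. norm x \<le> R' + 2 \<Longrightarrow> \<bar>F x\<bar> \<le> \<eta>" "\<And>x. R' + 2 < norm x \<Longrightarrow> F x = 0"
    and "0 \<le> \<eta>" "0 \<le> r"
  shows "\<bar>\<integral>x. F x \<partial>\<mu> r\<bar> \<le> \<eta> * c"
  by (rule integral_bound_support[OF sets_mu F mass[OF \<open>0 \<le> r\<close>] c \<open>0 \<le> \<eta>\<close>])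

lemma g_continuous: "continuous_on {0..t} g"
  unfolding continuous_on_def
proof
  fix s assume s: "s \<in> {0..t}"
  define h where "h r = \<Lambda>' * (B * \<bar>r - s\<bar>) * c + \<bar>(\<integral>x. f s x \<partial>\<mu> r) - g s\<bar>" for r
  have "continuous_on {0..t} (\<lambda>r. \<integral>x. f s x \<partial>\<mu> r)"
    using s by (intro continuous_on_subset[OF weakly_continuous] f_continuous exI[of _ "R' + 1"])
      (auto intro: f_supp)
  hence "((\<lambda>r. \<integral>x. f s x \<partial>\<mu> r) \<longlongrightarrow> g s) (at s within {0..t})"
    using s by (auto simp: continuous_on_def g_def)
  hence "(h \<longlongrightarrow> \<Lambda>' * (B * \<bar>s - s\<bar>) * c + \<bar>g s - g s\<bar>) (at s within {0..t})"
    unfolding h_def by (intro tendsto_intros)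
  hence h: "(h \<longlongrightarrow> 0) (at s within {0..t})" by simp
  have "norm (g r - g s) \<le> h r" if r: "r \<in> {0..t}" for r
  proof -
    have "(\<integral>x. f r x \<partial>\<mu> r) - (\<integral>x. f s x \<partial>\<mu> r) = (\<integral>x. f r x - f s x \<partial>\<mu> r)"
      using f_integrable[of r r] f_integrable[of s r] r s by simp
    moreover have "\<bar>\<integral>x. f r x - f s x \<partial>\<mu> r\<bar> \<le> \<Lambda>' * (B * \<bar>r - s\<bar>) * c"
    proof (rule integral_f_diff)
      show "(\<lambda>x. f r x - f s x) \<in> borel_measurable borel"
        using f_measurable[of r] f_measurable[of s] r s by simp
    qed (use r s f_time f_supp Lambda'_nonneg B_nonneg in auto)
    ultimately show ?thesis by (simp add: h_def g_def)
  qed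
  hence "((\<lambda>r. g r - g s) \<longlongrightarrow> 0) (at s within {0..t})"
    by (intro Lim_null_comparison[OF _ h]) (auto simp: eventually_at_filter)
  thus "(g \<longlongrightarrow> g s) (at s within {0..t})" by (simp add: Lim_null[symmetric])
qed

text \<open>\<open>Phi_shift\<close> expresses \<open>\<Phi> (s + h)\<close> by
  \<open>\<Phi> s\<close> at the end of a backward trajectory. For all starting points within
  \<epsilon> of \<open>x\<close> this trajectory is close to one common translation by
  \<open>- h *\<^sub>R u s x\<close>, which commutes with mollification. The part
  \<open>L * \<epsilon>\<close> is the commutator error; \<open>L * (B * h)\<close> and \<eta> are
  made small through the choice of \<open>h\<close>.\<close>

lemma f_step:
  assumes s: "0 \<le> s" "s < t" and h: "0 < h" "s + h \<le> t"
    and \<eta>: "\<And>r. s \<le> r \<Longrightarrow> r \<le> s + h \<Longrightarrow> norm (u r x - u s x) \<le> \<eta>"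
  shows "\<bar>f (s + h) x - f s (x - h *\<^sub>R u s x)\<bar> \<le> \<Lambda>' * ((L * (B * h + \<epsilon>) + \<eta>) * h)"
  unfolding f_def
proof (rule mollify_close[OF eps(1) Phi_measurable Phi_measurable Phi_bd Phi_bd])
  fix z :: 'a assume z: "norm z \<le> \<epsilon>"
  define y where "y = x - z"
  have "norm (flow (s + h) y s - y - (s - (s + h)) *\<^sub>R u s x) \<le> (L * (B * h + \<epsilon>) + \<eta>) * \<bar>s - (s + h)\<bar>"
  proof (rule flow_approx)
    fix r assume r: "min (s + h) s \<le> r" "r \<le> max (s + h) s"
    have "norm (flow (s + h) y r - x) \<le> norm (flow (s + h) y r - y) + norm (y - x)"
      using norm_triangle_ineq[of "flow (s + h) y r - y" "y - x"] by simp
    also have "norm (flow (s + h) y r - y) \<le> B * h"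
      using flow_displacement[of "s + h" y r "s + h"] r h mult_left_mono[of "\<bar>r - (s + h)\<bar>" h B] B_nonneg by auto
    finally have "norm (flow (s + h) y r - x) \<le> B * h + \<epsilon>" using z by (simp add: y_def)
    hence "norm (u r (flow (s + h) y r) - u r x) \<le> L * (B * h + \<epsilon>)"
      using order_trans[OF lip mult_left_mono[OF _ L_nonneg]] by blast
    moreover have "norm (u r x - u s x) \<le> \<eta>" using r h by (intro \<eta>) auto
    ultimately show "norm (u r (flow (s + h) y r) - u s x) \<le> L * (B * h + \<epsilon>) + \<eta>"
      using norm_triangle_ineq[of "u r (flow (s + h) y r) - u r x" "u r x - u s x"] by simp
  qed
  hence "norm (flow (s + h) y s - (x - h *\<^sub>R u s x - z)) \<le> (L * (B * h + \<epsilon>) + \<eta>) * h"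
    using h by (simp add: y_def algebra_simps)
  thus "\<bar>\<Phi> (s + h) (x - z) - \<Phi> s (x - h *\<^sub>R u s x - z)\<bar> \<le> \<Lambda>' * ((L * (B * h + \<epsilon>) + \<eta>) * h)"
    unfolding y_def[symmetric] Phi_shift[of "s + h" y s]
    using order_trans[OF Phi_lip mult_left_mono[OF _ Lambda'_nonneg]] s by simp
qed

text \<open>The motion of \<open>\<mu>\<close> contributes the integral of
  \<open>gf s x \<bullet> u s x\<close>; the motion of \<open>f\<close> contributes its negative, by
  a first-order expansion of the translation. What remains is the commutator error
  \<open>c * \<Lambda>' * L * \<epsilon>\<close> and four quarters of \<epsilon>: from \<eta>, from
  the terms with an extra \<open>h\<close>, from the difference quotient, and from the weak
  continuity of \<open>\<mu>\<close>.\<close>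

lemma g_step:
  assumes s: "0 \<le> s" "s < t"
  shows "\<exists>d>0. \<forall>h. 0 < h \<and> h < d \<longrightarrow> \<bar>g (s + h) - g s\<bar> \<le> ((c * \<Lambda>' * L + 1) * \<epsilon>) * h"
proof -
  have st: "s \<le> t" using s by simp
  define G where "G x = gf s x \<bullet> u s x" for x
  define b where "b = (\<integral>x. G x \<partial>\<mu> s)"
  from f_C11[OF s(1) st] obtain C0 where C0: "\<And>x h. \<bar>f s (x + h) - f s x - gf s x \<bullet> h\<bar> \<le> C0 * (norm h)\<^sup>2"
    unfolding C11_compact_def by blast
  define C where "C = max 0 C0"
  have C: "\<bar>f s (x + h) - f s x - gf s x \<bullet> h\<bar> \<le> C * (norm h)\<^sup>2" "0 \<le> C" for x h
    using order_trans[OF C0[of x h] mult_right_mono[of C0 C]] by (auto simp: C_def)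
  have us: "continuous_on UNIV (u s)"
    by (rule lipschitz_on_continuous_on[of L]) (use lip L_nonneg in \<open>auto intro!: lipschitz_onI simp: dist_norm\<close>)
  have Gc: "continuous_on UNIV G"
    unfolding G_def by (intro continuous_intros C11_continuous_gradient[OF f_C11] us s st)
  have Gsupp: "G x = 0" if "R' + 1 < norm x" for x
    using gf_supp[OF s(1) st that] by (simp add: G_def)
  have [measurable]: "G \<in> borel_measurable borel" by (rule borel_measurable_continuous_onI[OF Gc])
  define \<eta> where "\<eta> = \<epsilon> / (4 * (c * \<Lambda>' + 1))"
  have cL: "0 \<le> c * \<Lambda>'" using c Lambda'_nonneg by simp
  have \<eta>: "0 < \<eta>" using eps cL by (auto simp: \<eta>_def intro!: divide_pos_pos mult_pos_pos)
  have c\<eta>: "c * \<Lambda>' * \<eta> \<le> \<epsilon> / 4"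
  proof -
    have "(c * \<Lambda>') * \<eta> \<le> (c * \<Lambda>' + 1) * \<eta>" using \<eta> by (intro mult_right_mono) auto
    also have "\<dots> = \<epsilon> / 4" using cL by (simp add: \<eta>_def field_simps)
    finally show ?thesis .
  qed
  have "((\<lambda>r. \<integral>x. f s x \<partial>\<mu> r) has_real_derivative b) (at s within {0..})"
    unfolding b_def G_def by (rule weak_solution[OF f_C11[OF s(1) st] s(1)])
  hence "((\<lambda>r. ((\<integral>x. f s x \<partial>\<mu> r) - g s) / (r - s)) \<longlongrightarrow> b) (at s within {0..})"
    by (simp add: has_field_derivative_iff g_def)
  hence "\<forall>\<^sub>F r in at s within {0..}. dist (((\<integral>x. f s x \<partial>\<mu> r) - g s) / (r - s)) b < \<epsilon> / 4"
    using eps by (intro tendstoD) auto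
  then obtain d1 where d1: "d1 > 0" "\<And>r. r \<in> {0..} \<Longrightarrow> r \<noteq> s \<Longrightarrow> dist r s < d1 \<Longrightarrow>
      dist (((\<integral>x. f s x \<partial>\<mu> r) - g s) / (r - s)) b < \<epsilon> / 4"
    unfolding eventually_at by blast
  have "continuous_on {0..} (\<lambda>r. \<integral>x. G x \<partial>\<mu> r)"
    using Gsupp by (intro weakly_continuous Gc) auto
  hence "((\<lambda>r. \<integral>x. G x \<partial>\<mu> r) \<longlongrightarrow> b) (at s within {0..})"
    using s by (auto simp: continuous_on_def b_def)
  hence "\<forall>\<^sub>F r in at s within {0..}. dist (\<integral>x. G x \<partial>\<mu> r) b < \<epsilon> / 4"
    using eps by (intro tendstoD) auto
  then obtain d2 where d2: "d2 > 0" "\<And>r. r \<in> {0..} \<Longrightarrow> r \<noteq> s \<Longrightarrow> dist r s < d2 \<Longrightarrow>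
      dist (\<integral>x. G x \<partial>\<mu> r) b < \<epsilon> / 4"
    unfolding eventually_at by blast
  obtain d3 where d3: "d3 > 0" "\<And>r x. \<bar>r - s\<bar> < d3 \<Longrightarrow> x \<in> cball 0 (R' + 2) \<Longrightarrow> norm (u r x - u s x) \<le> \<eta>"
    using field_uniform_time[OF compact_cball[of 0 "R' + 2"] \<eta>, of s] by blast
  \<comment> \<open>Coefficient of the errors of second order in \<open>h\<close>: the displacement
    inside the Lipschitz field and the Taylor remainder of \<open>f s\<close>.\<close>
  define A where "A = c * (\<Lambda>' * (L * B) + C * B\<^sup>2)"
  have A: "0 \<le> A" using c C Lambda'_nonneg L_nonneg B_nonneg by (simp add: A_def)
  define d where "d = Min {d1, d2, d3, t - s, 1 / (B + 1), \<epsilon> / (4 * (A + 1))}"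
  have d: "0 < d" using d1 d2 d3 s B_nonneg A eps by (simp add: d_def)
  have "\<bar>g (s + h) - g s\<bar> \<le> ((c * \<Lambda>' * L + 1) * \<epsilon>) * h" if h: "0 < h" "h < d" for h
  proof -
    have hd: "h < d1" "h < d2" "h < d3" "h < t - s" "h < 1 / (B + 1)" "h < \<epsilon> / (4 * (A + 1))"
      using h by (auto simp: d_def)
    have hB: "B * h \<le> 1" using hd(5) B_nonneg h by (simp add: field_simps)
    have hA: "A * h \<le> \<epsilon> / 4"
    proof -
      have "A * h \<le> (A + 1) * (\<epsilon> / (4 * (A + 1)))" using hd(6) A h by (intro mult_mono) auto
      also have "\<dots> = \<epsilon> / 4" using A by (simp add: field_simps)
      finally show ?thesis .
    qed
    define E where "E = \<Lambda>' * (L * (B * h + \<epsilon>) + \<eta>) + C * h * B\<^sup>2"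
    have E: "0 \<le> E" using Lambda'_nonneg L_nonneg B_nonneg h eps \<eta> C by (simp add: E_def)
    have pt: "\<bar>f (s + h) x - f s x + h * G x\<bar> \<le> h * E" if x: "norm x \<le> R' + 2" for x
    proof -
      have "\<bar>f (s + h) x - f s (x - h *\<^sub>R u s x)\<bar> \<le> \<Lambda>' * ((L * (B * h + \<epsilon>) + \<eta>) * h)"
        by (rule f_step[OF s h(1)]) (use hd x d3(2) in auto)
      moreover have "\<bar>f s (x - h *\<^sub>R u s x) - f s x + h * G x\<bar> \<le> C * (h * B)\<^sup>2"
      proof -
        have "\<bar>f s (x + (- h) *\<^sub>R u s x) - f s x - gf s x \<bullet> ((- h) *\<^sub>R u s x)\<bar> \<le> C * (norm ((- h) *\<^sub>R u s x))\<^sup>2"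
          by (rule C)
        also have "\<dots> \<le> C * (h * B)\<^sup>2"
          using h C bd by (intro mult_left_mono power_mono) (auto intro: mult_left_mono)
        finally show ?thesis by (simp add: G_def)
      qed
      ultimately have "\<bar>f (s + h) x - f s x + h * G x\<bar> \<le> \<Lambda>' * ((L * (B * h + \<epsilon>) + \<eta>) * h) + C * (h * B)\<^sup>2"
        by linarith
      thus ?thesis by (simp add: E_def algebra_simps power2_eq_square)
    qed
    have sh: "0 \<le> s + h" "s + h \<le> t" using s h hd by auto
    have iG: "integrable (\<mu> (s + h)) G"
    proof -
      have "compact (G ` cball 0 (R' + 2))"
        by (intro compact_continuous_image continuous_on_subset[OF Gc]) auto
      then obtain K where K: "\<And>x. x \<in> cball 0 (R' + 2) \<Longrightarrow> norm (G x) \<le> K"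
        using compact_imp_bounded bounded_iff by (metis imageI)
      have "norm (G x) \<le> max 0 K" for x
        using K[of x] Gsupp[of x] by (cases "norm x \<le> R' + 2") auto
      thus ?thesis
        by (intro integrable_bounded_support[OF sets_mu _ _ _ mass[OF sh(1)]]) (use Gsupp in auto)
    qed
    have "(\<integral>x. f (s + h) x - f s x + h * G x \<partial>\<mu> (s + h)) =
       g (s + h) - (\<integral>x. f s x \<partial>\<mu> (s + h)) + h * (\<integral>x. G x \<partial>\<mu> (s + h))"
      using f_integrable[OF sh sh(1)] f_integrable[OF s(1) st sh(1)] iG by (simp add: g_def)
    moreover have "\<bar>\<integral>x. f (s + h) x - f s x + h * G x \<partial>\<mu> (s + h)\<bar> \<le> (h * E) * c"
    proof (rule integral_f_diff[OF _ pt])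
      show "(\<lambda>x. f (s + h) x - f s x + h * G x) \<in> borel_measurable borel"
        using f_measurable[OF sh] f_measurable[OF s(1) st] by simp
    qed (use f_supp[OF sh] f_supp[OF s(1) st] Gsupp E h sh in auto)
    moreover have "\<bar>(\<integral>x. f s x \<partial>\<mu> (s + h)) - g s - h * b\<bar> \<le> (\<epsilon> / 4) * h"
    proof -
      have "\<bar>((\<integral>x. f s x \<partial>\<mu> (s + h)) - g s) / h - b\<bar> < \<epsilon> / 4"
        using d1(2)[of "s + h"] h hd sh by (simp add: dist_norm)
      hence "\<bar>((\<integral>x. f s x \<partial>\<mu> (s + h)) - g s) / h - b\<bar> * h \<le> (\<epsilon> / 4) * h"
        using h by (intro mult_right_mono) auto
      also have "\<bar>((\<integral>x. f s x \<partial>\<mu> (s + h)) - g s) / h - b\<bar> * h = \<bar>(((\<integral>x. f s x \<partial>\<mu> (s + h)) - g s) / h - b) * h\<bar>"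
        using h by (simp add: abs_mult)
      also have "(((\<integral>x. f s x \<partial>\<mu> (s + h)) - g s) / h - b) * h = (\<integral>x. f s x \<partial>\<mu> (s + h)) - g s - h * b"
        using h by (simp add: field_simps)
      finally show ?thesis .
    qed
    moreover have "\<bar>h * (\<integral>x. G x \<partial>\<mu> (s + h)) - h * b\<bar> \<le> (\<epsilon> / 4) * h"
    proof -
      have "\<bar>(\<integral>x. G x \<partial>\<mu> (s + h)) - b\<bar> < \<epsilon> / 4"
        using d2(2)[of "s + h"] h hd sh by (simp add: dist_norm)
      hence "\<bar>(\<integral>x. G x \<partial>\<mu> (s + h)) - b\<bar> * h \<le> (\<epsilon> / 4) * h" using h by (intro mult_right_mono) auto
      thus ?thesis using h by (simp add: abs_mult right_diff_distrib[symmetric] mult.commute[of h] left_diff_distrib[symmetric])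
    qed
    ultimately have "\<bar>g (s + h) - g s\<bar> \<le> (h * E) * c + (\<epsilon> / 2) * h" by linarith
    also have "\<dots> = (c * E + \<epsilon> / 2) * h" by (simp add: algebra_simps)
    also have "\<dots> \<le> ((c * \<Lambda>' * L + 1) * \<epsilon>) * h"
    proof (rule mult_right_mono)
      have "c * E = c * \<Lambda>' * L * \<epsilon> + c * \<Lambda>' * \<eta> + A * h" by (simp add: E_def A_def algebra_simps)
      thus "c * E + \<epsilon> / 2 \<le> (c * \<Lambda>' * L + 1) * \<epsilon>" using c\<eta> hA by (simp add: distrib_right)
    qed (use h in simp)
    finally show ?thesis .
  qed
  thus ?thesis using d by blast
qed

text \<open>At time \<open>t\<close> the function \<open>\<Phi> t\<close> is \<psi>, and at time 0
  it is \<psi> after the flow. Each endpoint costs one mollification error, the time in between the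
  accumulated error of \<open>g_step\<close>; all of it is proportional to \<epsilon>.\<close>

lemma test_integral_close:
  "\<bar>(\<integral>x. \<psi> x \<partial>\<mu> t) - (\<integral>x. \<psi> (flow 0 x t) \<partial>\<mu> 0)\<bar> \<le> ((c * \<Lambda>' * L + 1) * t + 2 * \<Lambda>' * c) * \<epsilon>"
proof -
  have close: "\<bar>g s - (\<integral>x. \<Phi> s x \<partial>\<mu> s)\<bar> \<le> \<Lambda>' * \<epsilon> * c" if s: "0 \<le> s" "s \<le> t" for s
  proof -
    have i: "integrable (\<mu> s) (\<Phi> s)"
      by (rule integrable_bounded_support[OF sets_mu Phi_measurable _ _ mass[OF s(1)], of _ M])
         (use Phi_bd Phi_supp s in auto)
    have "g s - (\<integral>x. \<Phi> s x \<partial>\<mu> s) = (\<integral>x. f s x - \<Phi> s x \<partial>\<mu> s)"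
      using f_integrable[OF s s(1)] i by (simp add: g_def)
    also have "\<bar>\<dots>\<bar> \<le> \<Lambda>' * \<epsilon> * c"
      using f_measurable[OF s] Lambda'_nonneg eps s
      by (intro integral_f_diff) (auto simp: f_close f_supp Phi_supp)
    finally show ?thesis .
  qed
  have "\<bar>g t - g 0\<bar> \<le> ((c * \<Lambda>' * L + 1) * \<epsilon>) * (t - 0)"
    by (rule right_increment_bound[OF t_nonneg g_continuous g_step])
  with close[of 0] close[of t] t_nonneg
  have "\<bar>(\<integral>x. \<Phi> t x \<partial>\<mu> t) - (\<integral>x. \<Phi> 0 x \<partial>\<mu> 0)\<bar> \<le> ((c * \<Lambda>' * L + 1) * \<epsilon>) * t + 2 * (\<Lambda>' * \<epsilon> * c)"
    by simp
  moreover have "\<Phi> t = \<psi>" by (simp add: \<Phi>_def fun_eq_iff)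
  ultimately show ?thesis by (simp add: \<Phi>_def[of 0] algebra_simps)
qed

end

lemma test_integral_eq_aux: "(\<integral>x. \<psi> x \<partial>\<mu> t) = (\<integral>x. \<psi> (flow 0 x t) \<partial>\<mu> 0)"
proof -
  obtain c0 where c0: "\<And>s. 0 \<le> s \<Longrightarrow> emeasure (\<mu> s) (cball 0 (R' + 2)) \<le> ennreal c0"
    using locally_finite by blast
  define c where "c = max 0 c0"
  have c: "emeasure (\<mu> s) (cball 0 (R' + 2)) \<le> ennreal c" if "0 \<le> s" for s
    by (rule order_trans[OF c0[OF that] ennreal_leI]) (simp add: c_def)
  have "0 \<le> c" by (simp add: c_def)
  define Z where "Z = (c * \<Lambda>' * L + 1) * t + 2 * \<Lambda>' * c"
  have Z: "0 \<le> Z" using \<open>0 \<le> c\<close> Lambda'_nonneg L_nonneg t_nonneg by (simp add: Z_def)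
  have "\<bar>(\<integral>x. \<psi> x \<partial>\<mu> t) - (\<integral>x. \<psi> (flow 0 x t) \<partial>\<mu> 0)\<bar> \<le> e" if "0 < e" for e
  proof -
    define \<epsilon> where "\<epsilon> = min 1 (e / (Z + 1))"
    have \<epsilon>: "0 < \<epsilon>" "\<epsilon> \<le> 1" using that Z by (auto simp: \<epsilon>_def)
    have "Z * \<epsilon> \<le> (Z + 1) * (e / (Z + 1))" using Z \<epsilon> that by (intro mult_mono) (auto simp: \<epsilon>_def)
    also have "\<dots> = e" using Z by simp
    finally show ?thesis using test_integral_close[OF \<epsilon> c \<open>0 \<le> c\<close>] by (simp add: Z_def)
  qed
  thus ?thesis using dense_ge[of 0] by (metis abs_ge_zero abs_le_zero_iff dense_le_bounded dense_ge eq_iff_diff_eq_0)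
qed

end

text \<open>Supplies the sup bound: a Lipschitz function that vanishes at the point \<open>y\<close>
  outside its support is bounded on the support by the distance to \<open>y\<close>.\<close>

lemma test_integral_eq:
  assumes lip: "\<And>x y. \<bar>\<psi> x - \<psi> y\<bar> \<le> \<Lambda> * norm (x - y)" and supp: "\<And>x. R < norm x \<Longrightarrow> \<psi> x = 0" and "0 \<le> t"
  shows "(\<integral>x. \<psi> x \<partial>\<mu> t) = (\<integral>x. \<psi> (flow 0 x t) \<partial>\<mu> 0)"
proof -
  obtain b :: 'a where b: "b \<in> Basis" using nonempty_Basis by blast
  have L0: "0 \<le> \<Lambda>" using order_trans[OF abs_ge_zero lip[of b 0]] b by simp
  define y where "y = (\<bar>R\<bar> + 1) *\<^sub>R b"
  have y: "norm y = \<bar>R\<bar> + 1" using b by (simp add: y_def)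
  have "\<bar>\<psi> x\<bar> \<le> \<Lambda> * (2 * \<bar>R\<bar> + 1)" for x
  proof (cases "R < norm x")
    case False
    hence "norm (x - y) \<le> 2 * \<bar>R\<bar> + 1" using norm_triangle_ineq4[of x y] y by simp
    hence "\<Lambda> * norm (x - y) \<le> \<Lambda> * (2 * \<bar>R\<bar> + 1)" by (intro mult_left_mono L0)
    thus ?thesis using lip[of x y] supp[of y] y by simp
  qed (use L0 supp in auto)
  from test_integral_eq_aux[OF lip supp this L0 \<open>0 \<le> t\<close>] show ?thesis by simp
qed

text \<open>Uniqueness for the continuity equation. Applied to \<open>law (\<sigma> t)\<close> it
  represents the solution by trajectories; applied to Lebesgue measure it says that the flow
  preserves volume.\<close>

theorem flow_pushforward:
  assumes "0 \<le> t" shows "\<mu> t = distr (\<mu> 0) borel (\<lambda>x. flow 0 x t)"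
proof (rule measure_eqI_lipschitz)
  show fin: "emeasure (\<mu> t) (cball 0 R) < \<infinity>" for R
    using locally_finite[of R] assms ennreal_less_top order_le_less_trans by (metis infinity_ennreal_def)
  have fin0: "emeasure (\<mu> 0) (cball 0 R) < \<infinity>" for R
    using locally_finite[of R] ennreal_less_top order_le_less_trans by (metis infinity_ennreal_def order_refl)
  show "emeasure (distr (\<mu> 0) borel (\<lambda>x. flow 0 x t)) (cball 0 R) < \<infinity>" for R
  proof -
    have "emeasure (distr (\<mu> 0) borel (\<lambda>x. flow 0 x t)) (cball 0 R) = emeasure (\<mu> 0) ((\<lambda>x. flow 0 x t) -` cball 0 R \<inter> space (\<mu> 0))"
      by (intro emeasure_distr) auto
    also have "\<dots> \<le> emeasure (\<mu> 0) (cball 0 (R + B * t))"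
    proof (rule emeasure_mono)
      have "norm x \<le> R + B * t" if "norm (flow 0 x t) \<le> R" for x
        using flow_displacement[of 0 x t 0] norm_triangle_ineq2[of x "flow 0 x t"] that assms
        by (simp add: norm_minus_commute)
      thus "(\<lambda>x. flow 0 x t) -` cball 0 R \<inter> space (\<mu> 0) \<subseteq> cball 0 (R + B * t)" by auto
    qed (auto simp: sets_mu)
    finally show ?thesis using fin0 by (rule order_le_less_trans)
  qed
  fix \<psi> :: "'a \<Rightarrow> real" and \<Lambda> R :: real
  assume \<psi>: "\<And>x y. \<bar>\<psi> x - \<psi> y\<bar> \<le> \<Lambda> * norm (x - y)" "\<And>x. R < norm x \<Longrightarrow> \<psi> x = 0"
  obtain b :: 'a where b: "b \<in> Basis" using nonempty_Basis by blast
  have "0 \<le> \<Lambda>" using order_trans[OF abs_ge_zero \<psi>(1)[of b 0]] b by simp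
  hence "\<Lambda>-lipschitz_on UNIV \<psi>" using \<psi>(1) by (auto intro!: lipschitz_onI simp: dist_norm)
  hence [measurable]: "\<psi> \<in> borel_measurable borel"
    by (intro borel_measurable_continuous_onI lipschitz_on_continuous_on)
  show "(\<integral>x. \<psi> x \<partial>\<mu> t) = (\<integral>x. \<psi> x \<partial>distr (\<mu> 0) borel (\<lambda>x. flow 0 x t))"
    using test_integral_eq[OF \<psi> assms] by (subst integral_distr) auto
qed (auto simp: sets_mu)

end

section \<open>Convolution with the kernel\<close>

lemma ennreal_inverse_eq_iff:
  fixes x :: ennreal
  assumes "0 < c" "inverse x = ennreal c"
  shows "x = ennreal (1 / c)"
proof (cases x)
  case (real r)
  hence "r \<noteq> 0" using assms by (intro notI) simp
  hence "ennreal (inverse r) = ennreal c" using real assms by (simp add: inverse_ennreal)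
  thus ?thesis using real assms \<open>r \<noteq> 0\<close> by (auto simp: field_simps)
qed (use assms in auto)

text \<open>The reciprocals are taken in the extended nonnegative reals, so
  \<open>q = \<infinity>\<close> has to be split off before real exponents can be used.\<close>

lemma ennreal_conjugate_exponents:
  assumes "1 / q + 1 / q' = (1::ennreal)" "1 < q"
  shows "(q = \<infinity> \<and> q' = 1) \<or> (\<exists>r>1. q = ennreal r \<and> q' = ennreal (r / (r - 1)))"
proof (cases q)
  case top
  hence "inverse q' = 1" using assms(1) by (simp add: divide_ennreal_def)
  hence "q' = 1" using ennreal_inverse_eq_iff[of 1 q'] by simp
  thus ?thesis using top by simp
next
  case (real r)
  hence r: "1 < r" using assms(2) by (metis ennreal_1 ennreal_less_iff zero_le_one)
  have "inverse q' = 1 - ennreal (1 / r)"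
  proof -
    have "ennreal (1 / r) + inverse q' = 1"
      using assms(1) r real by (simp add: divide_ennreal_def inverse_ennreal inverse_eq_divide)
    thus ?thesis by (metis ennreal_add_diff_cancel_left ennreal_neq_top)
  qed
  also have "\<dots> = ennreal ((r - 1) / r)"
    using r ennreal_minus[of "1 / r" 1] by (simp add: diff_divide_distrib)
  finally have "q' = ennreal (r / (r - 1))" using r ennreal_inverse_eq_iff[of "(r - 1) / r" q'] by simp
  thus ?thesis using real r by blast
qed

lemma emeasure_law:
  assumes "f \<in> prob_Lq q" "A \<in> sets borel"
  shows "emeasure (law f) A = (\<integral>\<^sup>+x. ennreal (f x) * indicator A x \<partial>lborel)"
  using assms unfolding law_def prob_Lq_def by (subst emeasure_density) auto

lemma sets_law [simp, measurable_cong]: "sets (law f) = sets borel"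
  by (simp add: law_def)

lemma prob_space_law: "f \<in> prob_Lq q \<Longrightarrow> prob_space (law f)"
  using emeasure_law[of f q UNIV] by (intro prob_spaceI) (auto simp: law_def prob_Lq_def)

text \<open>Either \<open>x \<le> c\<close>, or \<open>x powr (1 - r) \<le> c powr (1 - r)\<close>.
  It replaces Hoelder's inequality at the price of a factor 2.\<close>

lemma young_split:
  fixes x c r :: real
  assumes "0 \<le> x" "0 < c" "1 \<le> r"
  shows "x \<le> c + c powr (1 - r) * x powr r"
proof (cases "x \<le> c")
  case False
  hence "x powr (1 - r) \<le> c powr (1 - r)" using assms by (intro powr_mono2') auto
  hence "x powr (1 - r) * x powr r \<le> c powr (1 - r) * x powr r" by (intro mult_right_mono) auto
  moreover have "x powr (1 - r) * x powr r = x" using False assms by (simp add: powr_add[symmetric])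
  ultimately show ?thesis using assms by linarith
qed (use assms in \<open>simp add: add_increasing2\<close>)

lemma law_set_bound:
  assumes f: "f \<in> prob_Lq q" and m: "Lp_norm q lborel f \<le> ennreal m" "0 < m"
    and q: "1 / q + 1 / q' = (1::ennreal)" "1 < q" and A: "A \<in> sets borel" "emeasure lborel A = ennreal a" "0 < a"
  shows "emeasure (law f) A \<le> ennreal (2 * m * a powr (1 / enn2real q'))"
  using ennreal_conjugate_exponents[OF q]
proof (elim disjE conjE exE)
  have [measurable]: "f \<in> borel_measurable borel" and f0: "\<And>x. 0 \<le> f x" using f by (auto simp: prob_Lq_def)
  note [measurable] = A(1)
  {
    assume q: "q = \<infinity>" "q' = 1"
    have "AE x in lborel. ennreal \<bar>f x\<bar> \<le> esssup lborel (\<lambda>x. ennreal \<bar>f x\<bar>)"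
      by (rule esssup_AE)
    moreover have "esssup lborel (\<lambda>x. ennreal \<bar>f x\<bar>) \<le> ennreal m" using m q by (simp add: Lp_norm_def)
    ultimately have "AE x in lborel. ennreal \<bar>f x\<bar> \<le> ennreal m"
      by (auto elim!: eventually_mono intro: order_trans)
    hence "AE x in lborel. ennreal (f x) \<le> ennreal m" using f0 by simp
    hence "(\<integral>\<^sup>+x. ennreal (f x) * indicator A x \<partial>lborel) \<le> (\<integral>\<^sup>+x. ennreal m * indicator A x \<partial>lborel)"
      by (intro nn_integral_mono_AE) (auto elim!: eventually_mono intro!: mult_right_mono)
    also have "\<dots> = ennreal (m * a)"
      using A m by (subst nn_integral_cmult_indicator) (auto simp: ennreal_mult)
    also have "\<dots> \<le> ennreal (2 * m * a powr (1 / enn2real q'))"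
      using m A q by (intro ennreal_leI) auto
    finally show ?thesis using f A by (simp add: emeasure_law)
  next
    fix r :: real assume r: "1 < r" and q: "q = ennreal r" and q': "q' = ennreal (r / (r - 1))"
    define I where "I = (\<integral>\<^sup>+x. ennreal (f x powr r) \<partial>lborel)"
    have le: "epow I (1 / r) \<le> ennreal m" using m(1) q r f0 by (simp add: Lp_norm_def I_def)
    hence "I \<noteq> \<infinity>" by (auto simp: epow_def top_unique split: if_splits)
    hence "enn2real I powr (1 / r) \<le> m" using le m by (simp add: epow_def ennreal_le_iff split: if_splits)
    hence "(enn2real I powr (1 / r)) powr r \<le> m powr r" using r by (intro powr_mono2) auto
    hence "enn2real I \<le> m powr r" using r by (simp add: powr_powr)
    hence I: "I \<le> ennreal (m powr r)" using \<open>I \<noteq> \<infinity>\<close> by (metis ennreal_enn2real ennreal_leI infinity_ennreal_def less_top)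
    \<comment> \<open>The threshold at which both terms of \<open>young_split\<close> integrate to
      \<open>m * a powr (1 - 1 / r)\<close>.\<close>
    define c where "c = m * a powr (- (1 / r))"
    have c: "0 < c" using m A by (simp add: c_def)
    have "(\<integral>\<^sup>+x. ennreal (f x) * indicator A x \<partial>lborel) \<le>
       (\<integral>\<^sup>+x. ennreal c * indicator A x + ennreal (c powr (1 - r)) * ennreal (f x powr r) \<partial>lborel)"
    proof (rule nn_integral_mono)
      fix x
      have "ennreal (f x) \<le> ennreal (c + c powr (1 - r) * f x powr r)"
        using young_split[OF f0[of x] c, of r] r by (intro ennreal_leI) auto
      also have "\<dots> = ennreal c + ennreal (c powr (1 - r)) * ennreal (f x powr r)"
        using c by (simp add: ennreal_plus ennreal_mult)
      finally show "ennreal (f x) * indicator A x \<le> ennreal c * indicator A x + ennreal (c powr (1 - r)) * ennreal (f x powr r)"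
        by (auto simp: indicator_def)
    qed
    also have "\<dots> = ennreal c * ennreal a + ennreal (c powr (1 - r)) * I"
      unfolding I_def using A by (subst nn_integral_add) (auto simp: nn_integral_cmult)
    also have "\<dots> \<le> ennreal c * ennreal a + ennreal (c powr (1 - r)) * ennreal (m powr r)"
      by (intro add_left_mono mult_left_mono I) auto
    also have "\<dots> = ennreal (c * a + c powr (1 - r) * m powr r)"
      using c A m by (simp add: ennreal_plus ennreal_mult)
    also have "c * a + c powr (1 - r) * m powr r = 2 * m * a powr (1 - 1 / r)"
    proof -
      have "c * a = m * (a powr (- (1 / r)) * a powr 1)" using A by (simp add: c_def)
      also have "\<dots> = m * a powr (1 - 1 / r)" by (simp only: powr_add[symmetric]) simp
      finally have 1: "c * a = m * a powr (1 - 1 / r)" .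
      have "c powr (1 - r) * m powr r = (m powr (1 - r) * m powr r) * (a powr (- (1 / r))) powr (1 - r)"
        using m A by (simp add: c_def powr_mult)
      also have "m powr (1 - r) * m powr r = m" using m by (simp add: powr_add[symmetric])
      also have "(a powr (- (1 / r))) powr (1 - r) = a powr (1 - 1 / r)"
      proof -
        have "- (1 / r) * (1 - r) = 1 - 1 / r" using r by (simp add: field_simps)
        thus ?thesis by (simp only: powr_powr)
      qed
      finally show ?thesis using 1 by simp
    qed
    also have "1 - 1 / r = 1 / enn2real q'" using r by (simp add: q' field_simps)
    finally show ?thesis using f A by (simp add: emeasure_law)
  }
qed

section \<open>Velocity fields generated by measures with bounded Riesz potential\<close>

context kernel
begin

definition kconv :: "'a measure \<Rightarrow> 'a \<Rightarrow> 'a" where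
  "kconv \<mu> x = (\<integral>y. K0 (x - y) \<partial>\<mu>)"

text \<open>A uniform bound on the potential of order \<open>\<alpha> + 1\<close> bounds
  \<open>kconv\<close> and, through \<open>K0_diff_le\<close>, makes it Lipschitz.\<close>

definition riesz_bounded :: "real \<Rightarrow> 'a measure \<Rightarrow> bool" where
  "riesz_bounded \<Lambda> \<mu> \<longleftrightarrow> prob_space \<mu> \<and> sets \<mu> = sets borel \<and> 0 \<le> \<Lambda> \<and>
     (\<forall>x. (\<integral>\<^sup>+y. ennreal (\<kappa> (x - y)) \<partial>\<mu>) \<le> ennreal \<Lambda>)"

lemma riesz_integrable:
  assumes "riesz_bounded \<Lambda> \<mu>"
  shows "integrable \<mu> (\<lambda>y. \<kappa> (x - y))" "(\<integral>y. \<kappa> (x - y) \<partial>\<mu>) \<le> \<Lambda>"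
proof -
  have [measurable_cong]: "sets \<mu> = sets borel" and
    le: "(\<integral>\<^sup>+y. ennreal (\<kappa> (x - y)) \<partial>\<mu>) \<le> ennreal \<Lambda>" and "0 \<le> \<Lambda>"
    using assms by (auto simp: riesz_bounded_def)
  show int: "integrable \<mu> (\<lambda>y. \<kappa> (x - y))"
    by (rule integrableI_bounded) (use le in \<open>auto simp: order_le_less_trans\<close>)
  have "(\<integral>\<^sup>+y. ennreal (\<kappa> (x - y)) \<partial>\<mu>) = ennreal (\<integral>y. \<kappa> (x - y) \<partial>\<mu>)"
    by (rule nn_integral_eq_integral[OF int]) simp
  thus "(\<integral>y. \<kappa> (x - y) \<partial>\<mu>) \<le> \<Lambda>" using le \<open>0 \<le> \<Lambda>\<close> by simp
qed

lemma K0_integrable: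
  assumes "riesz_bounded \<Lambda> \<mu>"
  shows "integrable \<mu> (\<lambda>y. K0 (x - y))"
proof -
  have [measurable_cong]: "sets \<mu> = sets borel" using assms by (auto simp: riesz_bounded_def)
  interpret prob_space \<mu> using assms by (auto simp: riesz_bounded_def)
  show ?thesis
  proof (rule Bochner_Integration.integrable_bound)
    show "integrable \<mu> (\<lambda>y. C\<^sub>K * (1 + \<kappa> (x - y)))"
      using riesz_integrable[OF assms] by auto
  qed (use norm_K0_le' CK_nonneg in \<open>auto simp: abs_mult\<close>)
qed

lemma norm_kconv_le:
  assumes "riesz_bounded \<Lambda> \<mu>"
  shows "norm (kconv \<mu> x) \<le> C\<^sub>K * (1 + \<Lambda>)"
proof -
  interpret prob_space \<mu> using assms by (auto simp: riesz_bounded_def)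
  have "norm (kconv \<mu> x) \<le> (\<integral>y. C\<^sub>K * (1 + \<kappa> (x - y)) \<partial>\<mu>)"
    unfolding kconv_def using riesz_integrable(1)[OF assms] K0_integrable[OF assms] norm_K0_le'
    by (intro integral_norm_bound[THEN order_trans] integral_mono) auto
  also have "\<dots> = C\<^sub>K * (1 + (\<integral>y. \<kappa> (x - y) \<partial>\<mu>))"
    using riesz_integrable(1)[OF assms] by (simp add: prob_space)
  also have "\<dots> \<le> C\<^sub>K * (1 + \<Lambda>)"
    using riesz_integrable(2)[OF assms] CK_nonneg by (intro mult_left_mono) auto
  finally show ?thesis .
qed

lemma kconv_lipschitz:
  assumes "riesz_bounded \<Lambda> \<mu>"
  shows "norm (kconv \<mu> x - kconv \<mu> y) \<le> 2 * C1 * \<Lambda> * norm (x - y)"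
proof -
  have "kconv \<mu> x - kconv \<mu> y = (\<integral>z. K0 (x - z) - K0 (y - z) \<partial>\<mu>)"
    using K0_integrable[OF assms] by (simp add: kconv_def)
  also have "norm \<dots> \<le> (\<integral>z. C1 * norm (x - y) * (\<kappa> (x - z) + \<kappa> (y - z)) \<partial>\<mu>)"
  proof (intro integral_norm_bound[THEN order_trans] integral_mono)
    show "norm (K0 (x - z) - K0 (y - z)) \<le> C1 * norm (x - y) * (\<kappa> (x - z) + \<kappa> (y - z))" for z
      using K0_diff_le[of "x - z" "y - z"] by simp
  qed (use K0_integrable[OF assms] riesz_integrable(1)[OF assms] in auto)
  also have "\<dots> = C1 * norm (x - y) * ((\<integral>z. \<kappa> (x - z) \<partial>\<mu>) + (\<integral>z. \<kappa> (y - z) \<partial>\<mu>))"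
    using riesz_integrable(1)[OF assms] by simp
  also have "\<dots> \<le> C1 * norm (x - y) * (\<Lambda> + \<Lambda>)"
    using riesz_integrable(2)[OF assms] C1_nonneg by (intro mult_left_mono add_mono) auto
  finally show ?thesis by (simp add: algebra_simps)
qed

lemma conv_eq_kconv:
  assumes f: "f \<in> prob_Lq q"
  shows "conv K f x = kconv (law f) x"
proof -
  have [measurable]: "f \<in> borel_measurable borel" and f0: "\<And>x. 0 \<le> f x" using f by (auto simp: prob_Lq_def)
  have "kconv (law f) x = (\<integral>y. f y *\<^sub>R K0 (x - y) \<partial>lborel)"
    unfolding kconv_def law_def using f0 by (subst integral_density) auto
  also have "\<dots> = conv K f x"
    unfolding conv_def
  \<comment> \<open>\<open>K\<close> and \<open>K0\<close> differ at the origin only, and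
    \<open>y = x\<close> is a null set.\<close>
  proof (rule integral_cong_AE)
    show "(\<lambda>y. f y *\<^sub>R K (x - y)) \<in> borel_measurable lborel"
    proof -
      have "(\<lambda>y. f y *\<^sub>R K (x - y)) = (\<lambda>y. f y *\<^sub>R (if y = x then K 0 else K0 (x - y)))"
        by (auto simp: K0_def fun_eq_iff)
      also have "\<dots> \<in> borel_measurable lborel" by measurable
      finally show ?thesis .
    qed
    show "AE y in lborel. f y *\<^sub>R K0 (x - y) = f y *\<^sub>R K (x - y)"
      using AE_lborel_singleton[of x] by eventually_elim (auto simp: K0_def)
  qed auto
  finally show ?thesis by simp
qed

text \<open>The factor is 0 for \<open>norm z \<le> e\<close>, 1 from \<open>2 * e\<close> on, and
  linear in the norm between. Weak continuity of \<sigma> in time tests bounded continuous functions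
  only, so the singular kernel needs such a substitute.\<close>

definition K_trunc :: "real \<Rightarrow> 'a \<Rightarrow> 'a" where
  "K_trunc e z = (min 1 (max 0 (norm z / e - 1))) *\<^sub>R K0 z"

lemma continuous_on_K_trunc: assumes "0 < e" shows "continuous_on S (K_trunc e)"
proof (intro continuous_at_imp_continuous_on ballI)
  fix z :: 'a
  show "isCont (K_trunc e) z"
  proof (cases "z = 0")
    case True
    have "K_trunc e w = 0" if "w \<in> ball 0 e" for w
      using that assms by (simp add: K_trunc_def divide_le_eq_1 max_def field_simps)
    hence "\<forall>\<^sub>F w in nhds z. K_trunc e w = 0"
      using True assms by (intro eventually_nhds[THEN iffD2] exI[of _ "ball 0 e"]) auto
    hence "isCont (K_trunc e) z = isCont (\<lambda>_. 0::'a) z" by (rule isCont_cong)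
    thus ?thesis by simp
  next
    case False
    have "isCont K z" using K_deriv[OF False] by (rule has_derivative_continuous)
    moreover have "\<forall>\<^sub>F w in nhds z. K0 w = K w"
      using False by (intro eventually_nhds[THEN iffD2] exI[of _ "- {0}"]) (auto simp: K0_def)
    ultimately have "isCont K0 z" by (simp add: isCont_cong)
    thus ?thesis unfolding K_trunc_def using assms by (intro continuous_intros) auto
  qed
qed

lemma norm_K_trunc_le: assumes "0 < e" shows "norm (K_trunc e z) \<le> C\<^sub>K * (1 + e powr - (\<alpha> + 1))"
proof (cases "norm z \<le> e")
  case True
  hence "K_trunc e z = 0" using assms by (simp add: K_trunc_def divide_le_eq_1 max_def field_simps)
  thus ?thesis using CK_nonneg by simp
next
  case False
  have "norm (K_trunc e z) \<le> 1 * norm (K0 z)"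
    unfolding K_trunc_def norm_scaleR by (intro mult_right_mono) auto
  also have "\<dots> \<le> C\<^sub>K * (1 + \<kappa> z)" using norm_K0_le' by simp
  also have "\<dots> \<le> C\<^sub>K * (1 + e powr - (\<alpha> + 1))"
    using False assms alpha_nonneg by (intro mult_left_mono add_left_mono riesz_antimono CK_nonneg) auto
  finally show ?thesis .
qed

text \<open>The two differ only for \<open>norm z < 2 * e\<close>, where
  \<open>norm (K0 z) \<le> C\<^sub>K * (norm z * \<kappa> z)\<close> yields the factor
  \<open>2 * e\<close>.\<close>

lemma K_trunc_close: assumes "0 < e" shows "norm (K_trunc e z - K0 z) \<le> 2 * e * C\<^sub>K * \<kappa> z"
proof (cases "2 * e \<le> norm z")
  case True
  hence "K_trunc e z = K0 z" using assms by (simp add: K_trunc_def field_simps)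
  thus ?thesis using assms CK_nonneg by simp
next
  case False
  define w where "w = min 1 (max 0 (norm z / e - 1))"
  have "K_trunc e z - K0 z = (w - 1) *\<^sub>R K0 z" by (simp add: K_trunc_def w_def algebra_simps)
  hence "norm (K_trunc e z - K0 z) \<le> 1 * norm (K0 z)"
    unfolding w_def by (simp only: norm_scaleR) (intro mult_right_mono, auto)
  also have "\<dots> \<le> C\<^sub>K * (norm z * \<kappa> z)" using norm_K0_le by simp
  also have "\<dots> \<le> C\<^sub>K * ((2 * e) * \<kappa> z)"
    using False by (intro mult_left_mono mult_right_mono CK_nonneg) auto
  finally show ?thesis by (simp add: mult_ac)
qed

text \<open>The truncated convolutions are continuous in time by weak continuity of each component.
  The truncation error is at most \<open>2 * e * C\<^sub>K * \<Lambda>\<close> uniformly in time, so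
  continuity passes to the limit.\<close>

lemma kconv_time_continuous:
  fixes \<mu> :: "real \<Rightarrow> 'a measure"
  assumes bd: "\<And>t. 0 \<le> t \<Longrightarrow> riesz_bounded \<Lambda> (\<mu> t)"
    and weak: "\<And>G :: 'a \<Rightarrow> real. continuous_on UNIV G \<Longrightarrow> bounded (range G) \<Longrightarrow> continuous_on {0..} (\<lambda>t. \<integral>x. G x \<partial>\<mu> t)"
  shows "continuous_on {0..} (\<lambda>t. kconv (\<mu> t) x)"
proof -
  define F where "F n t = (\<integral>y. K_trunc (1 / real (Suc n)) (x - y) \<partial>\<mu> t)" for n t
  have sets: "sets (\<mu> t) = sets borel" if "0 \<le> t" for t using bd[OF that] by (simp add: riesz_bounded_def)
  have int: "integrable (\<mu> t) (\<lambda>y. K_trunc (1 / real (Suc n)) (x - y))" if t: "0 \<le> t" for n t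
  proof -
    interpret prob_space "\<mu> t" using bd[OF t] by (simp add: riesz_bounded_def)
    have "(\<lambda>y. K_trunc (1 / real (Suc n)) (x - y)) \<in> borel_measurable borel"
      by (intro borel_measurable_continuous_onI continuous_on_compose2[OF continuous_on_K_trunc[of "1 / real (Suc n)" UNIV]])
         (auto intro!: continuous_intros)
    hence "(\<lambda>y. K_trunc (1 / real (Suc n)) (x - y)) \<in> borel_measurable (\<mu> t)"
      using sets[OF t] by (simp cong: measurable_cong_sets)
    thus ?thesis using norm_K_trunc_le[of "1 / real (Suc n)"] by (intro integrable_const_bound) auto
  qed
  have "\<forall>\<^sub>F n in sequentially. continuous_on {0..} (F n)"
  proof (intro always_eventually allI, subst continuous_on_componentwise, intro ballI)
    fix n :: nat and b :: 'a assume "b \<in> Basis"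
    let ?e = "1 / real (Suc n)"
    have "continuous_on {0..} (\<lambda>t. \<integral>y. K_trunc ?e (x - y) \<bullet> b \<partial>\<mu> t)"
    proof (rule weak)
      show "continuous_on UNIV (\<lambda>y. K_trunc ?e (x - y) \<bullet> b)"
        by (intro continuous_intros continuous_on_compose2[OF continuous_on_K_trunc[of ?e UNIV]]) auto
      show "bounded (range (\<lambda>y. K_trunc ?e (x - y) \<bullet> b))"
        using norm_K_trunc_le[of ?e] Basis_le_norm[OF \<open>b \<in> Basis\<close>]
        by (intro boundedI[of _ "C\<^sub>K * (1 + ?e powr - (\<alpha> + 1))"]) (auto intro: order_trans)
    qed
    also have "?this \<longleftrightarrow> continuous_on {0..} (\<lambda>t. F n t \<bullet> b)"
      unfolding F_def using int by (intro continuous_on_cong refl integral_inner_left) auto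
    finally show "continuous_on {0..} (\<lambda>t. F n t \<bullet> b)" .
  qed
  moreover have "uniform_limit {0..} F (\<lambda>t. kconv (\<mu> t) x) sequentially"
  proof (rule uniform_limitI)
    fix e :: real assume e: "0 < e"
    have "0 \<le> \<Lambda>" using bd[of 0] by (simp add: riesz_bounded_def)
    have "(\<lambda>n. 2 * (1 / real (Suc n)) * C\<^sub>K * \<Lambda>) \<longlonglongrightarrow> 2 * 0 * C\<^sub>K * \<Lambda>"
      by (intro tendsto_intros LIMSEQ_inverse_real_of_nat[unfolded inverse_eq_divide])
    hence "\<forall>\<^sub>F n in sequentially. 2 * (1 / real (Suc n)) * C\<^sub>K * \<Lambda> < e"
      using e by (intro order_tendstoD(2)) auto
    thus "\<forall>\<^sub>F n in sequentially. \<forall>t\<in>{0..}. dist (F n t) (kconv (\<mu> t) x) < e"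
    proof eventually_elim
      case (elim n)
      show ?case
      proof
        fix t :: real assume "t \<in> {0..}"
        hence t: "0 \<le> t" by simp
        let ?e = "1 / real (Suc n)"
        have "F n t - kconv (\<mu> t) x = (\<integral>y. K_trunc ?e (x - y) - K0 (x - y) \<partial>\<mu> t)"
          using int[OF t] K0_integrable[OF bd[OF t]] by (simp add: F_def kconv_def)
        also have "norm \<dots> \<le> (\<integral>y. 2 * ?e * C\<^sub>K * \<kappa> (x - y) \<partial>\<mu> t)"
          using int[OF t] K0_integrable[OF bd[OF t]] riesz_integrable(1)[OF bd[OF t]] K_trunc_close[of ?e]
          by (intro integral_norm_bound[THEN order_trans] integral_mono) auto
        also have "\<dots> = 2 * ?e * C\<^sub>K * (\<integral>y. \<kappa> (x - y) \<partial>\<mu> t)" by simp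
        also have "\<dots> \<le> 2 * ?e * C\<^sub>K * \<Lambda>"
          using riesz_integrable(2)[OF bd[OF t]] CK_nonneg by (intro mult_left_mono) auto
        finally show "dist (F n t) (kconv (\<mu> t) x) < e" using elim by (simp add: dist_norm)
      qed
    qed
  qed
  ultimately show ?thesis by (rule uniform_limit_theorem) simp
qed

end

section \<open>Divergence freeness of the kernel across the origin\<close>

definition cutoff :: "real \<Rightarrow> 'a::euclidean_space \<Rightarrow> real" where
  "cutoff e x = 1 - (max 0 (1 - (max 0 ((norm x)\<^sup>2 / e\<^sup>2 - 1))\<^sup>2))\<^sup>2"

definition cutoff_grad :: "real \<Rightarrow> 'a::euclidean_space \<Rightarrow> 'a" where
  "cutoff_grad e x =
     (8 * max 0 (1 - (max 0 ((norm x)\<^sup>2 / e\<^sup>2 - 1))\<^sup>2) * max 0 ((norm x)\<^sup>2 / e\<^sup>2 - 1) / e\<^sup>2) *\<^sub>R x"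

lemma pos_part_square_deriv: "((\<lambda>z. (max 0 z)\<^sup>2) has_real_derivative 2 * max 0 z) (at (z::real))"
  unfolding has_field_derivative_iff
proof (rule LIM_zero_cancel, rule Lim_null_comparison)
  show "\<forall>\<^sub>F w in at z. norm (((max 0 w)\<^sup>2 - (max 0 z)\<^sup>2) / (w - z) - 2 * max 0 z) \<le> \<bar>w - z\<bar>"
  proof (unfold eventually_at_filter, intro always_eventually allI impI)
    fix w assume "w \<noteq> z"
    have "\<bar>((max 0 w)\<^sup>2 - (max 0 z)\<^sup>2) / (w - z) - 2 * max 0 z\<bar> * \<bar>w - z\<bar> = \<bar>(max 0 w)\<^sup>2 - (max 0 z)\<^sup>2 - 2 * max 0 z * (w - z)\<bar>"
      using \<open>w \<noteq> z\<close> by (simp add: abs_mult[symmetric] left_diff_distrib[of "_ / _" "2 * max 0 z"])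
    also have "\<dots> \<le> \<bar>w - z\<bar> * \<bar>w - z\<bar>"
      using pos_part_square_taylor[of z "w - z"] by (simp add: power2_eq_square)
    finally show "norm (((max 0 w)\<^sup>2 - (max 0 z)\<^sup>2) / (w - z) - 2 * max 0 z) \<le> \<bar>w - z\<bar>"
      using \<open>w \<noteq> z\<close> by (simp only: real_norm_def) (erule mult_right_le_imp_le, simp)
  qed
  have "((\<lambda>w. \<bar>w - z\<bar>) \<longlongrightarrow> \<bar>z - z\<bar>) (at z)" by (intro tendsto_intros)
  thus "((\<lambda>w. \<bar>w - z\<bar>) \<longlongrightarrow> 0) (at z)" by simp
qed

lemma cutoff_has_derivative:
  "(cutoff e has_derivative (\<lambda>h. cutoff_grad e x \<bullet> h)) (at x)"
proof -
  have n: "((\<lambda>x. (norm x)\<^sup>2 / e\<^sup>2 - 1) has_derivative (\<lambda>h. (2 / e\<^sup>2) * (x \<bullet> h))) (at x)"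
  proof -
    have "((\<lambda>x. (x \<bullet> x) * inverse (e\<^sup>2) - 1) has_derivative (\<lambda>h. (x \<bullet> h + h \<bullet> x) * inverse (e\<^sup>2) - 0)) (at x)"
      by (rule has_derivative_diff[OF has_derivative_mult_left[OF has_derivative_inner[OF has_derivative_ident has_derivative_ident]]
          has_derivative_const])
    hence "((\<lambda>x. (norm x)\<^sup>2 / e\<^sup>2 - 1) has_derivative (\<lambda>h. (x \<bullet> h + h \<bullet> x) * inverse (e\<^sup>2) - 0)) (at x)"
      by (simp only: power2_norm_eq_inner divide_inverse)
    thus ?thesis by (rule has_derivative_eq_rhs) (auto simp: fun_eq_iff inner_commute divide_inverse)
  qed
  have inner: "((\<lambda>x. 1 - (max 0 ((norm x)\<^sup>2 / e\<^sup>2 - 1))\<^sup>2) has_derivative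
     (\<lambda>h. - (2 * max 0 ((norm x)\<^sup>2 / e\<^sup>2 - 1) * ((2 / e\<^sup>2) * (x \<bullet> h))))) (at x)"
    by (rule has_derivative_eq_rhs[OF has_derivative_diff[OF has_derivative_const
          has_derivative_compose[OF n pos_part_square_deriv[unfolded has_field_derivative_def]]]]) auto
  have "((\<lambda>x. 1 - (max 0 (1 - (max 0 ((norm x)\<^sup>2 / e\<^sup>2 - 1))\<^sup>2))\<^sup>2) has_derivative
     (\<lambda>h. - (2 * max 0 (1 - (max 0 ((norm x)\<^sup>2 / e\<^sup>2 - 1))\<^sup>2) * - (2 * max 0 ((norm x)\<^sup>2 / e\<^sup>2 - 1) * ((2 / e\<^sup>2) * (x \<bullet> h)))))) (at x)"
    by (rule has_derivative_eq_rhs[OF has_derivative_diff[OF has_derivative_const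
          has_derivative_compose[OF inner pos_part_square_deriv[unfolded has_field_derivative_def]]]]) auto
  thus ?thesis unfolding cutoff_def[abs_def]
    by (rule has_derivative_eq_rhs) (simp add: cutoff_grad_def fun_eq_iff)
qed

lemma cutoff_near:
  assumes "0 < e" "norm x \<le> e" shows "cutoff e x = 0" "cutoff_grad e x = 0"
proof -
  have "(norm x)\<^sup>2 \<le> e\<^sup>2" using assms by (intro power_mono) auto
  hence "max 0 ((norm x)\<^sup>2 / e\<^sup>2 - 1) = 0" using assms by simp
  thus "cutoff e x = 0" "cutoff_grad e x = 0" by (simp_all add: cutoff_def cutoff_grad_def)
qed

text \<open>The inner positive part reaches 1 when the norm is \<open>sqrt 2 * e\<close>, so the
  transition is complete before \<open>2 * e\<close>.\<close>

lemma cutoff_far: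
  assumes "0 < e" "2 * e \<le> norm x" shows "cutoff e x = 1" "cutoff_grad e x = 0"
proof -
  have "(2 * e)\<^sup>2 \<le> (norm x)\<^sup>2" using assms by (intro power_mono) auto
  moreover have "2 * e\<^sup>2 \<le> (2 * e)\<^sup>2" by (simp add: power_mult_distrib)
  ultimately have "2 * e\<^sup>2 \<le> (norm x)\<^sup>2" by linarith
  hence "2 \<le> (norm x)\<^sup>2 / e\<^sup>2" using assms by (simp add: le_divide_eq)
  hence "1 \<le> max 0 ((norm x)\<^sup>2 / e\<^sup>2 - 1)" by simp
  hence "max 0 (1 - (max 0 ((norm x)\<^sup>2 / e\<^sup>2 - 1))\<^sup>2) = 0" by (simp add: one_le_power)
  thus "cutoff e x = 1" "cutoff_grad e x = 0" by (simp_all add: cutoff_def cutoff_grad_def)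
qed

lemma cutoff_bounds: "0 \<le> cutoff e x" "cutoff e x \<le> 1"
  unfolding cutoff_def by (auto simp: power_le_one)

lemma norm_cutoff_grad_le:
  assumes "0 < e" shows "norm (cutoff_grad e x) \<le> 16 / e"
proof (cases "norm x \<le> 2 * e")
  case True
  define p where "p = max 0 ((norm x)\<^sup>2 / e\<^sup>2 - 1)"
  have "0 \<le> p" by (simp add: p_def)
  have "max 0 (1 - p\<^sup>2) * p \<le> 1"
  proof (cases "p \<le> 1")
    case True
    thus ?thesis using \<open>0 \<le> p\<close> by (intro mult_le_one) auto
  next
    case False
    hence "1 \<le> p\<^sup>2" by (simp add: one_le_power)
    thus ?thesis by simp
  qed
  hence "(max 0 (1 - p\<^sup>2) * p) * norm x \<le> 1 * (2 * e)"
    using True assms by (intro mult_mono) auto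
  hence "8 / e\<^sup>2 * ((max 0 (1 - p\<^sup>2) * p) * norm x) \<le> 8 / e\<^sup>2 * (2 * e)"
    by (intro mult_left_mono) auto
  also have "\<dots> = 16 / e" using assms by (simp add: power2_eq_square)
  finally show ?thesis unfolding cutoff_grad_def p_def[symmetric]
    using \<open>0 \<le> p\<close> by (simp add: abs_mult mult_ac)
next
  case False
  thus ?thesis using cutoff_far(2)[OF assms, of x] assms by simp
qed

lemma continuous_on_cutoff_grad: "continuous_on S (cutoff_grad e)"
  unfolding cutoff_grad_def divide_inverse by (intro continuous_intros)

lemma continuous_on_cutoff: "continuous_on S (cutoff e)"
  unfolding cutoff_def divide_inverse by (intro continuous_intros)

lemma C11_compact_bounds:
  fixes f :: "'a::euclidean_space \<Rightarrow> real"
  assumes "C11_compact f gf"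
  obtains M R where "0 \<le> M" "\<And>x. \<bar>f x\<bar> \<le> M" "\<And>x. norm (gf x) \<le> M" "\<And>x. R < norm x \<Longrightarrow> f x = 0 \<and> gf x = 0"
proof -
  from assms obtain R where R: "\<And>x. R < norm x \<Longrightarrow> f x = 0 \<and> gf x = 0" by (auto simp: C11_compact_def)
  have "compact (f ` cball 0 R)" "compact (gf ` cball 0 R)"
    using C11_continuous[OF assms] C11_continuous_gradient[OF assms] by (auto intro: compact_continuous_image)
  then obtain M1 M2 where "\<forall>y\<in>f ` cball 0 R. norm y \<le> M1" "\<forall>y\<in>gf ` cball 0 R. norm y \<le> M2"
    using compact_imp_bounded[of "f ` cball 0 R"] compact_imp_bounded[of "gf ` cball 0 R"]
    unfolding bounded_iff by blast
  hence "\<And>x. norm x \<le> R \<Longrightarrow> \<bar>f x\<bar> \<le> M1" "\<And>x. norm x \<le> R \<Longrightarrow> norm (gf x) \<le> M2" by auto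
  hence "\<bar>f x\<bar> \<le> max 0 (max M1 M2)" "norm (gf x) \<le> max 0 (max M1 M2)" for x
    using R[of x] by (cases "norm x \<le> R"; force)+
  thus thesis using that[of "max 0 (max M1 M2)" R] R by auto
qed

text \<open>Difference quotients in direction \<open>b\<close> integrate to 0 by translation
  invariance and are dominated through the Lipschitz constant \<open>M\<close>. The measurability of
  the derivative is obtained from the same limit.\<close>

lemma integral_directional_derivative_eq_0:
  fixes F :: "'a::euclidean_space \<Rightarrow> real"
  assumes deriv: "\<And>x. (F has_derivative F' x) (at x)" and bd: "\<And>x. onorm (F' x) \<le> M"
    and supp: "\<And>x. R < norm x \<Longrightarrow> F x = 0"
  shows "integrable lborel (\<lambda>x. F' x b)" "(\<integral>x. F' x b \<partial>lborel) = 0"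
proof -
  have M: "0 \<le> M" using onorm_pos_le[OF has_derivative_bounded_linear[OF deriv]] bd order_trans by blast
  have lip: "\<bar>F x - F y\<bar> \<le> M * norm (x - y)" for x y
    using differentiable_bound[of UNIV F F' M x y] deriv bd by auto
  have cont: "continuous_on UNIV F"
    by (intro continuous_at_imp_continuous_on ballI has_derivative_continuous[OF deriv])
  hence [measurable]: "F \<in> borel_measurable borel" by (rule borel_measurable_continuous_onI)
  define q where "q n x = (F (x + (1 / real (Suc n)) *\<^sub>R b) - F x) * real (Suc n)" for n x
  have lim: "(\<lambda>n. q n x) \<longlonglongrightarrow> F' x b" for x
  proof -
    have "((\<lambda>t. (F (x + t *\<^sub>R b) - F x) / t) \<longlongrightarrow> F' x b) (at 0)"
    proof -
      have "((\<lambda>t::real. x + t *\<^sub>R b) has_derivative (\<lambda>t. t *\<^sub>R b)) (at 0)"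
        by (auto intro!: derivative_eq_intros)
      hence "((\<lambda>t::real. F (x + t *\<^sub>R b)) has_derivative (\<lambda>t. F' x (t *\<^sub>R b))) (at 0)"
        by (rule has_derivative_compose) (use deriv in simp)
      moreover have "(\<lambda>t. F' x (t *\<^sub>R b)) = (*) (F' x b)"
        using linear_cmul[OF has_derivative_linear[OF deriv[of x]]] by (auto simp: fun_eq_iff)
      ultimately have "((\<lambda>t::real. F (x + t *\<^sub>R b)) has_real_derivative F' x b) (at 0)"
        by (simp add: has_field_derivative_def)
      thus ?thesis by (simp add: has_field_derivative_iff)
    qed
    moreover have "filterlim (\<lambda>n. 1 / real (Suc n)) (at 0) sequentially"
      using LIMSEQ_inverse_real_of_nat by (auto simp: filterlim_at inverse_eq_divide)
    ultimately have "(\<lambda>n. (F (x + (1 / real (Suc n)) *\<^sub>R b) - F x) / (1 / real (Suc n))) \<longlonglongrightarrow> F' x b"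
      by (rule filterlim_compose)
    thus ?thesis by (simp add: q_def)
  qed
  have qb: "\<bar>q n x\<bar> \<le> M * norm b * indicator (cball 0 (R + norm b)) x" for n x
  proof (cases "norm x \<le> R + norm b")
    case True
    have "\<bar>F (x + (1 / real (Suc n)) *\<^sub>R b) - F x\<bar> * real (Suc n) \<le> (M * norm ((1 / real (Suc n)) *\<^sub>R b)) * real (Suc n)"
      using lip[of "x + (1 / real (Suc n)) *\<^sub>R b" x] by (intro mult_right_mono) auto
    also have "\<dots> = M * norm b" by simp
    finally show ?thesis using True by (simp add: q_def abs_mult del: of_nat_Suc)
  next
    case False
    have "norm ((1 / real (Suc n)) *\<^sub>R b) \<le> norm b" by (simp add: divide_le_eq mult_le_cancel_left1)
    hence "R < norm (x + (1 / real (Suc n)) *\<^sub>R b)"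
      using False norm_triangle_ineq2[of x "- ((1 / real (Suc n)) *\<^sub>R b)"] by simp
    moreover have "R < norm x" using False norm_ge_zero[of b] by linarith
    ultimately show ?thesis using supp False by (simp add: q_def)
  qed
  have q0: "(\<integral>x. q n x \<partial>lborel) = 0" for n
  proof -
    define h where "h = (1 / real (Suc n)) *\<^sub>R b"
    obtain K where K: "\<And>x. \<bar>F x\<bar> \<le> K"
    proof -
      have "compact (F ` cball 0 R)" using cont by (intro compact_continuous_image) (auto intro: continuous_on_subset)
      then obtain K where "\<forall>y\<in>F ` cball 0 R. norm y \<le> K"
        using compact_imp_bounded[of "F ` cball 0 R"] unfolding bounded_iff by blast
      hence "\<And>x. norm x \<le> R \<Longrightarrow> \<bar>F x\<bar> \<le> K" by auto
      hence "\<bar>F x\<bar> \<le> max 0 K" for x using supp[of x] by (cases "norm x \<le> R"; force)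
      thus thesis using that by blast
    qed
    have i: "integrable lborel F"
      by (rule integrable_bounded_support[OF _ _ _ supp emeasure_lborel_cball_le]) (use K in auto)
    have lb: "lborel = distr (lborel::'a measure) borel ((+) h)" by (simp add: lborel_distr_plus)
    have "integrable lborel (\<lambda>x. F (h + x))"
      using i by (subst (asm) lb, subst (asm) integrable_distr_eq) auto
    moreover have "(\<integral>x. F (h + x) \<partial>lborel) = (\<integral>x. F x \<partial>lborel)"
      by (subst (2) lb, subst integral_distr) auto
    ultimately have "(\<integral>x. F (x + h) - F x \<partial>lborel) = 0" using i by (simp add: add.commute)
    thus ?thesis by (simp add: q_def h_def)
  qed
  have [measurable]: "q n \<in> borel_measurable lborel" for n unfolding q_def by measurable
  have [measurable]: "(\<lambda>x. F' x b) \<in> borel_measurable lborel"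
    by (rule borel_measurable_LIMSEQ_real[of _ q]) (use lim in auto)
  have w: "integrable lborel (\<lambda>x. M * norm b * indicator (cball (0::'a) (R + norm b)) x)"
    using emeasure_lborel_cball_finite[of "0::'a" "R + norm b"]
    by (intro integrable_mult_right integrable_real_indicator) auto
  show "integrable lborel (\<lambda>x. F' x b)"
    by (rule integrable_dominated_convergence[OF _ _ w, of _ q]) (use lim qb in auto)
  have "(\<lambda>n. \<integral>x. q n x \<partial>lborel) \<longlonglongrightarrow> (\<integral>x. F' x b \<partial>lborel)"
    by (rule integral_dominated_convergence[OF _ _ w]) (use lim qb in auto)
  thus "(\<integral>x. F' x b \<partial>lborel) = 0" unfolding q0 by (simp add: LIMSEQ_const_iff)
qed

lemma riesz_minus [simp]: "riesz s (- x) = riesz s x"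
  by (simp add: riesz_def)

lemma emeasure_lborel_cball_powr:
  "0 < r \<Longrightarrow> emeasure lborel (cball (x::'a::euclidean_space) r) = ennreal (unit_ball_vol (real DIM('a)) * r powr real DIM('a))"
  by (simp add: emeasure_cball powr_realpow)

context kernel
begin

lemma riesz_locally_integrable: "integrable lborel (\<lambda>x. \<kappa> x * indicator (cball (0::'a) R) x)"
proof (cases "0 < R")
  case True
  have "(\<integral>\<^sup>+ y. ennreal (\<kappa> (0 - y)) * indicator (cball (0::'a) R) y \<partial>lborel)
     \<le> ennreal (dyadic_const (\<alpha> + 1) (real DIM('a)) * unit_ball_vol (real DIM('a)) * R powr (real DIM('a) - (\<alpha> + 1)))"
  proof (rule nn_integral_riesz_cball_le)
    fix r :: real assume "0 < r"
    have "emeasure lborel (cball (0::'a) r - {0}) \<le> emeasure lborel (cball (0::'a) r)"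
      by (intro emeasure_mono) auto
    thus "emeasure lborel (cball (0::'a) r - {0}) \<le> ennreal (unit_ball_vol (real DIM('a)) * r powr real DIM('a))"
      using emeasure_lborel_cball_powr[OF \<open>0 < r\<close>] by metis
  qed (use alpha_nonneg alpha_less True in auto)
  also have "\<dots> < \<infinity>" by simp
  finally have "(\<integral>\<^sup>+ y. ennreal (\<kappa> y * indicator (cball 0 R) y) \<partial>lborel) < \<infinity>"
    by (simp add: ennreal_mult ennreal_indicator)
  thus ?thesis by (intro integrableI_nonneg) (auto intro!: borel_measurable_times borel_measurable_indicator)
next
  case False
  hence "\<kappa> x * indicator (cball 0 R) x = 0" for x :: 'a
  proof (cases "x = 0")
    case x: False
    hence "0 < norm x" by simp
    hence "\<not> norm x \<le> R" using False by linarith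
    thus ?thesis by (simp add: indicator_def)
  qed simp
  thus ?thesis by (simp only: integrable_zero)
qed

text \<open>The field \<open>(cutoff e x * g x) *\<^sub>R K0 x\<close> is differentiable everywhere,
  with bounded derivative and bounded support. The trace of its derivative is the integrand, as
  \<open>divergence K\<close> vanishes off the origin.\<close>

lemma divergence_free_cutoff:
  assumes g: "C11_compact g gg" and e: "0 < e"
  shows "(\<integral>x. K0 x \<bullet> (cutoff e x *\<^sub>R gg x + g x *\<^sub>R cutoff_grad e x) \<partial>lborel) = 0"
proof -
  obtain M R where M: "0 \<le> M" "\<And>x. \<bar>g x\<bar> \<le> M" "\<And>x. norm (gg x) \<le> M" "\<And>x. R < norm x \<Longrightarrow> g x = 0 \<and> gg x = 0"
    using C11_compact_bounds[OF g] by metis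
  define \<psi> where "\<psi> x = cutoff e x * g x" for x
  define d\<psi> where "d\<psi> x = cutoff e x *\<^sub>R gg x + g x *\<^sub>R cutoff_grad e x" for x
  have \<psi>: "(\<psi> has_derivative (\<lambda>h. d\<psi> x \<bullet> h)) (at x)" for x
    unfolding \<psi>_def[abs_def]
    by (rule has_derivative_eq_rhs[OF has_derivative_mult[OF cutoff_has_derivative C11_has_derivative[OF g]]])
       (simp add: d\<psi>_def fun_eq_iff inner_add_left mult.commute)
  have near: "\<psi> x = 0" "d\<psi> x = 0" if "norm x \<le> e" for x
    using cutoff_near[OF e that] by (auto simp: \<psi>_def d\<psi>_def)
  have d\<psi>_le: "norm (d\<psi> x) \<le> M + M * (16 / e)" for x
  proof -
    have "cutoff e x * norm (gg x) \<le> 1 * M" by (intro mult_mono M cutoff_bounds) auto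
    moreover have "\<bar>g x\<bar> * norm (cutoff_grad e x) \<le> M * (16 / e)" by (intro mult_mono M norm_cutoff_grad_le e) auto
    ultimately show ?thesis unfolding d\<psi>_def
      using norm_triangle_ineq[of "cutoff e x *\<^sub>R gg x" "g x *\<^sub>R cutoff_grad e x"] cutoff_bounds[of e x] by simp
  qed
  have \<psi>_le: "\<bar>\<psi> x\<bar> \<le> 1 * M" for x
    unfolding \<psi>_def abs_mult using cutoff_bounds[of e x] by (intro mult_mono M) auto
  define F where "F x = \<psi> x *\<^sub>R K0 x" for x
  define F' where "F' x h = (d\<psi> x \<bullet> h) *\<^sub>R K0 x + \<psi> x *\<^sub>R frechet_derivative K (at x) h" for x h
  have F: "(F has_derivative F' x) (at x)" for x
  proof (cases "norm x < e")
    case True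
    have "F' x = (\<lambda>_. 0)" using near[of x] True by (simp add: F'_def fun_eq_iff)
    hence "((\<lambda>_. 0::'a) has_derivative F' x) (at x)" by simp
    thus ?thesis
      by (rule has_derivative_transform_within_open[where s="ball 0 e"]) (auto simp: True F_def near)
  next
    case False
    hence x: "x \<noteq> 0" using e by auto
    have "((\<lambda>x. \<psi> x *\<^sub>R K x) has_derivative (\<lambda>h. \<psi> x *\<^sub>R frechet_derivative K (at x) h + (d\<psi> x \<bullet> h) *\<^sub>R K x)) (at x)"
      by (rule has_derivative_scaleR[OF \<psi> K_deriv[OF x]])
    hence "((\<lambda>x. \<psi> x *\<^sub>R K x) has_derivative F' x) (at x)"
      by (rule has_derivative_eq_rhs) (auto simp: F'_def K0_def x fun_eq_iff)
    thus ?thesis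
      by (rule has_derivative_transform_within_open[where s="- {0}"]) (auto simp: F_def K0_def x)
  qed
  define Z where "Z = (M + M * (16 / e)) * (C\<^sub>K * (1 + e powr - (\<alpha> + 1))) + M * (C\<^sub>K * e powr - (\<alpha> + 1))"
  have ke: "0 \<le> e powr - (\<alpha> + 1)" by simp
  have Z: "0 \<le> Z" unfolding Z_def using M(1) e CK_nonneg ke
    by (intro add_nonneg_nonneg mult_nonneg_nonneg) auto
  have F'le: "norm (F' x h) \<le> Z * norm h" for x h
  proof (cases "norm x \<le> e")
    case True
    thus ?thesis using near[OF True] Z by (simp add: F'_def)
  next
    case False
    hence x: "x \<noteq> 0" using e by auto
    have \<kappa>: "\<kappa> x \<le> e powr - (\<alpha> + 1)" using False e alpha_nonneg by (intro riesz_antimono) auto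
    have 1: "norm ((d\<psi> x \<bullet> h) *\<^sub>R K0 x) \<le> ((M + M * (16 / e)) * norm h) * (C\<^sub>K * (1 + e powr - (\<alpha> + 1)))"
      unfolding norm_scaleR
    proof (rule mult_mono)
      show "\<bar>d\<psi> x \<bullet> h\<bar> \<le> (M + M * (16 / e)) * norm h"
        using Cauchy_Schwarz_ineq2[of "d\<psi> x" h] mult_right_mono[OF d\<psi>_le[of x] norm_ge_zero[of h]] by linarith
      show "norm (K0 x) \<le> C\<^sub>K * (1 + e powr - (\<alpha> + 1))"
        using norm_K0_le'[of x] mult_left_mono[OF \<kappa> CK_nonneg] by (simp add: distrib_left)
    qed (use M e in auto)
    have 2: "norm (\<psi> x *\<^sub>R frechet_derivative K (at x) h) \<le> M * ((C\<^sub>K * e powr - (\<alpha> + 1)) * norm h)"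
      unfolding norm_scaleR
    proof (rule mult_mono)
      show "\<bar>\<psi> x\<bar> \<le> M" using \<psi>_le by simp
      have "norm (frechet_derivative K (at x) h) \<le> onorm (frechet_derivative K (at x)) * norm h"
        by (rule onorm[OF has_derivative_bounded_linear[OF K_deriv[OF x]]])
      also have "\<dots> \<le> (C\<^sub>K * e powr - (\<alpha> + 1)) * norm h"
        using onorm_K_le[OF x] mult_left_mono[OF \<kappa> CK_nonneg] by (intro mult_right_mono) auto
      finally show "norm (frechet_derivative K (at x) h) \<le> (C\<^sub>K * e powr - (\<alpha> + 1)) * norm h" .
    qed (use M in auto)
    show ?thesis unfolding F'_def using norm_triangle_mono[OF 1 2] by (simp add: Z_def algebra_simps)
  qed
  have Fb: "integrable lborel (\<lambda>x. F' x b \<bullet> b) \<and> (\<integral>x. F' x b \<bullet> b \<partial>lborel) = 0" if b: "b \<in> Basis" for b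
  proof -
    have d: "((\<lambda>x. F x \<bullet> b) has_derivative (\<lambda>h. F' x h \<bullet> b)) (at x)" for x
      by (rule has_derivative_inner_left[OF F])
    have "onorm (\<lambda>h. F' x h \<bullet> b) \<le> Z" for x
    proof (rule onorm_bound[OF Z])
      fix h
      show "norm (F' x h \<bullet> b) \<le> Z * norm h"
        using Basis_le_norm[OF b, of "F' x h"] F'le[of x h] by simp
    qed
    from integral_directional_derivative_eq_0[OF d this, of R b] show ?thesis
      using M(4) by (simp add: F_def \<psi>_def)
  qed
  have "K0 x \<bullet> d\<psi> x = (\<Sum>b\<in>Basis. F' x b \<bullet> b)" for x
  proof (cases "x = 0")
    case True
    thus ?thesis using near[of 0] e by (simp add: F'_def)
  next
    case False
    hence "divergence K x = 0" using admissible by (auto simp: admissible_kernel_def)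
    have "(\<Sum>b\<in>Basis. F' x b \<bullet> b) = (\<Sum>b\<in>Basis. (d\<psi> x \<bullet> b) * (K0 x \<bullet> b)) + \<psi> x * divergence K x"
      by (simp add: F'_def inner_add_left sum.distrib divergence_def sum_distrib_left)
    also have "\<dots> = K0 x \<bullet> d\<psi> x"
      using \<open>divergence K x = 0\<close> euclidean_inner[of "d\<psi> x" "K0 x"] by (simp add: inner_commute)
    finally show ?thesis by simp
  qed
  hence "(\<integral>x. K0 x \<bullet> d\<psi> x \<partial>lborel) = (\<Sum>b\<in>Basis. \<integral>x. F' x b \<bullet> b \<partial>lborel)"
    using Fb by (simp add: Bochner_Integration.integral_sum)
  also have "\<dots> = 0" using Fb by simp
  finally show ?thesis by (simp add: d\<psi>_def)
qed

text \<open>The cutoff radius tends to 0. \<open>cutoff_grad\<close> has size up to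
  \<open>16 / e\<close> but lives where \<open>norm x < 2 * e\<close>, so its product with
  \<open>K0\<close> is at most \<open>32 * C\<^sub>K * \<kappa> x\<close>. This is locally
  integrable because \<open>\<alpha> + 1\<close> is below the dimension; dominated convergence shows
  that the divergence has no part concentrated at the origin.\<close>

lemma divergence_free:
  assumes g: "C11_compact g gg"
  shows "(\<integral>x. K0 x \<bullet> gg x \<partial>lborel) = 0"
proof -
  obtain M R where M: "0 \<le> M" "\<And>x. \<bar>g x\<bar> \<le> M" "\<And>x. norm (gg x) \<le> M" "\<And>x. R < norm x \<Longrightarrow> g x = 0 \<and> gg x = 0"
    using C11_compact_bounds[OF g] by metis
  define e where "e n = 1 / real (Suc n)" for n
  have e: "0 < e n" for n by (simp add: e_def)
  have e0: "e \<longlonglongrightarrow> 0" unfolding e_def using LIMSEQ_inverse_real_of_nat by (simp add: inverse_eq_divide)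
  define S where "S n x = K0 x \<bullet> (cutoff (e n) x *\<^sub>R gg x + g x *\<^sub>R cutoff_grad (e n) x)" for n x
  define w where "w x = M * C\<^sub>K * indicator (cball 0 R) x + 33 * M * C\<^sub>K * (\<kappa> x * indicator (cball 0 R) x)" for x :: 'a
  have [measurable]: "g \<in> borel_measurable borel" "gg \<in> borel_measurable borel"
    "cutoff (e n) \<in> borel_measurable borel" "cutoff_grad (e n) \<in> borel_measurable (borel :: 'a measure)" for n
    by (auto intro!: borel_measurable_continuous_onI C11_continuous[OF g] C11_continuous_gradient[OF g]
        continuous_on_cutoff continuous_on_cutoff_grad)
  have "(\<lambda>n. \<integral>x. S n x \<partial>lborel) \<longlonglongrightarrow> (\<integral>x. K0 x \<bullet> gg x \<partial>lborel)"
  proof (rule integral_dominated_convergence[where w=w])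
    show "integrable lborel w"
      unfolding w_def using riesz_locally_integrable[of R] emeasure_lborel_cball_finite[of "0::'a" R]
      by (intro Bochner_Integration.integrable_add integrable_mult_right integrable_real_indicator) auto
    show "S n \<in> borel_measurable lborel" for n unfolding S_def by measurable
    show "AE x in lborel. (\<lambda>n. S n x) \<longlonglongrightarrow> K0 x \<bullet> gg x"
    proof (intro always_eventually allI)
      fix x :: 'a
      show "(\<lambda>n. S n x) \<longlonglongrightarrow> K0 x \<bullet> gg x"
      proof (cases "x = 0")
        case False
        have "\<forall>\<^sub>F n in sequentially. e n < norm x / 2"
          by (rule order_tendstoD(2)[OF e0]) (use False in simp)
        hence "\<forall>\<^sub>F n in sequentially. S n x = K0 x \<bullet> gg x"
        proof eventually_elim
          case (elim n)
          hence "2 * e n \<le> norm x" by simp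
          thus ?case by (simp add: S_def cutoff_far[OF e])
        qed
        thus ?thesis by (rule tendsto_eventually)
      qed (simp add: S_def)
    qed
    show "AE x in lborel. norm (S n x) \<le> w x" for n
    proof (intro always_eventually allI)
      fix x :: 'a
      show "norm (S n x) \<le> w x"
      proof (cases "norm x \<le> R")
        case False
        thus ?thesis using M(4)[of x] by (simp add: S_def w_def)
      next
        case True
        have 1: "cutoff (e n) x * \<bar>K0 x \<bullet> gg x\<bar> \<le> 1 * ((C\<^sub>K * (1 + \<kappa> x)) * M)"
        proof (rule mult_mono)
          have "\<bar>K0 x \<bullet> gg x\<bar> \<le> norm (K0 x) * norm (gg x)" by (rule Cauchy_Schwarz_ineq2)
          also have "\<dots> \<le> (C\<^sub>K * (1 + \<kappa> x)) * M" by (intro mult_mono norm_K0_le' M) (auto simp: CK_nonneg)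
          finally show "\<bar>K0 x \<bullet> gg x\<bar> \<le> (C\<^sub>K * (1 + \<kappa> x)) * M" .
        qed (auto simp: cutoff_bounds)
        have 2: "\<bar>g x\<bar> * \<bar>K0 x \<bullet> cutoff_grad (e n) x\<bar> \<le> M * (32 * C\<^sub>K * \<kappa> x)"
        proof (rule mult_mono)
          show "\<bar>K0 x \<bullet> cutoff_grad (e n) x\<bar> \<le> 32 * C\<^sub>K * \<kappa> x"
          proof (cases "2 * e n \<le> norm x")
            case True
            thus ?thesis using cutoff_far(2)[OF e True] CK_nonneg by simp
          next
            case False
            have "\<bar>K0 x \<bullet> cutoff_grad (e n) x\<bar> \<le> norm (K0 x) * norm (cutoff_grad (e n) x)" by (rule Cauchy_Schwarz_ineq2)
            also have "\<dots> \<le> (C\<^sub>K * ((2 * e n) * \<kappa> x)) * (16 / e n)"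
            proof (intro mult_mono norm_cutoff_grad_le e)
              show "norm (K0 x) \<le> C\<^sub>K * ((2 * e n) * \<kappa> x)"
                using norm_K0_le[of x] mult_left_mono[OF mult_right_mono[of "norm x" "2 * e n" "\<kappa> x"] CK_nonneg] False by simp
            qed (use CK_nonneg e[of n] in auto)
            also have "\<dots> = 32 * C\<^sub>K * \<kappa> x" using e[of n] by simp
            finally show ?thesis .
          qed
        qed (use M in auto)
        have "\<bar>S n x\<bar> \<le> cutoff (e n) x * \<bar>K0 x \<bullet> gg x\<bar> + \<bar>g x\<bar> * \<bar>K0 x \<bullet> cutoff_grad (e n) x\<bar>"
        proof -
          have "S n x = cutoff (e n) x * (K0 x \<bullet> gg x) + g x * (K0 x \<bullet> cutoff_grad (e n) x)"
            by (simp add: S_def inner_add_right)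
          thus ?thesis
            using abs_triangle_ineq[of "cutoff (e n) x * (K0 x \<bullet> gg x)" "g x * (K0 x \<bullet> cutoff_grad (e n) x)"]
              cutoff_bounds(1)[of "e n" x] by (simp only: abs_mult abs_of_nonneg)
        qed
        with 1 2 have "\<bar>S n x\<bar> \<le> (C\<^sub>K * (1 + \<kappa> x)) * M + M * (32 * C\<^sub>K * \<kappa> x)" by linarith
        thus ?thesis using True by (simp add: w_def algebra_simps)
      qed
    qed
  qed (measurable)
  moreover have "(\<integral>x. S n x \<partial>lborel) = 0" for n
    unfolding S_def by (rule divergence_free_cutoff[OF g e])
  ultimately show ?thesis by (simp add: LIMSEQ_const_iff)
qed

lemma C11_compact_shift: "C11_compact f gf \<Longrightarrow> C11_compact (\<lambda>x. f (x + y)) (\<lambda>x. gf (x + y))"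
proof -
  assume "C11_compact f gf"
  then obtain C R where C: "\<And>x h. \<bar>f (x + h) - f x - gf x \<bullet> h\<bar> \<le> C * (norm h)\<^sup>2"
    and R: "\<And>x. R < norm x \<Longrightarrow> f x = 0 \<and> gf x = 0" unfolding C11_compact_def by blast
  have "\<bar>f (x + h + y) - f (x + y) - gf (x + y) \<bullet> h\<bar> \<le> C * (norm h)\<^sup>2" for x h
    using C[of "x + y" h] by (simp add: add_ac)
  moreover have "f (x + y) = 0 \<and> gf (x + y) = 0" if "R + norm y < norm x" for x
    using R[of "x + y"] norm_triangle_ineq2[of x "- y"] that by simp
  ultimately show ?thesis unfolding C11_compact_def by blast
qed

text \<open>Fubini's theorem; for fixed \<open>y\<close> a translation reduces the inner integral to
  \<open>divergence_free\<close> for the shifted test function.\<close>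

lemma integral_kconv_gradient_eq_0:
  assumes \<mu>: "riesz_bounded \<Lambda> \<mu>" and f: "C11_compact f gf"
  shows "(\<integral>x. gf x \<bullet> kconv \<mu> x \<partial>lborel) = 0"
proof -
  interpret \<mu>: prob_space \<mu> using \<mu> by (simp add: riesz_bounded_def)
  have [measurable_cong]: "sets \<mu> = sets borel" using \<mu> by (simp add: riesz_bounded_def)
  interpret pair_sigma_finite lborel \<mu> ..
  obtain M R where M: "0 \<le> M" "\<And>x. \<bar>f x\<bar> \<le> M" "\<And>x. norm (gf x) \<le> M" "\<And>x. R < norm x \<Longrightarrow> f x = 0 \<and> gf x = 0"
    using C11_compact_bounds[OF f] by metis
  have [measurable]: "gf \<in> borel_measurable borel"
    by (intro borel_measurable_continuous_onI C11_continuous_gradient[OF f])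
  have int: "integrable (lborel \<Otimes>\<^sub>M \<mu>) (\<lambda>(x, y). gf x \<bullet> K0 (x - y))"
  proof (rule integrableI_bounded)
    have "(\<integral>\<^sup>+z. ennreal (norm (case z of (x, y) \<Rightarrow> gf x \<bullet> K0 (x - y))) \<partial>(lborel \<Otimes>\<^sub>M \<mu>))
       = (\<integral>\<^sup>+x. \<integral>\<^sup>+y. ennreal \<bar>gf x \<bullet> K0 (x - y)\<bar> \<partial>\<mu> \<partial>lborel)"
      by (subst \<mu>.nn_integral_fst[symmetric]) auto
    also have "\<dots> \<le> (\<integral>\<^sup>+x. ennreal (M * C\<^sub>K * (1 + \<Lambda>)) * indicator (cball 0 R) x \<partial>(lborel :: 'a measure))"
    proof (rule nn_integral_mono)
      fix x :: 'a
      show "(\<integral>\<^sup>+y. ennreal \<bar>gf x \<bullet> K0 (x - y)\<bar> \<partial>\<mu>) \<le> ennreal (M * C\<^sub>K * (1 + \<Lambda>)) * indicator (cball 0 R) x"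
      proof (cases "norm x \<le> R")
        case True
        have "(\<integral>\<^sup>+y. ennreal \<bar>gf x \<bullet> K0 (x - y)\<bar> \<partial>\<mu>) \<le> (\<integral>\<^sup>+y. ennreal (M * C\<^sub>K) * (1 + ennreal (\<kappa> (x - y))) \<partial>\<mu>)"
        proof (rule nn_integral_mono)
          fix y
          have "\<bar>gf x \<bullet> K0 (x - y)\<bar> \<le> norm (gf x) * norm (K0 (x - y))" by (rule Cauchy_Schwarz_ineq2)
          also have "\<dots> \<le> M * (C\<^sub>K * (1 + \<kappa> (x - y)))" by (intro mult_mono M norm_K0_le') auto
          finally have "ennreal \<bar>gf x \<bullet> K0 (x - y)\<bar> \<le> ennreal (M * C\<^sub>K * (1 + \<kappa> (x - y)))"
            by (intro ennreal_leI) (simp add: mult.assoc)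
          also have "\<dots> = ennreal (M * C\<^sub>K) * (1 + ennreal (\<kappa> (x - y)))"
            using M CK_nonneg by (simp add: ennreal_mult ennreal_plus)
          finally show "ennreal \<bar>gf x \<bullet> K0 (x - y)\<bar> \<le> ennreal (M * C\<^sub>K) * (1 + ennreal (\<kappa> (x - y)))" .
        qed
        also have "\<dots> = ennreal (M * C\<^sub>K) * (1 + (\<integral>\<^sup>+y. ennreal (\<kappa> (x - y)) \<partial>\<mu>))"
          by (simp add: nn_integral_cmult nn_integral_add \<mu>.emeasure_space_1)
        also have "\<dots> \<le> ennreal (M * C\<^sub>K) * (1 + ennreal \<Lambda>)"
          using \<mu> by (intro mult_left_mono add_left_mono) (auto simp: riesz_bounded_def)
        also have "\<dots> = ennreal (M * C\<^sub>K * (1 + \<Lambda>))"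
          using M CK_nonneg \<mu> by (simp add: ennreal_mult ennreal_plus riesz_bounded_def)
        finally show ?thesis using True by simp
      qed (use M(4) in simp)
    qed
    also have "\<dots> = ennreal (M * C\<^sub>K * (1 + \<Lambda>)) * emeasure lborel (cball (0::'a) R)"
      by (subst nn_integral_cmult_indicator) auto
    also have "\<dots> < \<infinity>"
      using emeasure_lborel_cball_finite[of "0::'a" R] by (simp add: ennreal_mult_less_top)
    finally show "(\<integral>\<^sup>+z. ennreal (norm (case z of (x, y) \<Rightarrow> gf x \<bullet> K0 (x - y))) \<partial>(lborel \<Otimes>\<^sub>M \<mu>)) < \<infinity>" .
  qed measurable
  have inner: "(\<integral>x. gf x \<bullet> K0 (x - y) \<partial>lborel) = 0" for y
  proof -
    have "(\<integral>x. gf x \<bullet> K0 (x - y) \<partial>lborel) = (\<integral>x. gf x \<bullet> K0 (x - y) \<partial>distr lborel borel ((+) y))"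
      by (simp add: lborel_distr_plus)
    also have "\<dots> = (\<integral>x. gf (x + y) \<bullet> K0 x \<partial>lborel)"
      by (subst integral_distr) (auto simp: add.commute)
    also have "\<dots> = 0" using divergence_free[OF C11_compact_shift[OF f, of y]] by (simp add: inner_commute)
    finally show ?thesis .
  qed
  have "(\<integral>x. gf x \<bullet> kconv \<mu> x \<partial>lborel) = (\<integral>x. \<integral>y. gf x \<bullet> K0 (x - y) \<partial>\<mu> \<partial>lborel)"
    unfolding kconv_def using K0_integrable[OF \<mu>] by simp
  also have "\<dots> = (\<integral>y. \<integral>x. gf x \<bullet> K0 (x - y) \<partial>lborel \<partial>\<mu>)"
    using Fubini_integral[OF int] by simp
  also have "\<dots> = 0" by (simp add: inner)
  finally show ?thesis .
qed

end

section \<open>From the weak formulation to derivatives in time\<close>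

definition hat :: "real \<Rightarrow> real" where
  "hat x = max 0 (1 + x) - 2 * max 0 x + max 0 (x - 1)"

text \<open>Primitive of \<open>hat\<close>: a continuously differentiable step that rises from 0 at
  -1 to 1 at 1.\<close>

definition hat_int :: "real \<Rightarrow> real" where
  "hat_int x = (max 0 (1 + x))\<^sup>2 / 2 - (max 0 x)\<^sup>2 + (max 0 (x - 1))\<^sup>2 / 2"

lemma hat_int_deriv: "(hat_int has_real_derivative hat x) (at x)"
proof -
  have d: "((\<lambda>x. (max 0 (c + x))\<^sup>2) has_real_derivative 2 * max 0 (c + x)) (at x)" for c :: real
  proof -
    have "((\<lambda>x. (max 0 (c + x))\<^sup>2) has_real_derivative 2 * max 0 (c + x) * 1) (at x)"
      by (rule DERIV_chain2[where f="\<lambda>z. (max 0 z)\<^sup>2" and g="\<lambda>x. c + x", OF pos_part_square_deriv])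
         (auto intro!: derivative_eq_intros)
    thus ?thesis by simp
  qed
  have "((\<lambda>x. (max 0 (1 + x))\<^sup>2 / 2 - (max 0 (0 + x))\<^sup>2 + (max 0 (- 1 + x))\<^sup>2 / 2) has_real_derivative
     2 * max 0 (1 + x) / 2 - 2 * max 0 (0 + x) + 2 * max 0 (- 1 + x) / 2) (at x)"
    by (rule DERIV_add[OF DERIV_diff[OF DERIV_cdivide[OF d] d] DERIV_cdivide[OF d]])
  thus ?thesis by (simp add: hat_int_def[abs_def] hat_def)
qed

lemma hat_eq_0: "x \<notin> {-1..1} \<Longrightarrow> hat x = 0"
  by (auto simp: hat_def max_def)

lemma hat_int_eq: "x \<le> - 1 \<Longrightarrow> hat_int x = 0" "1 \<le> x \<Longrightarrow> hat_int x = 1"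
  by (auto simp: hat_int_def max_def power2_eq_square field_simps)

lemma continuous_on_hat: "continuous_on S hat"
  unfolding hat_def by (intro continuous_intros)

lemma hat_measurable [measurable]: "hat \<in> borel_measurable borel"
  by (intro borel_measurable_continuous_onI continuous_on_hat)

lemma hat_bound: "\<bar>hat x\<bar> \<le> 4 * indicator {-1..1} x"
proof (cases "x \<in> {-1..1}")
  case True
  thus ?thesis by (auto simp: hat_def max_def)
qed (simp add: hat_eq_0)

lemma hat_int_bound: "\<bar>hat_int x\<bar> \<le> 1"
proof -
  consider "x \<le> -1" | "-1 \<le> x" "x \<le> 0" | "0 \<le> x" "x \<le> 1" | "1 \<le> x" by linarith
  thus ?thesis
  proof cases
    case 2
    hence "(1 + x)\<^sup>2 \<le> 1\<^sup>2" by (intro power_mono) auto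
    thus ?thesis using 2 by (auto simp: hat_int_def)
  next
    case 3
    have "hat_int x = 1 - (1 - x)\<^sup>2 / 2" using 3 by (auto simp: hat_int_def power2_eq_square field_simps)
    moreover have "(1 - x)\<^sup>2 \<le> 1\<^sup>2" using 3 by (intro power_mono) auto
    ultimately show ?thesis using zero_le_power2[of "1 - x"] by (auto simp del: zero_le_power2)
  qed (auto simp: hat_int_eq)
qed

lemma integral_hat: "(\<integral>x. hat x \<partial>lborel) = 1"
proof -
  have "(\<integral>x. hat x \<partial>lborel) = (\<integral>x. hat x * indicator {-1..1} x \<partial>lborel)"
  proof (intro Bochner_Integration.integral_cong refl)
    show "hat x = hat x * indicator {-1..1} x" for x
      using hat_eq_0[of x] by (cases "x \<in> {-1..1}") auto
  qed
  also have "\<dots> = hat_int 1 - hat_int (- 1)"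
    by (rule integral_FTC_Icc_real) (auto simp: hat_int_deriv intro!: continuous_on_interior[OF continuous_on_hat[of UNIV]])
  finally show ?thesis by (simp add: hat_int_eq)
qed

lemma hat_approximates_identity:
  fixes a :: "real \<Rightarrow> real"
  assumes a: "continuous_on UNIV a" and e: "\<And>n. 0 < e n" "\<And>n. e n \<le> 1" "e \<longlonglongrightarrow> 0"
  shows "(\<lambda>n. \<integral>r. (1 / e n) * hat ((r - s) / e n) * a r \<partial>lborel) \<longlonglongrightarrow> a s"
proof -
  have [measurable]: "a \<in> borel_measurable borel" by (rule borel_measurable_continuous_onI[OF a])
  have "compact (a ` {s - 1..s + 1})"
    by (intro compact_continuous_image continuous_on_subset[OF a]) auto
  then obtain M where "\<forall>y\<in>a ` {s - 1..s + 1}. norm y \<le> M"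
    using compact_imp_bounded[of "a ` {s - 1..s + 1}"] unfolding bounded_iff by blast
  hence M: "\<bar>a r\<bar> \<le> M" if "\<bar>r - s\<bar> \<le> 1" for r
  proof -
    have "s - 1 \<le> r" "r \<le> s + 1" using that by linarith+
    thus ?thesis using \<open>\<forall>y\<in>a ` {s - 1..s + 1}. norm y \<le> M\<close> by auto
  qed
  have "(\<lambda>n. \<integral>x. hat x * a (s + e n * x) \<partial>lborel) \<longlonglongrightarrow> (\<integral>x. hat x * a s \<partial>lborel)"
  proof (rule integral_dominated_convergence[where w="\<lambda>x. 4 * M * indicator {-1..1::real} x"])
    show "integrable lborel (\<lambda>x. 4 * M * indicator {-1..1::real} x)" by simp
    show "AE x in lborel. (\<lambda>n. hat x * a (s + e n * x)) \<longlonglongrightarrow> hat x * a s"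
    proof (intro always_eventually allI)
      fix x :: real
      have "(\<lambda>n. s + e n * x) \<longlonglongrightarrow> s + 0 * x" by (intro tendsto_intros e)
      hence "(\<lambda>n. a (s + e n * x)) \<longlonglongrightarrow> a s"
        using a by (intro isCont_tendsto_compose[where g=a]) (auto simp: continuous_on_eq_continuous_at)
      thus "(\<lambda>n. hat x * a (s + e n * x)) \<longlonglongrightarrow> hat x * a s" by (intro tendsto_intros)
    qed
    show "AE x in lborel. norm (hat x * a (s + e n * x)) \<le> 4 * M * indicator {-1..1} x" for n
    proof (intro always_eventually allI)
      fix x :: real
      show "norm (hat x * a (s + e n * x)) \<le> 4 * M * indicator {-1..1} x"
      proof (cases "x \<in> {-1..1}")
        case True
        hence "\<bar>e n * x\<bar> \<le> 1 * 1" unfolding abs_mult using e(1,2)[of n] by (intro mult_mono) (auto simp: abs_if)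
        hence "\<bar>hat x\<bar> * \<bar>a (s + e n * x)\<bar> \<le> 4 * M"
          using hat_bound[of x] True by (intro mult_mono M) auto
        thus ?thesis using True by (simp add: abs_mult)
      qed (simp add: hat_eq_0)
    qed
  qed auto
  moreover have "(\<integral>r. (1 / e n) * hat ((r - s) / e n) * a r \<partial>lborel) = (\<integral>x. hat x * a (s + e n * x) \<partial>lborel)" for n
    using e(1)[of n] lborel_integral_real_affine[of "e n" "\<lambda>r. (1 / e n) * hat ((r - s) / e n) * a r" s]
    by simp
  ultimately show ?thesis by (simp add: integral_hat)
qed

text \<open>The test functions are smoothed indicators of \<open>{s..t}\<close>, differences of two
  steps. Their derivatives tend to unit masses at \<open>s\<close> and \<open>t\<close> with
  opposite signs, by \<open>hat_approximates_identity\<close>.\<close>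

lemma du_bois_reymond:
  fixes a b :: "real \<Rightarrow> real"
  assumes a: "continuous_on UNIV a" and b: "continuous_on UNIV b"
    and test: "\<And>\<theta> \<theta>' l h. (\<And>t. (\<theta> has_real_derivative \<theta>' t) (at t)) \<Longrightarrow> continuous_on UNIV \<theta>' \<Longrightarrow> 0 < l \<Longrightarrow>
        (\<And>t. t \<notin> {l..h} \<Longrightarrow> \<theta> t = 0 \<and> \<theta>' t = 0) \<Longrightarrow> (\<integral>t. \<theta>' t * a t + \<theta> t * b t \<partial>lborel) = 0"
    and st: "0 < s" "s < t"
  shows "a t - a s = integral {s..t} b"
proof -
  \<comment> \<open>At most \<open>s / 2\<close>, so that the step around \<open>s\<close> stays at
    positive times; at most 1, so that all supports lie in one compact interval.\<close>
  define e where "e n = min 1 (s / 2) / real (Suc n)" for n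
  have e: "0 < e n" "e n \<le> 1" "e n \<le> s / 2" for n
  proof -
    show "0 < e n" using st by (simp add: e_def)
    define k where "k = min 1 (s / 2)"
    have "0 < k" using st by (simp add: k_def)
    hence "k / real (Suc n) \<le> k" by (simp add: divide_le_eq mult_le_cancel_left1)
    hence "e n \<le> min 1 (s / 2)" by (simp only: e_def k_def)
    thus "e n \<le> 1" "e n \<le> s / 2" by auto
  qed
  have e0: "e \<longlonglongrightarrow> 0" 
    unfolding e_def[abs_def] divide_inverse by (rule tendsto_mult_right_zero[OF LIMSEQ_inverse_real_of_nat])
  define \<theta> where "\<theta> n r = hat_int ((r - s) / e n) - hat_int ((r - t) / e n)" for n r
  define \<theta>' where "\<theta>' n r = (1 / e n) * hat ((r - s) / e n) - (1 / e n) * hat ((r - t) / e n)" for n r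
  have \<theta>: "(\<theta> n has_real_derivative \<theta>' n r) (at r)" for n r
  proof -
    have "((\<lambda>r. hat_int ((r - z) / e n)) has_real_derivative hat ((r - z) / e n) * (1 / e n)) (at r)" for z
      using e(1)[of n] by (intro DERIV_chain2[where f=hat_int and g="\<lambda>r. (r - z) / e n", OF hat_int_deriv])
        (auto intro!: derivative_eq_intros)
    from DERIV_diff[OF this[of s] this[of t]] show ?thesis
      by (simp add: \<theta>_def[abs_def] \<theta>'_def)
  qed
  have c\<theta>: "continuous_on UNIV (\<theta> n)" for n
    by (intro continuous_at_imp_continuous_on ballI DERIV_isCont[OF \<theta>])
  have c\<theta>': "continuous_on UNIV (\<theta>' n)" for n
    unfolding \<theta>'_def[abs_def] using e(1)[of n]
    by (intro continuous_intros continuous_on_compose2[OF continuous_on_hat[of UNIV]]) auto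
  have supp: "\<theta> n r = 0 \<and> \<theta>' n r = 0" if "r \<notin> {s / 2..t + 1}" for n r
  proof -
    have "(r - s) / e n < - 1 \<and> (r - t) / e n < - 1 \<or> 1 < (r - s) / e n \<and> 1 < (r - t) / e n"
      using that e[of n] st by (auto simp: field_simps)
    thus ?thesis by (auto simp: \<theta>_def \<theta>'_def hat_int_eq hat_eq_0)
  qed
  have int: "integrable lborel (\<lambda>r. f r * g r)"
    if "continuous_on UNIV f" "continuous_on UNIV g" "\<And>r. r \<notin> {s / 2..t + 1} \<Longrightarrow> f r = 0" for f g :: "real \<Rightarrow> real"
  proof -
    have "integrable lborel (\<lambda>r. indicator {s / 2..t + 1} r *\<^sub>R (f r * g r))"
      by (intro borel_integrable_compact continuous_intros continuous_on_subset[OF that(1)] continuous_on_subset[OF that(2)]) auto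
    also have "(\<lambda>r. indicator {s / 2..t + 1} r *\<^sub>R (f r * g r)) = (\<lambda>r. f r * g r)"
      using that(3) by (auto simp: indicator_def fun_eq_iff)
    finally show ?thesis .
  qed
  have chat: "continuous_on UNIV (\<lambda>r. (1 / e n) * hat ((r - z) / e n))" for n z
    using e(1)[of n] by (intro continuous_intros continuous_on_compose2[OF continuous_on_hat[of UNIV]]) auto
  have shat: "(1 / e n) * hat ((r - z) / e n) = 0" if "r \<notin> {s / 2..t + 1}" "z = s \<or> z = t" for n r z
  proof -
    have "(r - z) / e n < - 1 \<or> 1 < (r - z) / e n"
      using that e[of n] st by (auto simp: field_simps)
    thus ?thesis by (auto simp: hat_eq_0)
  qed
  have key: "(\<integral>r. (1 / e n) * hat ((r - s) / e n) * a r \<partial>lborel) - (\<integral>r. (1 / e n) * hat ((r - t) / e n) * a r \<partial>lborel)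
      + (\<integral>r. \<theta> n r * b r \<partial>lborel) = 0" for n
  proof -
    have "0 = (\<integral>r. \<theta>' n r * a r + \<theta> n r * b r \<partial>lborel)"
      using test[where l="s / 2" and h="t + 1", OF \<theta> c\<theta>' _ supp] st by simp
    also have "\<dots> = (\<integral>r. \<theta>' n r * a r \<partial>lborel) + (\<integral>r. \<theta> n r * b r \<partial>lborel)"
      by (intro Bochner_Integration.integral_add int c\<theta> c\<theta>' a b) (use supp in auto)
    also have "(\<integral>r. \<theta>' n r * a r \<partial>lborel) = (\<integral>r. (1 / e n) * hat ((r - s) / e n) * a r - (1 / e n) * hat ((r - t) / e n) * a r \<partial>lborel)"
      by (simp add: \<theta>'_def left_diff_distrib)
    also have "\<dots> = (\<integral>r. (1 / e n) * hat ((r - s) / e n) * a r \<partial>lborel) - (\<integral>r. (1 / e n) * hat ((r - t) / e n) * a r \<partial>lborel)"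
      by (intro Bochner_Integration.integral_diff int chat a) (use shat in auto)
    finally show ?thesis by simp
  qed
  have [measurable]: "b \<in> borel_measurable borel" "\<theta> n \<in> borel_measurable borel" for n
    by (auto intro!: borel_measurable_continuous_onI b c\<theta>)
  have "(\<lambda>n. \<integral>r. \<theta> n r * b r \<partial>lborel) \<longlonglongrightarrow> (\<integral>r. indicator {s..t} r * b r \<partial>lborel)"
  proof (rule integral_dominated_convergence[where w="\<lambda>r. indicator {s / 2..t + 1} r *\<^sub>R (2 * \<bar>b r\<bar>)"])
    show "integrable lborel (\<lambda>r. indicator {s / 2..t + 1} r *\<^sub>R (2 * \<bar>b r\<bar>))"
      by (intro borel_integrable_compact continuous_intros continuous_on_subset[OF b]) auto
    have "AE r in lborel. r \<noteq> s \<and> r \<noteq> t"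
      using AE_lborel_singleton[of s] AE_lborel_singleton[of t] by eventually_elim simp
    thus "AE r in lborel. (\<lambda>n. \<theta> n r * b r) \<longlonglongrightarrow> indicator {s..t} r * b r"
    proof eventually_elim
      case (elim r)
      have ev: "\<forall>\<^sub>F n in sequentially. hat_int ((r - z) / e n) = (if z < r then 1 else 0)" if "r \<noteq> z" for z
      proof -
        have "\<forall>\<^sub>F n in sequentially. e n < \<bar>r - z\<bar>"
          by (rule order_tendstoD(2)[OF e0]) (use that in simp)
        thus ?thesis
        proof eventually_elim
          case (elim n)
          show ?case
          proof (cases "z < r")
            case True
            hence "1 \<le> (r - z) / e n" using elim e(1)[of n] by (simp add: field_simps)
            thus ?thesis using True hat_int_eq by simp
          next
            case False
            hence "(r - z) / e n \<le> - 1" using elim e(1)[of n] by (simp add: field_simps)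
            thus ?thesis using False hat_int_eq by simp
          qed
        qed
      qed
      have "\<forall>\<^sub>F n in sequentially. \<theta> n r * b r = indicator {s..t} r * b r"
        using ev[of s, OF conjunct1[OF elim]] ev[of t, OF conjunct2[OF elim]]
        by eventually_elim (use st elim in \<open>auto simp: \<theta>_def indicator_def\<close>)
      thus ?case by (rule tendsto_eventually)
    qed
    show "AE r in lborel. norm (\<theta> n r * b r) \<le> indicator {s / 2..t + 1} r *\<^sub>R (2 * \<bar>b r\<bar>)" for n
    proof (intro always_eventually allI)
      fix r
      have "\<bar>\<theta> n r\<bar> \<le> 2" unfolding \<theta>_def using hat_int_bound[of "(r - s) / e n"] hat_int_bound[of "(r - t) / e n"] by linarith
      thus "norm (\<theta> n r * b r) \<le> indicator {s / 2..t + 1} r *\<^sub>R (2 * \<bar>b r\<bar>)"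
        using supp[of r n] by (cases "r \<in> {s / 2..t + 1}") (auto simp: abs_mult mult_right_mono)
    qed
  qed auto
  hence "(\<lambda>n. (\<integral>r. (1 / e n) * hat ((r - s) / e n) * a r \<partial>lborel) - (\<integral>r. (1 / e n) * hat ((r - t) / e n) * a r \<partial>lborel)
      + (\<integral>r. \<theta> n r * b r \<partial>lborel)) \<longlonglongrightarrow> a s - a t + (\<integral>r. indicator {s..t} r * b r \<partial>lborel)"
    by (intro tendsto_intros hat_approximates_identity a e(1) e(2) e0)
  hence "a s - a t + (\<integral>r. indicator {s..t} r * b r \<partial>lborel) = 0"
    unfolding key by (simp add: LIMSEQ_const_iff)
  moreover have "(\<integral>r. indicator {s..t} r * b r \<partial>lborel) = integral {s..t} b"
  proof -
    have "set_integrable lborel {s..t} b" unfolding set_integrable_def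
      by (intro borel_integrable_compact continuous_on_subset[OF b]) auto
    from set_borel_integral_eq_integral(2)[OF this] show ?thesis by (simp add: set_lebesgue_integral_def)
  qed
  ultimately show ?thesis by simp
qed

text \<open>Increments are known at positive times only. The difference \<open>c\<close> of the two
  sides is constant there and continuous at 0, which extends the identity, and with it the one-sided
  derivative, to time 0.\<close>

lemma derivative_from_increments:
  fixes a b :: "real \<Rightarrow> real"
  assumes a: "continuous_on UNIV a" and b: "continuous_on UNIV b"
    and incr: "\<And>s t. 0 < s \<Longrightarrow> s < t \<Longrightarrow> a t - a s = integral {s..t} b" and "0 \<le> t"
  shows "(a has_real_derivative b t) (at t within {0..})"
proof -
  have b': "continuous_on {0..t + 1} b" by (rule continuous_on_subset[OF b]) simp
  have I: "((\<lambda>r. integral {0..r} b) has_vector_derivative b r) (at r within {0..t + 1})" if "r \<in> {0..t + 1}" for r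
    by (rule integral_has_vector_derivative[OF b' that])
  define c where "c r = a r - integral {0..r} b" for r
  have cc: "continuous_on {0..t + 1} c"
    unfolding c_def
    by (intro continuous_intros continuous_on_subset[OF a] continuous_on_vector_derivative[OF I]) auto
  have const: "c r = c s" if "0 < s" "s \<le> r" "r \<le> t + 1" for r s
  proof (cases "s = r")
    case False
    have "integral {0..s} b + integral {s..r} b = integral {0..r} b"
      using that by (intro Henstock_Kurzweil_Integration.integral_combine integrable_continuous_real continuous_on_subset[OF b]) auto
    thus ?thesis using incr[of s r] that False by (simp add: c_def)
  qed simp
  have c0: "c 0 = c (t + 1)"
  proof -
    have "(c \<longlongrightarrow> c 0) (at 0 within {0..t + 1})" using cc \<open>0 \<le> t\<close> by (auto simp: continuous_on_def)
    hence "(c \<longlongrightarrow> c 0) (at_right 0)"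
      using \<open>0 \<le> t\<close> by (simp add: at_within_Icc_at_right)
    moreover have "\<forall>\<^sub>F r in at_right 0. c r = c (t + 1)"
      using eventually_at_right_less[of 0] eventually_at_right[of 0 "t + 1", THEN iffD2, of "\<lambda>r. r < t + 1"] \<open>0 \<le> t\<close>
      by (auto simp: eventually_at_right[of 0 "t + 1"] intro!: exI[of _ "t + 1"] const[symmetric])
    hence "(c \<longlongrightarrow> c (t + 1)) (at_right 0)" by (rule tendsto_eventually)
    ultimately show ?thesis by (intro tendsto_unique[of "at_right 0" c]) auto
  qed
  have eq: "a r = c (t + 1) + integral {0..r} b" if "r \<in> {0..t + 1}" for r
    using const[of r "t + 1"] c0 that by (cases "r = 0") (auto simp: c_def)
  have "((\<lambda>r. c (t + 1) + integral {0..r} b) has_vector_derivative b t) (at t within {0..t + 1})"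
    using I[of t] \<open>0 \<le> t\<close> by (auto intro!: derivative_eq_intros)
  hence "(a has_vector_derivative b t) (at t within {0..t + 1})"
    by (rule has_vector_derivative_transform[rotated 2]) (use eq \<open>0 \<le> t\<close> in auto)
  moreover have "at t within {0..t + 1} = at t within {0..}"
    by (rule at_within_nhd[of _ "{..<t + 1}"]) auto
  ultimately show ?thesis by (simp add: has_real_derivative_iff_has_vector_derivative)
qed

section \<open>The flow of the limit equation\<close>

text \<open>Under a density in \<open>L^q\<close>, a ball of radius \<open>r\<close> has mass of
  order \<open>r powr (d / q')\<close> by Hoelder's inequality.\<close>

definition growth_exponent :: "nat \<Rightarrow> ennreal \<Rightarrow> real" where
  "growth_exponent d q' = real d / enn2real q'"

definition growth_const :: "nat \<Rightarrow> ennreal \<Rightarrow> real \<Rightarrow> real" where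
  "growth_const d q' m = 2 * m * unit_ball_vol (real d) powr (1 / enn2real q')"

definition riesz_const :: "nat \<Rightarrow> real \<Rightarrow> ennreal \<Rightarrow> real \<Rightarrow> real" where
  "riesz_const d \<alpha> q' m = 1 + dyadic_const (\<alpha> + 1) (growth_exponent d q') * growth_const d q' m"

text \<open>Only the volume of \<open>A\<close> matters. Preimages of balls under a
  volume-preserving flow are therefore covered.\<close>

lemma law_ball_growth:
  fixes f :: "'a::euclidean_space \<Rightarrow> real"
  assumes "f \<in> prob_Lq q" "Lp_norm q lborel f \<le> ennreal m" "0 < m"
    and "1 / q + 1 / q' = (1::ennreal)" "1 < q" and A: "A \<in> sets borel" "emeasure lborel A = emeasure lborel (cball (x::'a) r)" and r: "0 < r"
  shows "emeasure (law f) A \<le> ennreal (growth_const DIM('a) q' m * r powr growth_exponent DIM('a) q')"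
proof -
  define a where "a = unit_ball_vol (real DIM('a)) * r powr real DIM('a)"
  have a: "0 < a" using r by (simp add: a_def)
  have "emeasure lborel A = ennreal a"
    using A emeasure_lborel_cball_powr[OF r] by (simp add: a_def)
  from law_set_bound[OF assms(1-5) A(1) this a]
  have "emeasure (law f) A \<le> ennreal (2 * m * a powr (1 / enn2real q'))" .
  also have "a powr (1 / enn2real q') = unit_ball_vol (real DIM('a)) powr (1 / enn2real q') * r powr growth_exponent DIM('a) q'"
    using r by (simp add: a_def powr_mult powr_powr growth_exponent_def)
  finally show ?thesis by (simp add: growth_const_def mult.assoc)
qed

lemma growth_const_nonneg: "0 \<le> m \<Longrightarrow> 0 \<le> growth_const d q' m"
  by (simp add: growth_const_def)

locale conjugate_exponents =
  fixes d :: nat and \<alpha> :: real and q q' :: ennreal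
  assumes alpha_nonneg': "0 \<le> \<alpha>" and alpha_less': "\<alpha> < real d - 1"
    and q: "q > ennreal (real d / (real d - \<alpha> - 1))" and conjugate: "1 / q + 1 / q' = 1"
begin

lemma one_less_q: "1 < q"
proof -
  have "1 \<le> real d / (real d - \<alpha> - 1)" using alpha_nonneg' alpha_less' by (simp add: le_divide_eq)
  hence "ennreal 1 \<le> ennreal (real d / (real d - \<alpha> - 1))" by (rule ennreal_leI)
  thus ?thesis using q by (metis ennreal_1 order_le_less_trans)
qed

lemma conjugate_pos: "0 < enn2real q'"
  using ennreal_conjugate_exponents[OF conjugate one_less_q] by (auto simp: enn2real_positive_iff)

text \<open>A reformulation of the lower bound on \<open>q\<close>, since
  \<open>1 / q' = 1 - 1 / q\<close>. It is the condition under which the dyadic sums for the limit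
  density converge.\<close>

lemma riesz_exponent_less_growth: "\<alpha> + 1 < growth_exponent d q'"
  using ennreal_conjugate_exponents[OF conjugate one_less_q]
proof (elim disjE conjE exE)
  assume "q = \<infinity>" "q' = 1"
  thus ?thesis using alpha_less' by (simp add: growth_exponent_def)
next
  fix r :: real assume r: "1 < r" "q = ennreal r" "q' = ennreal (r / (r - 1))"
  have pos: "0 < real d - \<alpha> - 1" using alpha_less' by simp
  have "real d / (real d - \<alpha> - 1) < r" using q r ennreal_leI[of r "real d / (real d - \<alpha> - 1)"] by (metis not_le)
  hence "real d < r * (real d - \<alpha> - 1)" using pos by (simp add: divide_less_eq)
  hence "(\<alpha> + 1) * r < real d * (r - 1)" by (simp add: algebra_simps)
  thus ?thesis using r by (simp add: growth_exponent_def field_simps)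
qed

end

locale transport = kernel K \<alpha> C\<^sub>K + conjugate_exponents "DIM('a)" \<alpha> q q'
  for K :: "'a::euclidean_space \<Rightarrow> 'a" and \<alpha> C\<^sub>K q q' +
  fixes m :: real and \<sigma>\<^sub>0 :: "'a \<Rightarrow> real" and \<sigma> :: "real \<Rightarrow> 'a \<Rightarrow> real"
  assumes initial: "\<sigma>\<^sub>0 \<in> prob_Lq q" and m: "Lp_norm q lborel \<sigma>\<^sub>0 \<le> ennreal m" "0 < m"
    and solution: "transport_solution q K \<sigma>\<^sub>0 \<sigma>"
begin

lemma sigma_prob: "0 \<le> t \<Longrightarrow> \<sigma> t \<in> prob_Lq q"
  using solution by (simp add: transport_solution_def)

lemma law_integral: "0 \<le> t \<Longrightarrow> f \<in> borel_measurable borel \<Longrightarrow> (\<integral>x. f x * \<sigma> t x \<partial>lborel) = (\<integral>x. f x \<partial>law (\<sigma> t))"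
  for f :: "'a \<Rightarrow> real"
  using sigma_prob[of t] unfolding law_def prob_Lq_def by (subst integral_density) (auto simp: mult.commute)

lemma law_weakly_continuous:
  fixes G :: "'a \<Rightarrow> real"
  assumes "continuous_on UNIV G" "bounded (range G)"
  shows "continuous_on {0..} (\<lambda>t. \<integral>x. G x \<partial>law (\<sigma> t))"
proof -
  have "continuous_on {0..} (\<lambda>t. \<integral>x. G x * \<sigma> t x \<partial>lborel)"
    using solution assms by (simp add: transport_solution_def)
  also have "?this \<longleftrightarrow> ?thesis"
    using assms by (intro continuous_on_cong law_integral borel_measurable_continuous_onI) auto
  finally show ?thesis .
qed

lemma law_initial: "law (\<sigma> 0) = law \<sigma>\<^sub>0"
  unfolding law_def using sigma_prob[of 0] initial solution
  by (intro density_cong) (auto simp: prob_Lq_def transport_solution_def)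

lemma riesz_bounded_law:
  assumes "f \<in> prob_Lq q" "Lp_norm q lborel f \<le> ennreal b" "0 < b"
  shows "riesz_bounded (riesz_const DIM('a) \<alpha> q' b) (law f)"
  unfolding riesz_bounded_def
proof (intro conjI allI prob_space_law[OF assms(1)] sets_law)
  have pos: "0 < dyadic_const (\<alpha> + 1) (growth_exponent DIM('a) q')"
    by (rule dyadic_const_pos[OF riesz_exponent_less_growth])
  show "0 \<le> riesz_const DIM('a) \<alpha> q' b"
    using pos growth_const_nonneg[of b] assms(3) by (simp add: riesz_const_def)
  fix x :: 'a
  show "(\<integral>\<^sup>+y. ennreal (\<kappa> (x - y)) \<partial>law f) \<le> ennreal (riesz_const DIM('a) \<alpha> q' b)"
    unfolding riesz_const_def
  proof (rule nn_integral_riesz_le[OF prob_space_law[OF assms(1)] sets_law _ riesz_exponent_less_growth])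
    fix r :: real assume r: "0 < r"
    have "emeasure (law f) (cball x r - {x}) \<le> emeasure (law f) (cball x r)"
      by (intro emeasure_mono) auto
    also have "\<dots> \<le> ennreal (growth_const DIM('a) q' b * r powr growth_exponent DIM('a) q')"
      by (rule law_ball_growth[OF assms conjugate one_less_q _ refl r]) simp
    finally show "emeasure (law f) (cball x r - {x}) \<le> ennreal (growth_const DIM('a) q' b * r powr growth_exponent DIM('a) q')" .
  qed (use alpha_nonneg growth_const_nonneg[of b] assms(3) in auto)
qed

text \<open>Frozen at its initial value for negative times, as flows are constructed on the whole
  line.\<close>

definition velocity :: "real \<Rightarrow> 'a \<Rightarrow> 'a" where
  "velocity t x = kconv (law (\<sigma> (max 0 t))) x"

text \<open>The last clause has the constant of the initial bound \<open>m\<close>, not of a bound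
  on the norms at later times; it is the form in which volume preservation is used below.\<close>

definition is_flow :: "(real \<Rightarrow> 'a \<Rightarrow> 'a) \<Rightarrow> bool" where
  "is_flow Y \<longleftrightarrow> continuous_on UNIV (\<lambda>(t, x). Y t x) \<and> (\<forall>x. Y 0 x = x) \<and>
     (\<forall>t x. ((\<lambda>s. Y s x) has_vector_derivative velocity t (Y t x)) (at t)) \<and>
     (\<forall>x. continuous_on UNIV (\<lambda>t. velocity t (Y t x))) \<and>
     (\<forall>t\<ge>0. law (\<sigma> t) = distr (law \<sigma>\<^sub>0) borel (Y t)) \<and>
     (\<forall>t\<ge>0. \<forall>x r. 0 < r \<longrightarrow> emeasure (law (\<sigma> t)) (cball x r)
         \<le> ennreal (growth_const DIM('a) q' m * r powr growth_exponent DIM('a) q'))"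

text \<open>Products of a function of time and one of space are all that is needed; paired with
  \<open>(1, velocity t x)\<close> their derivative is \<open>\<theta>' t * f x + \<theta> t * (gf x
  \<bullet> velocity t x)\<close>.\<close>

lemma test_function_product:
  fixes f :: "'a \<Rightarrow> real"
  assumes f: "C11_compact f gf" and \<theta>: "\<And>t. (\<theta> has_real_derivative \<theta>' t) (at t)" "continuous_on UNIV \<theta>'"
    and supp: "0 < l" "\<And>t. t \<notin> {l..h} \<Longrightarrow> \<theta> t = 0"
  shows "test_function (\<lambda>(t, x). \<theta> t * f x)
     (\<lambda>(t, x). (\<theta>' t * f x) *\<^sub>R fst_blinfun + \<theta> t *\<^sub>R (blinfun_inner_left (gf x) o\<^sub>L snd_blinfun))"
  unfolding test_function_def
proof (intro conjI allI)
  fix z :: "real \<times> 'a"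
  obtain t x where z: "z = (t, x)" by (cases z)
  have 1: "((\<lambda>z. \<theta> (fst z)) has_derivative (\<lambda>h. \<theta>' t * fst h)) (at z)"
    using has_derivative_compose[OF has_derivative_fst[OF has_derivative_ident, of "at z"] \<theta>(1)[of "fst z", unfolded has_field_derivative_def]]
    by (simp add: z)
  have 2: "((\<lambda>z. f (snd z)) has_derivative (\<lambda>h. gf x \<bullet> snd h)) (at z)"
    using has_derivative_compose[OF has_derivative_snd[OF has_derivative_ident, of "at z"] C11_has_derivative[OF f, of "snd z"]]
    by (simp add: z)
  show "((\<lambda>(t, x). \<theta> t * f x) has_derivative blinfun_apply ((\<lambda>(t, x). (\<theta>' t * f x) *\<^sub>R fst_blinfun +
     \<theta> t *\<^sub>R (blinfun_inner_left (gf x) o\<^sub>L snd_blinfun)) z)) (at z)"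
    unfolding case_prod_beta
    by (rule has_derivative_eq_rhs[OF has_derivative_mult[OF 1 2]])
       (auto simp: z fun_eq_iff blinfun.bilinear_simps inner_commute)
next
  have c: "continuous_on UNIV \<theta>" by (intro continuous_at_imp_continuous_on ballI DERIV_isCont[OF \<theta>(1)])
  show "continuous_on UNIV (\<lambda>(t, x). (\<theta>' t * f x) *\<^sub>R fst_blinfun + \<theta> t *\<^sub>R (blinfun_inner_left (gf x) o\<^sub>L snd_blinfun))"
    unfolding case_prod_beta
    by (intro continuous_intros continuous_on_compose2[OF \<theta>(2)] continuous_on_compose2[OF c]
        continuous_on_compose2[OF C11_continuous[OF f, of UNIV]] bounded_linear.continuous_on[OF bounded_linear_blinfun_inner_left]
        continuous_on_compose2[OF C11_continuous_gradient[OF f, of UNIV]]) auto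
next
  obtain R where R: "\<And>x. R < norm x \<Longrightarrow> f x = 0" using f by (auto simp: C11_compact_def)
  show "\<exists>S. compact S \<and> S \<subseteq> {0<..} \<times> UNIV \<and> (\<forall>z. z \<notin> S \<longrightarrow> (\<lambda>(t, x). \<theta> t * f x) z = 0)"
  proof (intro exI[of _ "{l..h} \<times> cball 0 R"] conjI allI impI)
    show "compact ({l..h} \<times> cball (0::'a) R)" by (intro compact_Times) auto
    fix z :: "real \<times> 'a" assume "z \<notin> {l..h} \<times> cball 0 R"
    thus "(\<lambda>(t, x). \<theta> t * f x) z = 0" using supp(2)[of "fst z"] R[of "snd z"] by (cases z) auto
  qed (use supp in auto)
qed

text \<open>A bound on the norms at all times, provided by the notion of solution and unrelated to
  \<open>m\<close>. It makes the velocity Lipschitz, so that the flow exists; the properties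
  collected in \<open>is_flow\<close> do not mention it.\<close>

context
  fixes B :: real
  assumes B: "\<And>t. 0 \<le> t \<Longrightarrow> Lp_norm q lborel (\<sigma> t) \<le> ennreal B" "0 < B"
begin

lemma law_riesz: "0 \<le> t \<Longrightarrow> riesz_bounded (riesz_const DIM('a) \<alpha> q' B) (law (\<sigma> t))"
  using riesz_bounded_law[OF sigma_prob B] by simp

lemma velocity_field:
  "lipschitz_field velocity (2 * C1 * riesz_const DIM('a) \<alpha> q' B) (C\<^sub>K * (1 + riesz_const DIM('a) \<alpha> q' B))"
proof
  show "norm (velocity t x - velocity t y) \<le> 2 * C1 * riesz_const DIM('a) \<alpha> q' B * norm (x - y)" for t x y
    unfolding velocity_def by (rule kconv_lipschitz[OF law_riesz]) simp
  show "norm (velocity t x) \<le> C\<^sub>K * (1 + riesz_const DIM('a) \<alpha> q' B)" for t x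
    unfolding velocity_def by (rule norm_kconv_le[OF law_riesz]) simp
  show "0 \<le> 2 * C1 * riesz_const DIM('a) \<alpha> q' B"
    using law_riesz[of 0] C1_nonneg by (simp add: riesz_bounded_def)
  show "continuous_on UNIV (\<lambda>t. velocity t x)" for x
    unfolding velocity_def
    by (intro continuous_on_compose2[OF kconv_time_continuous[of "riesz_const DIM('a) \<alpha> q' B" "\<lambda>t. law (\<sigma> t)" x]]
        law_riesz law_weakly_continuous continuous_intros) auto
qed

interpretation F: lipschitz_field velocity "2 * C1 * riesz_const DIM('a) \<alpha> q' B" "C\<^sub>K * (1 + riesz_const DIM('a) \<alpha> q' B)"
  by (rule velocity_field)

lemma velocity_continuous: "continuous_on UNIV (velocity t)"
  by (rule lipschitz_on_continuous_on[of "2 * C1 * riesz_const DIM('a) \<alpha> q' B"])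
     (use F.lip F.L_nonneg in \<open>auto intro!: lipschitz_onI simp: dist_norm\<close>)

context
  fixes f :: "'a \<Rightarrow> real" and gf
  assumes f: "C11_compact f gf"
begin

definition test_mean :: "real \<Rightarrow> real" where "test_mean t = (\<integral>x. f x \<partial>law (\<sigma> (max 0 t)))"
definition test_flux :: "real \<Rightarrow> real" where "test_flux t = (\<integral>x. gf x \<bullet> velocity t x \<partial>law (\<sigma> (max 0 t)))"

lemma bounded_gradient_velocity:
  obtains M R where "0 \<le> M" "\<And>x. norm (gf x) \<le> M" "\<And>x. R < norm x \<Longrightarrow> gf x = 0" "\<And>t x. \<bar>gf x \<bullet> velocity t x\<bar> \<le> M * (C\<^sub>K * (1 + riesz_const DIM('a) \<alpha> q' B))"
proof -
  obtain M R where M: "0 \<le> M" "\<And>x. \<bar>f x\<bar> \<le> M" "\<And>x. norm (gf x) \<le> M" "\<And>x. R < norm x \<Longrightarrow> f x = 0 \<and> gf x = 0"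
    using C11_compact_bounds[OF f] by metis
  have "\<bar>gf x \<bullet> velocity t x\<bar> \<le> M * (C\<^sub>K * (1 + riesz_const DIM('a) \<alpha> q' B))" for t x
    by (rule order_trans[OF Cauchy_Schwarz_ineq2 mult_mono]) (use M F.bd in auto)
  thus thesis using that M by blast
qed

lemma gradient_velocity_continuous: "continuous_on UNIV (\<lambda>x. gf x \<bullet> velocity t x)"
  by (intro continuous_intros C11_continuous_gradient[OF f] velocity_continuous)

lemma gradient_velocity_integrable: "0 \<le> s \<Longrightarrow> integrable (law (\<sigma> s)) (\<lambda>x. gf x \<bullet> velocity t x)"
proof -
  assume s: "0 \<le> s"
  interpret prob_space "law (\<sigma> s)" by (rule prob_space_law[OF sigma_prob[OF s]])
  obtain M R where M: "\<And>t x. \<bar>gf x \<bullet> velocity t x\<bar> \<le> M * (C\<^sub>K * (1 + riesz_const DIM('a) \<alpha> q' B))"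
    using bounded_gradient_velocity by metis
  have "(\<lambda>x. gf x \<bullet> velocity t x) \<in> borel_measurable borel"
    by (rule borel_measurable_continuous_onI[OF gradient_velocity_continuous])
  thus ?thesis using M by (intro integrable_const_bound[where B="M * (C\<^sub>K * (1 + riesz_const DIM('a) \<alpha> q' B))"]) (auto cong: measurable_cong_sets)
qed

lemma test_mean_continuous: "continuous_on UNIV test_mean"
proof -
  obtain M R where "\<And>x. \<bar>f x\<bar> \<le> M" using C11_compact_bounds[OF f] by metis
  hence "continuous_on {0..} (\<lambda>t. \<integral>x. f x \<partial>law (\<sigma> t))"
    by (intro law_weakly_continuous C11_continuous[OF f]) (auto intro!: boundedI)
  thus ?thesis unfolding test_mean_def by (rule continuous_on_compose2) (auto intro!: continuous_intros)
qed

text \<open>Measure and integrand both vary in time. The integrand is frozen at \<open>s\<close> to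
  use weak continuity, and the difference of the velocities is uniformly small on the bounded
  support of \<open>gf\<close>.\<close>

lemma test_flux_continuous: "continuous_on UNIV test_flux"
proof -
  have "continuous_on {0..} test_flux"
    unfolding continuous_on_def
  proof
    fix s :: real assume "s \<in> {0..}"
    hence s: "0 \<le> s" by simp
    obtain M R where M: "0 \<le> M" "\<And>x. norm (gf x) \<le> M" "\<And>x. R < norm x \<Longrightarrow> gf x = 0"
      "\<And>t x. \<bar>gf x \<bullet> velocity t x\<bar> \<le> M * (C\<^sub>K * (1 + riesz_const DIM('a) \<alpha> q' B))"
      using bounded_gradient_velocity by metis
    have "continuous_on {0..} (\<lambda>t. \<integral>x. gf x \<bullet> velocity s x \<partial>law (\<sigma> t))"
      using M(4) by (intro law_weakly_continuous gradient_velocity_continuous) (auto intro!: boundedI)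
    hence lim: "((\<lambda>t. \<integral>x. gf x \<bullet> velocity s x \<partial>law (\<sigma> t)) \<longlongrightarrow> test_flux s) (at s within {0..})"
      using s by (auto simp: continuous_on_def test_flux_def)
    show "(test_flux \<longlongrightarrow> test_flux s) (at s within {0..})"
    proof (rule tendstoI)
      fix e :: real assume e: "0 < e"
      define \<eta> where "\<eta> = e / (2 * (M + 1))"
      have \<eta>: "0 < \<eta>" using e M(1) by (simp add: \<eta>_def)
      have M\<eta>: "M * \<eta> \<le> e / 2"
      proof -
        have "M * \<eta> \<le> (M + 1) * \<eta>" using \<eta> by (intro mult_right_mono) auto
        also have "\<dots> = e / 2" using M(1) by (simp add: \<eta>_def field_simps)
        finally show ?thesis .
      qed
      obtain d where d: "0 < d" "\<And>r x. \<bar>r - s\<bar> < d \<Longrightarrow> x \<in> cball 0 R \<Longrightarrow> norm (velocity r x - velocity s x) \<le> \<eta>"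
        using F.field_uniform_time[OF compact_cball[of 0 R] \<eta>, of s] by blast
      have ev: "\<forall>\<^sub>F r in at s within {0..}. r \<in> {0..} \<and> dist r s < d"
        using d(1) unfolding eventually_at by auto
      have "\<forall>\<^sub>F r in at s within {0..}. dist (\<integral>x. gf x \<bullet> velocity s x \<partial>law (\<sigma> r)) (test_flux s) < e / 2"
        using e by (intro tendstoD[OF lim]) simp
      with ev show "\<forall>\<^sub>F r in at s within {0..}. dist (test_flux r) (test_flux s) < e"
      proof eventually_elim
        case (elim r)
        hence r: "0 \<le> r" by simp
        interpret prob_space "law (\<sigma> r)" by (rule prob_space_law[OF sigma_prob[OF r]])
        have "test_flux r - (\<integral>x. gf x \<bullet> velocity s x \<partial>law (\<sigma> r)) = (\<integral>x. gf x \<bullet> velocity r x - gf x \<bullet> velocity s x \<partial>law (\<sigma> r))"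
          using gradient_velocity_integrable[OF r] r by (simp add: test_flux_def)
        also have "\<bar>\<dots>\<bar> \<le> (\<integral>x. M * \<eta> \<partial>law (\<sigma> r))"
        proof (rule order_trans[OF integral_abs_bound integral_mono])
          fix x
          have "\<bar>gf x \<bullet> (velocity r x - velocity s x)\<bar> \<le> M * \<eta>"
          proof (cases "norm x \<le> R")
            case True
            show ?thesis
              by (rule order_trans[OF Cauchy_Schwarz_ineq2 mult_mono]) (use M d(2)[of r x] elim True in \<open>auto simp: dist_norm\<close>)
          qed (use M \<eta> in auto)
          thus "\<bar>gf x \<bullet> velocity r x - gf x \<bullet> velocity s x\<bar> \<le> M * \<eta>" by (simp add: inner_diff_right)
        qed (use gradient_velocity_integrable[OF r] in auto)
        also have "\<dots> \<le> e / 2" using M\<eta> by (simp add: prob_space)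
        finally have "\<bar>test_flux r - (\<integral>x. gf x \<bullet> velocity s x \<partial>law (\<sigma> r))\<bar> \<le> e / 2" .
        thus ?case using conjunct2[OF elim(1)] elim(2) unfolding dist_norm real_norm_def by linarith
      qed
    qed
  qed
  hence "continuous_on UNIV (\<lambda>t. test_flux (max 0 t))"
    by (rule continuous_on_compose2) (auto intro!: continuous_intros)
  thus ?thesis by (simp add: test_flux_def velocity_def cong: continuous_on_cong)
qed

text \<open>Product test functions show that \<open>test_flux\<close> is the distributional
  derivative of \<open>test_mean\<close> at positive times; as both are continuous, it is the
  classical one, including time 0.\<close>

lemma weak_derivative:
  assumes "0 \<le> t"
  shows "((\<lambda>t. \<integral>x. f x \<partial>law (\<sigma> t)) has_real_derivative (\<integral>x. gf x \<bullet> velocity t x \<partial>law (\<sigma> t))) (at t within {0..})"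
proof -
  have "(test_mean has_real_derivative test_flux t) (at t within {0..})"
  proof (rule derivative_from_increments[OF test_mean_continuous test_flux_continuous du_bois_reymond[OF test_mean_continuous test_flux_continuous] \<open>0 \<le> t\<close>])
    fix \<theta> \<theta>' l h
    assume \<theta>: "\<And>t. (\<theta> has_real_derivative \<theta>' t) (at t)" "continuous_on UNIV \<theta>'" "0 < l"
      "\<And>t. t \<notin> {l..h} \<Longrightarrow> \<theta> t = 0 \<and> \<theta>' t = 0"
    have "(LINT t:{0<..}|lborel. (\<integral>x. blinfun_apply ((\<lambda>(t, x). (\<theta>' t * f x) *\<^sub>R fst_blinfun +
        \<theta> t *\<^sub>R (blinfun_inner_left (gf x) o\<^sub>L snd_blinfun)) (t, x)) (1, conv K (\<sigma> t) x) * \<sigma> t x \<partial>lborel)) = 0"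
      using solution test_function_product[OF f \<theta>(1,2,3)] \<theta>(4) unfolding transport_solution_def by blast
    also have "(LINT t:{0<..}|lborel. (\<integral>x. blinfun_apply ((\<lambda>(t, x). (\<theta>' t * f x) *\<^sub>R fst_blinfun +
        \<theta> t *\<^sub>R (blinfun_inner_left (gf x) o\<^sub>L snd_blinfun)) (t, x)) (1, conv K (\<sigma> t) x) * \<sigma> t x \<partial>lborel))
       = (\<integral>t. \<theta>' t * test_mean t + \<theta> t * test_flux t \<partial>lborel)"
      unfolding set_lebesgue_integral_def
    proof (rule Bochner_Integration.integral_cong[OF refl])
      fix t :: real
      show "indicat_real {0<..} t *\<^sub>R (\<integral>x. blinfun_apply ((\<lambda>(t, x). (\<theta>' t * f x) *\<^sub>R fst_blinfun +
        \<theta> t *\<^sub>R (blinfun_inner_left (gf x) o\<^sub>L snd_blinfun)) (t, x)) (1, conv K (\<sigma> t) x) * \<sigma> t x \<partial>lborel)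
         = \<theta>' t * test_mean t + \<theta> t * test_flux t"
      proof (cases "0 < t")
        case False
        thus ?thesis using \<theta>(3) \<theta>(4)[of t] by auto
      next
        case True
        hence t: "0 \<le> t" by simp
        interpret prob_space "law (\<sigma> t)" by (rule prob_space_law[OF sigma_prob[OF t]])
        have [measurable]: "f \<in> borel_measurable borel" "(\<lambda>x. gf x \<bullet> velocity t x) \<in> borel_measurable borel"
          by (auto intro!: borel_measurable_continuous_onI gradient_velocity_continuous C11_continuous[OF f])
        obtain M where "\<And>x. \<bar>f x\<bar> \<le> M" using C11_compact_bounds[OF f] by metis
        hence i1: "integrable (law (\<sigma> t)) f"
          by (intro integrable_const_bound[where B=M]) (auto cong: measurable_cong_sets)
        have "(\<integral>x. blinfun_apply ((\<lambda>(t, x). (\<theta>' t * f x) *\<^sub>R fst_blinfun +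
          \<theta> t *\<^sub>R (blinfun_inner_left (gf x) o\<^sub>L snd_blinfun)) (t, x)) (1, conv K (\<sigma> t) x) * \<sigma> t x \<partial>lborel)
          = (\<integral>x. (\<theta>' t * f x + \<theta> t * (gf x \<bullet> velocity t x)) * \<sigma> t x \<partial>lborel)"
          using t by (intro Bochner_Integration.integral_cong refl)
            (simp add: blinfun.add_left blinfun.scaleR_left conv_eq_kconv[OF sigma_prob[OF t]] velocity_def inner_commute)
        also have "\<dots> = (\<integral>x. \<theta>' t * f x + \<theta> t * (gf x \<bullet> velocity t x) \<partial>law (\<sigma> t))"
          by (rule law_integral[OF t]) simp
        also have "\<dots> = \<theta>' t * test_mean t + \<theta> t * test_flux t"
          using i1 gradient_velocity_integrable[OF t] t by (simp add: test_mean_def test_flux_def)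
        finally show ?thesis using True by simp
      qed
    qed
    finally show "(\<integral>t. \<theta>' t * test_mean t + \<theta> t * test_flux t \<partial>lborel) = 0" .
  qed
  hence "((\<lambda>t. \<integral>x. f x \<partial>law (\<sigma> t)) has_real_derivative test_flux t) (at t within {0..})"
  proof (rule has_field_derivative_transform_within[where d=1])
    fix r :: real assume "r \<in> {0..}"
    thus "test_mean r = (\<integral>x. f x \<partial>law (\<sigma> r))" by (simp add: test_mean_def)
  qed (use assms in simp_all)
  thus ?thesis using assms by (simp add: test_flux_def)
qed

end

lemma continuity_equation_law:
  "continuity_equation velocity (2 * C1 * riesz_const DIM('a) \<alpha> q' B) (C\<^sub>K * (1 + riesz_const DIM('a) \<alpha> q' B)) (\<lambda>t. law (\<sigma> t))"
proof
  show "\<exists>c. \<forall>t\<ge>0. emeasure (law (\<sigma> t)) (cball 0 R) \<le> ennreal c" for R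
    using prob_space.emeasure_le_1[OF prob_space_law[OF sigma_prob]] by (intro exI[of _ 1]) auto
  fix G :: "'a \<Rightarrow> real" assume G: "continuous_on UNIV G" "\<exists>R. \<forall>x. R < norm x \<longrightarrow> G x = 0"
  then obtain R where R: "\<And>x. R < norm x \<Longrightarrow> G x = 0" by blast
  have "compact (G ` cball 0 R)" by (intro compact_continuous_image continuous_on_subset[OF G(1)]) auto
  then obtain M where "\<forall>y\<in>G ` cball 0 R. norm y \<le> M"
    using compact_imp_bounded[of "G ` cball 0 R"] unfolding bounded_iff by blast
  hence "\<bar>G x\<bar> \<le> max 0 M" for x using R[of x] by (cases "norm x \<le> R") (auto simp: le_max_iff_disj)
  thus "continuous_on {0..} (\<lambda>t. \<integral>x. G x \<partial>law (\<sigma> t))"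
    by (intro law_weakly_continuous G) (auto intro!: boundedI)
qed (simp_all add: weak_derivative)

text \<open>Both sides of the weak equation are constant or zero, since the velocity integrates to 0
  against every test gradient.\<close>

lemma continuity_equation_lborel:
  "continuity_equation velocity (2 * C1 * riesz_const DIM('a) \<alpha> q' B) (C\<^sub>K * (1 + riesz_const DIM('a) \<alpha> q' B)) (\<lambda>_. lborel)"
proof
  show "\<exists>c. \<forall>t\<ge>0::real. emeasure lborel (cball (0::'a) R) \<le> ennreal c" for R
    using emeasure_lborel_cball_le by blast
  fix f :: "'a \<Rightarrow> real" and gf and t :: real assume "C11_compact f gf"
  hence "(\<integral>x. gf x \<bullet> velocity t x \<partial>lborel) = 0"
    unfolding velocity_def by (intro integral_kconv_gradient_eq_0[OF law_riesz]) auto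
  thus "((\<lambda>t. \<integral>x. f x \<partial>lborel) has_real_derivative (\<integral>x. gf x \<bullet> velocity t x \<partial>lborel)) (at t within {0..})"
    by simp
qed auto

lemma flow_is_flow: "is_flow (\<lambda>t x. F.flow 0 x t)"
  unfolding is_flow_def
proof (intro conjI allI impI)
  interpret S: continuity_equation velocity "2 * C1 * riesz_const DIM('a) \<alpha> q' B" "C\<^sub>K * (1 + riesz_const DIM('a) \<alpha> q' B)" "\<lambda>t. law (\<sigma> t)"
    by (rule continuity_equation_law)
  interpret Z: continuity_equation velocity "2 * C1 * riesz_const DIM('a) \<alpha> q' B" "C\<^sub>K * (1 + riesz_const DIM('a) \<alpha> q' B)" "\<lambda>t. lborel"
    by (rule continuity_equation_lborel)
  show "continuous_on UNIV (\<lambda>(t, x). F.flow 0 x t)" by (rule F.continuous_on_flow)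
  show "F.flow 0 x 0 = x" for x by simp
  show "((\<lambda>s. F.flow 0 x s) has_vector_derivative velocity t (F.flow 0 x t)) (at t)" for t x
    using F.flow_deriv[of 0 x t] by simp
  have "continuous_on UNIV (\<lambda>t. F.flow 0 x t)" for x
    using F.flow_deriv by (intro continuous_on_vector_derivative[of UNIV _ "\<lambda>t. velocity t (F.flow 0 x t)"]) auto
  hence "continuous_on UNIV (\<lambda>t. (t, F.flow 0 x t))" for x
    by (intro continuous_on_Pair continuous_on_id)
  from continuous_on_compose2[OF F.continuous_on_field this]
  show "continuous_on UNIV (\<lambda>t. velocity t (F.flow 0 x t))" for x by simp
  show push: "law (\<sigma> t) = distr (law \<sigma>\<^sub>0) borel (\<lambda>x. F.flow 0 x t)" if "0 \<le> t" for t
    using S.flow_pushforward[OF that] by (simp add: law_initial)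
  fix t r :: real and x :: 'a assume t: "0 \<le> t" and r: "0 < r"
  let ?Y = "\<lambda>x. F.flow 0 x t"
  have sets: "?Y -` cball x r \<in> sets borel"
    using measurable_sets[OF F.flow_measurable[of 0 t], of "cball x r"] by simp
  \<comment> \<open>Volume preservation: the preimage of a ball has the volume of the ball, so the
    bound on the initial density controls its mass.\<close>
  have "emeasure lborel (cball x r) = emeasure (distr lborel borel ?Y) (cball x r)"
    using Z.flow_pushforward[OF t] by simp
  also have "\<dots> = emeasure lborel (?Y -` cball x r)" by (subst emeasure_distr) auto
  finally have vol: "emeasure lborel (?Y -` cball x r) = emeasure lborel (cball x r)" by simp
  have "emeasure (law (\<sigma> t)) (cball x r) = emeasure (law \<sigma>\<^sub>0) (?Y -` cball x r)"
    unfolding push[OF t] by (subst emeasure_distr) (auto simp: law_def)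
  also have "\<dots> \<le> ennreal (growth_const DIM('a) q' m * r powr growth_exponent DIM('a) q')"
    by (rule law_ball_growth[OF initial m conjugate one_less_q sets vol r])
  finally show "emeasure (law (\<sigma> t)) (cball x r) \<le> ennreal (growth_const DIM('a) q' m * r powr growth_exponent DIM('a) q')" .
qed

end

theorem flow_exists: "\<exists>Y. is_flow Y"
proof -
  obtain B0 where B0: "\<And>t. 0 \<le> t \<Longrightarrow> Lp_norm q lborel (\<sigma> t) \<le> ennreal B0"
    using solution by (auto simp: transport_solution_def)
  have "Lp_norm q lborel (\<sigma> t) \<le> ennreal (max 1 B0)" if "0 \<le> t" for t
    by (rule order_trans[OF B0[OF that] ennreal_leI]) simp
  moreover have "0 < max 1 B0" by (rule less_le_trans[of 0 1]) auto
  ultimately show ?thesis using flow_is_flow[of "max 1 B0"] by blast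
qed

text \<open>The argument of \<open>riesz_bounded_law\<close> with the growth bound of the flow, so
  that the initial norm bound \<open>m\<close> replaces the bound on all norms.\<close>

lemma riesz_bounded_sigma:
  assumes "is_flow Y" "0 \<le> t"
  shows "riesz_bounded (riesz_const DIM('a) \<alpha> q' m) (law (\<sigma> t))"
  unfolding riesz_bounded_def
proof (intro conjI allI prob_space_law[OF sigma_prob[OF assms(2)]] sets_law)
  have pos: "0 < dyadic_const (\<alpha> + 1) (growth_exponent DIM('a) q')"
    by (rule dyadic_const_pos[OF riesz_exponent_less_growth])
  show "0 \<le> riesz_const DIM('a) \<alpha> q' m"
    using pos growth_const_nonneg[of m] m by (simp add: riesz_const_def)
  fix x :: 'a
  show "(\<integral>\<^sup>+y. ennreal (\<kappa> (x - y)) \<partial>law (\<sigma> t)) \<le> ennreal (riesz_const DIM('a) \<alpha> q' m)"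
    unfolding riesz_const_def
  proof (rule nn_integral_riesz_le[OF prob_space_law[OF sigma_prob[OF assms(2)]] sets_law _ riesz_exponent_less_growth])
    fix r :: real assume r: "0 < r"
    have "emeasure (law (\<sigma> t)) (cball x r - {x}) \<le> emeasure (law (\<sigma> t)) (cball x r)"
      by (intro emeasure_mono) auto
    also have "\<dots> \<le> ennreal (growth_const DIM('a) q' m * r powr growth_exponent DIM('a) q')"
      using assms r unfolding is_flow_def by blast
    finally show "emeasure (law (\<sigma> t)) (cball x r - {x}) \<le> ennreal (growth_const DIM('a) q' m * r powr growth_exponent DIM('a) q')" .
  qed (use alpha_nonneg growth_const_nonneg[of m] m in auto)
qed

end

section \<open>The particle system\<close>

instance bcontfun :: (metric_space, banach) banach ..

text \<open>Bounded functions on \<^typ>\<open>nat discrete\<close> serve as the Banach space of configurations, so that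
  the number of particles need not be reflected in a type.\<close>

definition coord :: "(nat discrete \<Rightarrow>\<^sub>C 'b::real_normed_vector) \<Rightarrow> nat \<Rightarrow> 'b" where
  "coord z i = apply_bcontfun z (discrete i)"

definition tuple :: "nat \<Rightarrow> (nat \<Rightarrow> 'b) \<Rightarrow> (nat discrete \<Rightarrow>\<^sub>C 'b::real_normed_vector)" where
  "tuple N f = Bcontfun (\<lambda>i. if of_discrete i < N then f (of_discrete i) else 0)"

lemma bounded_linear_coord: "bounded_linear (\<lambda>z. coord z i)"
  unfolding coord_def
  by (rule bounded_linear_intro[of _ 1]) (auto simp: plus_bcontfun.rep_eq scaleR_bcontfun.rep_eq norm_bounded)

lemma coord_diff: "coord (z - w) i = coord z i - coord w i"
  by (simp add: coord_def minus_bcontfun.rep_eq)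

lemma norm_coord_le: "norm (coord z i) \<le> norm z"
  unfolding coord_def by (rule norm_bounded)

lemma norm_le_coord: "(\<And>i. norm (coord z i) \<le> b) \<Longrightarrow> norm z \<le> b"
  unfolding coord_def by (rule norm_bound) (metis of_discrete_inverse)

lemma coord_tuple: "coord (tuple N f) i = (if i < N then f i else 0)"
proof -
  have "(\<lambda>i. if of_discrete i < N then f (of_discrete i) else 0) \<in> bcontfun"
  proof (rule bcontfun_normI)
    show "continuous_on UNIV (\<lambda>i. if of_discrete i < N then f (of_discrete i) else 0)"
      by (simp add: continuous_on_open_vimage open_discrete)
    show "norm (if of_discrete i < N then f (of_discrete i) else 0) \<le> (\<Sum>j<N. norm (f j))" for i
      by (auto intro!: member_le_sum sum_nonneg)
  qed
  thus ?thesis by (simp add: coord_def tuple_def Bcontfun_inverse discrete_inverse)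
qed

lemma norm_fst_le_norm: "norm (fst p) \<le> norm p" and norm_snd_le_norm: "norm (snd p) \<le> norm p"
  by (cases p; simp add: norm_fst_le norm_snd_le)+

context kernel
begin

definition force :: "nat \<Rightarrow> (nat \<Rightarrow> 'a) \<Rightarrow> nat \<Rightarrow> 'a" where
  "force N x i = (1 / real N) *\<^sub>R (\<Sum>j<N. K0 (x i - x j))"

lemma force_eq:
  assumes "i < N" "\<And>j. j < N \<Longrightarrow> j \<noteq> i \<Longrightarrow> x i \<noteq> x j"
  shows "force N x i = (1 / real N) *\<^sub>R (\<Sum>j\<in>{..<N} - {i}. K (x i - x j))"
proof -
  have "(\<Sum>j<N. K0 (x i - x j)) = (\<Sum>j\<in>{..<N} - {i}. K0 (x i - x j))"
    by (rule sum.mono_neutral_right) auto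
  also have "\<dots> = (\<Sum>j\<in>{..<N} - {i}. K (x i - x j))"
    using assms by (intro sum.cong) (auto simp: K0_def)
  finally show ?thesis by (simp add: force_def)
qed

text \<open>The existence time \<delta> depends on the configuration only through its separation
  \<open>c\<close> and velocity bound \<open>M\<close>. Positions are projected to balls of radius
  \<open>c / 4\<close> around their initial values and velocities to a ball of radius
  \<open>M + 1\<close>. The modified field is bounded and Lipschitz, and up to time \<delta> its
  solution stays where the projections are the identity.\<close>

lemma local_particle_solution:
  assumes N: "0 < N" and lam: "0 < lam" and c: "0 < c" and M: "0 \<le> M"
  shows "\<exists>\<delta>>0. \<forall>x v. (\<forall>i<N. \<forall>j<N. i \<noteq> j \<longrightarrow> c \<le> dist (x i) (x j)) \<longrightarrow> (\<forall>i<N. norm (v i) \<le> M) \<longrightarrow>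
     (\<exists>Z W. (\<forall>i<N. Z i 0 = x i \<and> W i 0 = v i) \<and>
        (\<forall>t. 0 \<le> t \<and> t \<le> \<delta> \<longrightarrow> \<not> collision N Z t \<and>
           (\<forall>i<N. (Z i has_vector_derivative W i t) (at t) \<and>
             (W i has_vector_derivative lam *\<^sub>R (- W i t + force N (\<lambda>j. Z j t) i)) (at t))))"
proof -
  \<comment> \<open>Bound on \<kappa> at distances of at least \<open>c / 2\<close>, the separation
    left after two positions have moved by \<open>c / 4\<close> each.\<close>
  define k where "k = (c / 2) powr - (\<alpha> + 1)"
  define B where "B = (M + 1) + lam * ((M + 1) + C\<^sub>K * (1 + k))"
  define L where "L = 1 + lam + lam * (4 * C1 * k)"
  \<comment> \<open>With speed at most \<open>B\<close>, positions move by at most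
    \<open>c / 4\<close> and velocities change by at most 1 up to this time.\<close>
  define \<delta> where "\<delta> = min (c / 4) 1 / (B + 1)"
  have k: "0 \<le> k" by (simp add: k_def)
  have B: "0 \<le> B" using M lam CK_nonneg k by (simp add: B_def)
  have L: "0 \<le> L" using lam C1_nonneg k by (simp add: L_def)
  have \<delta>: "0 < \<delta>" using c B by (simp add: \<delta>_def)
  have B\<delta>: "B * t \<le> c / 4" "B * t \<le> 1" if "0 \<le> t" "t \<le> \<delta>" for t
  proof -
    have "B * t \<le> (B + 1) * \<delta>" using B that by (intro mult_mono) auto
    also have "\<dots> = min (c / 4) 1" using B by (simp add: \<delta>_def)
    finally show "B * t \<le> c / 4" "B * t \<le> 1" by auto
  qed
  show ?thesis
  proof (intro exI[of _ \<delta>] conjI \<delta> allI impI)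
    fix x v :: "nat \<Rightarrow> 'a"
    assume x: "\<forall>i<N. \<forall>j<N. i \<noteq> j \<longrightarrow> c \<le> dist (x i) (x j)" and v: "\<forall>i<N. norm (v i) \<le> M"
    define P where "P i = closest_point (cball (x i) (c / 4))" for i
    define Q where "Q = closest_point (cball (0::'a) (M + 1))"
    have P: "dist (x i) (P i y) \<le> c / 4" "norm (P i y - P i y') \<le> norm (y - y')"
      "dist (x i) y \<le> c / 4 \<Longrightarrow> P i y = y" for i y y'
    proof -
      have "P i y \<in> cball (x i) (c / 4)"
        unfolding P_def using c by (intro closest_point_in_set) auto
      thus "dist (x i) (P i y) \<le> c / 4" by simp
      show "norm (P i y - P i y') \<le> norm (y - y')"
        using closest_point_lipschitz[of "cball (x i) (c / 4)" y y'] c by (simp add: P_def dist_norm)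
      show "dist (x i) y \<le> c / 4 \<Longrightarrow> P i y = y" unfolding P_def by (intro closest_point_self) simp
    qed
    have Q: "norm (Q y) \<le> M + 1" "norm (Q y - Q y') \<le> norm (y - y')" "norm y \<le> M + 1 \<Longrightarrow> Q y = y" for y y'
    proof -
      have "Q y \<in> cball 0 (M + 1)" unfolding Q_def using M by (intro closest_point_in_set) auto
      thus "norm (Q y) \<le> M + 1" by simp
      show "norm (Q y - Q y') \<le> norm (y - y')"
        using closest_point_lipschitz[of "cball (0::'a) (M + 1)" y y'] M by (simp add: Q_def dist_norm)
      show "norm y \<le> M + 1 \<Longrightarrow> Q y = y" unfolding Q_def by (intro closest_point_self) simp
    qed
    have far: "c / 2 \<le> norm (P i y - P j y')" if "i < N" "j < N" "i \<noteq> j" for i j y y'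
    proof -
      have "c \<le> dist (x i) (x j)" using x that by blast
      also have "\<dots> \<le> dist (x i) (P i y) + dist (P i y) (P j y') + dist (P j y') (x j)"
        using dist_triangle[of "x i" "x j" "P i y"] dist_triangle[of "P i y" "x j" "P j y'"] by linarith
      finally show ?thesis using P(1)[of i y] P(1)[of j y'] by (simp add: dist_norm norm_minus_commute)
    qed
    have \<kappa>_le: "\<kappa> y \<le> k" if "c / 2 \<le> norm y" for y
      unfolding k_def using that c alpha_nonneg by (intro riesz_antimono) auto
    define h where "h i j z = (if i = j then 0 else K0 (P i (fst (z i)) - P j (fst (z j))))" for i j and z :: "nat \<Rightarrow> 'a \<times> 'a"
    define G where "G z i = (Q (snd (z i)), lam *\<^sub>R (- Q (snd (z i)) + (1 / real N) *\<^sub>R (\<Sum>j<N. h i j z)))" for z i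
    define F where "F z = tuple N (G (coord z))" for z
    have F: "coord (F z) i = (if i < N then G (coord z) i else 0)" for z i
      unfolding F_def by (simp add: coord_tuple)
    have h_le: "norm (h i j z) \<le> C\<^sub>K * (1 + k)" if "i < N" "j < N" for i j z
    proof (cases "i = j")
      case False
      have "norm (h i j z) \<le> C\<^sub>K * (1 + \<kappa> (P i (fst (z i)) - P j (fst (z j))))"
        using norm_K0_le' False by (simp add: h_def)
      also have "\<dots> \<le> C\<^sub>K * (1 + k)"
        using False that by (intro mult_left_mono add_left_mono \<kappa>_le far CK_nonneg) auto
      finally show ?thesis .
    qed (use CK_nonneg k in \<open>simp add: h_def\<close>)
    have avg: "norm ((1 / real N) *\<^sub>R (\<Sum>j<N. g j)) \<le> e" if "\<And>j. j < N \<Longrightarrow> norm (g j) \<le> e" for g :: "nat \<Rightarrow> 'a" and e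
    proof -
      have "norm (\<Sum>j<N. g j) \<le> (\<Sum>j<N. e)" using that by (intro order_trans[OF norm_sum] sum_mono) auto
      thus ?thesis using N by (simp add: divide_le_eq mult.commute)
    qed
    have G_le: "norm (G z i) \<le> B" if "i < N" for z i
    proof -
      have "norm (- Q (snd (z i)) + (1 / real N) *\<^sub>R (\<Sum>j<N. h i j z)) \<le> (M + 1) + C\<^sub>K * (1 + k)"
        using Q(1)[of "snd (z i)"] avg[of "\<lambda>j. h i j z" "C\<^sub>K * (1 + k)"] h_le[OF that]
        by (intro norm_triangle_mono) auto
      hence "norm (lam *\<^sub>R (- Q (snd (z i)) + (1 / real N) *\<^sub>R (\<Sum>j<N. h i j z))) \<le> lam * ((M + 1) + C\<^sub>K * (1 + k))"
        using lam by simp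
      thus ?thesis unfolding G_def B_def
        using norm_Pair_le[of "Q (snd (z i))"] Q(1)[of "snd (z i)"] by (smt (verit))
    qed
    have G_lip: "norm (G z i - G z' i) \<le> L * e"
      if i: "i < N" and e: "\<And>j. norm (z j - z' j) \<le> e" for z z' i e
    proof -
      have e': "norm (fst (z j) - fst (z' j)) \<le> e" "norm (snd (z j) - snd (z' j)) \<le> e" for j
        using order_trans[OF norm_fst_le_norm e[of j]] order_trans[OF norm_snd_le_norm e[of j]] by auto
      have "0 \<le> e" using order_trans[OF norm_ge_zero e[of 0]] .
      \<comment> \<open>Each of the two positions differs by at most \<open>e\<close> and each value
        of \<kappa> is at most \<open>k\<close>, whence
        \<open>C1 * (2 * e) * (k + k)\<close>.\<close>
      have hd: "norm (h i j z - h i j z') \<le> 4 * C1 * k * e" if j: "j < N" for j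
      proof (cases "i = j")
        case False
        define a where "a = P i (fst (z i)) - P j (fst (z j))"
        define b where "b = P i (fst (z' i)) - P j (fst (z' j))"
        have "norm (a - b) \<le> norm (P i (fst (z i)) - P i (fst (z' i))) + norm (P j (fst (z j)) - P j (fst (z' j)))"
          unfolding a_def b_def
          using norm_triangle_ineq4[of "P i (fst (z i)) - P i (fst (z' i))" "P j (fst (z j)) - P j (fst (z' j))"]
          by (simp add: algebra_simps)
        also have "\<dots> \<le> e + e" by (intro add_mono order_trans[OF P(2)] e')
        finally have ab: "norm (a - b) \<le> 2 * e" by simp
        have "\<kappa> a \<le> k" "\<kappa> b \<le> k" unfolding a_def b_def using far[OF i j False] by (auto intro: \<kappa>_le)
        hence "C1 * norm (a - b) * (\<kappa> a + \<kappa> b) \<le> C1 * (2 * e) * (k + k)"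
          using ab C1_nonneg \<open>0 \<le> e\<close> by (intro mult_mono add_mono) auto
        moreover have "h i j z - h i j z' = K0 a - K0 b" using False by (simp add: h_def a_def b_def)
        moreover have "C1 * (2 * e) * (k + k) = 4 * C1 * k * e" by simp
        ultimately show ?thesis using K0_diff_le[of a b] by (metis order_trans)
      qed (use C1_nonneg k \<open>0 \<le> e\<close> in \<open>simp add: h_def\<close>)
      define q where "q = Q (snd (z i)) - Q (snd (z' i))"
      have q: "norm q \<le> e" unfolding q_def by (rule order_trans[OF Q(2) e'(2)])
      define w where "w = (1 / real N) *\<^sub>R (\<Sum>j<N. h i j z - h i j z')"
      have w: "norm w \<le> 4 * C1 * k * e" unfolding w_def by (rule avg[OF hd])
      have "G z i - G z' i = (q, lam *\<^sub>R (- q + w))"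
        by (simp add: G_def q_def w_def sum_subtractf algebra_simps)
      moreover have "norm (lam *\<^sub>R (- q + w)) \<le> lam * (e + 4 * C1 * k * e)"
        using norm_triangle_mono[of "- q" e w "4 * C1 * k * e"] q w lam by simp
      ultimately have "norm (G z i - G z' i) \<le> e + lam * (e + 4 * C1 * k * e)"
        using norm_Pair_le[of q "lam *\<^sub>R (- q + w)"] q by simp
      thus ?thesis by (simp add: L_def algebra_simps)
    qed
    define z0 where "z0 = tuple N (\<lambda>i. (x i, v i))"
    have z0: "coord z0 i = (x i, v i)" if "i < N" for i
      unfolding z0_def using that by (simp add: coord_tuple)
    have "\<exists>z. z 0 = z0 \<and> (\<forall>t. (z has_vector_derivative F (z t)) (at t))"
    proof (rule picard_lindelof[of "\<lambda>_. F" L B])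
      fix z z' :: "nat discrete \<Rightarrow>\<^sub>C ('a \<times> 'a)"
      have e: "norm (coord z j - coord z' j) \<le> norm (z - z')" for j
        using norm_coord_le[of "z - z'" j] by (simp add: coord_diff)
      show "norm (F z - F z') \<le> L * norm (z - z')"
      proof (rule norm_le_coord)
        fix i
        show "norm (coord (F z - F z') i) \<le> L * norm (z - z')"
          using G_lip[OF _ e, of i] L by (simp add: coord_diff F)
      qed
      show "norm (F z) \<le> B"
      proof (rule norm_le_coord)
        fix i show "norm (coord (F z) i) \<le> B" using G_le[of i] B by (simp add: F)
      qed
    qed (use L in auto)
    then obtain z where zi: "z 0 = z0" and z: "\<And>t. (z has_vector_derivative F (z t)) (at t)" by blast
    have zc: "((\<lambda>t. coord (z t) i) has_vector_derivative G (coord (z t)) i) (at t)" if "i < N" for i t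
      using bounded_linear.has_vector_derivative[OF bounded_linear_coord z, of i t] that by (simp add: F)
    define Z where "Z i t = fst (coord (z t) i)" for i t
    define W where "W i t = snd (coord (z t) i)" for i t
    have Zd: "(Z i has_vector_derivative fst (G (coord (z t)) i)) (at t)"
      and Wd: "(W i has_vector_derivative snd (G (coord (z t)) i)) (at t)" if "i < N" for i t
      unfolding Z_def[abs_def] W_def[abs_def]
      using bounded_linear.has_vector_derivative[OF bounded_linear_fst zc[OF that]]
        bounded_linear.has_vector_derivative[OF bounded_linear_snd zc[OF that]] by auto
    have stay: "norm (coord (z t) i - (x i, v i)) \<le> B * t" if "0 \<le> t" "i < N" for t i
    proof -
      have "norm (coord (z t) i - coord (z 0) i) \<le> B * (t - 0)"
        by (rule norm_vector_deriv_bound[OF that(1) has_vector_derivative_at_within[OF zc[OF that(2)]] G_le[OF that(2)]])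
      thus ?thesis using z0[OF that(2)] zi by simp
    qed
    have near: "dist (x i) (Z i t) \<le> c / 4" "norm (W i t) \<le> M + 1" if t: "0 \<le> t" "t \<le> \<delta>" and i: "i < N" for i t
    proof -
      have "norm (fst (coord (z t) i - (x i, v i))) \<le> B * t"
        using order_trans[OF norm_fst_le_norm stay[OF t(1) i]] .
      thus "dist (x i) (Z i t) \<le> c / 4" using B\<delta>(1)[OF t] by (simp add: Z_def dist_norm norm_minus_commute)
      have "norm (snd (coord (z t) i - (x i, v i))) \<le> B * t"
        using order_trans[OF norm_snd_le_norm stay[OF t(1) i]] .
      thus "norm (W i t) \<le> M + 1"
        using B\<delta>(2)[OF t] v i norm_triangle_ineq2[of "W i t" "v i"] by (fastforce simp: W_def)
    qed
    show "\<exists>Z W. (\<forall>i<N. Z i 0 = x i \<and> W i 0 = v i) \<and>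
        (\<forall>t. 0 \<le> t \<and> t \<le> \<delta> \<longrightarrow> \<not> collision N Z t \<and>
           (\<forall>i<N. (Z i has_vector_derivative W i t) (at t) \<and>
             (W i has_vector_derivative lam *\<^sub>R (- W i t + force N (\<lambda>j. Z j t) i)) (at t)))"
    proof (rule exI[of _ Z], rule exI[of _ W], intro conjI allI impI)
      show "Z i 0 = x i" "W i 0 = v i" if "i < N" for i using z0[OF that] zi by (auto simp: Z_def W_def)
      fix t assume "0 \<le> t \<and> t \<le> \<delta>"
      hence t: "0 \<le> t" "t \<le> \<delta>" by auto
      have PZ: "P i (Z i t) = Z i t" and QW: "Q (W i t) = W i t" if "i < N" for i
        using P(3) Q(3) near[OF t that] by auto
      show "\<not> collision N Z t"
        unfolding collision_def
      proof (intro notI, elim exE conjE)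
        fix i j assume ij: "i < N" "j < N" "i \<noteq> j" "Z i t = Z j t"
        have "c / 2 \<le> norm (P i (Z i t) - P j (Z j t))" by (rule far[OF ij(1-3)])
        thus False unfolding PZ[OF ij(1)] PZ[OF ij(2)] using ij(4) c by simp
      qed
      fix i assume i: "i < N"
      have G: "G (coord (z t)) i = (W i t, lam *\<^sub>R (- W i t + force N (\<lambda>j. Z j t) i))"
      proof -
        have "h i j (coord (z t)) = K0 (Z i t - Z j t)" if "j < N" for j
          using PZ[OF i] PZ[OF that] by (simp add: h_def Z_def)
        hence "(\<Sum>j<N. h i j (coord (z t))) = (\<Sum>j<N. K0 (Z i t - Z j t))" by (intro sum.cong) auto
        thus ?thesis using QW[OF i] by (simp add: G_def force_def W_def)
      qed
      show "(Z i has_vector_derivative W i t) (at t)" using Zd[OF i, of t] by (simp add: G)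
      show "(W i has_vector_derivative lam *\<^sub>R (- W i t + force N (\<lambda>j. Z j t) i)) (at t)"
        using Wd[OF i, of t] by (simp add: G)
    qed
  qed
qed

text \<open>If the lifetime ended by \<open>T\<close>, the solution could be restarted shortly
  before the end: the uniform bounds give a local existence time \<delta> independent of the restart
  time, and the glued solution would outlive the maximal one.\<close>

lemma maximal_solution_extends:
  assumes max: "maximal_particle_solution K lam N X\<^sub>0 V\<^sub>0 \<tau> X V"
    and N: "0 < N" and lam: "0 < lam" and c: "0 < c" and T: "0 \<le> T"
    and init: "\<And>i j. i < N \<Longrightarrow> j < N \<Longrightarrow> i \<noteq> j \<Longrightarrow> c \<le> dist (X\<^sub>0 i) (X\<^sub>0 j)" "\<And>i. i < N \<Longrightarrow> norm (V\<^sub>0 i) \<le> M"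
    and bounds: "\<And>t i j. 0 \<le> t \<Longrightarrow> ereal t < \<tau> \<Longrightarrow> t \<le> T \<Longrightarrow> i < N \<Longrightarrow> j < N \<Longrightarrow> i \<noteq> j \<Longrightarrow> c \<le> dist (X i t) (X j t)"
      "\<And>t i. 0 \<le> t \<Longrightarrow> ereal t < \<tau> \<Longrightarrow> t \<le> T \<Longrightarrow> i < N \<Longrightarrow> norm (V i t) \<le> M"
  shows "ereal T < \<tau>"
proof (rule ccontr)
  assume "\<not> ereal T < \<tau>"
  hence le: "\<tau> \<le> ereal T" by simp
  have sol: "particle_solution K lam N X\<^sub>0 V\<^sub>0 \<tau> X V"
    and maximal: "\<And>\<tau>' X' V'. particle_solution K lam N X\<^sub>0 V\<^sub>0 \<tau>' X' V' \<Longrightarrow> \<tau>' \<le> \<tau>"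
    using max by (auto simp: maximal_particle_solution_def)
  have X0: "X i 0 = X\<^sub>0 i" "V i 0 = V\<^sub>0 i" if "i < N" for i
    using sol that by (auto simp: particle_solution_def)
  \<comment> \<open>With lifetime 0 the equations are void, so such a solution always exists and
    \<open>\<tau>\<close> is nonnegative.\<close>
  have "particle_solution K lam N X\<^sub>0 V\<^sub>0 (ereal 0) X V"
    using X0 by (auto simp: particle_solution_def)
  hence "0 \<le> \<tau>" using maximal by (metis zero_ereal_def)
  then obtain T1 where T1: "\<tau> = ereal T1" "0 \<le> T1" "T1 \<le> T"
    using le by (cases \<tau>) auto
  have M: "0 \<le> M" using order_trans[OF norm_ge_zero init(2)[OF N]] .
  define good where "good \<delta> x v Z W \<longleftrightarrow> (\<forall>i<N. Z i 0 = x i \<and> W i 0 = v i) \<and>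
        (\<forall>t. 0 \<le> t \<and> t \<le> \<delta> \<longrightarrow> \<not> collision N Z t \<and>
           (\<forall>i<N. (Z i has_vector_derivative W i t) (at t) \<and>
             (W i has_vector_derivative lam *\<^sub>R (- W i t + force N (\<lambda>j. Z j t) i)) (at t)))"
    for \<delta> x v Z W
  obtain \<delta> where \<delta>: "0 < \<delta>" and loc: "\<And>x v. (\<forall>i<N. \<forall>j<N. i \<noteq> j \<longrightarrow> c \<le> dist (x i) (x j)) \<Longrightarrow>
      (\<forall>i<N. norm (v i) \<le> M) \<Longrightarrow> \<exists>Z W. good \<delta> x v Z W"
    using local_particle_solution[OF N lam c M, folded good_def] by blast
  \<comment> \<open>Restart time, less than \<delta> before the end. If the lifetime is at most
    \<open>\<delta> / 2\<close>, in particular if it is 0, the restart happens at the initial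
    time.\<close>
  define t1 where "t1 = max 0 (T1 - \<delta> / 2)"
  have t1: "0 \<le> t1" "T1 < t1 + \<delta>" "t1 = 0 \<or> t1 < T1" using \<delta> T1 by (auto simp: t1_def)
  have "\<forall>i<N. \<forall>j<N. i \<noteq> j \<longrightarrow> c \<le> dist (X i t1) (X j t1)" "\<forall>i<N. norm (V i t1) \<le> M"
  proof -
    have "c \<le> dist (X i t1) (X j t1)" if "i < N" "j < N" "i \<noteq> j" for i j
      using t1(3)
    proof
      assume "t1 = 0" thus ?thesis using init(1)[OF that] X0(1)[OF that(1)] X0(1)[OF that(2)] by simp
    next
      assume "t1 < T1" thus ?thesis using T1 t1(1) by (intro bounds(1) that) auto
    qed
    moreover have "norm (V i t1) \<le> M" if "i < N" for i
      using t1(3)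
    proof
      assume "t1 = 0" thus ?thesis using init(2)[OF that] X0(2)[OF that] by simp
    next
      assume "t1 < T1" thus ?thesis using T1 t1(1) by (intro bounds(2) that) auto
    qed
    ultimately show "\<forall>i<N. \<forall>j<N. i \<noteq> j \<longrightarrow> c \<le> dist (X i t1) (X j t1)" "\<forall>i<N. norm (V i t1) \<le> M" by blast+
  qed
  from loc[OF this] obtain Z W where "good \<delta> (\<lambda>i. X i t1) (\<lambda>i. V i t1) Z W" by blast
  hence Z0: "\<And>i. i < N \<Longrightarrow> Z i 0 = X i t1 \<and> W i 0 = V i t1"
    and ZW: "\<And>t. 0 \<le> t \<Longrightarrow> t \<le> \<delta> \<Longrightarrow> \<not> collision N Z t \<and>
           (\<forall>i<N. (Z i has_vector_derivative W i t) (at t) \<and>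
             (W i has_vector_derivative lam *\<^sub>R (- W i t + force N (\<lambda>j. Z j t) i)) (at t))"
    unfolding good_def by simp_all
  define S where "S = {0..<t1}"
  define R where "R = {t1..<t1 + \<delta>}"
  define X' where "X' i t = (if t \<in> S then X i t else Z i (t - t1))" for i t
  define V' where "V' i t = (if t \<in> S then V i t else W i (t - t1))" for i t
  have SR: "S \<union> R = {s. 0 \<le> s \<and> ereal s < ereal (t1 + \<delta>)}" using t1 \<delta> by (auto simp: S_def R_def)
  have cl: "closure S \<inter> closure R \<subseteq> {t1}" "closure S \<noteq> {} \<longrightarrow> 0 < t1"
    using \<delta> t1(1) by (cases "t1 = 0"; auto simp: S_def R_def)+
  have frc: "force N (\<lambda>j. X' j t) i = (1 / real N) *\<^sub>R (\<Sum>j\<in>{..<N} - {i}. K (X' i t - X' j t))"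
    if "i < N" "\<not> collision N X' t" for i t
    using that by (intro force_eq) (auto simp: collision_def)
  have old: "\<not> collision N X t \<and> (\<forall>i<N. (X i has_vector_derivative V i t) (at t within {0..<T1}) \<and>
      (V i has_vector_derivative lam *\<^sub>R (- V i t + force N (\<lambda>j. X j t) i)) (at t within {0..<T1}))"
    if t: "0 \<le> t" "t < T1" for t
  proof -
    have set: "{s. 0 \<le> s \<and> ereal s < \<tau>} = {0..<T1}" using T1 by auto
    have nc: "\<not> collision N X t"
      using conjunct2[OF sol[unfolded particle_solution_def]] t T1(1) by simp
    hence f: "force N (\<lambda>j. X j t) i = (1 / real N) *\<^sub>R (\<Sum>j\<in>{..<N} - {i}. K (X i t - X j t))" if "i < N" for i
      using that by (intro force_eq) (auto simp: collision_def)
    have a: "0 \<le> t \<and> ereal t < \<tau>" using t T1 by simp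
    have d: "\<forall>i<N. (X i has_vector_derivative V i t) (at t within {0..<T1}) \<and>
       (V i has_vector_derivative lam *\<^sub>R (- V i t + (1 / real N) *\<^sub>R (\<Sum>j\<in>{..<N} - {i}. K (X i t - X j t)))) (at t within {0..<T1})"
      by (rule conjunct2[OF mp[OF spec[OF conjunct2[OF sol[unfolded particle_solution_def set]]] a]])
    show ?thesis
    proof (intro conjI nc allI impI)
      fix i assume i: "i < N"
      show "(X i has_vector_derivative V i t) (at t within {0..<T1})" using d i by blast
      show "(V i has_vector_derivative lam *\<^sub>R (- V i t + force N (\<lambda>j. X j t) i)) (at t within {0..<T1})"
        unfolding f[OF i] using d i by blast
    qed
  qed
  have inS: "closure S \<inter> closure R \<union> S \<subseteq> {0..<T1}" if "S \<union> (closure S \<inter> closure R) \<noteq> {}"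
  proof -
    have "S \<noteq> {}"
    proof
      assume "S = {}"
      with that show False by simp
    qed
    hence "0 < t1" by (simp add: S_def)
    hence "t1 < T1" using t1(3) by simp
    hence "S \<subseteq> {0..<T1}" "{t1} \<subseteq> {0..<T1}" using t1(1) by (auto simp: S_def)
    thus ?thesis using cl(1) by blast
  qed
  \<comment> \<open>At a positive \<open>t1\<close> both values and derivatives of the pieces agree,
    which glues positions and velocities alike; at \<open>t1 = 0\<close> the first piece is
    empty.\<close>
  have join: "((\<lambda>t. if t \<in> S then f t else g (t - t1)) has_vector_derivative (if t \<in> S then f' t else g' (t - t1))) (at t within S \<union> R)"
    if t: "t \<in> S \<union> R" and f: "\<And>t. 0 \<le> t \<Longrightarrow> t < T1 \<Longrightarrow> (f has_vector_derivative f' t) (at t within {0..<T1})"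
      and g: "\<And>t. 0 \<le> t \<Longrightarrow> t \<le> \<delta> \<Longrightarrow> (g has_vector_derivative g' t) (at t)"
      and eq: "f t1 = g 0" "0 < t1 \<Longrightarrow> f' t1 = g' 0" for t and f g f' g' :: "real \<Rightarrow> 'a"
  proof (rule has_vector_derivative_If_within_closures[OF t refl])
    assume t': "t \<in> S \<union> (closure S \<inter> closure R)"
    hence "t \<in> {0..<T1}" using inS by blast
    thus "(f has_vector_derivative f' t) (at t within S \<union> (closure S \<inter> closure R))"
    proof (intro has_vector_derivative_within_subset[OF f])
      show "S \<union> (closure S \<inter> closure R) \<subseteq> {0..<T1}" using inS t' by blast
    qed auto
  next
    assume "t \<in> R \<union> (closure S \<inter> closure R)"
    hence "t1 \<le> t" "t \<le> t1 + \<delta>" using cl \<delta> by (auto simp: R_def)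
    hence "(g has_vector_derivative g' (t - t1)) (at (t - t1))" by (intro g) auto
    hence "((\<lambda>t. g (t - t1)) has_vector_derivative g' (t - t1)) (at t)"
    proof -
      have "((\<lambda>t. t - t1) has_vector_derivative 1) (at t)"
        unfolding has_real_derivative_iff_has_vector_derivative[symmetric] by (auto intro!: derivative_eq_intros)
      from vector_diff_chain_at[OF this \<open>(g has_vector_derivative g' (t - t1)) (at (t - t1))\<close>]
      show ?thesis by (simp add: o_def)
    qed
    thus "((\<lambda>t. g (t - t1)) has_vector_derivative g' (t - t1)) (at t within R \<union> (closure S \<inter> closure R))"
      by (rule has_vector_derivative_at_within)
  next
    assume "t \<in> closure S" "t \<in> closure R"
    hence "t = t1" "0 < t1" using cl by auto
    thus "f t = g (t - t1)" "f' t = g' (t - t1)" using eq by auto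
  qed
  have "particle_solution K lam N X\<^sub>0 V\<^sub>0 (ereal (t1 + \<delta>)) X' V'"
    unfolding particle_solution_def SR[symmetric]
  proof (intro conjI allI impI)
    show "X' i 0 = X\<^sub>0 i" "V' i 0 = V\<^sub>0 i" if "i < N" for i
      using t1 Z0[OF that] X0[OF that] by (auto simp: X'_def V'_def S_def not_less)
    fix t assume "0 \<le> t \<and> ereal t < ereal (t1 + \<delta>)"
    hence t: "t \<in> S \<union> R" unfolding SR by simp
    show nc: "\<not> collision N X' t"
    proof (cases "t \<in> S")
      case True
      hence "0 \<le> t" "t < T1" using t1 by (auto simp: S_def)
      thus ?thesis using old[of t] True by (auto simp: collision_def X'_def)
    next
      case False
      hence "0 \<le> t - t1" "t - t1 \<le> \<delta>" using t by (auto simp: R_def)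
      thus ?thesis using ZW[of "t - t1"] False by (auto simp: collision_def X'_def)
    qed
    fix i assume i: "i < N"
    have "((\<lambda>t. if t \<in> S then X i t else Z i (t - t1)) has_vector_derivative (if t \<in> S then V i t else W i (t - t1))) (at t within S \<union> R)"
      using old ZW Z0 i by (intro join[OF t]) auto
    thus "(X' i has_vector_derivative V' i t) (at t within S \<union> R)"
      by (simp add: X'_def[abs_def] V'_def)
    have "force N (\<lambda>j. X j t1) i = force N (\<lambda>j. Z j 0) i"
      unfolding force_def using Z0 i by (intro arg_cong[where f="\<lambda>x. (1 / real N) *\<^sub>R x"] sum.cong) auto
    hence "((\<lambda>t. if t \<in> S then V i t else W i (t - t1)) has_vector_derivative
       (if t \<in> S then lam *\<^sub>R (- V i t + force N (\<lambda>j. X j t) i) else lam *\<^sub>R (- W i (t - t1) + force N (\<lambda>j. Z j (t - t1)) i))) (at t within S \<union> R)"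
      using old ZW Z0 i by (intro join[OF t]) auto
    moreover have "(if t \<in> S then lam *\<^sub>R (- V i t + force N (\<lambda>j. X j t) i) else lam *\<^sub>R (- W i (t - t1) + force N (\<lambda>j. Z j (t - t1)) i))
       = lam *\<^sub>R (- V' i t + force N (\<lambda>j. X' j t) i)"
      by (simp add: V'_def X'_def)
    ultimately show "(V' i has_vector_derivative lam *\<^sub>R (- V' i t + (1 / real N) *\<^sub>R (\<Sum>j\<in>{..<N} - {i}. K (X' i t - X' j t)))) (at t within S \<union> R)"
      using frc[OF i nc] by (simp add: V'_def[abs_def])
  qed
  hence "ereal (t1 + \<delta>) \<le> \<tau>" by (rule maximal)
  thus False using T1 t1 by simp
qed

end

section \<open>A priori bounds while the Riesz sums are bounded\<close>

locale particles = kernel K \<alpha> C\<^sub>K for K :: "'a::euclidean_space \<Rightarrow> 'a" and \<alpha> C\<^sub>K +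
  fixes N :: nat and lam :: real and X V :: "nat \<Rightarrow> real \<Rightarrow> 'a" and b \<Lambda> :: real
  assumes N_pos: "0 < N" and lam_pos: "0 < lam" and b_nonneg: "0 \<le> b" and Lambda_nonneg: "0 \<le> \<Lambda>"
    and X_deriv: "\<And>i s. i < N \<Longrightarrow> 0 \<le> s \<Longrightarrow> s \<le> b \<Longrightarrow> (X i has_vector_derivative V i s) (at s within {0..b})"
    and V_deriv: "\<And>i s. i < N \<Longrightarrow> 0 \<le> s \<Longrightarrow> s \<le> b \<Longrightarrow>
        (V i has_vector_derivative lam *\<^sub>R (- V i s + force N (\<lambda>j. X j s) i)) (at s within {0..b})"
    and no_collision: "\<And>i j s. i < N \<Longrightarrow> j < N \<Longrightarrow> i \<noteq> j \<Longrightarrow> 0 \<le> s \<Longrightarrow> s \<le> b \<Longrightarrow> X i s \<noteq> X j s"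
    and riesz_sum: "\<And>i s. i < N \<Longrightarrow> 0 \<le> s \<Longrightarrow> s \<le> b \<Longrightarrow> (1 / real N) * (\<Sum>j<N. \<kappa> (X i s - X j s)) \<le> \<Lambda>"
begin

definition F :: "nat \<Rightarrow> real \<Rightarrow> 'a" where "F i s = force N (\<lambda>j. X j s) i"

lemma norm_F_le:
  assumes "i < N" "0 \<le> s" "s \<le> b" shows "norm (F i s) \<le> C\<^sub>K * (1 + \<Lambda>)"
proof -
  have "norm (F i s) \<le> (1 / real N) * (\<Sum>j<N. norm (K0 (X i s - X j s)))"
    unfolding F_def force_def norm_scaleR using N_pos by (simp add: norm_sum divide_right_mono)
  also have "\<dots> \<le> (1 / real N) * (\<Sum>j<N. C\<^sub>K * (1 + \<kappa> (X i s - X j s)))"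
    by (intro mult_left_mono sum_mono norm_K0_le') auto
  also have "\<dots> = C\<^sub>K * (1 + (1 / real N) * (\<Sum>j<N. \<kappa> (X i s - X j s)))"
    using N_pos by (simp add: sum_distrib_left[symmetric] sum.distrib field_simps)
  also have "\<dots> \<le> C\<^sub>K * (1 + \<Lambda>)" by (intro mult_left_mono add_left_mono riesz_sum assms CK_nonneg)
  finally show ?thesis .
qed

lemma norm_F_diff_le:
  assumes "i < N" "j < N" "0 \<le> s" "s \<le> b"
  shows "norm (F i s - F j s) \<le> 2 * C1 * \<Lambda> * norm (X i s - X j s)"
proof -
  let ?r = "norm (X i s - X j s)"
  have "F i s - F j s = (1 / real N) *\<^sub>R (\<Sum>k<N. K0 (X i s - X k s) - K0 (X j s - X k s))"
    by (simp add: F_def force_def sum_subtractf scaleR_diff_right)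
  also have "norm \<dots> \<le> (1 / real N) * (\<Sum>k<N. norm (K0 (X i s - X k s) - K0 (X j s - X k s)))"
    unfolding norm_scaleR using N_pos by (simp add: norm_sum divide_right_mono)
  also have "\<dots> \<le> (1 / real N) * (\<Sum>k<N. C1 * ?r * (\<kappa> (X i s - X k s) + \<kappa> (X j s - X k s)))"
  proof (intro mult_left_mono sum_mono)
    show "norm (K0 (X i s - X k s) - K0 (X j s - X k s)) \<le> C1 * ?r * (\<kappa> (X i s - X k s) + \<kappa> (X j s - X k s))" for k
      using K0_diff_le[of "X i s - X k s" "X j s - X k s"] by simp
  qed auto
  also have "\<dots> = C1 * ?r * ((1 / real N) * (\<Sum>k<N. \<kappa> (X i s - X k s)) + (1 / real N) * (\<Sum>k<N. \<kappa> (X j s - X k s)))"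
    by (simp add: sum_distrib_left[symmetric] sum.distrib distrib_left)
  also have "\<dots> \<le> C1 * ?r * (\<Lambda> + \<Lambda>)"
    using C1_nonneg assms by (intro mult_left_mono add_mono riesz_sum) auto
  finally show ?thesis by (simp add: algebra_simps)
qed

text \<open>Variation of constants: \<open>exp (lam * s) *\<^sub>R V i s\<close> has derivative
  \<open>lam * exp (lam * s)\<close> times the force. Integrating the weight cancels
  \<open>lam\<close>, so the bound is uniform in the friction.\<close>

lemma norm_V_le:
  assumes i: "i < N" and s: "0 \<le> s" "s \<le> b"
  shows "norm (V i s) \<le> norm (V i 0) + C\<^sub>K * (1 + \<Lambda>)"
proof (cases "s = 0")
  case True
  thus ?thesis using CK_nonneg Lambda_nonneg by simp
next
  case False
  hence "0 < s" using s by simp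
  define S where "S = C\<^sub>K * (1 + \<Lambda>)"
  have S: "0 \<le> S" using CK_nonneg Lambda_nonneg by (simp add: S_def)
  have d: "((\<lambda>r. exp (lam * r) *\<^sub>R V i r) has_vector_derivative (lam * exp (lam * r)) *\<^sub>R F i r) (at r within {0..b})"
    if "0 \<le> r" "r \<le> b" for r
  proof -
    have e: "((\<lambda>r. exp (lam * r)) has_real_derivative lam * exp (lam * r)) (at r within {0..b})"
      by (auto intro!: derivative_eq_intros)
    show ?thesis
      by (rule has_vector_derivative_eq_rhs[OF has_vector_derivative_scaleR[OF e V_deriv[OF i that]]])
         (simp add: F_def algebra_simps)
  qed
  have "norm (exp (lam * s) *\<^sub>R V i s - exp (lam * 0) *\<^sub>R V i 0) \<le> S * exp (lam * s) - S * exp (lam * 0)"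
  proof (rule differentiable_bound_general[OF \<open>0 < s\<close>])
    show "continuous_on {0..s} (\<lambda>r. exp (lam * r) *\<^sub>R V i r)"
      by (rule continuous_on_subset[of "{0..b}"], rule continuous_on_vector_derivative[OF d]) (use s in auto)
    show "continuous_on {0..s} (\<lambda>r. S * exp (lam * r))" by (intro continuous_intros)
    fix r assume r: "0 < r" "r < s"
    show "((\<lambda>r. exp (lam * r) *\<^sub>R V i r) has_vector_derivative (lam * exp (lam * r)) *\<^sub>R F i r) (at r)"
      using d[of r] r s by (simp add: at_within_Icc_at)
    have "((\<lambda>r. S * exp (lam * r)) has_real_derivative S * (lam * exp (lam * r))) (at r)"
      by (auto intro!: derivative_eq_intros)
    thus "((\<lambda>r. S * exp (lam * r)) has_vector_derivative S * (lam * exp (lam * r))) (at r)"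
      by (simp add: has_real_derivative_iff_has_vector_derivative)
    have "norm ((lam * exp (lam * r)) *\<^sub>R F i r) = (lam * exp (lam * r)) * norm (F i r)"
      using lam_pos by (simp add: abs_mult)
    also have "\<dots> \<le> (lam * exp (lam * r)) * S"
      using lam_pos r s by (intro mult_left_mono norm_F_le[folded S_def] i) auto
    finally show "norm ((lam * exp (lam * r)) *\<^sub>R F i r) \<le> S * (lam * exp (lam * r))" by (simp add: mult.commute)
  qed
  moreover have "exp (lam * s) * norm (V i s) - norm (V i 0) \<le> norm (exp (lam * s) *\<^sub>R V i s - exp (lam * 0) *\<^sub>R V i 0)"
    using norm_triangle_ineq2[of "exp (lam * s) *\<^sub>R V i s" "V i 0"] by simp
  ultimately have "exp (lam * s) * norm (V i s) \<le> norm (V i 0) + S * exp (lam * s) - S" by simp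
  also have "norm (V i 0) \<le> exp (lam * s) * norm (V i 0)"
    using lam_pos s mult_right_mono[of 1 "exp (lam * s)" "norm (V i 0)"] by simp
  also have "exp (lam * s) * norm (V i 0) + S * exp (lam * s) - S \<le> exp (lam * s) * (norm (V i 0) + S)"
    using S by (simp add: distrib_left mult.commute)
  finally show ?thesis by (simp add: S_def)
qed

text \<open>For relative position \<open>x\<close> and relative velocity \<open>w\<close>, the cone
  \<open>norm w \<le> lam / 2 * norm x\<close> is invariant. Inside it \<open>x + w / lam\<close>,
  whose derivative is the difference of the forces without a factor \<open>lam\<close>, is
  comparable to \<open>x\<close> and decays at most exponentially. The comparison constants 2 and
  3/2 multiply to 3.\<close>

lemma separation:
  assumes ij: "i < N" "j < N" and lam: "8 * C1 * \<Lambda> \<le> lam"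
    and init: "norm (V i 0 - V j 0) \<le> lam / 2 * norm (X i 0 - X j 0)" and s: "0 \<le> s" "s \<le> b"
  shows "exp (- (4 * C1 * \<Lambda> * s)) * norm (X i 0 - X j 0) \<le> 3 * norm (X i s - X j s)"
proof -
  define M where "M = 2 * C1 * \<Lambda>"
  have M: "0 \<le> M" "4 * M \<le> lam" using C1_nonneg Lambda_nonneg lam by (auto simp: M_def)
  define x where "x r = X i r - X j r" for r
  define w where "w r = V i r - V j r" for r
  define f where "f r = F i r - F j r" for r
  have xd: "(x has_vector_derivative w r) (at r within {0..b})" if "0 \<le> r" "r \<le> b" for r
    unfolding x_def[abs_def] w_def by (intro has_vector_derivative_diff X_deriv ij that)
  have wd: "(w has_vector_derivative lam *\<^sub>R (f r - w r)) (at r within {0..b})" if "0 \<le> r" "r \<le> b" for r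
    unfolding w_def[abs_def] f_def
    by (rule has_vector_derivative_eq_rhs[OF has_vector_derivative_diff[OF V_deriv[OF ij(1) that] V_deriv[OF ij(2) that]]])
       (simp add: F_def algebra_simps)
  have fx: "norm (f r) \<le> M * norm (x r)" if "0 \<le> r" "r \<le> b" for r
    using norm_F_diff_le[OF ij that] by (simp add: f_def x_def M_def)
  have norm2: "((\<lambda>r. (norm (g r))\<^sup>2) has_real_derivative 2 * (g r \<bullet> g')) (at r within {0..b})"
    if "(g has_vector_derivative g') (at r within {0..b})" for g g' r
  proof -
    have "((\<lambda>r. g r \<bullet> g r) has_derivative (\<lambda>h. g r \<bullet> (h *\<^sub>R g') + (h *\<^sub>R g') \<bullet> g r)) (at r within {0..b})"
      using that unfolding has_vector_derivative_def by (intro has_derivative_inner)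
    thus ?thesis unfolding power2_norm_eq_inner has_field_derivative_def
      by (rule has_derivative_eq_rhs) (auto simp: fun_eq_iff inner_commute)
  qed
  have w_le: "norm (w r) \<le> lam / 2 * norm (x r)" if r: "0 \<le> r" "r \<le> b" for r
  proof -
    \<comment> \<open>Nonnegative exactly in the cone. With \<open>a = lam / 2 * norm x\<close> and
      \<open>\<omega> = norm w\<close>, the computation gives
      \<open>Q' + lam * Q \<ge> lam * (a - \<omega>)\<^sup>2\<close>; the lower bound on
      \<open>lam\<close> enters through \<open>norm f \<le> a / 2\<close>.\<close>
    define Q where "Q r = lam\<^sup>2 / 4 * (norm (x r))\<^sup>2 - (norm (w r))\<^sup>2" for r
    define Q' where "Q' r = lam\<^sup>2 / 4 * (2 * (x r \<bullet> w r)) - 2 * (w r \<bullet> (lam *\<^sub>R (f r - w r)))" for r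
    have Qd: "(Q has_real_derivative Q' z) (at z within {0..b})" if "0 \<le> z" "z \<le> b" for z
      unfolding Q_def[abs_def] Q'_def by (intro DERIV_diff DERIV_cmult norm2 xd wd that)
    have "exp (- lam * (r - 0)) * Q 0 \<le> Q r"
    proof (rule linear_differential_inequality[OF r(1), of Q Q'])
      show "continuous_on {0..r} Q"
        by (rule continuous_on_subset[of "{0..b}"], rule DERIV_continuous_on[OF Qd]) (use r in auto)
      fix z assume z: "0 < z" "z < r"
      show "(Q has_real_derivative Q' z) (at z)" using Qd[of z] z r by (simp add: at_within_Icc_at)
      define a where "a = lam / 2 * norm (x z)"
      define \<omega> where "\<omega> = norm (w z)"
      have a: "0 \<le> a" "0 \<le> \<omega>" using lam_pos by (auto simp: a_def \<omega>_def)
      have xw: "- (a * \<omega>) \<le> lam / 2 * (x z \<bullet> w z)"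
        using Cauchy_Schwarz_ineq2[of "x z" "w z"] lam_pos mult_left_mono[of "- (norm (x z) * norm (w z))" "x z \<bullet> w z" "lam / 2"]
        by (simp add: a_def \<omega>_def abs_le_iff)
      have wf: "w z \<bullet> f z \<le> a * \<omega> / 2"
      proof -
        have "w z \<bullet> f z \<le> norm (w z) * norm (f z)" by (rule norm_cauchy_schwarz)
        also have "\<dots> \<le> norm (w z) * (a / 2)"
        proof (rule mult_left_mono)
          have "norm (f z) \<le> M * norm (x z)" using fx[of z] z r by simp
          also have "\<dots> \<le> (lam / 4) * norm (x z)" using M by (intro mult_right_mono) auto
          finally show "norm (f z) \<le> a / 2" by (simp add: a_def)
        qed simp
        finally show ?thesis by (simp add: \<omega>_def mult.commute)
      qed
      have a2: "lam\<^sup>2 / 4 * (norm (x z))\<^sup>2 = a\<^sup>2" by (simp add: a_def power_mult_distrib power_divide)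
      have "Q' z + lam * Q z = lam * (lam / 2 * (x z \<bullet> w z) - 2 * (w z \<bullet> f z) + \<omega>\<^sup>2 + a\<^sup>2)"
        unfolding Q_def a2
        by (simp add: Q'_def \<omega>_def inner_diff_right power2_norm_eq_inner[of "w z"]
            power2_eq_square[of lam] algebra_simps)
      also have "\<dots> \<ge> lam * (- (a * \<omega>) - 2 * (a * \<omega> / 2) + \<omega>\<^sup>2 + a\<^sup>2)"
        using xw wf lam_pos by (intro mult_left_mono) (auto simp: mult.commute[of \<omega> a])
      moreover have "lam * (- (a * \<omega>) - 2 * (a * \<omega> / 2) + \<omega>\<^sup>2 + a\<^sup>2) = lam * (a - \<omega>)\<^sup>2"
        by (simp add: power2_eq_square algebra_simps)
      moreover have "0 \<le> lam * (a - \<omega>)\<^sup>2" using lam_pos by simp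
      ultimately show "- lam * Q z \<le> Q' z" by linarith
    qed
    moreover have "0 \<le> Q 0"
    proof -
      have "(norm (w 0))\<^sup>2 \<le> (lam / 2 * norm (x 0))\<^sup>2" using init by (intro power_mono) (auto simp: w_def x_def)
      thus ?thesis by (simp add: Q_def power_mult_distrib power_divide)
    qed
    ultimately have "0 \<le> Q r" by (meson exp_ge_zero mult_nonneg_nonneg order_trans)
    hence "(norm (w r))\<^sup>2 \<le> (lam / 2 * norm (x r))\<^sup>2" by (simp add: Q_def power_mult_distrib power_divide)
    thus ?thesis by (rule power2_le_imp_le) (use lam_pos in simp)
  qed
  \<comment> \<open>The friction term cancels in the derivative of this combination.\<close>
  define \<psi> where "\<psi> r = x r + (1 / lam) *\<^sub>R w r" for r
  have wl: "norm ((1 / lam) *\<^sub>R w r) \<le> norm (x r) / 2" if "0 \<le> r" "r \<le> b" for r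
    using w_le[OF that] lam_pos by (simp add: field_simps)
  have \<psi>x: "norm (x r) \<le> 2 * norm (\<psi> r)" "norm (\<psi> r) \<le> 3 / 2 * norm (x r)" if "0 \<le> r" "r \<le> b" for r
    using wl[OF that] norm_triangle_ineq2[of "x r" "- ((1 / lam) *\<^sub>R w r)"] norm_triangle_ineq[of "x r" "(1 / lam) *\<^sub>R w r"]
    unfolding \<psi>_def norm_minus_cancel diff_minus_eq_add by linarith+
  have \<psi>d: "(\<psi> has_vector_derivative f r) (at r within {0..b})" if "0 \<le> r" "r \<le> b" for r
  proof -
    have "((\<lambda>r. (1 / lam) *\<^sub>R w r) has_vector_derivative (1 / lam) *\<^sub>R (lam *\<^sub>R (f r - w r))) (at r within {0..b})"
      by (rule bounded_linear.has_vector_derivative[OF bounded_linear_scaleR_right wd[OF that]])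
    from has_vector_derivative_add[OF xd[OF that] this] show ?thesis
      using lam_pos by (simp add: \<psi>_def[abs_def])
  qed
  define P where "P r = (norm (\<psi> r))\<^sup>2" for r
  have Pd: "(P has_real_derivative 2 * (\<psi> r \<bullet> f r)) (at r within {0..b})" if "0 \<le> r" "r \<le> b" for r
    unfolding P_def[abs_def] by (intro norm2 \<psi>d that)
  have "exp (- (4 * M) * (s - 0)) * P 0 \<le> P s"
  proof (rule linear_differential_inequality[OF s(1), of P "\<lambda>r. 2 * (\<psi> r \<bullet> f r)"])
    show "continuous_on {0..s} P"
      by (rule continuous_on_subset[of "{0..b}"], rule DERIV_continuous_on[OF Pd]) (use s in auto)
    fix z assume z: "0 < z" "z < s"
    show "(P has_real_derivative 2 * (\<psi> z \<bullet> f z)) (at z)" using Pd[of z] z s by (simp add: at_within_Icc_at)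
    have "\<bar>\<psi> z \<bullet> f z\<bar> \<le> norm (\<psi> z) * norm (f z)" by (rule Cauchy_Schwarz_ineq2)
    also have "\<dots> \<le> norm (\<psi> z) * (M * (2 * norm (\<psi> z)))"
      using fx[of z] \<psi>x(1)[of z] z s M by (intro mult_left_mono order_trans[OF fx] mult_left_mono) auto
    finally show "- (4 * M) * P z \<le> 2 * (\<psi> z \<bullet> f z)" by (simp add: P_def power2_eq_square algebra_simps abs_le_iff)
  qed
  hence "(exp (- (2 * M * s)) * norm (\<psi> 0))\<^sup>2 \<le> (norm (\<psi> s))\<^sup>2"
    by (simp add: P_def power_mult_distrib exp_double[symmetric] mult.assoc)
  hence "exp (- (2 * M * s)) * norm (\<psi> 0) \<le> norm (\<psi> s)" by (rule power2_le_imp_le) simp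
  moreover have "exp (- (2 * M * s)) * (norm (x 0) / 2) \<le> exp (- (2 * M * s)) * norm (\<psi> 0)"
    by (rule mult_left_mono) (use \<psi>x(1)[of 0] b_nonneg in simp_all)
  ultimately have "exp (- (2 * M * s)) * (norm (x 0) / 2) \<le> norm (\<psi> s)" by linarith
  also have "\<dots> \<le> 3 / 2 * norm (x s)" by (rule \<psi>x(2)[OF s])
  finally show ?thesis by (simp add: x_def M_def mult_ac)
qed

end

section \<open>A Gronwall inequality for moments\<close>

lemma powr_mult_self: "0 \<le> x \<Longrightarrow> x powr (p - 1) * x = x powr (p::real)"
  by (cases "x = 0") (auto simp: powr_diff)

text \<open>A crude form of Young's inequality: the smaller of the two numbers is replaced by the
  larger.\<close>

lemma powr_mult_le_sum:
  fixes x y p :: real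
  assumes "0 \<le> x" "0 \<le> y" "1 \<le> p"
  shows "x powr (p - 1) * y \<le> x powr p + y powr p"
proof (cases "y \<le> x")
  case True
  hence "x powr (p - 1) * y \<le> x powr (p - 1) * x" by (intro mult_left_mono) auto
  thus ?thesis using powr_mult_self[OF assms(1), of p] by (simp add: add_increasing2)
next
  case False
  hence "x powr (p - 1) * y \<le> y powr (p - 1) * y" using assms by (intro mult_right_mono powr_mono2) auto
  thus ?thesis using powr_mult_self[OF assms(2), of p] by (simp add: add_increasing)
qed

text \<open>The weight 1/4 leaves room for absorbing the first term; the threshold
  \<open>a = x / 4\<close> produces the power of 4.\<close>

lemma powr_mult_le_quarter:
  fixes x a p :: real
  assumes "0 \<le> x" "0 \<le> a" "1 \<le> p"
  shows "x powr (p - 1) * a \<le> 1 / 4 * x powr p + 4 powr p * a powr p"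
proof (cases "a \<le> x / 4")
  case True
  hence "x powr (p - 1) * a \<le> x powr (p - 1) * (x / 4)" by (intro mult_left_mono) auto
  thus ?thesis using powr_mult_self[OF assms(1), of p] by (simp add: add_increasing2)
next
  case False
  hence "x powr (p - 1) * a \<le> (4 * a) powr (p - 1) * (4 * a)" using assms by (intro mult_mono powr_mono2) auto
  also have "\<dots> = 4 powr p * a powr p" using powr_mult_self[of "4 * a" p] assms by (simp add: powr_mult)
  finally show ?thesis by (simp add: add_increasing)
qed

text \<open>Abstract setting: \<open>D\<close> is the distance of coupled trajectories,
  \<open>k\<close> a symmetric interaction with marginals at most \<open>A\<close>, and
  \<open>a\<close> the initial error. The inequality is kept in integral form, so that moments of
  \<open>D\<close> never have to be differentiated.\<close>

locale coupled_gronwall = prob_space \<gamma> for \<gamma> :: "'w measure" +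
  fixes D :: "real \<Rightarrow> 'w \<Rightarrow> real" and k :: "real \<Rightarrow> 'w \<Rightarrow> 'w \<Rightarrow> real" and a :: "'w \<Rightarrow> real" and A c T :: real
  assumes D_measurable_pair: "(\<lambda>(s, \<omega>). D s \<omega>) \<in> borel_measurable (borel \<Otimes>\<^sub>M \<gamma>)"
    and k_measurable_triple: "(\<lambda>(s, \<omega>, \<omega>'). k s \<omega> \<omega>') \<in> borel_measurable (borel \<Otimes>\<^sub>M \<gamma> \<Otimes>\<^sub>M \<gamma>)"
    and a_measurable [measurable]: "a \<in> borel_measurable \<gamma>"
    and D_nonneg: "\<And>s \<omega>. 0 \<le> D s \<omega>" and k_nonneg: "\<And>s \<omega> \<omega>'. 0 \<le> k s \<omega> \<omega>'" and a_nonneg: "\<And>\<omega>. 0 \<le> a \<omega>"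
    and k_sym: "\<And>s \<omega> \<omega>'. k s \<omega> \<omega>' = k s \<omega>' \<omega>"
    and k_bound: "\<And>s \<omega>. 0 \<le> s \<Longrightarrow> s \<le> T \<Longrightarrow> (\<integral>\<^sup>+\<omega>'. ennreal (k s \<omega> \<omega>') \<partial>\<gamma>) \<le> ennreal A"
    and A_pos: "0 < A" and c_pos: "0 < c"
    and ineq: "\<And>t \<omega>. 0 \<le> t \<Longrightarrow> t \<le> T \<Longrightarrow> ennreal (D t \<omega>) \<le> ennreal (a \<omega>) +
        ennreal c * (\<integral>\<^sup>+s. (ennreal A * ennreal (D s \<omega>) + (\<integral>\<^sup>+\<omega>'. ennreal (k s \<omega> \<omega>') * ennreal (D s \<omega>') \<partial>\<gamma>)) * indicator {0..t} s \<partial>lborel)"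
begin

lemma D_measurable [measurable (raw)]:
  assumes "f \<in> measurable M borel" "g \<in> measurable M \<gamma>"
  shows "(\<lambda>x. D (f x) (g x)) \<in> borel_measurable M"
  using measurable_compose[OF measurable_Pair[OF assms] D_measurable_pair] by simp

lemma k_measurable [measurable (raw)]:
  assumes "f \<in> measurable M borel" "g \<in> measurable M \<gamma>" "h \<in> measurable M \<gamma>"
  shows "(\<lambda>x. k (f x) (g x) (h x)) \<in> borel_measurable M"
  using measurable_compose[OF measurable_Pair[OF assms(1) measurable_Pair[OF assms(2,3)]] k_measurable_triple] by simp

text \<open>Chosen so that \<open>c * (4 * A) / \<beta> = 1 / 4\<close>, the share of the supremum
  taken by the time integral in \<open>P_integral_le\<close>.\<close>

definition \<beta> :: real where "\<beta> = 16 * A * c"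

lemma beta_pos: "0 < \<beta>" using A_pos c_pos by (simp add: \<beta>_def)

context
  fixes p :: real
  assumes p: "1 \<le> p"
begin

text \<open>The exponential damping allows a supremum over the time interval to take the place of a
  differential argument.\<close>

definition P :: "real \<Rightarrow> 'w \<Rightarrow> real" where "P s \<omega> = (exp (- \<beta> * s) * D s \<omega>) powr p"

lemma P_measurable [measurable (raw)]:
  assumes "f \<in> measurable M borel" "g \<in> measurable M \<gamma>"
  shows "(\<lambda>x. P (f x) (g x)) \<in> borel_measurable M"
  unfolding P_def using assms by measurable

text \<open>Young's inequality after each distance has received its own exponential weight; the
  excess \<open>exp (- \<beta> * (t - s))\<close> becomes small on integration in
  \<open>s\<close>.\<close>

lemma weighted_product_le:
  "(exp (- \<beta> * t) * D t \<omega>) powr (p - 1) * exp (- \<beta> * t) * D s \<omega>' \<le> exp (- \<beta> * (t - s)) * (P t \<omega> + P s \<omega>')"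
proof -
  have "(exp (- \<beta> * t) * D t \<omega>) powr (p - 1) * (exp (- \<beta> * s) * D s \<omega>') \<le> P t \<omega> + P s \<omega>'"
    unfolding P_def by (rule powr_mult_le_sum) (use D_nonneg p in auto)
  hence "exp (- \<beta> * (t - s)) * ((exp (- \<beta> * t) * D t \<omega>) powr (p - 1) * (exp (- \<beta> * s) * D s \<omega>')) \<le> exp (- \<beta> * (t - s)) * (P t \<omega> + P s \<omega>')"
    by (rule mult_left_mono) simp
  moreover have "exp (- \<beta> * t) = exp (- \<beta> * (t - s)) * exp (- \<beta> * s)"
    by (simp add: exp_add[symmetric] algebra_simps)
  ultimately show ?thesis by (simp add: mult_ac)
qed

text \<open>The integral inequality is multiplied by \<open>z\<close>, the factor that turns
  \<open>D t \<omega>\<close> into \<open>P t \<omega>\<close>. Products with distances are then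
  split by \<open>weighted_product_le\<close>, the product with \<open>a\<close> by
  \<open>powr_mult_le_quarter\<close>.\<close>

lemma P_le:
  assumes t: "0 \<le> t" "t \<le> T" and \<omega> [measurable]: "\<omega> \<in> space \<gamma>"
  shows "ennreal (P t \<omega>) \<le> ennreal (1 / 4) * ennreal (P t \<omega>) + ennreal (4 powr p) * ennreal (a \<omega> powr p) +
    ennreal c * (\<integral>\<^sup>+s. ennreal (exp (- \<beta> * (t - s))) * (ennreal A * (ennreal (P t \<omega>) + ennreal (P s \<omega>)) +
       (\<integral>\<^sup>+\<omega>'. ennreal (k s \<omega> \<omega>') * (ennreal (P t \<omega>) + ennreal (P s \<omega>')) \<partial>\<gamma>)) * indicator {0..t} s \<partial>lborel)"
proof -
  define x where "x = exp (- \<beta> * t) * D t \<omega>"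
  define z where "z = x powr (p - 1) * exp (- \<beta> * t)"
  have x: "0 \<le> x" using D_nonneg by (simp add: x_def)
  have z: "0 \<le> z" by (simp add: z_def)
  have wp: "ennreal z * ennreal (D s \<omega>') \<le> ennreal (exp (- \<beta> * (t - s))) * (ennreal (P t \<omega>) + ennreal (P s \<omega>'))" for s \<omega>'
  proof -
    have "ennreal (z * D s \<omega>') \<le> ennreal (exp (- \<beta> * (t - s)) * (P t \<omega> + P s \<omega>'))"
      using weighted_product_le[of t \<omega> s \<omega>'] by (intro ennreal_leI) (simp add: z_def x_def)
    thus ?thesis using z D_nonneg by (simp add: ennreal_mult ennreal_plus P_def)
  qed
  have "ennreal (P t \<omega>) = ennreal z * ennreal (D t \<omega>)"
    using powr_mult_self[OF x, of p] z D_nonneg by (simp add: P_def x_def z_def ennreal_mult[symmetric] mult_ac)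
  also have "\<dots> \<le> ennreal z * (ennreal (a \<omega>) + ennreal c * (\<integral>\<^sup>+s. (ennreal A * ennreal (D s \<omega>) +
      (\<integral>\<^sup>+\<omega>'. ennreal (k s \<omega> \<omega>') * ennreal (D s \<omega>') \<partial>\<gamma>)) * indicator {0..t} s \<partial>lborel))"
    by (intro mult_left_mono ineq t) auto
  also have "\<dots> = ennreal z * ennreal (a \<omega>) + ennreal c * (\<integral>\<^sup>+s. (ennreal A * (ennreal z * ennreal (D s \<omega>)) +
      (\<integral>\<^sup>+\<omega>'. ennreal (k s \<omega> \<omega>') * (ennreal z * ennreal (D s \<omega>')) \<partial>\<gamma>)) * indicator {0..t} s \<partial>lborel)"
  proof -
    have "ennreal z * (\<integral>\<^sup>+s. (ennreal A * ennreal (D s \<omega>) + (\<integral>\<^sup>+\<omega>'. ennreal (k s \<omega> \<omega>') * ennreal (D s \<omega>') \<partial>\<gamma>)) * indicator {0..t} s \<partial>lborel)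
       = (\<integral>\<^sup>+s. ennreal z * ((ennreal A * ennreal (D s \<omega>) + (\<integral>\<^sup>+\<omega>'. ennreal (k s \<omega> \<omega>') * ennreal (D s \<omega>') \<partial>\<gamma>)) * indicator {0..t} s) \<partial>lborel)"
      by (rule nn_integral_cmult[symmetric]) measurable
    also have "\<dots> = (\<integral>\<^sup>+s. (ennreal A * (ennreal z * ennreal (D s \<omega>)) +
      (\<integral>\<^sup>+\<omega>'. ennreal (k s \<omega> \<omega>') * (ennreal z * ennreal (D s \<omega>')) \<partial>\<gamma>)) * indicator {0..t} s \<partial>lborel)"
    proof (rule nn_integral_cong)
      fix s
      have "ennreal z * (\<integral>\<^sup>+\<omega>'. ennreal (k s \<omega> \<omega>') * ennreal (D s \<omega>') \<partial>\<gamma>) = (\<integral>\<^sup>+\<omega>'. ennreal z * (ennreal (k s \<omega> \<omega>') * ennreal (D s \<omega>')) \<partial>\<gamma>)"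
        by (rule nn_integral_cmult[symmetric]) measurable
      also have "\<dots> = (\<integral>\<^sup>+\<omega>'. ennreal (k s \<omega> \<omega>') * (ennreal z * ennreal (D s \<omega>')) \<partial>\<gamma>)"
        by (simp only: mult.left_commute)
      finally have eq: "ennreal z * (\<integral>\<^sup>+\<omega>'. ennreal (k s \<omega> \<omega>') * ennreal (D s \<omega>') \<partial>\<gamma>) = (\<integral>\<^sup>+\<omega>'. ennreal (k s \<omega> \<omega>') * (ennreal z * ennreal (D s \<omega>')) \<partial>\<gamma>)" .
      show "ennreal z * ((ennreal A * ennreal (D s \<omega>) + (\<integral>\<^sup>+\<omega>'. ennreal (k s \<omega> \<omega>') * ennreal (D s \<omega>') \<partial>\<gamma>)) * indicator {0..t} s)
        = (ennreal A * (ennreal z * ennreal (D s \<omega>)) + (\<integral>\<^sup>+\<omega>'. ennreal (k s \<omega> \<omega>') * (ennreal z * ennreal (D s \<omega>')) \<partial>\<gamma>)) * indicator {0..t} s"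
        unfolding eq[symmetric] by (simp only: distrib_left distrib_right mult_ac)
    qed
    finally show ?thesis by (simp only: distrib_left mult.left_commute[of "ennreal z"])
  qed
  also have "ennreal z * ennreal (a \<omega>) \<le> ennreal (1 / 4) * ennreal (P t \<omega>) + ennreal (4 powr p) * ennreal (a \<omega> powr p)"
  proof -
    have "z * a \<omega> \<le> x powr (p - 1) * a \<omega>"
      unfolding z_def using beta_pos t a_nonneg[of \<omega>] by (intro mult_right_mono) (auto simp: mult_left_le)
    also have "\<dots> \<le> 1 / 4 * P t \<omega> + 4 powr p * a \<omega> powr p"
      unfolding P_def x_def[symmetric] by (rule powr_mult_le_quarter) (use x a_nonneg p in auto)
    finally have "ennreal (z * a \<omega>) \<le> ennreal (1 / 4 * P t \<omega> + 4 powr p * a \<omega> powr p)" by (rule ennreal_leI)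
    also have "\<dots> = ennreal (1 / 4) * ennreal (P t \<omega>) + ennreal (4 powr p) * ennreal (a \<omega> powr p)"
      by (subst ennreal_plus, simp_all only: ennreal_mult' P_def powr_ge_zero) auto
    finally show ?thesis using z by (simp only: ennreal_mult')
  qed
  also have "(\<integral>\<^sup>+s. (ennreal A * (ennreal z * ennreal (D s \<omega>)) +
      (\<integral>\<^sup>+\<omega>'. ennreal (k s \<omega> \<omega>') * (ennreal z * ennreal (D s \<omega>')) \<partial>\<gamma>)) * indicator {0..t} s \<partial>lborel)
    \<le> (\<integral>\<^sup>+s. ennreal (exp (- \<beta> * (t - s))) * (ennreal A * (ennreal (P t \<omega>) + ennreal (P s \<omega>)) +
       (\<integral>\<^sup>+\<omega>'. ennreal (k s \<omega> \<omega>') * (ennreal (P t \<omega>) + ennreal (P s \<omega>')) \<partial>\<gamma>)) * indicator {0..t} s \<partial>lborel)"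
  proof (intro nn_integral_mono mult_right_mono)
    fix s
    let ?e = "ennreal (exp (- \<beta> * (t - s)))"
    show "ennreal A * (ennreal z * ennreal (D s \<omega>)) + (\<integral>\<^sup>+\<omega>'. ennreal (k s \<omega> \<omega>') * (ennreal z * ennreal (D s \<omega>')) \<partial>\<gamma>)
       \<le> ?e * (ennreal A * (ennreal (P t \<omega>) + ennreal (P s \<omega>)) +
       (\<integral>\<^sup>+\<omega>'. ennreal (k s \<omega> \<omega>') * (ennreal (P t \<omega>) + ennreal (P s \<omega>')) \<partial>\<gamma>))"
    proof -
      have "ennreal A * (ennreal z * ennreal (D s \<omega>)) \<le> ?e * (ennreal A * (ennreal (P t \<omega>) + ennreal (P s \<omega>)))"
        using mult_left_mono[OF wp[of s \<omega>], of "ennreal A"] by (simp only: mult.left_commute[of ?e]) simp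
      moreover have "(\<integral>\<^sup>+\<omega>'. ennreal (k s \<omega> \<omega>') * (ennreal z * ennreal (D s \<omega>')) \<partial>\<gamma>)
          \<le> (\<integral>\<^sup>+\<omega>'. ?e * (ennreal (k s \<omega> \<omega>') * (ennreal (P t \<omega>) + ennreal (P s \<omega>'))) \<partial>\<gamma>)"
      proof (rule nn_integral_mono)
        fix \<omega>'
        show "ennreal (k s \<omega> \<omega>') * (ennreal z * ennreal (D s \<omega>')) \<le> ?e * (ennreal (k s \<omega> \<omega>') * (ennreal (P t \<omega>) + ennreal (P s \<omega>')))"
          using mult_left_mono[OF wp[of s \<omega>'], of "ennreal (k s \<omega> \<omega>')"] by (simp only: mult.left_commute[of ?e]) simp
      qed
      moreover have "(\<integral>\<^sup>+\<omega>'. ?e * (ennreal (k s \<omega> \<omega>') * (ennreal (P t \<omega>) + ennreal (P s \<omega>'))) \<partial>\<gamma>)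
         = ?e * (\<integral>\<^sup>+\<omega>'. ennreal (k s \<omega> \<omega>') * (ennreal (P t \<omega>) + ennreal (P s \<omega>')) \<partial>\<gamma>)"
        by (rule nn_integral_cmult) measurable
      ultimately show ?thesis by (simp only: distrib_left add_mono)
    qed
  qed auto
  finally show ?thesis by (simp add: add_left_mono mult_left_mono)
qed

text \<open>Schur's test: by symmetry both marginals of \<open>k\<close> are at most
  \<open>A\<close>.\<close>

lemma kernel_integral_le:
  assumes s: "0 \<le> s" "s \<le> T" and f [measurable]: "f \<in> borel_measurable \<gamma>"
  shows "(\<integral>\<^sup>+\<omega>. \<integral>\<^sup>+\<omega>'. ennreal (k s \<omega> \<omega>') * f \<omega> \<partial>\<gamma> \<partial>\<gamma>) \<le> ennreal A * (\<integral>\<^sup>+\<omega>. f \<omega> \<partial>\<gamma>)"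
    and "(\<integral>\<^sup>+\<omega>. \<integral>\<^sup>+\<omega>'. ennreal (k s \<omega> \<omega>') * f \<omega>' \<partial>\<gamma> \<partial>\<gamma>) \<le> ennreal A * (\<integral>\<^sup>+\<omega>. f \<omega> \<partial>\<gamma>)"
proof -
  interpret pair_sigma_finite \<gamma> \<gamma> ..
  have "(\<integral>\<^sup>+\<omega>. \<integral>\<^sup>+\<omega>'. ennreal (k s \<omega> \<omega>') * f \<omega> \<partial>\<gamma> \<partial>\<gamma>) = (\<integral>\<^sup>+\<omega>. (\<integral>\<^sup>+\<omega>'. ennreal (k s \<omega> \<omega>') \<partial>\<gamma>) * f \<omega> \<partial>\<gamma>)"
    by (intro nn_integral_cong nn_integral_multc) measurable
  also have "\<dots> \<le> (\<integral>\<^sup>+\<omega>. ennreal A * f \<omega> \<partial>\<gamma>)"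
    by (intro nn_integral_mono mult_right_mono k_bound s) auto
  also have "\<dots> = ennreal A * (\<integral>\<^sup>+\<omega>. f \<omega> \<partial>\<gamma>)" by (rule nn_integral_cmult) measurable
  finally show 1: "(\<integral>\<^sup>+\<omega>. \<integral>\<^sup>+\<omega>'. ennreal (k s \<omega> \<omega>') * f \<omega> \<partial>\<gamma> \<partial>\<gamma>) \<le> ennreal A * (\<integral>\<^sup>+\<omega>. f \<omega> \<partial>\<gamma>)" .
  have "(\<integral>\<^sup>+\<omega>. \<integral>\<^sup>+\<omega>'. ennreal (k s \<omega> \<omega>') * f \<omega>' \<partial>\<gamma> \<partial>\<gamma>) = (\<integral>\<^sup>+\<omega>'. \<integral>\<^sup>+\<omega>. ennreal (k s \<omega> \<omega>') * f \<omega>' \<partial>\<gamma> \<partial>\<gamma>)"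
    by (rule Fubini'[symmetric]) measurable
  also have "\<dots> = (\<integral>\<^sup>+\<omega>'. \<integral>\<^sup>+\<omega>. ennreal (k s \<omega>' \<omega>) * f \<omega>' \<partial>\<gamma> \<partial>\<gamma>)"
    by (subst k_sym) (rule refl)
  also note 1
  finally show "(\<integral>\<^sup>+\<omega>. \<integral>\<^sup>+\<omega>'. ennreal (k s \<omega> \<omega>') * f \<omega>' \<partial>\<gamma> \<partial>\<gamma>) \<le> ennreal A * (\<integral>\<^sup>+\<omega>. f \<omega> \<partial>\<gamma>)" .
qed

text \<open>One quarter of \<open>F\<close> comes from the term with \<open>a\<close>. Another comes
  from the time integral, where four contributions \<open>A * F\<close> meet the factor
  \<open>c / \<beta>\<close>.\<close>

lemma P_integral_le:
  assumes F: "\<And>s. 0 \<le> s \<Longrightarrow> s \<le> T \<Longrightarrow> (\<integral>\<^sup>+\<omega>. ennreal (P s \<omega>) \<partial>\<gamma>) \<le> F" and t: "0 \<le> t" "t \<le> T"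
  shows "(\<integral>\<^sup>+\<omega>. ennreal (P t \<omega>) \<partial>\<gamma>) \<le> ennreal (1 / 2) * F + ennreal (4 powr p) * (\<integral>\<^sup>+\<omega>. ennreal (a \<omega> powr p) \<partial>\<gamma>)"
proof -
  interpret L: pair_sigma_finite lborel \<gamma> ..
  define I where "I s \<omega> = ennreal A * (ennreal (P t \<omega>) + ennreal (P s \<omega>)) +
       (\<integral>\<^sup>+\<omega>'. ennreal (k s \<omega> \<omega>') * (ennreal (P t \<omega>) + ennreal (P s \<omega>')) \<partial>\<gamma>)" for s \<omega>
  have I_measurable [measurable (raw)]: "(\<lambda>x. I (f x) (g x)) \<in> borel_measurable M"
    if [measurable]: "f \<in> measurable M borel" "g \<in> measurable M \<gamma>" for f g and M :: "'z measure"
    unfolding I_def by measurable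
  have I_le: "(\<integral>\<^sup>+\<omega>. I s \<omega> \<partial>\<gamma>) \<le> ennreal (4 * A) * F" if s: "0 \<le> s" "s \<le> T" for s
  proof -
    have "(\<integral>\<^sup>+\<omega>. I s \<omega> \<partial>\<gamma>) = ennreal A * ((\<integral>\<^sup>+\<omega>. ennreal (P t \<omega>) \<partial>\<gamma>) + (\<integral>\<^sup>+\<omega>. ennreal (P s \<omega>) \<partial>\<gamma>)) +
       ((\<integral>\<^sup>+\<omega>. \<integral>\<^sup>+\<omega>'. ennreal (k s \<omega> \<omega>') * ennreal (P t \<omega>) \<partial>\<gamma> \<partial>\<gamma>) + (\<integral>\<^sup>+\<omega>. \<integral>\<^sup>+\<omega>'. ennreal (k s \<omega> \<omega>') * ennreal (P s \<omega>') \<partial>\<gamma> \<partial>\<gamma>))"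
    proof -
      have "(\<integral>\<^sup>+\<omega>. \<integral>\<^sup>+\<omega>'. ennreal (k s \<omega> \<omega>') * (ennreal (P t \<omega>) + ennreal (P s \<omega>')) \<partial>\<gamma> \<partial>\<gamma>)
        = (\<integral>\<^sup>+\<omega>. (\<integral>\<^sup>+\<omega>'. ennreal (k s \<omega> \<omega>') * ennreal (P t \<omega>) \<partial>\<gamma>) + (\<integral>\<^sup>+\<omega>'. ennreal (k s \<omega> \<omega>') * ennreal (P s \<omega>') \<partial>\<gamma>) \<partial>\<gamma>)"
        unfolding distrib_left by (intro nn_integral_cong nn_integral_add) measurable
      thus ?thesis unfolding I_def by (simp add: nn_integral_add nn_integral_cmult)
    qed
    also have "\<dots> \<le> ennreal A * (F + F) + (ennreal A * F + ennreal A * F)"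
      by (intro add_mono mult_left_mono F t s order_trans[OF kernel_integral_le(1)] order_trans[OF kernel_integral_le(2)]) auto
    also have "\<dots> = (ennreal A + ennreal A + ennreal A + ennreal A) * F" by (simp add: distrib_left distrib_right add_ac)
    also have "ennreal A + ennreal A + ennreal A + ennreal A = ennreal (4 * A)"
      using A_pos by (simp add: ennreal_plus[symmetric] del: ennreal_plus)
    finally show ?thesis .
  qed
  have time: "(\<integral>\<^sup>+s. ennreal (exp (- \<beta> * (t - s))) * indicator {0..t} s \<partial>lborel) \<le> ennreal (1 / \<beta>)"
  proof -
    have "(\<integral>\<^sup>+s. ennreal (exp (- \<beta> * (t - s))) * indicator {0..t} s \<partial>lborel)
       = ennreal (exp (- \<beta> * (t - t)) / \<beta> - exp (- \<beta> * (t - 0)) / \<beta>)"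
      using beta_pos t by (intro nn_integral_FTC_Icc) (auto intro!: derivative_eq_intros)
    also have "\<dots> \<le> ennreal (1 / \<beta>)" using beta_pos by (intro ennreal_leI) simp
    finally show ?thesis .
  qed
  have "(\<integral>\<^sup>+\<omega>. ennreal (P t \<omega>) \<partial>\<gamma>) \<le> (\<integral>\<^sup>+\<omega>. ennreal (1 / 4) * ennreal (P t \<omega>) + ennreal (4 powr p) * ennreal (a \<omega> powr p) +
    ennreal c * (\<integral>\<^sup>+s. ennreal (exp (- \<beta> * (t - s))) * I s \<omega> * indicator {0..t} s \<partial>lborel) \<partial>\<gamma>)"
    unfolding I_def by (intro nn_integral_mono P_le t)
  also have "\<dots> = ennreal (1 / 4) * (\<integral>\<^sup>+\<omega>. ennreal (P t \<omega>) \<partial>\<gamma>) + ennreal (4 powr p) * (\<integral>\<^sup>+\<omega>. ennreal (a \<omega> powr p) \<partial>\<gamma>) +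
    ennreal c * (\<integral>\<^sup>+\<omega>. \<integral>\<^sup>+s. ennreal (exp (- \<beta> * (t - s))) * I s \<omega> * indicator {0..t} s \<partial>lborel \<partial>\<gamma>)"
    by (simp add: nn_integral_add nn_integral_cmult)
  also have "(\<integral>\<^sup>+\<omega>. \<integral>\<^sup>+s. ennreal (exp (- \<beta> * (t - s))) * I s \<omega> * indicator {0..t} s \<partial>lborel \<partial>\<gamma>)
     = (\<integral>\<^sup>+s. \<integral>\<^sup>+\<omega>. ennreal (exp (- \<beta> * (t - s))) * I s \<omega> * indicator {0..t} s \<partial>\<gamma> \<partial>lborel)"
    by (rule L.Fubini') measurable
  also have "\<dots> \<le> (\<integral>\<^sup>+s. (ennreal (4 * A) * F) * (ennreal (exp (- \<beta> * (t - s))) * indicator {0..t} s) \<partial>lborel)"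
  proof (rule nn_integral_mono)
    fix s :: real
    show "(\<integral>\<^sup>+\<omega>. ennreal (exp (- \<beta> * (t - s))) * I s \<omega> * indicator {0..t} s \<partial>\<gamma>)
       \<le> (ennreal (4 * A) * F) * (ennreal (exp (- \<beta> * (t - s))) * indicator {0..t} s)"
    proof (cases "s \<in> {0..t}")
      case True
      have "(\<integral>\<^sup>+\<omega>. ennreal (exp (- \<beta> * (t - s))) * I s \<omega> * indicator {0..t} s \<partial>\<gamma>) = ennreal (exp (- \<beta> * (t - s))) * (\<integral>\<^sup>+\<omega>. I s \<omega> \<partial>\<gamma>)"
        using True by (simp add: nn_integral_cmult)
      also have "\<dots> \<le> ennreal (exp (- \<beta> * (t - s))) * (ennreal (4 * A) * F)"
        using True t by (intro mult_left_mono I_le) auto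
      finally show ?thesis using True by (simp add: mult.commute)
    qed simp
  qed
  also have "\<dots> = (ennreal (4 * A) * F) * (\<integral>\<^sup>+s. ennreal (exp (- \<beta> * (t - s))) * indicator {0..t} s \<partial>lborel)"
    by (rule nn_integral_cmult) measurable
  also have "\<dots> \<le> (ennreal (4 * A) * F) * ennreal (1 / \<beta>)" by (intro mult_left_mono time) auto
  also have "ennreal c * ((ennreal (4 * A) * F) * ennreal (1 / \<beta>)) = ennreal (1 / 4) * F"
  proof -
    have "ennreal c * ((ennreal (4 * A) * F) * ennreal (1 / \<beta>)) = ennreal (c * (4 * A) * (1 / \<beta>)) * F"
    proof -
      have "ennreal (c * (4 * A) * (1 / \<beta>)) = ennreal c * ennreal (4 * A) * ennreal (1 / \<beta>)"
        using c_pos A_pos beta_pos by (subst ennreal_mult, simp, simp, subst ennreal_mult, auto)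
      thus ?thesis by (simp only: mult_ac)
    qed
    also have "c * (4 * A) * (1 / \<beta>) = 1 / 4" using c_pos A_pos by (simp add: \<beta>_def)
    finally show ?thesis .
  qed
  also have "(\<integral>\<^sup>+\<omega>. ennreal (P t \<omega>) \<partial>\<gamma>) \<le> F" by (rule F[OF t])
  finally have "(\<integral>\<^sup>+\<omega>. ennreal (P t \<omega>) \<partial>\<gamma>) \<le> ennreal (1 / 4) * F + ennreal (4 powr p) * (\<integral>\<^sup>+\<omega>. ennreal (a \<omega> powr p) \<partial>\<gamma>) + ennreal (1 / 4) * F"
    by (simp add: add_left_mono add_right_mono mult_left_mono)
  also have "\<dots> = (ennreal (1 / 4) + ennreal (1 / 4)) * F + ennreal (4 powr p) * (\<integral>\<^sup>+\<omega>. ennreal (a \<omega> powr p) \<partial>\<gamma>)"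
    by (simp add: distrib_right add_ac)
  also have "ennreal (1 / 4) + ennreal (1 / 4) = ennreal (1 / 2)"
    by (simp add: ennreal_plus[symmetric] del: ennreal_plus)
  finally show ?thesis .
qed

text \<open>The supremum \<open>F\<close> satisfies \<open>F \<le> F / 2 + J\<close>, and the first
  term is absorbed because \<open>F\<close> is finite, which the bound \<open>M\<close> secures
  without appearing in the result. The factor \<open>2 * 4 powr p\<close> has a \<open>p\<close>-th
  root of at most 8 for every \<open>p\<close>.\<close>

theorem coupled_gronwall_bound:
  assumes fin: "\<And>t. 0 \<le> t \<Longrightarrow> t \<le> T \<Longrightarrow> (\<integral>\<^sup>+\<omega>. ennreal (D t \<omega> powr p) \<partial>\<gamma>) \<le> ennreal M" and t: "0 \<le> t" "t \<le> T"
  shows "(\<integral>\<^sup>+\<omega>. ennreal (D t \<omega> powr p) \<partial>\<gamma>) \<le> ennreal (exp (\<beta> * t) powr p * (2 * 4 powr p)) * (\<integral>\<^sup>+\<omega>. ennreal (a \<omega> powr p) \<partial>\<gamma>)"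
proof -
  define F where "F = (SUP s\<in>{0..T}. \<integral>\<^sup>+\<omega>. ennreal (P s \<omega>) \<partial>\<gamma>)"
  define J where "J = ennreal (4 powr p) * (\<integral>\<^sup>+\<omega>. ennreal (a \<omega> powr p) \<partial>\<gamma>)"
  have F: "(\<integral>\<^sup>+\<omega>. ennreal (P s \<omega>) \<partial>\<gamma>) \<le> F" if "0 \<le> s" "s \<le> T" for s
    unfolding F_def using that by (intro SUP_upper) auto
  have "F \<le> ennreal M"
    unfolding F_def
  proof (rule SUP_least)
    fix s assume s: "s \<in> {0..T}"
    have "P s \<omega> \<le> D s \<omega> powr p" for \<omega>
      unfolding P_def using beta_pos s D_nonneg p by (intro powr_mono2) (auto simp: mult_left_le_one_le)
    hence "(\<integral>\<^sup>+\<omega>. ennreal (P s \<omega>) \<partial>\<gamma>) \<le> (\<integral>\<^sup>+\<omega>. ennreal (D s \<omega> powr p) \<partial>\<gamma>)"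
      by (intro nn_integral_mono ennreal_leI)
    also have "\<dots> \<le> ennreal M" using s by (intro fin) auto
    finally show "(\<integral>\<^sup>+\<omega>. ennreal (P s \<omega>) \<partial>\<gamma>) \<le> ennreal M" .
  qed
  hence Ffin: "F \<noteq> \<infinity>" by (auto simp: top_unique)
  have "F \<le> ennreal (1 / 2) * F + J"
    unfolding F_def[of] J_def by (rule SUP_least) (use P_integral_le[OF F] F_def in auto)
  hence FJ: "F \<le> 2 * J"
  proof (cases "J = \<infinity>")
    case False
    then obtain f j where fj: "F = ennreal f" "J = ennreal j" "0 \<le> f" "0 \<le> j"
      using Ffin by (metis ennreal_cases infinity_ennreal_def)
    have "ennreal f \<le> ennreal (1 / 2 * f + j)"
      using \<open>F \<le> ennreal (1 / 2) * F + J\<close> fj ennreal_mult[of "1 / 2" f] by (simp add: ennreal_plus)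
    hence "f \<le> 1 / 2 * f + j" using fj by (subst (asm) ennreal_le_iff) auto
    hence "f \<le> 2 * j" by simp
    hence "ennreal f \<le> ennreal (2 * j)" by (rule ennreal_leI)
    thus ?thesis using fj by (simp add: ennreal_mult)
  qed simp
  have "D t \<omega> powr p = exp (\<beta> * t) powr p * P t \<omega>" for \<omega>
    unfolding P_def using D_nonneg by (subst powr_mult[symmetric]) (auto simp: mult.assoc[symmetric] exp_add[symmetric])
  hence "(\<integral>\<^sup>+\<omega>. ennreal (D t \<omega> powr p) \<partial>\<gamma>) = ennreal (exp (\<beta> * t) powr p) * (\<integral>\<^sup>+\<omega>. ennreal (P t \<omega>) \<partial>\<gamma>)"
    by (simp add: ennreal_mult nn_integral_cmult P_def)
  also have "\<dots> \<le> ennreal (exp (\<beta> * t) powr p) * (2 * J)"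
    by (intro mult_left_mono order_trans[OF F[OF t] FJ]) auto
  also have "\<dots> = ennreal (exp (\<beta> * t) powr p * (2 * 4 powr p)) * (\<integral>\<^sup>+\<omega>. ennreal (a \<omega> powr p) \<partial>\<gamma>)"
    by (simp add: J_def ennreal_mult mult_ac)
  finally show ?thesis .
qed

end
end

section \<open>Discrete Riesz sums of separated points\<close>

text \<open>Packing: the balls of radius \<open>dm / 2\<close> around the points are disjoint and,
  for \<open>dm \<le> r\<close>, lie in the ball of radius \<open>3 * r / 2\<close>. For
  \<open>r < dm\<close> there are no such points.\<close>

lemma separated_card_le:
  fixes x :: "nat \<Rightarrow> 'a::euclidean_space"
  assumes sep: "\<And>i j. i < N \<Longrightarrow> j < N \<Longrightarrow> i \<noteq> j \<Longrightarrow> dm \<le> dist (x i) (x j)" and dm: "0 < dm"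
    and i: "i < N" and r: "0 < r"
  shows "real (card {j. j < N \<and> j \<noteq> i \<and> dist (x i) (x j) \<le> r}) \<le> (3 * r / dm) powr real DIM('a)"
proof (cases "dm \<le> r")
  case False
  hence "{j. j < N \<and> j \<noteq> i \<and> dist (x i) (x j) \<le> r} = {}" using sep[OF i] by force
  thus ?thesis by (simp only: card.empty of_nat_0 powr_ge_zero)
next
  case True
  let ?J = "{j. j < N \<and> j \<noteq> i \<and> dist (x i) (x j) \<le> r}" and ?d = "DIM('a)" and ?\<omega> = "unit_ball_vol (real DIM('a))"
  have "disjoint_family_on (\<lambda>j. ball (x j) (dm / 2)) ?J"
    unfolding disjoint_family_on_def
  proof (intro ballI impI)
    fix j k assume jk: "j \<in> ?J" "k \<in> ?J" "j \<noteq> k"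
    have "dm \<le> dist (x j) (x k)" using jk by (intro sep) auto
    thus "ball (x j) (dm / 2) \<inter> ball (x k) (dm / 2) = {}" by (intro disjoint_ballI) simp
  qed
  hence "(\<Sum>j\<in>?J. emeasure lborel (ball (x j) (dm / 2))) = emeasure lborel (\<Union>j\<in>?J. ball (x j) (dm / 2))"
    by (intro sum_emeasure) auto
  also have "\<dots> \<le> emeasure lborel (cball (x i) (3 * r / 2))"
  proof (rule emeasure_mono)
    show "(\<Union>j\<in>?J. ball (x j) (dm / 2)) \<subseteq> cball (x i) (3 * r / 2)"
    proof safe
      fix j z assume "dist (x i) (x j) \<le> r" "z \<in> ball (x j) (dm / 2)"
      thus "z \<in> cball (x i) (3 * r / 2)" using True dist_triangle[of "x i" z "x j"] by simp
    qed
  qed simp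
  also have "\<dots> = ennreal (?\<omega> * (3 * r / 2) powr real ?d)" using r by (intro emeasure_lborel_cball_powr) simp
  also have "(\<Sum>j\<in>?J. emeasure lborel (ball (x j) (dm / 2))) = (\<Sum>j\<in>?J. ennreal (?\<omega> * (dm / 2) powr real ?d))"
    using dm by (intro sum.cong refl) (simp add: emeasure_ball powr_realpow)
  also have "\<dots> = ennreal (real (card ?J) * (?\<omega> * (dm / 2) powr real ?d))"
    by (subst sum_ennreal) auto
  finally have "real (card ?J) * (?\<omega> * (dm / 2) powr real ?d) \<le> ?\<omega> * (3 * r / 2) powr real ?d"
    by (subst (asm) ennreal_le_iff) auto
  hence "?\<omega> * (real (card ?J) * (dm / 2) powr real ?d) \<le> ?\<omega> * (3 * r / 2) powr real ?d"
    by (simp only: mult.left_commute)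
  hence "real (card ?J) * (dm / 2) powr real ?d \<le> (3 * r / 2) powr real ?d"
    by (rule mult_left_le_imp_le) simp
  hence "real (card ?J) \<le> (3 * r / 2) powr real ?d / (dm / 2) powr real ?d"
    using dm by (simp add: le_divide_eq)
  also have "\<dots> = ((3 * r / 2) / (dm / 2)) powr real ?d" using r dm by (subst powr_divide) auto
  finally show ?thesis by simp
qed

text \<open>The radius \<open>R = n powr (1 / d) * dm\<close> is that of a ball filled by
  \<open>n\<close> points at distance \<open>dm\<close>. Points outside it contribute at most
  \<open>R powr - s\<close> each, those inside are controlled by the packing bound, and both parts
  are of order \<open>n powr (1 - s / d) * dm powr - s\<close>.\<close>

lemma near_riesz_sum_le:
  fixes x :: "nat \<Rightarrow> 'a::euclidean_space"
  assumes sep: "\<And>i j. i < N \<Longrightarrow> j < N \<Longrightarrow> i \<noteq> j \<Longrightarrow> dm \<le> dist (x i) (x j)" and dm: "0 < dm"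
    and i: "i < N" and s: "0 < s" "s < real DIM('a)" and J: "J \<subseteq> {j. j < N \<and> j \<noteq> i}"
  shows "(\<Sum>j\<in>J. riesz s (x i - x j)) \<le>
     (1 + dyadic_const s (real DIM('a)) * 3 powr real DIM('a)) * (real (card J) powr (1 - s / real DIM('a)) * dm powr - s)"
proof (cases "J = {}")
  case False
  let ?d = "real DIM('a)"
  have fin: "finite J" using J by (rule finite_subset) auto
  define n where "n = real (card J)"
  have n: "0 < n" using False fin by (simp add: n_def card_gt_0_iff)
  define R where "R = n powr (1 / ?d) * dm"
  have R: "0 < R" using n dm by (simp add: R_def)
  have Rpow: "R powr e = n powr (e / ?d) * dm powr e" for e
    using n dm by (simp add: R_def powr_mult powr_powr)
  define M where "M = distr (count_space J) borel x"
  have [measurable]: "x \<in> measurable (count_space J) borel" "cball (x i) R \<in> sets borel" by simp_all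
  have "(\<integral>\<^sup>+y. ennreal (riesz s (x i - y)) * indicator (cball (x i) R) y \<partial>M)
     \<le> ennreal (dyadic_const s ?d * (3 powr ?d * dm powr - ?d) * R powr (?d - s))"
  proof (rule nn_integral_riesz_cball_le)
    fix r :: real assume r: "0 < r"
    have "emeasure M (cball (x i) r - {x i}) = emeasure (count_space J) (x -` (cball (x i) r - {x i}) \<inter> J)"
      unfolding M_def by (subst emeasure_distr) auto
    also have "\<dots> = ennreal (real (card (x -` (cball (x i) r - {x i}) \<inter> J)))"
      using fin by (simp add: emeasure_count_space_finite ennreal_of_nat_eq_real_of_nat)
    also have "card (x -` (cball (x i) r - {x i}) \<inter> J) \<le> card {j. j < N \<and> j \<noteq> i \<and> dist (x i) (x j) \<le> r}"
      using J by (intro card_mono) auto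
    hence "ennreal (real (card (x -` (cball (x i) r - {x i}) \<inter> J))) \<le> ennreal ((3 * r / dm) powr ?d)"
      using separated_card_le[where x=x and N=N and dm=dm, OF sep dm i r] by (intro ennreal_leI) linarith
    also have "(3 * r / dm) powr ?d = 3 powr ?d * dm powr - ?d * r powr ?d"
      using r dm by (simp add: powr_divide powr_mult powr_minus_divide)
    finally show "emeasure M (cball (x i) r - {x i}) \<le> ennreal (3 powr ?d * dm powr - ?d * r powr ?d)" .
  qed (use s R dm in \<open>auto simp: M_def\<close>)
  also have "(\<integral>\<^sup>+y. ennreal (riesz s (x i - y)) * indicator (cball (x i) R) y \<partial>M)
     = (\<Sum>j\<in>J. ennreal (riesz s (x i - x j) * indicator (cball (x i) R) (x j)))"
    unfolding M_def using fin
    by (subst nn_integral_distr) (auto simp: nn_integral_count_space_finite ennreal_mult ennreal_indicator)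
  also have "\<dots> = ennreal (\<Sum>j\<in>J. riesz s (x i - x j) * indicator (cball (x i) R) (x j))"
    by (rule sum_ennreal) simp
  finally have in_R: "(\<Sum>j\<in>J. riesz s (x i - x j) * indicator (cball (x i) R) (x j)) \<le>
      dyadic_const s ?d * (3 powr ?d * dm powr - ?d) * R powr (?d - s)"
    using dyadic_const_pos[OF s(2)] by (subst (asm) ennreal_le_iff) auto
  have "dm powr - ?d * R powr (?d - s) = n powr ((?d - s) / ?d) * (dm powr - ?d * dm powr (?d - s))"
    unfolding Rpow by simp
  also have "dm powr - ?d * dm powr (?d - s) = dm powr - s" by (simp add: powr_add[symmetric])
  also have "(?d - s) / ?d = 1 - s / ?d" by (simp add: field_simps)
  finally have eq: "dm powr - ?d * R powr (?d - s) = n powr (1 - s / ?d) * dm powr - s" .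
  have "(\<Sum>j\<in>J. riesz s (x i - x j)) \<le> (\<Sum>j\<in>J. R powr - s + riesz s (x i - x j) * indicator (cball (x i) R) (x j))"
  proof (rule sum_mono)
    fix j
    show "riesz s (x i - x j) \<le> R powr - s + riesz s (x i - x j) * indicator (cball (x i) R) (x j)"
      using riesz_antimono[of s R "x i - x j"] R s by (cases "x j \<in> cball (x i) R") (auto simp: dist_norm)
  qed
  also have "\<dots> = n * R powr - s + (\<Sum>j\<in>J. riesz s (x i - x j) * indicator (cball (x i) R) (x j))"
    by (simp add: sum.distrib n_def)
  also have "n * R powr - s = n powr (1 - s / ?d) * dm powr - s"
  proof -
    have "n * n powr (- s / ?d) = n powr 1 * n powr (- s / ?d)" using n by simp
    also have "\<dots> = n powr (1 - s / ?d)" by (simp only: powr_add[symmetric]) simp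
    finally show ?thesis unfolding Rpow by simp
  qed
  also note in_R
  also have "dyadic_const s ?d * (3 powr ?d * dm powr - ?d) * R powr (?d - s)
      = dyadic_const s ?d * 3 powr ?d * (n powr (1 - s / ?d) * dm powr - s)"
    using eq by (simp only: mult.assoc)
  finally show ?thesis by (simp add: n_def algebra_simps)
qed simp

lemma nn_integral_uniform_count:
  assumes "0 < N"
  shows "(\<integral>\<^sup>+j. f j \<partial>uniform_count_measure {..<N}) = ennreal (1 / real N) * (\<Sum>j<N. f j)"
  unfolding uniform_count_measure_def
  by (subst nn_integral_point_measure_finite) (auto simp: sum_distrib_left)

lemma far_riesz_sum_le:
  fixes x :: "nat \<Rightarrow> 'a::euclidean_space"
  assumes i: "i < N" and s: "0 < s" "s < \<delta>" and A: "0 \<le> A"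
    and growth: "\<And>r. \<rho> \<le> r \<Longrightarrow> real (card {j. j < N \<and> dist (x i) (x j) \<le> r}) \<le> real N * (A * r powr \<delta>)"
  shows "(1 / real N) * (\<Sum>j | j < N \<and> \<rho> < dist (x i) (x j). riesz s (x i - x j)) \<le> 1 + dyadic_const s \<delta> * A"
proof -
  have N: "0 < N" using i by simp
  \<comment> \<open>Near points are moved to \<open>x i\<close>, where the kernel vanishes and which
    the punctured balls omit. The image measure is still a probability measure and satisfies the
    growth bound at every radius, not only from \<rho> on.\<close>
  define y where "y j = (if \<rho> < dist (x i) (x j) then x j else x i)" for j
  have [measurable]: "y \<in> measurable (uniform_count_measure {..<N}) borel"
    by (simp add: measurable_def space_uniform_count_measure sets_uniform_count_measure)
  define M where "M = distr (uniform_count_measure {..<N}) borel y"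
  interpret U: prob_space "uniform_count_measure {..<N}"
    using N by (intro prob_space_uniform_count_measure) auto
  have "(\<integral>\<^sup>+z. ennreal (riesz s (x i - z)) \<partial>M) \<le> ennreal (1 + dyadic_const s \<delta> * A)"
  proof (rule nn_integral_riesz_le)
    show "prob_space M" unfolding M_def by (rule U.prob_space_distr) measurable
    fix r :: real assume r: "0 < r"
    let ?S = "y -` (cball (x i) r - {x i}) \<inter> {..<N}"
    have "emeasure M (cball (x i) r - {x i}) = emeasure (uniform_count_measure {..<N}) ?S"
      unfolding M_def by (subst emeasure_distr) (auto simp: space_uniform_count_measure)
    also have "\<dots> = ennreal (real (card ?S) / real N)"
      using N by (subst emeasure_uniform_count_measure) auto
    also have "real (card ?S) \<le> real N * (A * r powr \<delta>)"
    proof (cases "?S = {}")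
      case True
      thus ?thesis using A by simp
    next
      case False
      then obtain j where "y j \<in> cball (x i) r" "y j \<noteq> x i" by blast
      hence "\<rho> < dist (x i) (x j)" "dist (x i) (x j) \<le> r" by (auto simp: y_def split: if_splits)
      hence "real (card {j. j < N \<and> dist (x i) (x j) \<le> r}) \<le> real N * (A * r powr \<delta>)" by (intro growth) simp
      moreover have "card ?S \<le> card {j. j < N \<and> dist (x i) (x j) \<le> r}"
        by (intro card_mono) (auto simp: y_def split: if_splits)
      ultimately show ?thesis by linarith
    qed
    hence "ennreal (real (card ?S) / real N) \<le> ennreal (A * r powr \<delta>)"
      using N by (intro ennreal_leI) (simp add: divide_le_eq mult.commute)
    finally show "emeasure M (cball (x i) r - {x i}) \<le> ennreal (A * r powr \<delta>)" .
  qed (use s A in \<open>auto simp: M_def\<close>)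
  also have "(\<integral>\<^sup>+z. ennreal (riesz s (x i - z)) \<partial>M) = ennreal (1 / real N) * (\<Sum>j<N. ennreal (riesz s (x i - y j)))"
    unfolding M_def using N by (subst nn_integral_distr) (auto simp: nn_integral_uniform_count)
  also have "\<dots> = ennreal ((1 / real N) * (\<Sum>j<N. riesz s (x i - y j)))"
    by (subst sum_ennreal, simp, subst ennreal_mult) (auto intro: sum_nonneg)
  also have "(\<Sum>j<N. riesz s (x i - y j)) = (\<Sum>j | j < N \<and> \<rho> < dist (x i) (x j). riesz s (x i - x j))"
    by (rule sum.mono_neutral_cong_right) (auto simp: y_def)
  finally show ?thesis
    using dyadic_const_pos[OF s(2)] A by (subst (asm) ennreal_le_iff) auto
qed

definition near_const :: "nat \<Rightarrow> real \<Rightarrow> real \<Rightarrow> real" where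
  "near_const d s A = (1 + dyadic_const s (real d) * 3 powr real d) * A powr (1 - s / real d)"

text \<open>Beyond \<rho> the counting bound acts like the growth bound of a density. At most
  \<open>N * A * \<rho> powr \<delta>\<close> particles lie closer, and for these only the minimal
  distance is available.\<close>

lemma riesz_sum_le:
  fixes x :: "nat \<Rightarrow> 'a::euclidean_space"
  assumes sep: "\<And>i j. i < N \<Longrightarrow> j < N \<Longrightarrow> i \<noteq> j \<Longrightarrow> dm \<le> dist (x i) (x j)" and dm: "0 < dm"
    and i: "i < N" and s: "0 < s" "s < real DIM('a)" "s < \<delta>" and A: "0 \<le> A" and \<rho>: "0 < \<rho>"
    and growth: "\<And>r. \<rho> \<le> r \<Longrightarrow> real (card {j. j < N \<and> dist (x i) (x j) \<le> r}) \<le> real N * (A * r powr \<delta>)"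
  shows "(1 / real N) * (\<Sum>j<N. riesz s (x i - x j)) \<le> 1 + dyadic_const s \<delta> * A +
     near_const DIM('a) s A * ((real N powr (1 / real DIM('a)) * dm) powr - s * \<rho> powr (\<delta> * (1 - s / real DIM('a))))"
proof -
  let ?d = "real DIM('a)"
  define J where "J = {j. j < N \<and> j \<noteq> i \<and> dist (x i) (x j) \<le> \<rho>}"
  define F where "F = {j. j < N \<and> \<rho> < dist (x i) (x j)}"
  have N: "0 < real N" using i by simp
  have e: "0 < 1 - s / ?d" using s by simp
  have "(\<Sum>j<N. riesz s (x i - x j)) = (\<Sum>j\<in>J \<union> F. riesz s (x i - x j))"
  proof (rule sum.mono_neutral_right)
    show "\<forall>j\<in>{..<N} - (J \<union> F). riesz s (x i - x j) = 0" by (auto simp: J_def F_def)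
  qed (auto simp: J_def F_def)
  also have "\<dots> = (\<Sum>j\<in>J. riesz s (x i - x j)) + (\<Sum>j\<in>F. riesz s (x i - x j))"
    by (rule sum.union_disjoint) (auto simp: J_def F_def)
  finally have split: "(1 / real N) * (\<Sum>j<N. riesz s (x i - x j)) =
      (1 / real N) * (\<Sum>j\<in>J. riesz s (x i - x j)) + (1 / real N) * (\<Sum>j\<in>F. riesz s (x i - x j))"
    by (simp only: distrib_left)
  have far: "(1 / real N) * (\<Sum>j\<in>F. riesz s (x i - x j)) \<le> 1 + dyadic_const s \<delta> * A"
    unfolding F_def by (rule far_riesz_sum_le[OF i s(1,3) A growth])
  define D where "D = 1 + dyadic_const s ?d * 3 powr ?d"
  have D: "0 \<le> D" using dyadic_const_pos[OF s(2)] by (simp add: D_def)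
  have "card J \<le> card {j. j < N \<and> dist (x i) (x j) \<le> \<rho>}"
    unfolding J_def by (intro card_mono) auto
  hence cardJ: "real (card J) \<le> real N * (A * \<rho> powr \<delta>)" using growth[OF order_refl] by linarith
  have "(\<Sum>j\<in>J. riesz s (x i - x j)) \<le> D * (real (card J) powr (1 - s / ?d) * dm powr - s)"
    unfolding D_def by (rule near_riesz_sum_le[OF sep dm i s(1,2)]) (auto simp: J_def)
  also have "\<dots> \<le> D * ((real N * (A * \<rho> powr \<delta>)) powr (1 - s / ?d) * dm powr - s)"
    using e by (intro mult_left_mono mult_right_mono powr_mono2 cardJ D) auto
  finally have "(1 / real N) * (\<Sum>j\<in>J. riesz s (x i - x j)) \<le> (1 / real N) * (D * ((real N * (A * \<rho> powr \<delta>)) powr (1 - s / ?d) * dm powr - s))"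
    by (rule mult_left_mono) simp
  also have "(real N * (A * \<rho> powr \<delta>)) powr (1 - s / ?d) = real N powr (1 - s / ?d) * (A powr (1 - s / ?d) * \<rho> powr (\<delta> * (1 - s / ?d)))"
    using N A \<rho> by (simp add: powr_mult powr_powr)
  also have "(1 / real N) * (D * (real N powr (1 - s / ?d) * (A powr (1 - s / ?d) * \<rho> powr (\<delta> * (1 - s / ?d))) * dm powr - s))
     = (D * A powr (1 - s / ?d)) * (((1 / real N) * real N powr (1 - s / ?d) * dm powr - s) * \<rho> powr (\<delta> * (1 - s / ?d)))"
    by (simp only: mult_ac)
  also have "(1 / real N) * real N powr (1 - s / ?d) * dm powr - s = (real N powr (1 / ?d) * dm) powr - s"
  proof -
    have "(1 / real N) * real N powr (1 - s / ?d) = real N powr - 1 * real N powr (1 - s / ?d)"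
      using N by (simp add: powr_minus_divide)
    also have "\<dots> = real N powr (1 / ?d * - s)" by (simp only: powr_add[symmetric]) simp
    finally show ?thesis using dm by (simp only: powr_mult powr_powr) 
  qed
  finally show ?thesis using split far by (simp add: near_const_def D_def)
qed

section \<open>Coupling of the particles with the limit flow\<close>

lemma norm_increment_le_nn_integral:
  fixes z :: "real \<Rightarrow> 'a::euclidean_space"
  assumes "0 \<le> t" and d: "\<And>s. 0 \<le> s \<Longrightarrow> s \<le> t \<Longrightarrow> (z has_vector_derivative z' s) (at s within {0..t})"
    and c: "continuous_on {0..t} z'"
  shows "ennreal (norm (z t - z 0)) \<le> (\<integral>\<^sup>+s. ennreal (norm (z' s)) * indicator {0..t} s \<partial>lborel)"
proof -
  have "(z' has_integral (z t - z 0)) {0..t}"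
    by (rule fundamental_theorem_of_calculus) (use assms in auto)
  hence I: "integral {0..t} z' = z t - z 0" by (rule integral_unique)
  have si: "set_integrable lborel {0..t} z'" by (rule borel_integrable_atLeastAtMost'[OF c])
  have "z t - z 0 = (\<integral>s. indicator {0..t} s *\<^sub>R z' s \<partial>lborel)"
    using set_borel_integral_eq_integral(2)[OF si] I by (simp add: set_lebesgue_integral_def)
  moreover have "ennreal (norm (\<integral>s. indicator {0..t} s *\<^sub>R z' s \<partial>lborel)) \<le> (\<integral>\<^sup>+s. ennreal (norm (indicator {0..t} s *\<^sub>R z' s)) \<partial>lborel)"
    by (rule integral_norm_bound_ennreal) (use si in \<open>simp add: set_integrable_def\<close>)
  moreover have "ennreal (norm (indicator {0..t} s *\<^sub>R z' s)) = ennreal (norm (z' s)) * indicator {0..t} s" for s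
    by (auto simp: indicator_def)
  ultimately show ?thesis by simp
qed

text \<open>The coupling \<gamma> pairs initial particle positions with points distributed by
  \<open>\<sigma>\<^sub>0\<close>. Particles move by label rather than by a map of space, so
  \<open>idx\<close> recovers the label from the position; the last assumption says that the labels
  are uniformly distributed.\<close>

locale mean_field = transport K \<alpha> C\<^sub>K q q' m \<sigma>\<^sub>0 \<sigma> + particles K \<alpha> C\<^sub>K N lam X V b \<Lambda>
  for K :: "'a::euclidean_space \<Rightarrow> 'a" and \<alpha> C\<^sub>K q q' m \<sigma>\<^sub>0 \<sigma> N lam X V b \<Lambda> +
  fixes Y :: "real \<Rightarrow> 'a \<Rightarrow> 'a" and \<gamma> :: "('a \<times> 'a) measure" and idx :: "'a \<Rightarrow> nat"
  assumes flow: "is_flow Y" and prob_gamma: "prob_space \<gamma>" and sets_gamma [measurable_cong]: "sets \<gamma> = sets borel"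
    and snd_marginal: "distr \<gamma> borel snd = law \<sigma>\<^sub>0"
    and idx_measurable [measurable]: "idx \<in> measurable borel (count_space UNIV)" and idx_less: "\<And>x. idx x < N"
    and fst_marginal: "distr \<gamma> (count_space UNIV) (\<lambda>\<omega>. idx (fst \<omega>)) = distr (uniform_count_measure {..<N}) (count_space UNIV) (\<lambda>j. j)"
begin

sublocale \<gamma>: prob_space \<gamma> by (rule prob_gamma)

text \<open>Extends trajectories known on \<open>{0..b}\<close> to all times, as
  \<open>coupled_gronwall\<close> asks for measurability on the whole line.\<close>

definition clamp :: "real \<Rightarrow> real" where "clamp s = max 0 (min b s)"

definition I :: "'a \<times> 'a \<Rightarrow> nat" where "I \<omega> = idx (fst \<omega>)"

definition D :: "real \<Rightarrow> 'a \<times> 'a \<Rightarrow> real" where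
  "D s \<omega> = norm (X (I \<omega>) (clamp s) - Y s (snd \<omega>))"

definition k :: "real \<Rightarrow> 'a \<times> 'a \<Rightarrow> 'a \<times> 'a \<Rightarrow> real" where
  "k s \<omega> \<omega>' = \<kappa> (X (I \<omega>) (clamp s) - X (I \<omega>') (clamp s)) + \<kappa> (Y s (snd \<omega>) - Y s (snd \<omega>'))"

definition S :: real where "S = C\<^sub>K * (1 + \<Lambda>)"

text \<open>Besides the initial distance it holds the inertial terms
  \<open>norm (V i 0) / lam\<close> and \<open>norm (V i t) / lam\<close>, the latter estimated by
  \<open>norm_V_le\<close>.\<close>

definition a :: "'a \<times> 'a \<Rightarrow> real" where
  "a \<omega> = D 0 \<omega> + (2 * norm (V (I \<omega>) 0) + S) / lam"

definition \<Lambda>\<sigma> :: real where "\<Lambda>\<sigma> = riesz_const DIM('a) \<alpha> q' m"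

lemma clamp_eq [simp]: "0 \<le> s \<Longrightarrow> s \<le> b \<Longrightarrow> clamp s = s"
  and clamp_bounds [simp]: "0 \<le> clamp s" "clamp s \<le> b"
  using b_nonneg by (auto simp: clamp_def)

lemma Sigma_riesz_one_le: "1 \<le> \<Lambda>\<sigma>"
  unfolding \<Lambda>\<sigma>_def riesz_const_def
  using dyadic_const_pos[OF riesz_exponent_less_growth] growth_const_nonneg[of m] m by simp

lemma riesz_sigma: "0 \<le> t \<Longrightarrow> riesz_bounded \<Lambda>\<sigma> (law (\<sigma> t))"
  unfolding \<Lambda>\<sigma>_def by (rule riesz_bounded_sigma[OF flow])

lemma I_less [simp]: "I \<omega> < N" by (simp add: I_def idx_less)

lemma fst_measurable_gamma [measurable]: "fst \<in> measurable \<gamma> borel"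
  and snd_measurable_gamma [measurable]: "snd \<in> measurable \<gamma> borel"
  unfolding measurable_cong_sets[OF sets_gamma refl]
  by (intro borel_measurable_continuous_onI continuous_intros)+

lemma I_measurable [measurable]: "I \<in> measurable \<gamma> (count_space UNIV)"
  unfolding I_def[abs_def] by measurable

lemma S_nonneg: "0 \<le> S" using CK_nonneg Lambda_nonneg by (simp add: S_def)

lemma nn_integral_I: "(\<integral>\<^sup>+\<omega>. f (I \<omega>) \<partial>\<gamma>) = ennreal (1 / real N) * (\<Sum>j<N. f j)"
proof -
  have "(\<integral>\<^sup>+\<omega>. f (I \<omega>) \<partial>\<gamma>) = (\<integral>\<^sup>+j. f j \<partial>distr \<gamma> (count_space UNIV) I)"
    by (subst nn_integral_distr) auto
  also have "\<dots> = (\<integral>\<^sup>+j. f j \<partial>distr (uniform_count_measure {..<N}) (count_space UNIV) (\<lambda>j. j))"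
    unfolding fst_marginal[symmetric] I_def ..
  also have "\<dots> = (\<integral>\<^sup>+j. f j \<partial>uniform_count_measure {..<N})"
    by (subst nn_integral_distr) (auto simp: measurable_def sets_uniform_count_measure space_uniform_count_measure)
  finally show ?thesis using N_pos by (simp add: nn_integral_uniform_count)
qed

lemma integral_I:
  fixes f :: "nat \<Rightarrow> 'a"
  shows "integrable \<gamma> (\<lambda>\<omega>. f (I \<omega>))" "(\<integral>\<omega>. f (I \<omega>) \<partial>\<gamma>) = (1 / real N) *\<^sub>R (\<Sum>j<N. f j)"
proof -
  show "integrable \<gamma> (\<lambda>\<omega>. f (I \<omega>))"
  proof (rule \<gamma>.integrable_const_bound[where B="\<Sum>j<N. norm (f j)"])
    show "AE \<omega> in \<gamma>. norm (f (I \<omega>)) \<le> (\<Sum>j<N. norm (f j))"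
      by (intro always_eventually allI member_le_sum) auto
    show "(\<lambda>\<omega>. f (I \<omega>)) \<in> borel_measurable \<gamma>" by measurable
  qed
  have "(\<integral>\<omega>. f (I \<omega>) \<partial>\<gamma>) = (\<integral>j. f j \<partial>distr \<gamma> (count_space UNIV) I)"
    by (subst integral_distr) auto
  also have "\<dots> = (\<integral>j. f j \<partial>distr (uniform_count_measure {..<N}) (count_space UNIV) (\<lambda>j. j))"
    unfolding fst_marginal[symmetric] I_def ..
  also have "\<dots> = (\<integral>j. f j \<partial>uniform_count_measure {..<N})"
    by (subst integral_distr) (auto simp: measurable_def sets_uniform_count_measure space_uniform_count_measure)
  also have "\<dots> = (1 / real N) *\<^sub>R (\<Sum>j<N. f j)"
    unfolding uniform_count_measure_def by (subst lebesgue_integral_point_measure_finite) (auto simp: scaleR_sum_right)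
  finally show "(\<integral>\<omega>. f (I \<omega>) \<partial>\<gamma>) = (1 / real N) *\<^sub>R (\<Sum>j<N. f j)" .
qed

lemma Y_continuous: "continuous_on UNIV (\<lambda>(t, x). Y t x)"
  and Y_0 [simp]: "Y 0 x = x"
  and Y_deriv: "((\<lambda>s. Y s x) has_vector_derivative velocity t (Y t x)) (at t)"
  and velocity_Y_continuous: "continuous_on UNIV (\<lambda>t. velocity t (Y t x))"
  and Y_push: "0 \<le> t \<Longrightarrow> law (\<sigma> t) = distr (law \<sigma>\<^sub>0) borel (Y t)"
  and Y_growth: "0 \<le> t \<Longrightarrow> 0 < r \<Longrightarrow> emeasure (law (\<sigma> t)) (cball x r)
         \<le> ennreal (growth_const DIM('a) q' m * r powr growth_exponent DIM('a) q')"
  using flow unfolding is_flow_def by blast+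

lemma Y_measurable [measurable (raw)]:
  assumes "f \<in> measurable M borel" "g \<in> measurable M borel"
  shows "(\<lambda>x. Y (f x) (g x)) \<in> borel_measurable M"
proof -
  have "(\<lambda>(t, x). Y t x) \<in> borel_measurable (borel \<Otimes>\<^sub>M borel)"
    unfolding borel_prod by (rule borel_measurable_continuous_onI[OF Y_continuous])
  from measurable_compose[OF measurable_Pair[OF assms] this] show ?thesis by simp
qed

lemma X_continuous: "i < N \<Longrightarrow> continuous_on {0..b} (X i)"
  by (rule continuous_on_vector_derivative[OF X_deriv]) auto

text \<open>Each label contributes a continuous function of time, and \<open>I\<close> selects
  measurably among countably many of them.\<close>

lemma X_clamp_measurable [measurable (raw)]:
  assumes f: "f \<in> measurable M borel" and g: "g \<in> measurable M \<gamma>"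
  shows "(\<lambda>x. X (I (g x)) (clamp (f x))) \<in> borel_measurable M"
proof -
  have c: "(\<lambda>s. X i (clamp s)) \<in> borel_measurable borel" if "i < N" for i
  proof (rule borel_measurable_continuous_onI)
    have "continuous_on UNIV clamp" unfolding clamp_def[abs_def] by (intro continuous_intros)
    thus "continuous_on UNIV (\<lambda>s. X i (clamp s))"
      by (rule continuous_on_compose2[OF X_continuous[OF that]]) auto
  qed
  have "(\<lambda>x. if i < N then X i (clamp (f x)) else 0) \<in> borel_measurable M" for i
    using measurable_compose[OF f c, of i] by (cases "i < N") auto
  hence "(\<lambda>x. if I (g x) < N then X (I (g x)) (clamp (f x)) else 0) \<in> borel_measurable M"
    by (rule measurable_compose_countable) (rule measurable_compose[OF g I_measurable])
  thus ?thesis by simp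
qed

lemma snd_marginal_nn:
  "f \<in> borel_measurable borel \<Longrightarrow> 0 \<le> t \<Longrightarrow> (\<integral>\<^sup>+\<omega>. f (Y t (snd \<omega>)) \<partial>\<gamma>) = (\<integral>\<^sup>+z. f z \<partial>law (\<sigma> t))"
  by (simp add: Y_push snd_marginal[symmetric] nn_integral_distr)

lemma snd_marginal_integral:
  fixes f :: "'a \<Rightarrow> 'a"
  assumes [measurable]: "f \<in> borel_measurable borel" and t: "0 \<le> t" and f: "integrable (law (\<sigma> t)) f"
  shows "integrable \<gamma> (\<lambda>\<omega>. f (Y t (snd \<omega>)))" "(\<integral>\<omega>. f (Y t (snd \<omega>)) \<partial>\<gamma>) = (\<integral>z. f z \<partial>law (\<sigma> t))"
proof -
  show "integrable \<gamma> (\<lambda>\<omega>. f (Y t (snd \<omega>)))"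
    using f unfolding Y_push[OF t] snd_marginal[symmetric]
    by (simp add: integrable_distr_eq)
  show "(\<integral>\<omega>. f (Y t (snd \<omega>)) \<partial>\<gamma>) = (\<integral>z. f z \<partial>law (\<sigma> t))"
    unfolding Y_push[OF t] snd_marginal[symmetric] by (simp add: integral_distr)
qed

text \<open>The particle part of the kernel integrates to a discrete Riesz sum, the other part to
  the Riesz potential of \<open>law (\<sigma> s)\<close>.\<close>

lemma k_integral_le:
  assumes s: "0 \<le> s" "s \<le> b"
  shows "(\<integral>\<^sup>+\<omega>'. ennreal (k s \<omega> \<omega>') \<partial>\<gamma>) \<le> ennreal (\<Lambda> + \<Lambda>\<sigma>)"
proof -
  have "(\<integral>\<^sup>+\<omega>'. ennreal (k s \<omega> \<omega>') \<partial>\<gamma>) = (\<integral>\<^sup>+\<omega>'. ennreal (\<kappa> (X (I \<omega>) s - X (I \<omega>') s)) \<partial>\<gamma>) +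
      (\<integral>\<^sup>+\<omega>'. ennreal (\<kappa> (Y s (snd \<omega>) - Y s (snd \<omega>'))) \<partial>\<gamma>)"
    unfolding k_def using s by (subst nn_integral_add[symmetric]) (auto simp: ennreal_plus)
  also have "(\<integral>\<^sup>+\<omega>'. ennreal (\<kappa> (X (I \<omega>) s - X (I \<omega>') s)) \<partial>\<gamma>) = ennreal ((1 / real N) * (\<Sum>j<N. \<kappa> (X (I \<omega>) s - X j s)))"
    unfolding nn_integral_I[of "\<lambda>j. ennreal (\<kappa> (X (I \<omega>) s - X j s))"]
    by (subst sum_ennreal, simp, subst ennreal_mult) (auto intro: sum_nonneg)
  also have "\<dots> \<le> ennreal \<Lambda>" by (intro ennreal_leI riesz_sum s) simp
  also have "(\<integral>\<^sup>+\<omega>'. ennreal (\<kappa> (Y s (snd \<omega>) - Y s (snd \<omega>'))) \<partial>\<gamma>) = (\<integral>\<^sup>+z. ennreal (\<kappa> (Y s (snd \<omega>) - z)) \<partial>law (\<sigma> s))"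
    using s by (intro snd_marginal_nn[of "\<lambda>z. ennreal (\<kappa> (Y s (snd \<omega>) - z))"]) auto
  also have "\<dots> \<le> ennreal \<Lambda>\<sigma>" using riesz_sigma[OF s(1)] by (simp add: riesz_bounded_def)
  finally show ?thesis using Lambda_nonneg Sigma_riesz_one_le by (simp add: ennreal_plus add_mono)
qed

lemma D_nonneg [simp]: "0 \<le> D s \<omega>"
  by (simp add: D_def)

lemma a_nonneg: "0 \<le> a \<omega>"
  using S_nonneg lam_pos by (simp add: a_def)

text \<open>Force and limit velocity are integrals of \<open>K0\<close> against the same coupling,
  taken along its two components. Under the integral \<open>K0_diff_le\<close> applies with
  \<open>norm (x - y) \<le> D s \<omega> + D s \<omega>'\<close>. The constant is
  \<open>C1 + 1\<close> because \<open>coupled_gronwall\<close> asks for a positive one.\<close>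

lemma velocity_difference_le:
  assumes s: "0 \<le> s" "s \<le> b"
  shows "ennreal (norm (F (I \<omega>) s - velocity s (Y s (snd \<omega>)))) \<le> ennreal (C1 + 1) *
    (ennreal (\<Lambda> + \<Lambda>\<sigma>) * ennreal (D s \<omega>) + (\<integral>\<^sup>+\<omega>'. ennreal (k s \<omega> \<omega>') * ennreal (D s \<omega>') \<partial>\<gamma>))"
proof -
  define f where "f \<omega>' = K0 (X (I \<omega>) s - X (I \<omega>') s)" for \<omega>'
  define g where "g \<omega>' = K0 (Y s (snd \<omega>) - Y s (snd \<omega>'))" for \<omega>' :: "'a \<times> 'a"
  have f: "integrable \<gamma> f" "(\<integral>\<omega>'. f \<omega>' \<partial>\<gamma>) = F (I \<omega>) s"
    using integral_I[of "\<lambda>j. K0 (X (I \<omega>) s - X j s)"] by (simp_all add: f_def[abs_def] F_def force_def)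
  have "(\<lambda>z. K0 (Y s (snd \<omega>) - z)) \<in> borel_measurable borel" by measurable
  from snd_marginal_integral[OF this s(1) K0_integrable[OF riesz_sigma[OF s(1)]]]
  have g: "integrable \<gamma> g" "(\<integral>\<omega>'. g \<omega>' \<partial>\<gamma>) = velocity s (Y s (snd \<omega>))"
    using s by (simp_all add: g_def[abs_def] velocity_def kconv_def)
  have pt: "ennreal (norm (f \<omega>' - g \<omega>')) \<le> ennreal (C1 + 1) * (ennreal (k s \<omega> \<omega>') * ennreal (D s \<omega>) + ennreal (k s \<omega> \<omega>') * ennreal (D s \<omega>'))" for \<omega>'
  proof -
    define x where "x = X (I \<omega>) s - X (I \<omega>') s"
    define y where "y = Y s (snd \<omega>) - Y s (snd \<omega>')"
    have k: "k s \<omega> \<omega>' = \<kappa> x + \<kappa> y" using s by (simp add: k_def x_def y_def)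
    have "norm (x - y) \<le> D s \<omega> + D s \<omega>'"
      using norm_triangle_ineq4[of "X (I \<omega>) s - Y s (snd \<omega>)" "X (I \<omega>') s - Y s (snd \<omega>')"] s
      by (simp add: D_def x_def y_def algebra_simps)
    hence "C1 * norm (x - y) * (\<kappa> x + \<kappa> y) \<le> (C1 + 1) * (D s \<omega> + D s \<omega>') * (\<kappa> x + \<kappa> y)"
      using C1_nonneg by (intro mult_mono) (auto simp: D_def)
    with K0_diff_le[of x y] have "norm (f \<omega>' - g \<omega>') \<le> (C1 + 1) * (k s \<omega> \<omega>' * D s \<omega> + k s \<omega> \<omega>' * D s \<omega>')"
      by (simp add: f_def g_def x_def[symmetric] y_def[symmetric] k algebra_simps)
    hence "ennreal (norm (f \<omega>' - g \<omega>')) \<le> ennreal ((C1 + 1) * (k s \<omega> \<omega>' * D s \<omega> + k s \<omega> \<omega>' * D s \<omega>'))"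
      by (rule ennreal_leI)
    thus ?thesis using C1_nonneg by (simp add: ennreal_mult ennreal_plus k D_def)
  qed
  have [measurable]: "(\<lambda>\<omega>'. k s \<omega> \<omega>') \<in> borel_measurable \<gamma>" "D s \<in> borel_measurable \<gamma>"
    unfolding k_def D_def[abs_def] by measurable
  have "F (I \<omega>) s - velocity s (Y s (snd \<omega>)) = (\<integral>\<omega>'. f \<omega>' - g \<omega>' \<partial>\<gamma>)" using f g by simp
  hence "ennreal (norm (F (I \<omega>) s - velocity s (Y s (snd \<omega>)))) \<le> (\<integral>\<^sup>+\<omega>'. ennreal (norm (f \<omega>' - g \<omega>')) \<partial>\<gamma>)"
    using integral_norm_bound_ennreal[of \<gamma> "\<lambda>\<omega>'. f \<omega>' - g \<omega>'"] f g by simp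
  also have "\<dots> \<le> (\<integral>\<^sup>+\<omega>'. ennreal (C1 + 1) * (ennreal (k s \<omega> \<omega>') * ennreal (D s \<omega>) + ennreal (k s \<omega> \<omega>') * ennreal (D s \<omega>')) \<partial>\<gamma>)"
    by (intro nn_integral_mono pt)
  also have "\<dots> = ennreal (C1 + 1) * ((\<integral>\<^sup>+\<omega>'. ennreal (k s \<omega> \<omega>') \<partial>\<gamma>) * ennreal (D s \<omega>) + (\<integral>\<^sup>+\<omega>'. ennreal (k s \<omega> \<omega>') * ennreal (D s \<omega>') \<partial>\<gamma>))"
    by (simp add: nn_integral_cmult nn_integral_add nn_integral_multc)
  also have "\<dots> \<le> ennreal (C1 + 1) * (ennreal (\<Lambda> + \<Lambda>\<sigma>) * ennreal (D s \<omega>) + (\<integral>\<^sup>+\<omega>'. ennreal (k s \<omega> \<omega>') * ennreal (D s \<omega>') \<partial>\<gamma>))"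
    by (intro mult_left_mono add_right_mono mult_right_mono k_integral_le s) auto
  finally show ?thesis .
qed

text \<open>\<open>X + V / lam - Y\<close> has derivative force minus limit velocity, free of
  \<open>lam\<close>. Passing to \<open>X - Y\<close> costs the velocities at times 0 and
  \<open>t\<close> divided by \<open>lam\<close>, which \<open>a\<close> collects.\<close>

lemma D_inequality:
  assumes t: "0 \<le> t" "t \<le> b"
  shows "ennreal (D t \<omega>) \<le> ennreal (a \<omega>) + ennreal (C1 + 1) * (\<integral>\<^sup>+s. (ennreal (\<Lambda> + \<Lambda>\<sigma>) * ennreal (D s \<omega>) +
     (\<integral>\<^sup>+\<omega>'. ennreal (k s \<omega> \<omega>') * ennreal (D s \<omega>') \<partial>\<gamma>)) * indicator {0..t} s \<partial>lborel)"
proof -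
  define i where "i = I \<omega>"
  have i: "i < N" by (simp add: i_def)
  define y where "y s = Y s (snd \<omega>)" for s
  define \<psi> where "\<psi> s = X i s + (1 / lam) *\<^sub>R V i s - y s" for s
  define \<psi>' where "\<psi>' s = F i s - velocity s (y s)" for s
  have F_continuous: "continuous_on {0..b} (F i)"
  proof -
    have "continuous_on {0..b} (\<lambda>s. K0 (X i s - X j s))" if j: "j < N" for j
    proof (cases "i = j")
      case False
      have "continuous_on {0..b} (\<lambda>s. K (X i s - X j s))"
        by (rule continuous_on_compose2[OF continuous_on_K])
           (use no_collision[OF i j False] in \<open>auto intro!: continuous_intros X_continuous i j\<close>)
      also have "?this \<longleftrightarrow> ?thesis"
        using no_collision[OF i j False] by (intro continuous_on_cong) (auto simp: K0_def)
      finally show ?thesis .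
    qed simp
    thus ?thesis unfolding F_def[abs_def] force_def by (intro continuous_intros) auto
  qed
  have \<psi>d: "(\<psi> has_vector_derivative \<psi>' s) (at s within {0..t})" if "0 \<le> s" "s \<le> t" for s
  proof -
    have sb: "0 \<le> s" "s \<le> b" using that t by auto
    have "((\<lambda>s. (1 / lam) *\<^sub>R V i s) has_vector_derivative (1 / lam) *\<^sub>R (lam *\<^sub>R (- V i s + force N (\<lambda>j. X j s) i))) (at s within {0..b})"
      by (rule bounded_linear.has_vector_derivative[OF bounded_linear_scaleR_right V_deriv[OF i sb]])
    from has_vector_derivative_diff[OF has_vector_derivative_add[OF X_deriv[OF i sb] this]
        has_vector_derivative_at_within[OF Y_deriv[of "snd \<omega>" s]]]
    have "(\<psi> has_vector_derivative \<psi>' s) (at s within {0..b})"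
      using lam_pos by (simp add: \<psi>_def[abs_def] \<psi>'_def y_def F_def)
    thus ?thesis by (rule has_vector_derivative_within_subset) (use t in auto)
  qed
  have "continuous_on {0..t} \<psi>'"
    unfolding \<psi>'_def[abs_def] y_def
    by (intro continuous_on_diff continuous_on_subset[OF F_continuous] continuous_on_subset[OF velocity_Y_continuous]) (use t in auto)
  from norm_increment_le_nn_integral[OF t(1) \<psi>d this]
  have "ennreal (norm (\<psi> t - \<psi> 0)) \<le> (\<integral>\<^sup>+s. ennreal (norm (\<psi>' s)) * indicator {0..t} s \<partial>lborel)" .
  also have "\<dots> \<le> (\<integral>\<^sup>+s. ennreal (C1 + 1) * ((ennreal (\<Lambda> + \<Lambda>\<sigma>) * ennreal (D s \<omega>) +
     (\<integral>\<^sup>+\<omega>'. ennreal (k s \<omega> \<omega>') * ennreal (D s \<omega>') \<partial>\<gamma>)) * indicator {0..t} s) \<partial>lborel)"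
  proof (rule nn_integral_mono)
    fix s
    show "ennreal (norm (\<psi>' s)) * indicator {0..t} s \<le> ennreal (C1 + 1) * ((ennreal (\<Lambda> + \<Lambda>\<sigma>) * ennreal (D s \<omega>) +
     (\<integral>\<^sup>+\<omega>'. ennreal (k s \<omega> \<omega>') * ennreal (D s \<omega>') \<partial>\<gamma>)) * indicator {0..t} s)"
      using velocity_difference_le[of s \<omega>] t by (auto simp: indicator_def \<psi>'_def i_def y_def)
  qed
  also have "\<dots> = ennreal (C1 + 1) * (\<integral>\<^sup>+s. (ennreal (\<Lambda> + \<Lambda>\<sigma>) * ennreal (D s \<omega>) +
     (\<integral>\<^sup>+\<omega>'. ennreal (k s \<omega> \<omega>') * ennreal (D s \<omega>') \<partial>\<gamma>)) * indicator {0..t} s \<partial>lborel)"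
  proof (rule nn_integral_cmult)
    have sp: "\<omega> \<in> space \<gamma>" using sets_eq_imp_space_eq[OF sets_gamma] by simp
    note [measurable] = measurable_const[OF sp]
    have [measurable]: "(\<lambda>s. D s \<omega>) \<in> borel_measurable lborel"
      unfolding D_def using X_clamp_measurable[of "\<lambda>s. s" lborel "\<lambda>_. \<omega>"] sp by measurable
    have "(\<lambda>z. ennreal (k (fst z) \<omega> (snd z)) * ennreal (D (fst z) (snd z))) \<in> borel_measurable (lborel \<Otimes>\<^sub>M \<gamma>)"
    proof -
      have [measurable]: "(\<lambda>z. X (I \<omega>) (clamp (fst z))) \<in> borel_measurable (lborel \<Otimes>\<^sub>M \<gamma>)"
        using X_clamp_measurable[of "fst" "lborel \<Otimes>\<^sub>M \<gamma>" "\<lambda>_. \<omega>"] sp by simp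
      show ?thesis unfolding k_def D_def by measurable
    qed
    hence [measurable]: "(\<lambda>s. \<integral>\<^sup>+\<omega>'. ennreal (k s \<omega> \<omega>') * ennreal (D s \<omega>') \<partial>\<gamma>) \<in> borel_measurable lborel"
      using \<gamma>.borel_measurable_nn_integral_fst[of "\<lambda>z. ennreal (k (fst z) \<omega> (snd z)) * ennreal (D (fst z) (snd z))" lborel] by simp
    show "(\<lambda>s. (ennreal (\<Lambda> + \<Lambda>\<sigma>) * ennreal (D s \<omega>) + (\<integral>\<^sup>+\<omega>'. ennreal (k s \<omega> \<omega>') * ennreal (D s \<omega>') \<partial>\<gamma>)) * indicator {0..t} s) \<in> borel_measurable lborel"
      by measurable
  qed
  finally have int: "ennreal (norm (\<psi> t - \<psi> 0)) \<le> ennreal (C1 + 1) * (\<integral>\<^sup>+s. (ennreal (\<Lambda> + \<Lambda>\<sigma>) * ennreal (D s \<omega>) +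
     (\<integral>\<^sup>+\<omega>'. ennreal (k s \<omega> \<omega>') * ennreal (D s \<omega>') \<partial>\<gamma>)) * indicator {0..t} s \<partial>lborel)" .
  have "D t \<omega> \<le> a \<omega> + norm (\<psi> t - \<psi> 0)"
  proof -
    have "X i t - y t = (\<psi> t - \<psi> 0) + (X i 0 - y 0) + (1 / lam) *\<^sub>R V i 0 - (1 / lam) *\<^sub>R V i t"
      by (simp add: \<psi>_def)
    hence "norm (X i t - y t) = norm ((\<psi> t - \<psi> 0) + (X i 0 - y 0) + (1 / lam) *\<^sub>R V i 0 - (1 / lam) *\<^sub>R V i t)"
      by (rule arg_cong)
    hence "norm (X i t - y t) \<le> norm (\<psi> t - \<psi> 0) + norm (X i 0 - y 0) + norm ((1 / lam) *\<^sub>R V i 0) + norm ((1 / lam) *\<^sub>R V i t)"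
      using norm_triangle_ineq4[of "(\<psi> t - \<psi> 0) + (X i 0 - y 0) + (1 / lam) *\<^sub>R V i 0" "(1 / lam) *\<^sub>R V i t"]
        norm_triangle_ineq[of "(\<psi> t - \<psi> 0) + (X i 0 - y 0)" "(1 / lam) *\<^sub>R V i 0"]
        norm_triangle_ineq[of "\<psi> t - \<psi> 0" "X i 0 - y 0"] by linarith
    moreover have "norm ((1 / lam) *\<^sub>R V i t) \<le> (norm (V i 0) + S) / lam"
      using norm_V_le[OF i t] lam_pos by (simp add: S_def divide_right_mono)
    moreover have "norm ((1 / lam) *\<^sub>R V i 0) = norm (V i 0) / lam" using lam_pos by simp
    moreover have "a \<omega> = norm (X i 0 - y 0) + norm (V i 0) / lam + (norm (V i 0) + S) / lam"
      using b_nonneg by (simp add: a_def D_def i_def y_def add_divide_distrib)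
    moreover have "D t \<omega> = norm (X i t - y t)" using t by (simp add: D_def i_def y_def)
    ultimately show ?thesis by linarith
  qed
  hence "ennreal (D t \<omega>) \<le> ennreal (a \<omega>) + ennreal (norm (\<psi> t - \<psi> 0))"
    using ennreal_leI[of "D t \<omega>" "a \<omega> + norm (\<psi> t - \<psi> 0)"] by (simp add: a_nonneg)
  also note int
  finally show ?thesis by (simp add: add_left_mono)
qed

sublocale G: coupled_gronwall \<gamma> D k a "\<Lambda> + \<Lambda>\<sigma>" "C1 + 1" b
proof
  show "(\<lambda>(s, \<omega>). D s \<omega>) \<in> borel_measurable (borel \<Otimes>\<^sub>M \<gamma>)" unfolding D_def case_prod_beta by measurable
  show "(\<lambda>(s, \<omega>, \<omega>'). k s \<omega> \<omega>') \<in> borel_measurable (borel \<Otimes>\<^sub>M \<gamma> \<Otimes>\<^sub>M \<gamma>)" unfolding k_def case_prod_beta by measurable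
  show "a \<in> borel_measurable \<gamma>" unfolding a_def[abs_def] D_def by measurable
  show "k s \<omega> \<omega>' = k s \<omega>' \<omega>" for s \<omega> \<omega>'
    by (simp add: k_def riesz_minus_commute)
  show "0 \<le> a \<omega>" for \<omega> by (rule a_nonneg)
qed (use k_integral_le D_inequality Lambda_nonneg Sigma_riesz_one_le C1_nonneg in \<open>auto simp: D_def k_def\<close>)

end

section \<open>Norm bounds, tails and moments of the coupling distance\<close>

lemma Lp_norm_finite_le_iff:
  assumes p: "1 \<le> p" "p \<noteq> \<infinity>" and f: "0 \<le> f"
  shows "Lp_norm p M g \<le> ennreal f \<longleftrightarrow> (\<integral>\<^sup>+x. ennreal (\<bar>g x\<bar> powr enn2real p) \<partial>M) \<le> ennreal (f powr enn2real p)"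
proof -
  define r where "r = enn2real p"
  have r: "1 \<le> r" using p enn2real_mono[of 1 p] by (simp add: r_def less_top)
  define J where "J = (\<integral>\<^sup>+x. ennreal (\<bar>g x\<bar> powr r) \<partial>M)"
  show ?thesis
  proof (cases "J = \<infinity>")
    case True
    thus ?thesis using p by (simp add: Lp_norm_def epow_def J_def r_def top_unique)
  next
    case False
    then obtain j where j: "0 \<le> j" "J = ennreal j" by (cases J) auto
    have "Lp_norm p M g \<le> ennreal f \<longleftrightarrow> j powr (1 / r) \<le> f"
      using p j f by (simp add: Lp_norm_def epow_def J_def[symmetric] r_def[symmetric] ennreal_le_iff)
    also have "\<dots> \<longleftrightarrow> j \<le> f powr r"
    proof
      assume "j powr (1 / r) \<le> f"
      hence "(j powr (1 / r)) powr r \<le> f powr r" using r by (intro powr_mono2) auto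
      thus "j \<le> f powr r" using r j by (simp add: powr_powr)
    next
      assume "j \<le> f powr r"
      hence "j powr (1 / r) \<le> (f powr r) powr (1 / r)" using r j by (intro powr_mono2) auto
      thus "j powr (1 / r) \<le> f" using r f by (simp add: powr_powr)
    qed
    finally show ?thesis using j by (simp add: J_def[symmetric] r_def[symmetric] ennreal_le_iff)
  qed
qed

lemma Lp_norm_infinite_le_iff:
  assumes g: "g \<in> borel_measurable M" and f: "0 \<le> f"
  shows "Lp_norm \<infinity> M g \<le> ennreal f \<longleftrightarrow> (AE x in M. \<bar>g x\<bar> \<le> f)"
proof
  assume le: "Lp_norm \<infinity> M g \<le> ennreal f"
  have "AE x in M. ennreal \<bar>g x\<bar> \<le> esssup M (\<lambda>x. ennreal \<bar>g x\<bar>)" by (rule esssup_AE)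
  thus "AE x in M. \<bar>g x\<bar> \<le> f"
  proof eventually_elim
    case (elim x)
    hence "ennreal \<bar>g x\<bar> \<le> ennreal f" using le by (auto simp: Lp_norm_def)
    thus ?case using f by simp
  qed
next
  assume "AE x in M. \<bar>g x\<bar> \<le> f"
  hence "AE x in M. ennreal \<bar>g x\<bar> \<le> ennreal f" by eventually_elim (rule ennreal_leI)
  thus "Lp_norm \<infinity> M g \<le> ennreal f" using g unfolding Lp_norm_def by (simp, intro esssup_I) auto
qed

text \<open>For \<open>p = \<infinity>\<close> the two norms are identified through their finite
  upper bounds, which \<open>Lp_norm_infinite_le_iff\<close> expresses as almost sure
  bounds.\<close>

lemma Lp_norm_distr:
  assumes [measurable]: "h \<in> measurable M M'" "g \<in> borel_measurable M'"
  shows "Lp_norm p (distr M M' h) g = Lp_norm p M (\<lambda>x. g (h x))"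
proof (cases "p = \<infinity>")
  case True
  have "Lp_norm p (distr M M' h) g \<le> ennreal f \<longleftrightarrow> Lp_norm p M (\<lambda>x. g (h x)) \<le> ennreal f" if "0 \<le> f" for f
    unfolding True using that by (subst (1 2) Lp_norm_infinite_le_iff) (auto simp: AE_distr_iff)
  hence "Lp_norm p (distr M M' h) g \<le> z \<longleftrightarrow> Lp_norm p M (\<lambda>x. g (h x)) \<le> z" for z
    by (cases z) auto
  thus ?thesis by (metis order_antisym order_refl)
next
  case False
  thus ?thesis by (simp add: Lp_norm_def nn_integral_distr)
qed

lemma powr_sum3_le:
  fixes x y z p :: real
  assumes "0 \<le> x" "0 \<le> y" "0 \<le> z" "1 \<le> p"
  shows "(x + y + z) powr p \<le> 3 powr p * (x powr p + y powr p + z powr p)"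
proof -
  define w where "w = max x (max y z)"
  have w: "0 \<le> w" using assms by (simp add: w_def)
  have "(x + y + z) powr p \<le> (3 * w) powr p"
    using assms by (intro powr_mono2) (auto simp: w_def)
  also have "\<dots> = 3 powr p * w powr p" using w by (simp add: powr_mult)
  also have "w powr p \<le> x powr p + y powr p + z powr p"
    unfolding w_def by (auto simp: max_def)
  finally show ?thesis by (simp add: mult_left_mono)
qed

text \<open>The radius below which the tail \<open>\<gamma> {r < D}\<close> of a distance with \<open>Lp_norm p \<gamma> D \<le> f\<close> is no
  longer controlled by \<open>r powr \<delta>\<close>.\<close>

definition tail_radius :: "ennreal \<Rightarrow> real \<Rightarrow> real \<Rightarrow> real" where
  "tail_radius p \<delta> f = f powr (if p = \<infinity> then 1 else enn2real p / (enn2real p + \<delta>))"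

text \<open>Chebyshev's inequality bounds the tail by \<open>(f / r) powr p\<close>, which is at
  most \<open>r powr \<delta>\<close> exactly from \<open>r = f powr (p / (p + \<delta>))\<close>
  on. For \<open>p = \<infinity>\<close> the tail beyond \<open>f\<close> is null.\<close>

lemma Lp_norm_tail_le:
  assumes p: "1 \<le> p" and g [measurable]: "g \<in> borel_measurable M"
    and f: "Lp_norm p M g \<le> ennreal f" "0 < f" and \<delta>: "0 < \<delta>" and r: "tail_radius p \<delta> f \<le> r"
  shows "emeasure M {x\<in>space M. r < \<bar>g x\<bar>} \<le> ennreal (r powr \<delta>)"
proof (cases "p = \<infinity>")
  case True
  hence "AE x in M. \<bar>g x\<bar> \<le> f" using f Lp_norm_infinite_le_iff[OF g, of f] by simp
  hence "AE x in M. \<not> r < \<bar>g x\<bar>" using True r f by (auto simp: tail_radius_def elim!: eventually_mono)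
  hence "emeasure M {x\<in>space M. r < \<bar>g x\<bar>} = 0" by (subst (asm) AE_iff_measurable[OF _ refl]) auto
  thus ?thesis by simp
next
  case False
  define s where "s = enn2real p"
  have s: "1 \<le> s" using p False enn2real_mono[of 1 p] by (simp add: s_def less_top)
  define \<rho> where "\<rho> = tail_radius p \<delta> f"
  have \<rho>: "0 < \<rho>" "\<rho> powr (s + \<delta>) = f powr s"
    using f s \<delta> False by (simp_all add: \<rho>_def tail_radius_def s_def[symmetric] powr_powr)
  have r: "0 < r" "\<rho> \<le> r" using r \<rho> by (auto simp: \<rho>_def)
  have "f powr s \<le> r powr (s + \<delta>)" unfolding \<rho>(2)[symmetric] using r \<rho> s \<delta> by (intro powr_mono2) auto
  hence le: "r powr (- s) * f powr s \<le> r powr \<delta>"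
    using mult_left_mono[of "f powr s" "r powr (s + \<delta>)" "r powr (- s)"] by (simp add: powr_add[symmetric])
  have "emeasure M {x\<in>space M. r < \<bar>g x\<bar>} \<le> emeasure M {x\<in>space M. 1 \<le> ennreal (r powr (- s)) * ennreal (\<bar>g x\<bar> powr s)}"
  proof (rule emeasure_mono)
    show "{x\<in>space M. r < \<bar>g x\<bar>} \<subseteq> {x\<in>space M. 1 \<le> ennreal (r powr (- s)) * ennreal (\<bar>g x\<bar> powr s)}"
    proof safe
      fix x assume "r < \<bar>g x\<bar>"
      hence "r powr s \<le> \<bar>g x\<bar> powr s" using r s by (intro powr_mono2) auto
      hence "1 \<le> r powr (- s) * \<bar>g x\<bar> powr s" using r by (simp add: powr_minus_divide)
      hence "ennreal 1 \<le> ennreal (r powr (- s) * \<bar>g x\<bar> powr s)" by (rule ennreal_leI)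
      thus "1 \<le> ennreal (r powr (- s)) * ennreal (\<bar>g x\<bar> powr s)" by (simp add: ennreal_mult)
    qed
  qed measurable
  also have "\<dots> \<le> ennreal (r powr (- s)) * (\<integral>\<^sup>+x. ennreal (\<bar>g x\<bar> powr s) * indicator (space M) x \<partial>M)"
    by (rule nn_integral_Markov_inequality) auto
  also have "(\<integral>\<^sup>+x. ennreal (\<bar>g x\<bar> powr s) * indicator (space M) x \<partial>M) = (\<integral>\<^sup>+x. ennreal (\<bar>g x\<bar> powr s) \<partial>M)"
    by (intro nn_integral_cong) simp
  also have "\<dots> \<le> ennreal (f powr s)" using Lp_norm_finite_le_iff[OF p False, of f M g] f by (simp add: s_def)
  also have "ennreal (r powr (- s)) * ennreal (f powr s) \<le> ennreal (r powr \<delta>)"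
    using le by (simp add: ennreal_mult[symmetric])
  finally show ?thesis by (simp add: mult_left_mono)
qed

text \<open>Ratio between the distance and the initial error \<open>E\<close>, apart from the
  exponential. The finite case is the \<open>p\<close>-th root of the Gronwall factor
  \<open>2 * 4 powr p\<close> times the moment bound of \<open>a\<close>, whose
  \<open>3 powr p\<close> stems from a sum of three terms. At \<open>\<infinity>\<close> the 8 is
  the Gronwall 4 times the 2 of a Markov threshold.\<close>

definition amplification :: "ennreal \<Rightarrow> real \<Rightarrow> real \<Rightarrow> real" where
  "amplification p C\<^sub>V S = (if p = \<infinity> then 8 * (1 + 2 * C\<^sub>V + S)
     else (2 * 4 powr enn2real p * 3 powr enn2real p * (1 + 2 powr enn2real p * C\<^sub>V + S powr enn2real p)) powr (1 / enn2real p))"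

lemma amplification_pos: "0 \<le> C\<^sub>V \<Longrightarrow> 0 \<le> S \<Longrightarrow> 0 < amplification p C\<^sub>V S"
  unfolding amplification_def using add_pos_nonneg[of "1 + 2 powr enn2real p * C\<^sub>V" "S powr enn2real p"] add_pos_nonneg[of 1 "2 powr enn2real p * C\<^sub>V"]
  by (auto intro!: mult_pos_pos)

text \<open>Growth bound at twice the radius plus 1 for the tail of the distance.\<close>

definition counting_const :: "nat \<Rightarrow> ennreal \<Rightarrow> real \<Rightarrow> real" where
  "counting_const d q' m = growth_const d q' m * 2 powr growth_exponent d q' + 1"

context mean_field
begin

text \<open>A crude bound that depends on the individual trajectories. Its purpose is the finiteness
  of the moments on which the absorption in the Gronwall argument rests.\<close>

lemma D_le_initial:
  obtains B where "0 \<le> B" "\<And>t \<omega>. 0 \<le> t \<Longrightarrow> t \<le> b \<Longrightarrow> D t \<omega> \<le> D 0 \<omega> + B"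
proof -
  have "\<exists>B. \<forall>t\<in>{0..b}. norm (X i t - X i 0) \<le> B" if "i < N" for i
  proof -
    have "compact ((\<lambda>t. X i t - X i 0) ` {0..b})"
      by (intro compact_continuous_image continuous_intros X_continuous that) simp
    thus ?thesis by (auto dest!: compact_imp_bounded simp: bounded_iff)
  qed
  then obtain \<xi> where \<xi>: "\<And>i t. i < N \<Longrightarrow> t \<in> {0..b} \<Longrightarrow> norm (X i t - X i 0) \<le> \<xi> i" by metis
  have \<xi>0: "0 \<le> \<xi> i" if "i < N" for i using \<xi>[OF that, of 0] b_nonneg by simp
  define W where "W = C\<^sub>K * (1 + \<Lambda>\<sigma>)"
  have W: "0 \<le> W" using CK_nonneg Sigma_riesz_one_le by (simp add: W_def)
  have Y: "norm (Y t x - Y 0 x) \<le> W * t" if "0 \<le> t" for t x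
  proof -
    have "norm (Y t x - Y 0 x) \<le> W * (t - 0)"
    proof (rule norm_vector_deriv_bound[OF that])
      fix s assume s: "0 \<le> s" "s \<le> t"
      show "((\<lambda>s. Y s x) has_vector_derivative velocity s (Y s x)) (at s within {0..t})"
        by (rule has_vector_derivative_at_within[OF Y_deriv])
      show "norm (velocity s (Y s x)) \<le> W"
        unfolding velocity_def W_def by (rule norm_kconv_le[OF riesz_sigma]) simp
    qed
    thus ?thesis by simp
  qed
  show thesis
  proof
    show "0 \<le> (\<Sum>i<N. \<xi> i) + W * b" using \<xi>0 W b_nonneg by (intro add_nonneg_nonneg sum_nonneg mult_nonneg_nonneg) auto
    fix t \<omega> assume t: "0 \<le> t" "t \<le> b"
    have "norm (X (I \<omega>) t - Y t (snd \<omega>)) \<le> norm (X (I \<omega>) 0 - Y 0 (snd \<omega>)) + norm (X (I \<omega>) t - X (I \<omega>) 0) + norm (Y t (snd \<omega>) - Y 0 (snd \<omega>))"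
      using norm_triangle_ineq[of "X (I \<omega>) 0 - Y 0 (snd \<omega>)" "X (I \<omega>) t - X (I \<omega>) 0"]
        norm_triangle_ineq4[of "(X (I \<omega>) 0 - Y 0 (snd \<omega>)) + (X (I \<omega>) t - X (I \<omega>) 0)" "Y t (snd \<omega>) - Y 0 (snd \<omega>)"]
      by (simp add: algebra_simps)
    moreover have "norm (X (I \<omega>) t - X (I \<omega>) 0) \<le> \<xi> (I \<omega>)" using t by (intro \<xi>) auto
    moreover have "\<xi> (I \<omega>) \<le> (\<Sum>i<N. \<xi> i)" by (rule member_le_sum) (use \<xi>0 in auto)
    moreover have "norm (Y t (snd \<omega>) - Y 0 (snd \<omega>)) \<le> W * b"
      using Y[OF t(1), of "snd \<omega>"] mult_left_mono[OF t(2) W] by linarith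
    moreover have "D t \<omega> = norm (X (I \<omega>) t - Y t (snd \<omega>))" "D 0 \<omega> = norm (X (I \<omega>) 0 - Y 0 (snd \<omega>))"
      using t b_nonneg by (simp_all add: D_def)
    ultimately show "D t \<omega> \<le> D 0 \<omega> + ((\<Sum>i<N. \<xi> i) + W * b)" by linarith
  qed
qed

lemma D_measurable_gamma [measurable]: "D t \<in> borel_measurable \<gamma>"
  unfolding D_def[abs_def] by measurable

text \<open>Derives the finiteness hypothesis of \<open>coupled_gronwall_bound\<close> from the
  moment at time 0 and \<open>D_le_initial\<close>.\<close>

lemma powr_moment_bound:
  assumes r: "1 \<le> r" and fin: "(\<integral>\<^sup>+\<omega>. ennreal (D 0 \<omega> powr r) \<partial>\<gamma>) \<le> ennreal M" and t: "0 \<le> t" "t \<le> b"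
  shows "(\<integral>\<^sup>+\<omega>. ennreal (D t \<omega> powr r) \<partial>\<gamma>) \<le> ennreal (exp (G.\<beta> * t) powr r * (2 * 4 powr r)) * (\<integral>\<^sup>+\<omega>. ennreal (a \<omega> powr r) \<partial>\<gamma>)"
proof -
  obtain B where B: "0 \<le> B" "\<And>t \<omega>. 0 \<le> t \<Longrightarrow> t \<le> b \<Longrightarrow> D t \<omega> \<le> D 0 \<omega> + B" by (rule D_le_initial) blast
  have "(\<integral>\<^sup>+\<omega>. ennreal (D s \<omega> powr r) \<partial>\<gamma>) \<le> ennreal (3 powr r) * (ennreal M + ennreal (B powr r))"
    if "0 \<le> s" "s \<le> b" for s
  proof -
    have "(\<integral>\<^sup>+\<omega>. ennreal (D s \<omega> powr r) \<partial>\<gamma>) \<le> (\<integral>\<^sup>+\<omega>. ennreal (3 powr r) * (ennreal (D 0 \<omega> powr r) + ennreal (B powr r)) \<partial>\<gamma>)"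
    proof (rule nn_integral_mono)
      fix \<omega>
      have "D s \<omega> powr r \<le> (D 0 \<omega> + B + 0) powr r" using B(2)[OF that, of \<omega>] r by (intro powr_mono2) auto
      also have "\<dots> \<le> 3 powr r * (D 0 \<omega> powr r + B powr r + 0 powr r)"
        by (rule powr_sum3_le) (use B r in auto)
      finally have "ennreal (D s \<omega> powr r) \<le> ennreal (3 powr r * (D 0 \<omega> powr r + B powr r))"
        by (intro ennreal_leI) simp
      thus "ennreal (D s \<omega> powr r) \<le> ennreal (3 powr r) * (ennreal (D 0 \<omega> powr r) + ennreal (B powr r))"
        by (simp add: ennreal_mult)
    qed
    also have "\<dots> = ennreal (3 powr r) * ((\<integral>\<^sup>+\<omega>. ennreal (D 0 \<omega> powr r) \<partial>\<gamma>) + ennreal (B powr r))"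
      by (subst nn_integral_cmult, measurable, subst nn_integral_add) (auto simp: \<gamma>.emeasure_space_1)
    also have "\<dots> \<le> ennreal (3 powr r) * (ennreal M + ennreal (B powr r))"
      by (intro mult_left_mono add_right_mono fin) auto
    finally show ?thesis .
  qed
  moreover have "ennreal (3 powr r) * (ennreal M + ennreal (B powr r)) = ennreal (3 powr r * (max 0 M + B powr r))"
    by (simp add: ennreal_mult max_def ennreal_neg)
  ultimately show ?thesis using G.coupled_gronwall_bound[OF r _ t] by metis
qed

definition \<beta> :: real where "\<beta> = G.\<beta>"

lemma beta_eq: "\<beta> = 16 * (\<Lambda> + \<Lambda>\<sigma>) * (C1 + 1)"
  by (simp add: \<beta>_def G.\<beta>_def)

context
  fixes p :: ennreal and E C\<^sub>V :: real
  assumes p: "1 \<le> p" and E: "0 < E" "1 / lam \<le> E" and D0: "Lp_norm p \<gamma> (D 0) \<le> ennreal E"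
    and CV: "0 < C\<^sub>V" "velocity_bound p N (\<lambda>i. V i 0) C\<^sub>V"
begin

lemma a_le: "a \<omega> \<le> D 0 \<omega> + 2 * norm (V (I \<omega>) 0) * E + S * E"
proof -
  have "(2 * norm (V (I \<omega>) 0) + S) * (1 / lam) \<le> (2 * norm (V (I \<omega>) 0) + S) * E"
    using S_nonneg by (intro mult_left_mono E) auto
  thus ?thesis unfolding a_def by (simp add: distrib_right add_divide_distrib)
qed

text \<open>For finite \<open>p\<close> this is the moment bound with \<open>a\<close> estimated
  termwise. For \<open>p = \<infinity>\<close> the moments of every integer order \<open>n\<close>
  are at most \<open>2 * g ^ n\<close>; by Markov's inequality \<open>D t\<close> reaches
  \<open>2 * g\<close> with probability at most \<open>2 * (1 / 2) ^ n\<close>, hence almost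
  never.\<close>

lemma Lp_norm_D_le:
  assumes t: "0 \<le> t" "t \<le> b"
  shows "Lp_norm p \<gamma> (D t) \<le> ennreal (amplification p C\<^sub>V S * exp (\<beta> * t) * E)"
proof (cases "p = \<infinity>")
  case True
  define h where "h = (1 + 2 * C\<^sub>V + S) * E"
  have h: "0 < h" using CV E S_nonneg by (simp add: h_def)
  have AE0: "AE \<omega> in \<gamma>. D 0 \<omega> \<le> E"
    using D0 E Lp_norm_infinite_le_iff[OF D_measurable_gamma, of E 0] by (simp add: True)
  hence AEa: "AE \<omega> in \<gamma>. a \<omega> \<le> h"
  proof eventually_elim
    case (elim \<omega>)
    have "2 * norm (V (I \<omega>) 0) * E \<le> 2 * C\<^sub>V * E"
      using CV(2) E by (simp add: velocity_bound_def True)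
    thus ?case using a_le[of \<omega>] elim by (simp add: h_def algebra_simps)
  qed
  define g where "g = 4 * exp (\<beta> * t) * h"
  have g: "0 < g" using h by (simp add: g_def)
  have moment: "(\<integral>\<^sup>+\<omega>. ennreal (D t \<omega> powr real n) \<partial>\<gamma>) \<le> ennreal (2 * g ^ n)" if n: "1 \<le> n" for n :: nat
  proof -
    have "(\<integral>\<^sup>+\<omega>. ennreal (D 0 \<omega> powr real n) \<partial>\<gamma>) \<le> (\<integral>\<^sup>+\<omega>. ennreal (E powr real n) \<partial>\<gamma>)"
      using AE0 by (intro nn_integral_mono_AE) (auto elim!: eventually_mono intro!: ennreal_leI powr_mono2)
    hence fin: "(\<integral>\<^sup>+\<omega>. ennreal (D 0 \<omega> powr real n) \<partial>\<gamma>) \<le> ennreal (E powr real n)"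
      by (simp add: \<gamma>.emeasure_space_1)
    have "(\<integral>\<^sup>+\<omega>. ennreal (D t \<omega> powr real n) \<partial>\<gamma>) \<le> ennreal (exp (\<beta> * t) powr real n * (2 * 4 powr real n)) * (\<integral>\<^sup>+\<omega>. ennreal (a \<omega> powr real n) \<partial>\<gamma>)"
      unfolding \<beta>_def by (rule powr_moment_bound[OF _ fin t]) (use n in simp)
    also have "(\<integral>\<^sup>+\<omega>. ennreal (a \<omega> powr real n) \<partial>\<gamma>) \<le> (\<integral>\<^sup>+\<omega>. ennreal (h powr real n) \<partial>\<gamma>)"
      using AEa a_nonneg by (intro nn_integral_mono_AE) (auto elim!: eventually_mono intro!: ennreal_leI powr_mono2)
    also have "\<dots> = ennreal (h powr real n)" by (simp add: \<gamma>.emeasure_space_1)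
    also have "ennreal (exp (\<beta> * t) powr real n * (2 * 4 powr real n)) * ennreal (h powr real n) = ennreal (2 * g ^ n)"
      using h n by (simp add: ennreal_mult[symmetric] powr_realpow g_def power_mult_distrib mult_ac)
    finally show ?thesis by (simp add: mult_left_mono)
  qed
  have tail: "emeasure \<gamma> {\<omega>\<in>space \<gamma>. 2 * g \<le> D t \<omega>} \<le> ennreal (2 * (1 / 2) ^ n)" if n: "1 \<le> n" for n
  proof -
    have "emeasure \<gamma> {\<omega>\<in>space \<gamma>. 2 * g \<le> D t \<omega>} \<le> emeasure \<gamma> {\<omega>\<in>space \<gamma>. 1 \<le> ennreal (1 / (2 * g) ^ n) * ennreal (D t \<omega> powr real n)}"
    proof (rule emeasure_mono)
      show "{\<omega>\<in>space \<gamma>. 2 * g \<le> D t \<omega>} \<subseteq> {\<omega>\<in>space \<gamma>. 1 \<le> ennreal (1 / (2 * g) ^ n) * ennreal (D t \<omega> powr real n)}"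
      proof safe
        fix \<omega> assume le: "2 * g \<le> D t \<omega>"
        have "(2 * g) ^ n \<le> D t \<omega> ^ n" using le g by (intro power_mono) auto
        hence "1 \<le> 1 / (2 * g) ^ n * D t \<omega> ^ n" using g by (simp add: le_divide_eq)
        hence "ennreal 1 \<le> ennreal (1 / (2 * g) ^ n * D t \<omega> ^ n)" by (rule ennreal_leI)
        also have "\<dots> = ennreal (1 / (2 * g) ^ n) * ennreal (D t \<omega> ^ n)" by (rule ennreal_mult) (use g in auto)
        also have "D t \<omega> ^ n = D t \<omega> powr real n" using le g by (intro powr_realpow[symmetric]) auto
        finally show "1 \<le> ennreal (1 / (2 * g) ^ n) * ennreal (D t \<omega> powr real n)" by simp
      qed
    qed measurable
    also have "\<dots> \<le> ennreal (1 / (2 * g) ^ n) * (\<integral>\<^sup>+\<omega>. ennreal (D t \<omega> powr real n) * indicator (space \<gamma>) \<omega> \<partial>\<gamma>)"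
      by (rule nn_integral_Markov_inequality) auto
    also have "(\<integral>\<^sup>+\<omega>. ennreal (D t \<omega> powr real n) * indicator (space \<gamma>) \<omega> \<partial>\<gamma>) = (\<integral>\<^sup>+\<omega>. ennreal (D t \<omega> powr real n) \<partial>\<gamma>)"
      by (intro nn_integral_cong) simp
    also note moment[OF n]
    also have "ennreal (1 / (2 * g) ^ n) * ennreal (2 * g ^ n) = ennreal (2 * (1 / 2) ^ n)"
      using g by (simp add: ennreal_mult[symmetric] power_mult_distrib field_simps)
    finally show ?thesis by (simp add: mult_left_mono)
  qed
  have "(\<lambda>n. ennreal (2 * (1 / 2) ^ n)) \<longlonglongrightarrow> ennreal (2 * 0)"
    by (intro tendsto_ennrealI tendsto_mult tendsto_const LIMSEQ_power_zero) auto
  hence "emeasure \<gamma> {\<omega>\<in>space \<gamma>. 2 * g \<le> D t \<omega>} \<le> ennreal (2 * 0)"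
    by (rule tendsto_lowerbound) (use tail in \<open>auto simp: eventually_sequentially intro!: exI[of _ 1]\<close>)
  hence "AE \<omega> in \<gamma>. \<not> 2 * g \<le> D t \<omega>" by (subst AE_iff_measurable[OF _ refl]) auto
  hence "AE \<omega> in \<gamma>. \<bar>D t \<omega>\<bar> \<le> 2 * g" by eventually_elim simp
  moreover have "2 * g = amplification p C\<^sub>V S * exp (\<beta> * t) * E"
    by (simp add: g_def h_def amplification_def True)
  ultimately show ?thesis using Lp_norm_infinite_le_iff[OF D_measurable_gamma, of "2 * g" t] g unfolding True by simp
next
  case False
  define r where "r = enn2real p"
  have r: "1 \<le> r" using p False enn2real_mono[of 1 p] by (simp add: r_def less_top)
  define Z where "Z = 1 + 2 powr r * C\<^sub>V + S powr r"
  have Z: "0 < Z" using CV by (simp add: Z_def add_pos_nonneg)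
  have D0r: "(\<integral>\<^sup>+\<omega>. ennreal (D 0 \<omega> powr r) \<partial>\<gamma>) \<le> ennreal (E powr r)"
    using D0 E Lp_norm_finite_le_iff[OF p False, of E \<gamma> "D 0"] by (simp add: r_def)
  have "(\<integral>\<^sup>+\<omega>. ennreal (a \<omega> powr r) \<partial>\<gamma>) \<le> (\<integral>\<^sup>+\<omega>. ennreal (3 powr r) * (ennreal (D 0 \<omega> powr r) +
       (ennreal (2 powr r * E powr r) * ennreal (norm (V (I \<omega>) 0) powr r) + ennreal (S powr r * E powr r))) \<partial>\<gamma>)"
  proof (rule nn_integral_mono)
    fix \<omega>
    have "a \<omega> powr r \<le> (D 0 \<omega> + 2 * norm (V (I \<omega>) 0) * E + S * E) powr r"
      using r by (intro powr_mono2 a_le a_nonneg) auto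
    also have "\<dots> \<le> 3 powr r * (D 0 \<omega> powr r + (2 * norm (V (I \<omega>) 0) * E) powr r + (S * E) powr r)"
      by (rule powr_sum3_le) (use r E S_nonneg in auto)
    also have "(2 * norm (V (I \<omega>) 0) * E) powr r = 2 powr r * E powr r * norm (V (I \<omega>) 0) powr r"
      using E by (simp add: powr_mult)
    also have "(S * E) powr r = S powr r * E powr r" using E S_nonneg by (simp add: powr_mult)
    finally have "ennreal (a \<omega> powr r) \<le> ennreal (3 powr r * (D 0 \<omega> powr r + 2 powr r * E powr r * norm (V (I \<omega>) 0) powr r + S powr r * E powr r))"
      by (rule ennreal_leI)
    thus "ennreal (a \<omega> powr r) \<le> ennreal (3 powr r) * (ennreal (D 0 \<omega> powr r) +
       (ennreal (2 powr r * E powr r) * ennreal (norm (V (I \<omega>) 0) powr r) + ennreal (S powr r * E powr r)))"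
      by (simp add: ennreal_mult ennreal_plus add.assoc)
  qed
  also have "\<dots> = ennreal (3 powr r) * ((\<integral>\<^sup>+\<omega>. ennreal (D 0 \<omega> powr r) \<partial>\<gamma>) +
       (ennreal (2 powr r * E powr r) * (\<integral>\<^sup>+\<omega>. ennreal (norm (V (I \<omega>) 0) powr r) \<partial>\<gamma>) + ennreal (S powr r * E powr r)))"
    by (simp add: nn_integral_cmult nn_integral_add \<gamma>.emeasure_space_1)
  also have "(\<integral>\<^sup>+\<omega>. ennreal (norm (V (I \<omega>) 0) powr r) \<partial>\<gamma>) = ennreal ((1 / real N) * (\<Sum>j<N. norm (V j 0) powr r))"
    unfolding nn_integral_I[of "\<lambda>j. ennreal (norm (V j 0) powr r)"]
    by (subst sum_ennreal, simp, subst ennreal_mult) (auto intro: sum_nonneg)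
  also have "\<dots> \<le> ennreal C\<^sub>V" using CV(2) False by (intro ennreal_leI) (simp add: velocity_bound_def r_def)
  also note D0r
  also have "ennreal (3 powr r) * (ennreal (E powr r) + (ennreal (2 powr r * E powr r) * ennreal C\<^sub>V + ennreal (S powr r * E powr r)))
     = ennreal (3 powr r * Z * E powr r)"
    using CV by (simp add: ennreal_mult[symmetric] ennreal_plus[symmetric] Z_def algebra_simps del: ennreal_plus)
  finally have a: "(\<integral>\<^sup>+\<omega>. ennreal (a \<omega> powr r) \<partial>\<gamma>) \<le> ennreal (3 powr r * Z * E powr r)"
    by (simp add: mult_left_mono add_mono)
  have "(\<integral>\<^sup>+\<omega>. ennreal (D t \<omega> powr r) \<partial>\<gamma>) \<le> ennreal (exp (\<beta> * t) powr r * (2 * 4 powr r)) * (\<integral>\<^sup>+\<omega>. ennreal (a \<omega> powr r) \<partial>\<gamma>)"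
    unfolding \<beta>_def by (rule powr_moment_bound[OF r D0r t])
  also note a
  also have "ennreal (exp (\<beta> * t) powr r * (2 * 4 powr r)) * ennreal (3 powr r * Z * E powr r)
     = ennreal ((amplification p C\<^sub>V S * exp (\<beta> * t) * E) powr r)"
  proof -
    have "amplification p C\<^sub>V S powr r = 2 * 4 powr r * 3 powr r * Z"
      using False r Z by (simp add: amplification_def r_def[symmetric] Z_def[symmetric] powr_powr)
    thus ?thesis using E Z amplification_pos[of C\<^sub>V S p] CV S_nonneg
      by (simp add: ennreal_mult[symmetric] powr_mult mult_ac)
  qed
  finally have "(\<integral>\<^sup>+\<omega>. ennreal (D t \<omega> powr r) \<partial>\<gamma>) \<le> ennreal ((amplification p C\<^sub>V S * exp (\<beta> * t) * E) powr r)"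
    by (simp add: mult_left_mono)
  thus ?thesis using E amplification_pos[of C\<^sub>V S p] CV S_nonneg
    by (subst Lp_norm_finite_le_iff[OF p False]) (auto simp: r_def)
qed

end

text \<open>The joint law of the two transported components is a competitor in the infimum.\<close>

lemma wasserstein_le:
  assumes "0 \<le> t" "t \<le> b"
  shows "wasserstein p (empirical N (\<lambda>i. X i t)) (law (\<sigma> t)) \<le> Lp_norm p \<gamma> (D t)"
proof -
  define h where "h \<omega> = (X (I \<omega>) t, Y t (snd \<omega>))" for \<omega> :: "'a \<times> 'a"
  have c: "clamp t = t" using assms by simp
  have [measurable]: "(\<lambda>\<omega>. X (I \<omega>) t) \<in> borel_measurable \<gamma>"
    using X_clamp_measurable[of "\<lambda>_. t" \<gamma> "\<lambda>\<omega>. \<omega>"] by (simp add: c)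
  have h [measurable]: "h \<in> measurable \<gamma> borel"
    unfolding h_def borel_prod[symmetric] by measurable
  have "distr \<gamma> borel h \<in> couplings (empirical N (\<lambda>i. X i t)) (law (\<sigma> t))"
    unfolding couplings_def
  proof (intro CollectI conjI)
    have f: "fst \<in> borel_measurable borel" "snd \<in> borel_measurable borel"
      by (intro borel_measurable_continuous_onI continuous_intros)+
    have "distr (distr \<gamma> borel h) borel fst = distr \<gamma> borel (\<lambda>\<omega>. X (I \<omega>) t)"
      by (subst distr_distr[OF f(1) h]) (simp add: h_def comp_def)
    also have "\<dots> = distr (distr \<gamma> (count_space UNIV) I) borel (\<lambda>i. X i t)"
      by (subst distr_distr) (auto simp: comp_def)
    also have "distr \<gamma> (count_space UNIV) I = distr (uniform_count_measure {..<N}) (count_space UNIV) (\<lambda>j. j)"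
      unfolding fst_marginal[symmetric] I_def ..
    also have "distr \<dots> borel (\<lambda>i. X i t) = empirical N (\<lambda>i. X i t)"
      unfolding empirical_def
      by (subst distr_distr) (auto simp: comp_def measurable_def sets_uniform_count_measure space_uniform_count_measure)
    finally show "distr (distr \<gamma> borel h) borel fst = empirical N (\<lambda>i. X i t)" .
    have "distr (distr \<gamma> borel h) borel snd = distr \<gamma> borel (\<lambda>\<omega>. Y t (snd \<omega>))"
      by (subst distr_distr[OF f(2) h]) (simp add: h_def comp_def)
    also have "\<dots> = distr (distr \<gamma> borel snd) borel (Y t)"
      by (subst distr_distr) (auto simp: comp_def)
    also have "\<dots> = law (\<sigma> t)" using assms by (simp add: snd_marginal Y_push)
    finally show "distr (distr \<gamma> borel h) borel snd = law (\<sigma> t)" .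
  qed simp
  hence "wasserstein p (empirical N (\<lambda>i. X i t)) (law (\<sigma> t)) \<le> Lp_norm p (distr \<gamma> borel h) (\<lambda>(x, y). dist x y)"
    unfolding wasserstein_def by (rule INF_lower)
  also have "\<dots> = Lp_norm p \<gamma> (\<lambda>\<omega>. (\<lambda>(x, y). dist x y) (h \<omega>))"
    by (rule Lp_norm_distr[OF h]) (auto simp: case_prod_beta intro!: borel_measurable_continuous_onI continuous_intros)
  also have "(\<lambda>\<omega>. (\<lambda>(x, y). dist x y) (h \<omega>)) = D t"
    using assms by (simp add: fun_eq_iff h_def D_def dist_norm)
  finally show ?thesis .
qed

lemma counting_const_nonneg: "0 \<le> counting_const DIM('a) q' m"
  using growth_const_nonneg[of m] m by (simp add: counting_const_def)

text \<open>If a particle lies within \<open>r\<close> of \<open>X i t\<close> and its partner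
  within \<open>r\<close> of it, the partner lies in the ball of radius \<open>2 * r\<close>, where
  the growth bound applies. The other particles belong to the tail event \<open>r < D\<close>, whose
  probability is at most \<open>r powr \<delta>\<close>.\<close>

lemma particles_in_ball_le:
  assumes p: "1 \<le> p" and t: "0 \<le> t" "t \<le> b" and f: "Lp_norm p \<gamma> (D t) \<le> ennreal f" "0 < f"
    and i: "i < N" and r: "tail_radius p (growth_exponent DIM('a) q') f \<le> r"
  shows "real (card {j. j < N \<and> dist (X i t) (X j t) \<le> r}) \<le> real N * (counting_const DIM('a) q' m * r powr growth_exponent DIM('a) q')"
proof -
  let ?\<delta> = "growth_exponent DIM('a) q'"
  let ?J = "{j. j < N \<and> dist (X i t) (X j t) \<le> r}"
  have \<delta>: "0 < ?\<delta>" using conjugate_pos by (simp add: growth_exponent_def)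
  have "0 < tail_radius p ?\<delta> f" using f by (simp add: tail_radius_def)
  hence r0: "0 < r" using r by linarith
  have [measurable]: "(\<lambda>\<omega>. X (I \<omega>) t) \<in> borel_measurable \<gamma>"
    using X_clamp_measurable[of "\<lambda>_. t" \<gamma> "\<lambda>\<omega>. \<omega>"] t by simp
  have [measurable]: "(\<lambda>\<omega>. Y t (snd \<omega>)) \<in> borel_measurable \<gamma>" by measurable
  have [measurable]: "cball (X i t) (2 * r) \<in> sets borel" by simp
  have "ennreal (real (card ?J) / real N) = (\<integral>\<^sup>+\<omega>. indicator ?J (I \<omega>) \<partial>\<gamma>)"
  proof -
    have "(\<Sum>j<N. indicator ?J j) = (of_nat (card ?J) :: ennreal)"
      by (simp add: indicator_def of_bool_def sum.If_cases Int_def)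
    thus ?thesis unfolding nn_integral_I using N_pos
      by (simp add: ennreal_of_nat_eq_real_of_nat ennreal_mult[symmetric])
  qed
  also have "\<dots> \<le> (\<integral>\<^sup>+\<omega>. indicator (cball (X i t) (2 * r)) (Y t (snd \<omega>)) + indicator {\<omega>\<in>space \<gamma>. r < \<bar>D t \<omega>\<bar>} \<omega> \<partial>\<gamma>)"
  proof (rule nn_integral_mono)
    fix \<omega> assume \<omega>: "\<omega> \<in> space \<gamma>"
    show "indicator ?J (I \<omega>) \<le> (indicator (cball (X i t) (2 * r)) (Y t (snd \<omega>)) + indicator {\<omega>\<in>space \<gamma>. r < \<bar>D t \<omega>\<bar>} \<omega> :: ennreal)"
    proof (cases "I \<omega> \<in> ?J \<and> D t \<omega> \<le> r")
      case True
      have "D t \<omega> = dist (X (I \<omega>) t) (Y t (snd \<omega>))" using t by (simp add: D_def dist_norm)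
      hence "dist (X i t) (Y t (snd \<omega>)) \<le> 2 * r"
        using True dist_triangle[of "X i t" "Y t (snd \<omega>)" "X (I \<omega>) t"] by auto
      thus ?thesis using True by (simp add: indicator_def)
    next
      case False
      thus ?thesis using \<omega> by (auto simp: indicator_def)
    qed
  qed
  also have "\<dots> = (\<integral>\<^sup>+\<omega>. indicator (cball (X i t) (2 * r)) (Y t (snd \<omega>)) \<partial>\<gamma>) + emeasure \<gamma> {\<omega>\<in>space \<gamma>. r < \<bar>D t \<omega>\<bar>}"
    by (subst nn_integral_add) auto
  also have "(\<integral>\<^sup>+\<omega>. indicator (cball (X i t) (2 * r)) (Y t (snd \<omega>)) \<partial>\<gamma>) = emeasure (law (\<sigma> t)) (cball (X i t) (2 * r))"
    by (subst snd_marginal_nn[OF _ t(1)]) auto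
  also have "\<dots> \<le> ennreal (growth_const DIM('a) q' m * (2 * r) powr ?\<delta>)"
    using r0 by (intro Y_growth t) auto
  also have "emeasure \<gamma> {\<omega>\<in>space \<gamma>. r < \<bar>D t \<omega>\<bar>} \<le> ennreal (r powr ?\<delta>)"
    by (rule Lp_norm_tail_le[OF p D_measurable_gamma f \<delta> r])
  also have "ennreal (growth_const DIM('a) q' m * (2 * r) powr ?\<delta>) + ennreal (r powr ?\<delta>) = ennreal (counting_const DIM('a) q' m * r powr ?\<delta>)"
    using r0 growth_const_nonneg[of m] m by (simp add: ennreal_plus[symmetric] counting_const_def powr_mult algebra_simps del: ennreal_plus)
  finally have "ennreal (real (card ?J) / real N) \<le> ennreal (counting_const DIM('a) q' m * r powr ?\<delta>)" by (simp add: add_mono)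
  hence "real (card ?J) / real N \<le> counting_const DIM('a) q' m * r powr ?\<delta>" using counting_const_nonneg by (subst (asm) ennreal_le_iff) auto
  thus ?thesis using N_pos by (simp add: divide_le_eq mult.commute)
qed

text \<open>With \<open>\<delta> = d / q'\<close> one has \<open>\<delta> * (1 - (\<alpha> + 1) / d)
  = (d - \<alpha> - 1) / q'\<close>; the factor \<open>p / (p + \<delta>)\<close> of the radius then
  gives the rate.\<close>

lemma tail_radius_rate:
  assumes "0 < f" "1 \<le> p"
  shows "tail_radius p (growth_exponent DIM('a) q') f powr (growth_exponent DIM('a) q' * (1 - (\<alpha> + 1) / real DIM('a)))
     = f powr rate_exponent p q' DIM('a) \<alpha>"
proof -
  define d where "d = real DIM('a)"
  define s where "s = enn2real q'"
  have d: "0 < d" "0 < s" using conjugate_pos by (simp_all add: d_def s_def)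
  have e: "d / s * (1 - (\<alpha> + 1) / d) = (d - \<alpha> - 1) / s" using d by (simp add: field_simps)
  show ?thesis
  proof (cases "p = \<infinity>")
    case True
    thus ?thesis using assms
      by (simp add: tail_radius_def rate_exponent_def growth_exponent_def d_def[symmetric] s_def[symmetric] e[unfolded times_divide_eq_left])
  next
    case False
    define r where "r = enn2real p"
    have r: "1 \<le> r" using assms False enn2real_mono[of 1 p] by (simp add: r_def less_top)
    have "r / (r + d / s) * ((d - \<alpha> - 1) / s) = r * (d - \<alpha> - 1) / (d + r * s)"
    proof -
      have "r + d / s = (d + r * s) / s" using d by (simp add: field_simps)
      thus ?thesis using d by simp
    qed
    thus ?thesis using False assms
      by (simp add: e[symmetric] tail_radius_def rate_exponent_def growth_exponent_def d_def[symmetric] s_def[symmetric] r_def[symmetric] powr_powr)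
  qed
qed

text \<open>\<open>riesz_sum_le\<close> at the smallest radius for which the particle count is
  controlled. Apart from \<open>f\<close> and \<open>dm\<close> nothing on the right depends on
  time, nor does the a priori bound \<open>\<Lambda>\<close> occur.\<close>

lemma riesz_sum_improved:
  assumes p: "1 \<le> p" and t: "0 \<le> t" "t \<le> b" and f: "Lp_norm p \<gamma> (D t) \<le> ennreal f" "0 < f" and i: "i < N"
    and dm: "0 < dm" "\<And>i j. i < N \<Longrightarrow> j < N \<Longrightarrow> i \<noteq> j \<Longrightarrow> dm \<le> dist (X i t) (X j t)"
  shows "(1 / real N) * (\<Sum>j<N. \<kappa> (X i t - X j t)) \<le> 1 + dyadic_const (\<alpha> + 1) (growth_exponent DIM('a) q') * counting_const DIM('a) q' m +
     near_const DIM('a) (\<alpha> + 1) (counting_const DIM('a) q' m) * ((real N powr (1 / real DIM('a)) * dm) powr - (\<alpha> + 1) * f powr rate_exponent p q' DIM('a) \<alpha>)"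
  using riesz_sum_le[where x="\<lambda>j. X j t" and N=N and i=i and dm=dm and s="\<alpha> + 1" and \<delta>="growth_exponent DIM('a) q'" and A="counting_const DIM('a) q' m" and \<rho>="tail_radius p (growth_exponent DIM('a) q') f",
      OF dm(2) dm(1) i _ _ riesz_exponent_less_growth counting_const_nonneg _ particles_in_ball_le[OF p t f i]]
    alpha_nonneg alpha_less f
  by (simp add: tail_radius_rate[OF f(2) p]) (simp add: tail_radius_def)

end

section \<open>The continuity argument\<close>

text \<open>Exceeds the far-field bound by 1: one half absorbs the near field, the other half is the
  strict gain in the continuity argument.\<close>

definition riesz_sum_const :: "nat \<Rightarrow> real \<Rightarrow> ennreal \<Rightarrow> real \<Rightarrow> real" where
  "riesz_sum_const d \<alpha> q' m = 2 + dyadic_const (\<alpha> + 1) (growth_exponent d q') * counting_const d q' m"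

lemma Lp_norm_cong_AE:
  assumes "f \<in> borel_measurable M" "g \<in> borel_measurable M" "AE x in M. f x = g x"
  shows "Lp_norm p M f = Lp_norm p M g"
proof -
  have "(\<integral>\<^sup>+x. ennreal (\<bar>f x\<bar> powr enn2real p) \<partial>M) = (\<integral>\<^sup>+x. ennreal (\<bar>g x\<bar> powr enn2real p) \<partial>M)"
    by (rule nn_integral_cong_AE) (use assms(3) in eventually_elim, simp)
  moreover have "esssup M (\<lambda>x. ennreal \<bar>f x\<bar>) = esssup M (\<lambda>x. ennreal \<bar>g x\<bar>)"
  proof (rule esssup_AE_cong)
    show "AE x in M. ennreal \<bar>f x\<bar> = ennreal \<bar>g x\<bar>" using assms(3) by eventually_elim simp
  qed (use assms(1,2) in auto)
  ultimately show ?thesis by (simp add: Lp_norm_def)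
qed

text \<open>Injectivity makes the label of a particle position unambiguous. The first marginal
  charges particle positions only, so the label reproduces the position almost everywhere.\<close>

lemma empirical_coupling_index:
  fixes x :: "nat \<Rightarrow> 'a::euclidean_space"
  assumes N: "0 < N" and inj: "inj_on x {..<N}"
    and \<gamma>: "sets \<gamma> = sets borel" "distr \<gamma> borel fst = empirical N x"
  obtains idx :: "'a \<Rightarrow> nat" where "idx \<in> measurable borel (count_space UNIV)" "\<And>z. idx z < N"
    "distr \<gamma> (count_space UNIV) (\<lambda>\<omega>. idx (fst \<omega>)) = distr (uniform_count_measure {..<N}) (count_space UNIV) (\<lambda>j. j)"
    "AE \<omega> in \<gamma>. x (idx (fst \<omega>)) = fst \<omega>"
proof
  \<comment> \<open>The alternative \<open>i = N - 1\<close> is a default for points without a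
    particle; it makes \<open>idx\<close> total with values below \<open>N\<close>.\<close>
  define idx where "idx z = (LEAST i. x i = z \<or> i = N - 1)" for z
  show m [measurable]: "idx \<in> measurable borel (count_space UNIV)"
    unfolding idx_def[abs_def] by measurable
  have "idx z \<le> N - 1" for z unfolding idx_def by (rule Least_le) simp
  thus "idx z < N" for z using N by (metis Suc_pred' less_Suc_eq_le)
  have idx: "idx (x i) = i" if "i < N" for i
    unfolding idx_def
  proof (rule Least_equality)
    fix j assume "x j = x i \<or> j = N - 1"
    thus "i \<le> j" using that inj_onD[OF inj, of j i] by (cases "j < N") auto
  qed simp
  have fst [measurable]: "fst \<in> measurable \<gamma> borel"
    unfolding measurable_cong_sets[OF \<gamma>(1) refl] by (intro borel_measurable_continuous_onI continuous_intros)
  have x [measurable]: "x \<in> measurable (uniform_count_measure {..<N}) borel"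
    by (simp add: measurable_def space_uniform_count_measure sets_uniform_count_measure)
  have "distr \<gamma> (count_space UNIV) (\<lambda>\<omega>. idx (fst \<omega>)) = distr (distr \<gamma> borel fst) (count_space UNIV) idx"
    by (subst distr_distr) (auto simp: comp_def)
  also have "\<dots> = distr (uniform_count_measure {..<N}) (count_space UNIV) (\<lambda>j. idx (x j))"
    unfolding \<gamma>(2) empirical_def by (subst distr_distr) (auto simp: comp_def)
  also have "\<dots> = distr (uniform_count_measure {..<N}) (count_space UNIV) (\<lambda>j. j)"
    by (intro distr_cong) (auto simp: space_uniform_count_measure idx)
  finally show "distr \<gamma> (count_space UNIV) (\<lambda>\<omega>. idx (fst \<omega>)) = distr (uniform_count_measure {..<N}) (count_space UNIV) (\<lambda>j. j)" .
  have [measurable]: "(\<lambda>z. x (idx z)) \<in> borel_measurable borel"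
    by (rule measurable_compose[OF m]) simp
  have "AE z in empirical N x. x (idx z) = z"
    unfolding empirical_def by (subst AE_distr_iff) (auto simp: space_uniform_count_measure idx intro!: AE_I2)
  thus "AE \<omega> in \<gamma>. x (idx (fst \<omega>)) = fst \<omega>"
    unfolding \<gamma>(2)[symmetric] by (subst (asm) AE_distr_iff) auto
qed

text \<open>\<open>E\<close> stands for the initial distance plus \<open>1 / lam\<close>. Being
  strictly above the Wasserstein distance it admits a coupling of smaller cost, so that no optimal
  coupling has to be produced.\<close>

locale particle_approximation = transport K \<alpha> C\<^sub>K q q' m \<sigma>\<^sub>0 \<sigma>
  for K :: "'a::euclidean_space \<Rightarrow> 'a" and \<alpha> C\<^sub>K q q' m \<sigma>\<^sub>0 \<sigma> +
  fixes N :: nat and lam :: real and X\<^sub>0 V\<^sub>0 :: "nat \<Rightarrow> 'a" and \<tau> :: ereal and X V :: "nat \<Rightarrow> real \<Rightarrow> 'a"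
    and p :: ennreal and C\<^sub>V E dm :: real
  assumes p: "1 \<le> p" and N_pos: "0 < N" and lam_pos: "0 < lam"
    and maximal: "maximal_particle_solution K lam N X\<^sub>0 V\<^sub>0 \<tau> X V"
    and V0_diff: "\<And>i j. i < N \<Longrightarrow> j < N \<Longrightarrow> norm (V\<^sub>0 i - V\<^sub>0 j) \<le> lam / 2 * norm (X\<^sub>0 i - X\<^sub>0 j)"
    and CV: "0 < C\<^sub>V" "velocity_bound p N V\<^sub>0 C\<^sub>V"
    and E: "0 < E" "1 / lam \<le> E" "wasserstein p (empirical N X\<^sub>0) (law \<sigma>\<^sub>0) < ennreal E"
    and dm: "0 < dm" "\<And>i j. i < N \<Longrightarrow> j < N \<Longrightarrow> i \<noteq> j \<Longrightarrow> dm \<le> dist (X\<^sub>0 i) (X\<^sub>0 j)"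
begin

abbreviation riesz_mean :: "nat \<Rightarrow> real \<Rightarrow> real" where
  "riesz_mean i t \<equiv> (1 / real N) * (\<Sum>j<N. \<kappa> (X i t - X j t))"

definition rate :: real where "rate = rate_exponent p q' DIM('a) \<alpha>"

definition near :: real where "near = near_const DIM('a) (\<alpha> + 1) (counting_const DIM('a) q' m)"

text \<open>The vanishing quantity of the theorem, with \<open>N powr (1 / d) * dm\<close> in place
  of the minimal distance factor that dominates it.\<close>

definition Q :: real where "Q = (real N powr (1 / real DIM('a)) * dm) powr (- (\<alpha> + 1)) * E powr rate"

lemma solution_at:
  assumes "0 \<le> t" "ereal t < \<tau>"
  shows "i < N \<Longrightarrow> j < N \<Longrightarrow> i \<noteq> j \<Longrightarrow> X i t \<noteq> X j t"
    and "i < N \<Longrightarrow> (X i has_vector_derivative V i t) (at t within {s. 0 \<le> s \<and> ereal s < \<tau>})"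
    and "i < N \<Longrightarrow> (V i has_vector_derivative lam *\<^sub>R (- V i t + force N (\<lambda>j. X j t) i)) (at t within {s. 0 \<le> s \<and> ereal s < \<tau>})"
proof -
  have sol: "\<not> collision N X t \<and> (\<forall>i<N. (X i has_vector_derivative V i t) (at t within {s. 0 \<le> s \<and> ereal s < \<tau>}) \<and>
          (V i has_vector_derivative
             lam *\<^sub>R (- V i t + (1 / real N) *\<^sub>R (\<Sum>j\<in>{..<N} - {i}. K (X i t - X j t))))
            (at t within {s. 0 \<le> s \<and> ereal s < \<tau>}))"
    using maximal assms unfolding maximal_particle_solution_def particle_solution_def by blast
  show nc: "i < N \<Longrightarrow> j < N \<Longrightarrow> i \<noteq> j \<Longrightarrow> X i t \<noteq> X j t" for i j
    using sol unfolding collision_def by blast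
  show "i < N \<Longrightarrow> (X i has_vector_derivative V i t) (at t within {s. 0 \<le> s \<and> ereal s < \<tau>})"
    using sol by blast
  assume i: "i < N"
  have "force N (\<lambda>j. X j t) i = (1 / real N) *\<^sub>R (\<Sum>j\<in>{..<N} - {i}. K (X i t - X j t))"
    by (rule force_eq[OF i]) (use nc[OF i] in metis)
  thus "(V i has_vector_derivative lam *\<^sub>R (- V i t + force N (\<lambda>j. X j t) i)) (at t within {s. 0 \<le> s \<and> ereal s < \<tau>})"
    using sol i by simp
qed

lemma initial_values: "i < N \<Longrightarrow> X i 0 = X\<^sub>0 i" "i < N \<Longrightarrow> V i 0 = V\<^sub>0 i"
  using maximal by (auto simp: maximal_particle_solution_def particle_solution_def)

text \<open>Extension with horizon 0: the bounds asked for are those of the initial data.\<close>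

lemma lifetime_pos: "0 < \<tau>"
proof -
  have "ereal 0 < \<tau>"
  proof (rule maximal_solution_extends[OF maximal N_pos lam_pos dm(1) order_refl dm(2)])
    show "norm (V\<^sub>0 i) \<le> (\<Sum>j<N. norm (V\<^sub>0 j))" if "i < N" for i
      by (rule member_le_sum) (use that in auto)
    thus "norm (V i t) \<le> (\<Sum>j<N. norm (V\<^sub>0 j))" if "0 \<le> t" "t \<le> 0" "i < N" for t i
      using that initial_values(2)[of i] by simp
    show "dm \<le> dist (X i t) (X j t)" if "0 \<le> t" "t \<le> 0" "i < N" "j < N" "i \<noteq> j" for t i j
      using that dm(2)[of i j] initial_values(1)[of i] initial_values(1)[of j] by simp
  qed
  thus ?thesis by (simp add: zero_ereal_def)
qed

lemma particlesI:
  assumes b: "0 \<le> b" "ereal b < \<tau>" and \<Lambda>: "0 \<le> \<Lambda>" "\<And>i t. i < N \<Longrightarrow> 0 \<le> t \<Longrightarrow> t \<le> b \<Longrightarrow> riesz_mean i t \<le> \<Lambda>"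
  shows "particles K \<alpha> C\<^sub>K N lam X V b \<Lambda>"
proof
  have sub: "{0..b} \<subseteq> {s. 0 \<le> s \<and> ereal s < \<tau>}" using b by (auto intro: le_less_trans[of "ereal _" "ereal b"])
  have t: "ereal t < \<tau>" if "t \<le> b" for t using that b by (auto intro: le_less_trans[of "ereal _" "ereal b"])
  show "(X i has_vector_derivative V i t) (at t within {0..b})"
    and "(V i has_vector_derivative lam *\<^sub>R (- V i t + force N (\<lambda>j. X j t) i)) (at t within {0..b})"
    if "i < N" "0 \<le> t" "t \<le> b" for i t
    by (rule has_vector_derivative_within_subset[OF _ sub], rule solution_at; use that t in simp)+
  show "X i t \<noteq> X j t" if "i < N" "j < N" "i \<noteq> j" "0 \<le> t" "t \<le> b" for i j t
    using solution_at(1) that t by blast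
qed (use N_pos lam_pos b \<Lambda> in auto)

lemma mean_field_exists:
  assumes b: "0 \<le> b" "ereal b < \<tau>" and \<Lambda>: "0 \<le> \<Lambda>" "\<And>i t. i < N \<Longrightarrow> 0 \<le> t \<Longrightarrow> t \<le> b \<Longrightarrow> riesz_mean i t \<le> \<Lambda>"
  obtains Y \<gamma> idx where "mean_field K \<alpha> C\<^sub>K q q' m \<sigma>\<^sub>0 \<sigma> N lam X V b \<Lambda> Y \<gamma> idx"
    "Lp_norm p \<gamma> (mean_field.D X b Y idx 0) \<le> ennreal E"
proof -
  obtain Y where Y: "is_flow Y" using flow_exists by blast
  obtain \<gamma> where \<gamma>: "\<gamma> \<in> couplings (empirical N X\<^sub>0) (law \<sigma>\<^sub>0)" "Lp_norm p \<gamma> (\<lambda>(x, y). dist x y) < ennreal E"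
    using E(3) unfolding wasserstein_def by (auto simp: INF_less_iff)
  have g: "sets \<gamma> = sets borel" "distr \<gamma> borel fst = empirical N X\<^sub>0" "distr \<gamma> borel snd = law \<sigma>\<^sub>0"
    using \<gamma>(1) by (auto simp: couplings_def)
  have snd: "snd \<in> measurable \<gamma> borel"
    unfolding measurable_cong_sets[OF g(1) refl] by (intro borel_measurable_continuous_onI continuous_intros)
  have "prob_space (distr \<gamma> borel snd)" unfolding g(3) by (rule prob_space_law[OF initial])
  hence prob: "prob_space \<gamma>" by (rule prob_space_distrD[OF snd])
  have inj: "inj_on X\<^sub>0 {..<N}"
    using dm by (force simp: inj_on_def)
  obtain idx where idx: "idx \<in> measurable borel (count_space UNIV)" "\<And>z. idx z < N"
    "distr \<gamma> (count_space UNIV) (\<lambda>\<omega>. idx (fst \<omega>)) = distr (uniform_count_measure {..<N}) (count_space UNIV) (\<lambda>j. j)"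
    "AE \<omega> in \<gamma>. X\<^sub>0 (idx (fst \<omega>)) = fst \<omega>"
    by (rule empirical_coupling_index[OF N_pos inj g(1,2)]) blast
  have ps: "particles K \<alpha> C\<^sub>K N lam X V b \<Lambda>" by (rule particlesI[OF b \<Lambda>])
  interpret M: mean_field K \<alpha> C\<^sub>K q q' m \<sigma>\<^sub>0 \<sigma> N lam X V b \<Lambda> Y \<gamma> idx
    by (intro mean_field.intro mean_field_axioms.intro transport_axioms ps Y prob g idx)
  have "Lp_norm p \<gamma> (M.D 0) = Lp_norm p \<gamma> (\<lambda>(x, y). dist x y)"
  proof (rule Lp_norm_cong_AE)
    show "(\<lambda>(x, y). dist x y) \<in> borel_measurable \<gamma>"
      unfolding measurable_cong_sets[OF g(1) refl] case_prod_beta by (intro borel_measurable_continuous_onI continuous_intros)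
    show "AE \<omega> in \<gamma>. M.D 0 \<omega> = (\<lambda>(x, y). dist x y) \<omega>"
      using idx(4)
    proof eventually_elim
      case (elim \<omega>)
      thus ?case using b idx(2) by (simp add: M.D_def M.I_def initial_values case_prod_beta dist_norm)
    qed
  qed simp
  thus thesis using that M.mean_field_axioms \<gamma>(2) by (simp add: less_imp_le)
qed

definition \<Lambda>\<^sub>0 :: real where "\<Lambda>\<^sub>0 = riesz_sum_const DIM('a) \<alpha> q' m"

definition \<beta>\<^sub>0 :: real where "\<beta>\<^sub>0 = 16 * (\<Lambda>\<^sub>0 + riesz_const DIM('a) \<alpha> q' m) * (C1 + 1)"

definition L\<^sub>0 :: real where "L\<^sub>0 = amplification p C\<^sub>V (C\<^sub>K * (1 + \<Lambda>\<^sub>0))"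

text \<open>The factor by which \<open>separation\<close> lets the minimal distance shrink up to
  time \<open>t\<close>.\<close>

definition separation_loss :: "real \<Rightarrow> real" where "separation_loss t = exp (- (4 * C1 * \<Lambda>\<^sub>0 * t)) / 3"

lemma Lambda0_nonneg: "0 \<le> \<Lambda>\<^sub>0"
  using dyadic_const_pos[OF riesz_exponent_less_growth] growth_const_nonneg[of m] m
  by (simp add: \<Lambda>\<^sub>0_def riesz_sum_const_def counting_const_def)

lemma L0_pos: "0 < L\<^sub>0"
  unfolding L\<^sub>0_def using CV CK_nonneg Lambda0_nonneg by (intro amplification_pos) auto

lemma near_nonneg: "0 \<le> near"
  using dyadic_const_pos[of "\<alpha> + 1" "real DIM('a)"] alpha_less by (simp add: near_def near_const_def)

lemma rate_pos: "0 < rate"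
  using conjugate_pos alpha_less p enn2real_mono[of 1 p]
  by (auto simp: rate_def rate_exponent_def less_top intro!: divide_pos_pos mult_pos_pos add_pos_pos)

text \<open>The interval \<open>{0..0}\<close> already gives access to the coupling estimates, with
  the sum of all Riesz means as a trivial bound in place of
  \<open>\<Lambda>\<^sub>0\<close>.\<close>

lemma initial_riesz_mean:
  assumes "near * Q \<le> 1 / 2" "i < N"
  shows "riesz_mean i 0 \<le> \<Lambda>\<^sub>0 - 1 / 2"
proof -
  have b: "0 \<le> (0::real)" "ereal 0 < \<tau>" using lifetime_pos by (simp_all add: zero_ereal_def)
  define \<Lambda> where "\<Lambda> = (\<Sum>i<N. riesz_mean i 0)"
  have \<Lambda>: "0 \<le> \<Lambda>" unfolding \<Lambda>_def by (intro sum_nonneg mult_nonneg_nonneg) auto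
  have le: "riesz_mean i t \<le> \<Lambda>" if "i < N" "0 \<le> t" "t \<le> 0" for i t
  proof -
    have "t = 0" using that by simp
    thus ?thesis unfolding \<Lambda>_def
      using member_le_sum[of i "{..<N}" "\<lambda>i. riesz_mean i 0"] that(1) by (simp add: sum_nonneg)
  qed
  obtain Y \<gamma> idx where M: "mean_field K \<alpha> C\<^sub>K q q' m \<sigma>\<^sub>0 \<sigma> N lam X V 0 \<Lambda> Y \<gamma> idx"
    "Lp_norm p \<gamma> (mean_field.D X 0 Y idx 0) \<le> ennreal E"
    by (rule mean_field_exists[OF b \<Lambda> le])
  interpret M: mean_field K \<alpha> C\<^sub>K q q' m \<sigma>\<^sub>0 \<sigma> N lam X V 0 \<Lambda> Y \<gamma> idx by (rule M(1))
  have sep: "dm \<le> dist (X i 0) (X j 0)" if "i < N" "j < N" "i \<noteq> j" for i j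
    using dm(2)[OF that] that by (simp add: initial_values)
  have "riesz_mean i 0 \<le> \<Lambda>\<^sub>0 - 1 + near * Q"
    using M.riesz_sum_improved[OF p order_refl order_refl M(2) E(1) assms(2) dm(1) sep]
    unfolding Q_def near_def \<Lambda>\<^sub>0_def riesz_sum_const_def rate_def by simp
  thus ?thesis using assms(1) by simp
qed

text \<open>While the sums stay below \<open>\<Lambda>\<^sub>0\<close> all constants are fixed, and
  the coupling distance at the end is at most
  \<open>L\<^sub>0 * exp (\<beta>\<^sub>0 * b) * E\<close>. This growth and the loss of separation,
  both taken at the horizon \<open>T\<close>, multiply \<open>Q\<close>; its smallness brings the
  sums down to \<open>\<Lambda>\<^sub>0 - 1 / 2\<close>.\<close>

lemma bootstrap_step:
  assumes b: "0 \<le> b" "ereal b < \<tau>" "b \<le> T" and le: "\<And>i t. i < N \<Longrightarrow> 0 \<le> t \<Longrightarrow> t \<le> b \<Longrightarrow> riesz_mean i t \<le> \<Lambda>\<^sub>0"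
    and lam: "8 * C1 * \<Lambda>\<^sub>0 \<le> lam"
    and small: "near * (separation_loss T powr - (\<alpha> + 1) * (L\<^sub>0 * exp (\<beta>\<^sub>0 * T)) powr rate * Q) \<le> 1 / 2"
  shows "i < N \<Longrightarrow> j < N \<Longrightarrow> i \<noteq> j \<Longrightarrow> separation_loss T * dm \<le> dist (X i b) (X j b)"
    and "i < N \<Longrightarrow> norm (V i b) \<le> norm (V\<^sub>0 i) + C\<^sub>K * (1 + \<Lambda>\<^sub>0)"
    and "i < N \<Longrightarrow> riesz_mean i b \<le> \<Lambda>\<^sub>0 - 1 / 2"
    and "wasserstein p (empirical N (\<lambda>i. X i b)) (law (\<sigma> b)) \<le> ennreal (L\<^sub>0 * exp (\<beta>\<^sub>0 * b) * E)"
proof -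
  obtain Y \<gamma> idx where M: "mean_field K \<alpha> C\<^sub>K q q' m \<sigma>\<^sub>0 \<sigma> N lam X V b \<Lambda>\<^sub>0 Y \<gamma> idx"
    "Lp_norm p \<gamma> (mean_field.D X b Y idx 0) \<le> ennreal E"
    by (rule mean_field_exists[OF b(1,2) Lambda0_nonneg le])
  interpret M: mean_field K \<alpha> C\<^sub>K q q' m \<sigma>\<^sub>0 \<sigma> N lam X V b \<Lambda>\<^sub>0 Y \<gamma> idx by (rule M(1))
  have \<beta>: "M.\<beta> = \<beta>\<^sub>0" by (simp add: M.beta_eq \<beta>\<^sub>0_def M.\<Lambda>\<sigma>_def)
  have S: "M.S = C\<^sub>K * (1 + \<Lambda>\<^sub>0)" by (simp add: M.S_def)
  have vb: "velocity_bound p N (\<lambda>i. V i 0) C\<^sub>V"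
  proof -
    have "(\<Sum>i<N. norm (V i 0) powr r) = (\<Sum>i<N. norm (V\<^sub>0 i) powr r)" for r
      by (intro sum.cong) (auto simp: initial_values)
    thus ?thesis using CV(2) by (simp add: velocity_bound_def initial_values split: if_splits)
  qed
  define f where "f = L\<^sub>0 * exp (\<beta>\<^sub>0 * b) * E"
  have f: "0 < f" using L0_pos E by (simp add: f_def)
  have D: "Lp_norm p \<gamma> (M.D b) \<le> ennreal f"
    using M.Lp_norm_D_le[OF p E(1,2) M(2) CV(1) vb b(1) order_refl] by (simp add: \<beta> S f_def L\<^sub>0_def)
  have \<beta>0: "0 \<le> \<beta>\<^sub>0"
    using Lambda0_nonneg M.Sigma_riesz_one_le C1_nonneg by (simp add: \<beta>\<^sub>0_def M.\<Lambda>\<sigma>_def)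
  have CL: "0 \<le> 4 * C1 * \<Lambda>\<^sub>0" using C1_nonneg Lambda0_nonneg by simp
  have loss: "0 < separation_loss T" "separation_loss T \<le> separation_loss b"
    using mult_left_mono[OF b(3) CL] by (simp_all add: separation_loss_def)
  show sep: "separation_loss T * dm \<le> dist (X i b) (X j b)" if "i < N" "j < N" "i \<noteq> j" for i j
  proof -
    have "separation_loss T * dm \<le> separation_loss b * norm (X i 0 - X j 0)"
      using loss dm(1) dm(2)[OF that] that by (intro mult_mono) (auto simp: initial_values dist_norm)
    also have "\<dots> \<le> dist (X i b) (X j b)"
      using M.separation[OF that(1,2) lam _ b(1) order_refl] V0_diff[OF that(1,2)] that
      by (simp add: separation_loss_def initial_values dist_norm)
    finally show ?thesis .
  qed
  show "i < N \<Longrightarrow> norm (V i b) \<le> norm (V\<^sub>0 i) + C\<^sub>K * (1 + \<Lambda>\<^sub>0)" for i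
    using M.norm_V_le[of i b] b(1) by (simp add: initial_values)
  show "wasserstein p (empirical N (\<lambda>i. X i b)) (law (\<sigma> b)) \<le> ennreal (L\<^sub>0 * exp (\<beta>\<^sub>0 * b) * E)"
    using M.wasserstein_le[OF b(1) order_refl, of p] D unfolding f_def by (rule order_trans)
  assume i: "i < N"
  have "riesz_mean i b \<le> \<Lambda>\<^sub>0 - 1 + near * ((real N powr (1 / real DIM('a)) * (separation_loss T * dm)) powr - (\<alpha> + 1) * f powr rate)"
    using M.riesz_sum_improved[OF p b(1) order_refl D f i mult_pos_pos[OF loss(1) dm(1)] sep]
    unfolding near_def \<Lambda>\<^sub>0_def riesz_sum_const_def rate_def by simp
  also have "near * ((real N powr (1 / real DIM('a)) * (separation_loss T * dm)) powr - (\<alpha> + 1) * f powr rate)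
     \<le> near * (separation_loss T powr - (\<alpha> + 1) * (L\<^sub>0 * exp (\<beta>\<^sub>0 * T)) powr rate * Q)"
  proof (rule mult_left_mono[OF _ near_nonneg])
    have "f powr rate \<le> (L\<^sub>0 * exp (\<beta>\<^sub>0 * T) * E) powr rate"
      unfolding f_def using L0_pos E rate_pos mult_left_mono[OF b(3) \<beta>0]
      by (intro powr_mono2 mult_right_mono mult_left_mono) auto
    also have "\<dots> = (L\<^sub>0 * exp (\<beta>\<^sub>0 * T)) powr rate * E powr rate" using L0_pos E by (simp add: powr_mult)
    finally have le: "f powr rate \<le> (L\<^sub>0 * exp (\<beta>\<^sub>0 * T)) powr rate * E powr rate" .
    have "real N powr (1 / real DIM('a)) * (separation_loss T * dm) = separation_loss T * (real N powr (1 / real DIM('a)) * dm)"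
      by (simp only: mult_ac)
    hence eq: "(real N powr (1 / real DIM('a)) * (separation_loss T * dm)) powr - (\<alpha> + 1) =
        separation_loss T powr - (\<alpha> + 1) * (real N powr (1 / real DIM('a)) * dm) powr - (\<alpha> + 1)"
      by (simp only: powr_mult)
    show "(real N powr (1 / real DIM('a)) * (separation_loss T * dm)) powr - (\<alpha> + 1) * f powr rate
       \<le> separation_loss T powr - (\<alpha> + 1) * (L\<^sub>0 * exp (\<beta>\<^sub>0 * T)) powr rate * Q"
      using mult_left_mono[OF le, of "(real N powr (1 / real DIM('a)) * (separation_loss T * dm)) powr - (\<alpha> + 1)"]
      unfolding Q_def eq by (simp only: mult_ac powr_ge_zero mult_nonneg_nonneg simp_thms)
  qed
  finally show "riesz_mean i b \<le> \<Lambda>\<^sub>0 - 1 / 2" using small by linarith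
qed

lemma riesz_mean_continuous:
  assumes "0 \<le> b" "ereal b < \<tau>" "i < N"
  shows "continuous_on {0..b} (riesz_mean i)"
proof -
  have t: "ereal t < \<tau>" if "t \<le> b" for t using that assms(2) by (auto intro: le_less_trans[of "ereal _" "ereal b"])
  hence sub: "{0..b} \<subseteq> {s. 0 \<le> s \<and> ereal s < \<tau>}" by auto
  have X: "continuous_on {0..b} (X j)" if j: "j < N" for j
  proof (rule continuous_on_vector_derivative)
    fix r assume "r \<in> {0..b}"
    thus "(X j has_vector_derivative V j r) (at r within {0..b})"
      using has_vector_derivative_within_subset[OF solution_at(2)[OF _ t j] sub] by simp
  qed
  have "continuous_on {0..b} (\<lambda>r. \<kappa> (X i r - X j r))" if j: "j < N" for j
  proof (cases "i = j")
    case False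
    show ?thesis unfolding riesz_def
      by (intro continuous_intros X assms(3) j ballI) (use solution_at(1)[OF _ t assms(3) j False] in auto)
  qed simp
  thus ?thesis by (intro continuous_intros) auto
qed

text \<open>Continuous induction on the bound \<open>\<Lambda>\<^sub>0\<close>: the gain of 1/2 and
  continuity push it past each time, and it is closed under limits. The separation and velocity
  bounds are then uniform up to \<open>T\<close>, so the maximal solution outlives
  \<open>T\<close>.\<close>

theorem convergence_estimate:
  assumes T: "0 \<le> T" and lam: "8 * C1 * \<Lambda>\<^sub>0 \<le> lam" and small0: "near * Q \<le> 1 / 2"
    and small: "near * (separation_loss T powr - (\<alpha> + 1) * (L\<^sub>0 * exp (\<beta>\<^sub>0 * T)) powr rate * Q) \<le> 1 / 2"
  shows "ereal T < \<tau>"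
    and "0 \<le> t \<Longrightarrow> t \<le> T \<Longrightarrow> wasserstein p (empirical N (\<lambda>i. X i t)) (law (\<sigma> t)) \<le> ennreal (L\<^sub>0 * exp (\<beta>\<^sub>0 * t) * E)"
proof -
  have P: "\<forall>i<N. riesz_mean i b \<le> \<Lambda>\<^sub>0" if b: "0 \<le> b" "ereal b < \<tau>" "b \<le> T" for b
  proof (rule real_interval_induct[OF b(1)])
    show "\<forall>i<N. riesz_mean i 0 \<le> \<Lambda>\<^sub>0" using initial_riesz_mean[OF small0] by fastforce
  next
    fix r assume r: "0 \<le> r" "r < b" "\<And>u. 0 \<le> u \<Longrightarrow> u \<le> r \<Longrightarrow> \<forall>i<N. riesz_mean i u \<le> \<Lambda>\<^sub>0"
    have rb: "ereal r < \<tau>" "r \<le> T" using r b by (auto intro: less_trans[of "ereal r" "ereal b"])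
    have "riesz_mean i r \<le> \<Lambda>\<^sub>0 - 1 / 2" if "i < N" for i
      by (rule bootstrap_step(3)[OF r(1) rb _ lam small that]) (use r(3) in blast)
    hence lt: "riesz_mean i r < \<Lambda>\<^sub>0" if "i < N" for i using that by fastforce
    have "\<forall>\<^sub>F u in at r within {0..b}. riesz_mean i u < \<Lambda>\<^sub>0" if i: "i < N" for i
    proof (rule order_tendstoD(2)[OF _ lt[OF i]])
      show "(riesz_mean i \<longlongrightarrow> riesz_mean i r) (at r within {0..b})"
        using riesz_mean_continuous[OF b(1,2) i] r by (auto simp: continuous_on_def)
    qed
    hence "\<forall>\<^sub>F u in at r within {0..b}. \<forall>i\<in>{..<N}. riesz_mean i u < \<Lambda>\<^sub>0"
      by (intro eventually_ball_finite) auto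
    then obtain d where d: "0 < d" "\<And>u. u \<in> {0..b} \<Longrightarrow> u \<noteq> r \<Longrightarrow> dist u r < d \<Longrightarrow> \<forall>i\<in>{..<N}. riesz_mean i u < \<Lambda>\<^sub>0"
      unfolding eventually_at by blast
    show "\<exists>d>0. \<forall>u. r < u \<and> u < r + d \<and> u \<le> b \<longrightarrow> (\<forall>i<N. riesz_mean i u \<le> \<Lambda>\<^sub>0)"
    proof (intro exI[of _ d] conjI allI impI d(1))
      fix u i assume "r < u \<and> u < r + d \<and> u \<le> b" "i < N"
      thus "riesz_mean i u \<le> \<Lambda>\<^sub>0" using bspec[OF d(2)[of u], of i] r(1) by (simp add: dist_real_def)
    qed
  next
    fix r assume r: "0 < r" "r \<le> b" "\<And>u. 0 \<le> u \<Longrightarrow> u < r \<Longrightarrow> \<forall>i<N. riesz_mean i u \<le> \<Lambda>\<^sub>0"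
    show "\<forall>i<N. riesz_mean i r \<le> \<Lambda>\<^sub>0"
    proof (intro allI impI)
      fix i assume i: "i < N"
      have lim: "(riesz_mean i \<longlongrightarrow> riesz_mean i r) (at r within {0..<r})"
      proof (rule tendsto_within_subset)
        show "(riesz_mean i \<longlongrightarrow> riesz_mean i r) (at r within {0..b})"
          using riesz_mean_continuous[OF b(1,2) i] r by (auto simp: continuous_on_def)
      qed (use r in auto)
      show "riesz_mean i r \<le> \<Lambda>\<^sub>0"
      proof (rule tendsto_upperbound[OF lim])
        show "\<forall>\<^sub>F u in at r within {0..<r}. riesz_mean i u \<le> \<Lambda>\<^sub>0"
          using r(3) i by (auto simp: eventually_at_filter)
        show "at r within {0..<r} \<noteq> bot"
          using r(1) by (simp add: trivial_limit_within islimpt_Ico)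
      qed
    qed
  qed
  have le: "riesz_mean i u \<le> \<Lambda>\<^sub>0" if "i < N" "0 \<le> u" "u \<le> b" "ereal b < \<tau>" "b \<le> T" for i u b
  proof -
    have "ereal u < \<tau>" using that(3,4) by (auto intro: le_less_trans[of "ereal u" "ereal b"])
    thus ?thesis using P[of u] that by simp
  qed
  show *: "ereal T < \<tau>"
  proof (rule maximal_solution_extends[OF maximal N_pos lam_pos _ T])
    have CL: "0 \<le> 4 * C1 * \<Lambda>\<^sub>0 * T" using C1_nonneg Lambda0_nonneg T by simp
    hence "exp (- (4 * C1 * \<Lambda>\<^sub>0 * T)) \<le> 1" by simp
    hence "separation_loss T \<le> 1" unfolding separation_loss_def by linarith
    moreover have "0 < separation_loss T" by (simp add: separation_loss_def)
    ultimately have "separation_loss T * dm \<le> dm" using dm(1) by simp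
    thus "separation_loss T * dm \<le> dist (X\<^sub>0 i) (X\<^sub>0 j)" if "i < N" "j < N" "i \<noteq> j" for i j
      using dm(2)[OF that] by linarith
    show "0 < separation_loss T * dm" using dm(1) by (simp add: separation_loss_def)
    have S: "0 \<le> C\<^sub>K * (1 + \<Lambda>\<^sub>0)" using CK_nonneg Lambda0_nonneg by simp
    have V: "norm (V\<^sub>0 i) \<le> (\<Sum>j<N. norm (V\<^sub>0 j))" if "i < N" for i
      by (rule member_le_sum) (use that in auto)
    show "norm (V\<^sub>0 i) \<le> (\<Sum>j<N. norm (V\<^sub>0 j)) + C\<^sub>K * (1 + \<Lambda>\<^sub>0)" if "i < N" for i
      using V[OF that] S by linarith
    show "separation_loss T * dm \<le> dist (X i t) (X j t)"
      if "0 \<le> t" "ereal t < \<tau>" "t \<le> T" "i < N" "j < N" "i \<noteq> j" for t i j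
      using that by (intro bootstrap_step(1)[OF that(1-3) _ lam small] le) auto
    show "norm (V i t) \<le> (\<Sum>j<N. norm (V\<^sub>0 j)) + C\<^sub>K * (1 + \<Lambda>\<^sub>0)"
      if "0 \<le> t" "ereal t < \<tau>" "t \<le> T" "i < N" for t i
    proof -
      have "norm (V i t) \<le> norm (V\<^sub>0 i) + C\<^sub>K * (1 + \<Lambda>\<^sub>0)"
        using that by (intro bootstrap_step(2)[OF that(1-3) _ lam small] le) auto
      thus ?thesis using V[OF that(4)] by linarith
    qed
  qed
  assume t: "0 \<le> t" "t \<le> T"
  have "ereal t < \<tau>" using t * by (auto intro: le_less_trans[of "ereal t" "ereal T"])
  thus "wasserstein p (empirical N (\<lambda>i. X i t)) (law (\<sigma> t)) \<le> ennreal (L\<^sub>0 * exp (\<beta>\<^sub>0 * t) * E)"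
    using t by (intro bootstrap_step(4)[OF t(1) _ t(2) _ lam small] le) auto
qed

end

section \<open>Extraction of the initial scales, and conclusion\<close>

lemma epow_ennreal: "0 \<le> x \<Longrightarrow> epow (ennreal x) r = ennreal (x powr r)"
  by (simp add: epow_def)

text \<open>The second factor is at least 1, so the product bounds \<open>E powr r\<close> alone. An
  infinite Wasserstein distance or a vanishing minimal distance would make the product infinite, the
  first factor being positive thanks to \<open>1 / lam\<close>.\<close>

lemma initial_scales:
  fixes w dmin :: ennreal and r s n lam \<eta> :: real
  assumes lt: "epow (w + 1 / ennreal lam) r * epow (1 + 1 / (ennreal n * dmin)) s < ennreal \<eta>"
    and pos: "0 < lam" "0 < r" "0 < s" "0 < n" and fin: "dmin < \<infinity>"
  obtains E dm where "w + 1 / ennreal lam = ennreal E" "0 < E" "w < ennreal E" "1 / lam \<le> E" "E powr r < \<eta>"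
    "dmin = ennreal dm" "0 < dm" "(n * dm) powr (- s) * E powr r < \<eta>"
proof -
  have l: "1 / ennreal lam = ennreal (1 / lam)" using pos divide_ennreal[of 1 lam] by simp
  obtain dm where dm: "dmin = ennreal dm" "0 \<le> dm" using fin by (cases dmin) auto
  define y where "y = epow (1 + 1 / (ennreal n * dmin)) s"
  have y1: "1 \<le> y"
  proof (cases "1 / (ennreal n * dmin) = \<infinity>")
    case True
    thus ?thesis by (simp add: y_def epow_def)
  next
    case False
    then obtain z where z: "1 / (ennreal n * dmin) = ennreal z" "0 \<le> z" by (cases "1 / (ennreal n * dmin)") auto
    have "y = ennreal ((1 + z) powr s)"
      using z epow_ennreal[of "1 + z" s] by (simp add: y_def)
    moreover have "1 \<le> (1 + z) powr s" using z pos by (intro ge_one_powr_ge_zero) auto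
    ultimately show ?thesis using ennreal_leI[of 1 "(1 + z) powr s"] by simp
  qed
  define x where "x = epow (w + 1 / ennreal lam) r"
  have x: "x < ennreal \<eta>" using mult_left_mono[OF y1, of x] lt by (simp add: x_def y_def)
  hence "w + 1 / ennreal lam \<noteq> \<infinity>" by (auto simp: x_def epow_def)
  hence "w \<noteq> \<infinity>" by auto
  then obtain w' where w: "w = ennreal w'" "0 \<le> w'" by (cases w) auto
  define E where "E = w' + 1 / lam"
  have E: "0 < E" "1 / lam \<le> E" using w pos by (simp_all add: E_def add_nonneg_pos)
  have e: "w + 1 / ennreal lam = ennreal E" using w pos by (simp add: l E_def)
  have x_eq: "x = ennreal (E powr r)" using E by (simp add: x_def e epow_ennreal)
  have wE: "w < ennreal E" using w pos by (simp add: E_def ennreal_less_iff)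
  have Er: "E powr r < \<eta>" using x by (simp add: x_eq ennreal_less_iff)
  have "dm \<noteq> 0"
  proof
    assume "dm = 0"
    hence "y = \<infinity>" using dm pos by (simp add: y_def epow_def)
    thus False using lt x_eq E by (simp add: x_def[symmetric] y_def[symmetric] ennreal_mult_top)
  qed
  hence dm0: "0 < dm" using dm by simp
  have "1 / (ennreal n * dmin) = ennreal (1 / (n * dm))"
    using dm0 pos divide_ennreal[of 1 "n * dm"] by (simp add: dm ennreal_mult)
  hence y_eq: "y = ennreal ((1 + 1 / (n * dm)) powr s)"
    using dm0 pos epow_ennreal[of "1 + 1 / (n * dm)" s] by (simp add: y_def)
  have "(n * dm) powr (- s) = (1 / (n * dm)) powr s"
    using dm0 pos by (simp add: powr_divide powr_minus_divide)
  also have "\<dots> \<le> (1 + 1 / (n * dm)) powr s" using dm0 pos by (intro powr_mono2) auto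
  finally have "(n * dm) powr (- s) * E powr r \<le> (1 + 1 / (n * dm)) powr s * E powr r"
    by (rule mult_right_mono) simp
  also have "\<dots> < \<eta>"
    using lt unfolding x_def[symmetric] y_def[symmetric] x_eq y_eq
    by (simp add: ennreal_mult[symmetric] ennreal_less_iff mult.commute)
  finally show thesis using that e E wE Er dm(1) dm0 by blast
qed

lemma d_min_le:
  "i < N \<Longrightarrow> j < N \<Longrightarrow> i \<noteq> j \<Longrightarrow> d_min N x \<le> ennreal (dist (x i) (x j))"
  unfolding d_min_def by (rule INF_lower2[of "(i, j)"]) auto

text \<open>\<open>C\<close> is quantified before the kernel, the solution and the particle data,
  which expresses that it depends on the listed parameters and the norm \<open>m\<close>
  only.\<close>

theorem theorem2p3:
  fixes \<alpha> C\<^sub>K C\<^sub>V m :: real and p q q' :: ennreal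
  assumes "0 \<le> \<alpha>" and "\<alpha> < real DIM('a::euclidean_space) - 1"
    and "q > ennreal (real DIM('a) / (real DIM('a) - \<alpha> - 1))"
    and "1 / q + 1 / q' = 1"
    and "1 \<le> p"
    and "0 < C\<^sub>V"
  shows "\<exists>C>0. \<forall>(K :: 'a \<Rightarrow> 'a) (\<sigma>\<^sub>0 :: 'a \<Rightarrow> real) (\<sigma> :: real \<Rightarrow> 'a \<Rightarrow> real)
           (lam :: nat \<Rightarrow> real) (X\<^sub>0 :: nat \<Rightarrow> nat \<Rightarrow> 'a) (V\<^sub>0 :: nat \<Rightarrow> nat \<Rightarrow> 'a)
           (\<tau> :: nat \<Rightarrow> ereal) (X :: nat \<Rightarrow> nat \<Rightarrow> real \<Rightarrow> 'a) (V :: nat \<Rightarrow> nat \<Rightarrow> real \<Rightarrow> 'a).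
       admissible_kernel \<alpha> C\<^sub>K K \<and>
       \<sigma>\<^sub>0 \<in> prob_Lq q \<and> Lp_norm q lborel \<sigma>\<^sub>0 = ennreal m \<and>
       transport_solution q K \<sigma>\<^sub>0 \<sigma> \<and>
       (\<forall>N\<ge>1. 0 < lam N) \<and>
       (\<forall>N\<ge>1. maximal_particle_solution K (lam N) N (X\<^sub>0 N) (V\<^sub>0 N) (\<tau> N) (X N) (V N)) \<and>
       (\<lambda>N. epow (wasserstein p (empirical N (X\<^sub>0 N)) (law \<sigma>\<^sub>0) + 1 / ennreal (lam N))
                 (rate_exponent p q' DIM('a) \<alpha>)
            * epow (1 + 1 / (ennreal (real N powr (1 / real DIM('a))) * d_min N (X\<^sub>0 N))) (\<alpha> + 1))
         \<longlonglongrightarrow> 0 \<and>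
       (\<forall>N\<ge>1. \<forall>i<N. \<forall>j<N.
          norm (V\<^sub>0 N i - V\<^sub>0 N j) \<le> 1 / 2 * lam N * norm (X\<^sub>0 N i - X\<^sub>0 N j)) \<and>
       (\<forall>N\<ge>1. velocity_bound p N (V\<^sub>0 N) C\<^sub>V)
       \<longrightarrow>
       (\<forall>T>0. \<forall>\<^sub>F N in sequentially.
          ereal T < \<tau> N \<and>
          (\<forall>t\<in>{0..T}. \<not> collision N (X N) t) \<and>
          (\<forall>t\<in>{0..T}.
             wasserstein p (empirical N (\<lambda>i. X N i t)) (law (\<sigma> t))
               \<le> ennreal C
                   * (wasserstein p (empirical N (X\<^sub>0 N)) (law \<sigma>\<^sub>0) + 1 / ennreal (lam N))
                   * ennreal (exp (C * t))))"
proof -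
  define d where "d = DIM('a)"
  \<comment> \<open>Turns the norm into a strictly positive bound, as \<open>transport\<close> asks
    for.\<close>
  define m1 where "m1 = \<bar>m\<bar> + 1"
  define \<Lambda> where "\<Lambda> = riesz_sum_const d \<alpha> q' m1"
  \<comment> \<open>The value of \<open>C1\<close>, written out because the kernel is fixed only
    later.\<close>
  define c1 where "c1 = C\<^sub>K * 2 powr (\<alpha> + 1)"
  define \<beta> where "\<beta> = 16 * (\<Lambda> + riesz_const d \<alpha> q' m1) * (c1 + 1)"
  define L where "L = amplification p C\<^sub>V (C\<^sub>K * (1 + \<Lambda>))"
  \<comment> \<open>\<open>L\<close> is needed as prefactor and \<beta> in the exponent; the 1
    secures positivity.\<close>
  define C where "C = max 1 (max \<beta> L)"
  define r where "r = rate_exponent p q' d \<alpha>"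
  define near where "near = near_const d (\<alpha> + 1) (counting_const d q' m1)"
  show ?thesis
  proof (rule exI[of _ C], intro conjI allI impI)
    show "0 < C" by (simp add: C_def)
    fix K :: "'a \<Rightarrow> 'a" and \<sigma>\<^sub>0 :: "'a \<Rightarrow> real" and \<sigma> lam X\<^sub>0 V\<^sub>0 \<tau> X V and T :: real
    assume T: "0 < T"
    assume H: "admissible_kernel \<alpha> C\<^sub>K K \<and>
       \<sigma>\<^sub>0 \<in> prob_Lq q \<and> Lp_norm q lborel \<sigma>\<^sub>0 = ennreal m \<and>
       transport_solution q K \<sigma>\<^sub>0 \<sigma> \<and>
       (\<forall>N\<ge>1. 0 < lam N) \<and>
       (\<forall>N\<ge>1. maximal_particle_solution K (lam N) N (X\<^sub>0 N) (V\<^sub>0 N) (\<tau> N) (X N) (V N)) \<and>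
       (\<lambda>N. epow (wasserstein p (empirical N (X\<^sub>0 N)) (law \<sigma>\<^sub>0) + 1 / ennreal (lam N))
                 (rate_exponent p q' DIM('a) \<alpha>)
            * epow (1 + 1 / (ennreal (real N powr (1 / real DIM('a))) * d_min N (X\<^sub>0 N))) (\<alpha> + 1))
         \<longlonglongrightarrow> 0 \<and>
       (\<forall>N\<ge>1. \<forall>i<N. \<forall>j<N.
          norm (V\<^sub>0 N i - V\<^sub>0 N j) \<le> 1 / 2 * lam N * norm (X\<^sub>0 N i - X\<^sub>0 N j)) \<and>
       (\<forall>N\<ge>1. velocity_bound p N (V\<^sub>0 N) C\<^sub>V)"
    hence K: "admissible_kernel \<alpha> C\<^sub>K K" and \<sigma>\<^sub>0: "\<sigma>\<^sub>0 \<in> prob_Lq q" "Lp_norm q lborel \<sigma>\<^sub>0 = ennreal m"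
      and sol: "transport_solution q K \<sigma>\<^sub>0 \<sigma>" and lam: "\<And>N. 1 \<le> N \<Longrightarrow> 0 < lam N"
      and maximal: "\<And>N. 1 \<le> N \<Longrightarrow> maximal_particle_solution K (lam N) N (X\<^sub>0 N) (V\<^sub>0 N) (\<tau> N) (X N) (V N)"
      and lim: "(\<lambda>N. epow (wasserstein p (empirical N (X\<^sub>0 N)) (law \<sigma>\<^sub>0) + 1 / ennreal (lam N)) r
            * epow (1 + 1 / (ennreal (real N powr (1 / real d)) * d_min N (X\<^sub>0 N))) (\<alpha> + 1)) \<longlonglongrightarrow> 0"
      and V0: "\<And>N i j. 1 \<le> N \<Longrightarrow> i < N \<Longrightarrow> j < N \<Longrightarrow> norm (V\<^sub>0 N i - V\<^sub>0 N j) \<le> 1 / 2 * lam N * norm (X\<^sub>0 N i - X\<^sub>0 N j)"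
      and CV: "\<And>N. 1 \<le> N \<Longrightarrow> velocity_bound p N (V\<^sub>0 N) C\<^sub>V"
      unfolding r_def d_def by blast+
    interpret transport K \<alpha> C\<^sub>K q q' m1 \<sigma>\<^sub>0 \<sigma>
    proof
      show "Lp_norm q lborel \<sigma>\<^sub>0 \<le> ennreal m1" unfolding \<sigma>\<^sub>0(2) by (rule ennreal_leI) (simp add: m1_def)
      show "0 < m1" by (simp add: m1_def)
    qed (use assms K \<sigma>\<^sub>0 sol in blast)+
    have c1: "C1 = c1" by (simp add: C1_def c1_def)
    have r0: "0 < r"
      using conjugate_pos alpha_less' assms(5) enn2real_mono[of 1 p] unfolding d_def[symmetric]
      by (auto simp: r_def rate_exponent_def less_top d_def intro!: divide_pos_pos mult_pos_pos add_pos_pos)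
    \<comment> \<open>The losses up to \<open>T\<close> as they occur in
      \<open>convergence_estimate\<close>. Through \<eta> they make the threshold for
      \<open>N\<close> depend on \<open>T\<close>.\<close>
    define G where "G = (exp (- (4 * c1 * \<Lambda> * T)) / 3) powr - (\<alpha> + 1) * (L * exp (\<beta> * T)) powr r"
    \<comment> \<open>Lower bound on \<open>lam N\<close> for \<open>separation\<close>. Since
      \<open>1 / lam N \<le> E\<close>, it follows from
      \<open>E powr r < (1 / H) powr r\<close>.\<close>
    define H where "H = 8 * \<bar>c1 * \<Lambda>\<bar> + 1"
    \<comment> \<open>Three demands: a small near field at time 0, a small near field with the
      losses up to \<open>T\<close>, and strong friction.\<close>
    define \<eta> where "\<eta> = min (min (1 / (2 * (\<bar>near\<bar> + 1))) (1 / (2 * (\<bar>near\<bar> * G + 1)))) ((1 / H) powr r)"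
    have G: "0 \<le> G" by (simp add: G_def)
    have H: "1 \<le> H" by (simp add: H_def)
    have \<eta>: "0 < \<eta>" "\<eta> \<le> 1 / (2 * (\<bar>near\<bar> + 1))" "\<eta> \<le> 1 / (2 * (\<bar>near\<bar> * G + 1))" "\<eta> \<le> (1 / H) powr r"
      using G H by (auto simp: \<eta>_def add_nonneg_pos)
    have near_le: "near * Z \<le> 1 / 2" if "0 \<le> Z" "Z < \<eta>" for Z
    proof -
      have "near * Z \<le> \<bar>near\<bar> * (1 / (2 * (\<bar>near\<bar> + 1)))" using that \<eta>(2) by (intro mult_mono) auto
      also have "\<dots> \<le> 1 / 2" by (simp add: field_simps)
      finally show ?thesis .
    qed
    have near_G_le: "near * (G * Z) \<le> 1 / 2" if "0 \<le> Z" "Z < \<eta>" for Z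
    proof -
      have "near * (G * Z) \<le> \<bar>near\<bar> * G * (1 / (2 * (\<bar>near\<bar> * G + 1)))"
        unfolding mult.assoc[symmetric] using that \<eta>(3) G by (intro mult_mono) (auto intro: mult_right_mono)
      also have "\<dots> \<le> 1 / 2" using mult_nonneg_nonneg[OF abs_ge_zero[of near] G] by (simp add: divide_le_eq)
      finally show ?thesis .
    qed
    have "\<forall>\<^sub>F N in sequentially. epow (wasserstein p (empirical N (X\<^sub>0 N)) (law \<sigma>\<^sub>0) + 1 / ennreal (lam N)) r
            * epow (1 + 1 / (ennreal (real N powr (1 / real d)) * d_min N (X\<^sub>0 N))) (\<alpha> + 1) < ennreal \<eta>"
      by (rule order_tendstoD(2)[OF lim]) (use \<eta>(1) in simp)
    \<comment> \<open>With two particles or more \<open>d_min\<close> is finite; for a single one it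
      is the infimum of the empty set.\<close>
    with eventually_ge_at_top[of 2]
    show "\<forall>\<^sub>F N in sequentially. ereal T < \<tau> N \<and> (\<forall>t\<in>{0..T}. \<not> collision N (X N) t) \<and>
          (\<forall>t\<in>{0..T}. wasserstein p (empirical N (\<lambda>i. X N i t)) (law (\<sigma> t)) \<le> ennreal C
                   * (wasserstein p (empirical N (X\<^sub>0 N)) (law \<sigma>\<^sub>0) + 1 / ennreal (lam N)) * ennreal (exp (C * t)))"
    proof eventually_elim
      case (elim N)
      have N: "1 \<le> N" "0 < N" using elim(1) by simp_all
      have fin: "d_min N (X\<^sub>0 N) < \<infinity>"
        using d_min_le[of 0 N 1 "X\<^sub>0 N"] elim(1) by (auto intro: le_less_trans)
      obtain E dm where E: "wasserstein p (empirical N (X\<^sub>0 N)) (law \<sigma>\<^sub>0) + 1 / ennreal (lam N) = ennreal E" "0 < E"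
          "wasserstein p (empirical N (X\<^sub>0 N)) (law \<sigma>\<^sub>0) < ennreal E" "1 / lam N \<le> E" "E powr r < \<eta>"
        and dm: "d_min N (X\<^sub>0 N) = ennreal dm" "0 < dm"
        and Q: "(real N powr (1 / real d) * dm) powr (- (\<alpha> + 1)) * E powr r < \<eta>"
        by (rule initial_scales[OF elim(2) lam[OF N(1)] r0 _ _ fin]) (use N alpha_nonneg in auto)
      interpret P: particle_approximation K \<alpha> C\<^sub>K q q' m1 \<sigma>\<^sub>0 \<sigma> N "lam N" "X\<^sub>0 N" "V\<^sub>0 N" "\<tau> N" "X N" "V N" p C\<^sub>V E dm
      proof
        show "norm (V\<^sub>0 N i - V\<^sub>0 N j) \<le> lam N / 2 * norm (X\<^sub>0 N i - X\<^sub>0 N j)" if "i < N" "j < N" for i j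
          using V0[OF N(1) that] by simp
        show "dm \<le> dist (X\<^sub>0 N i) (X\<^sub>0 N j)" if "i < N" "j < N" "i \<noteq> j" for i j
          using d_min_le[OF that, of "X\<^sub>0 N"] by (simp add: dm)
      qed (use assms N lam maximal CV E dm in blast)+
      have const_eqs: "P.\<Lambda>\<^sub>0 = \<Lambda>" "P.\<beta>\<^sub>0 = \<beta>" "P.L\<^sub>0 = L" "P.near = near" "P.rate = r"
        by (simp_all add: P.\<Lambda>\<^sub>0_def P.\<beta>\<^sub>0_def P.L\<^sub>0_def P.near_def P.rate_def \<Lambda>_def \<beta>_def L_def near_def r_def c1 d_def)
      have "P.Q < \<eta>" "0 \<le> P.Q" using Q by (simp_all add: P.Q_def const_eqs d_def)
      hence small: "P.near * P.Q \<le> 1 / 2"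
        "P.near * (P.separation_loss T powr - (\<alpha> + 1) * (P.L\<^sub>0 * exp (P.\<beta>\<^sub>0 * T)) powr P.rate * P.Q) \<le> 1 / 2"
        using near_le[of P.Q] near_G_le[of P.Q] by (simp_all add: const_eqs P.separation_loss_def c1 G_def)
      have "E powr r < (1 / H) powr r" using E(5) \<eta>(4) by linarith
      hence "E < 1 / H" using powr_mono2[of r "1 / H" E] r0 H by fastforce
      hence "1 / lam N \<le> 1 / H" using E(4) by linarith
      hence "H \<le> lam N" using lam[OF N(1)] H by (simp add: field_simps)
      hence lam_large: "8 * C1 * P.\<Lambda>\<^sub>0 \<le> lam N"
        using abs_ge_self[of "c1 * \<Lambda>"] unfolding H_def c1 const_eqs by linarith
      have life: "ereal T < \<tau> N" by (rule P.convergence_estimate(1)[OF less_imp_le[OF T] lam_large small])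
      have "\<not> collision N (X N) t" if "t \<in> {0..T}" for t
        using P.solution_at(1)[of t] that life unfolding collision_def
        by (metis atLeastAtMost_iff ereal_less_eq(3) order_le_less_trans)
      moreover have "wasserstein p (empirical N (\<lambda>i. X N i t)) (law (\<sigma> t)) \<le> ennreal C
           * (wasserstein p (empirical N (X\<^sub>0 N)) (law \<sigma>\<^sub>0) + 1 / ennreal (lam N)) * ennreal (exp (C * t))"
        if t: "t \<in> {0..T}" for t
      proof -
        have "wasserstein p (empirical N (\<lambda>i. X N i t)) (law (\<sigma> t)) \<le> ennreal (P.L\<^sub>0 * exp (P.\<beta>\<^sub>0 * t) * E)"
          by (rule P.convergence_estimate(2)[OF less_imp_le[OF T] lam_large small]) (use t in auto)
        also have "P.L\<^sub>0 * exp (P.\<beta>\<^sub>0 * t) * E \<le> C * exp (C * t) * E"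
          using t E(2) unfolding const_eqs
          by (intro mult_right_mono mult_mono) (auto simp: C_def intro!: mult_right_mono)
        hence "ennreal (P.L\<^sub>0 * exp (P.\<beta>\<^sub>0 * t) * E) \<le> ennreal (C * exp (C * t) * E)" by (rule ennreal_leI)
        also have "\<dots> = ennreal C * ennreal E * ennreal (exp (C * t))"
          using E(2) by (simp add: C_def ennreal_mult mult_ac)
        finally show ?thesis by (simp only: E(1))
      qed
      ultimately show ?case using life by blast
    qed
  qed
qed

end
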